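(* Let $\mu$ be a nonempty partition, $i_1,\dots,i_k\ge0$, and let $\mathsf{W}^{\mathsf{Vert}}_\mu\big(\prod_{j=1}^k\tau_{i_j}([0])\big)$ be the 1-leg descendent vertex. For every integer $a>0$, the evaluation $$\mathsf{W}^{\mathsf{Vert}}_\mu\Big(\prod_{j=1}^k\tau_{i_j}([0])\Big)\Big|_{s_3=\frac{1}{a}(s_1+s_2)}$$ is well-defined and is a Laurent polynomial in $q$ with coefficients in $\mathbb{Q}(s_1,s_2)$.
   Context: View $\mu$ as a finite set of lattice points $(k_1,k_2)\in\mathbb{Z}_{\ge0}^2$; $\mu[x_1,x_2]\subset\mathbb{C}[x_1,x_2]$ is the monomial ideal spanned by the monomials $x_1^{k_1}x_2^{k_2}$ with $(k_1,k_2)\notin\mu$. $\mathbf{T}=(\mathbb{C}^* )^3$ acts on $R=\mathbb{C}[x_1,x_2,x_3]$ by $(t_1,t_2,t_3)\cdot x_i=t_ix_i$; a monomial $x^w$ has character $t^w$, and $s_i$ corresponds to $t_i$ (the weight $t^w$ has equivariant first Chern class $w_1s_1+w_2s_2+w_3s_3$). Let $M_3=\mathbb{C}[x_3,x_3^{-1}]\otimes\mathbb{C}[x_1,x_2]/\mu[x_1,x_2]$, with its canonical invariant element $1$ generating the submodule $\langle1\rangle$. For each finite-dimensional $\mathbf{T}$-invariant $R$-submodule $Q\subset M_3/\langle1\rangle$, let $\ell(Q)=\dim_{\mathbb{C}}Q$ and let $\mathsf{F}_Q$ be the $\mathbf{T}$-character of the preimage of $Q$ in $M_3$ (so $\mathsf{F}_Q=\mathsf{F}_\mu/(1-t_3)+\mathrm{char}(Q)$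 with $\mathsf{F}_\mu=\sum_{(k_1,k_2)\in\mu}t_1^{k_1}t_2^{k_2}$). Bar denotes $t_i\mapsto t_i^{-1}$. Set $\mathsf{G}_\mu=-\mathsf{F}_\mu-\overline{\mathsf{F}}_\mu/(t_1t_2)+\mathsf{F}_\mu\overline{\mathsf{F}}_\mu(1-t_1)(1-t_2)/(t_1t_2)$ and $$\mathsf{V}_Q=\mathsf{F}_Q-\frac{\overline{\mathsf{F}}_Q}{t_1t_2t_3}+\mathsf{F}_Q\overline{\mathsf{F}}_Q\frac{(1-t_1)(1-t_2)(1-t_3)}{t_1t_2t_3}+\frac{\mathsf{G}_\mu(t_1,t_2)}{1-t_3},$$ which is a Laurent polynomial $\sum_w c_wt^w$ in $t_1,t_2,t_3$ (a known fact). Put $e(-\mathsf{V}_Q)=\prod_w(w_1s_1+w_2s_2+w_3s_3)^{-c_w}$, and for a Laurent polynomial $W=\sum_w b_wt^w$ put $\mathrm{ch}_m(W)=\sum_w b_w(w_1s_1+w_2s_2+w_3s_3)^m/m!$ (note $\mathsf{F}_Q(1-t_1)(1-t_2)(1-t_3)$ is a Laurent polynomial). Define $\mathsf{w}_{i_1,\dots,i_k}(Q)=e(-\mathsf{V}_Q)\prod_{j=1}^k\mathrm{ch}_{2+i_j}\big(\mathsf{F}_Q(1-t_1)(1-t_2)(1-t_3)\big)$ and $$\mathsf{W}^{\mathsf{Vert}}_\mu\Big(\prod_{j=1}^k\tau_{i_j}([0])\Big)=\Big(\frac{1}{s_1s_2}\Big)^k\sum_Q\mathsf{w}_{i_1,\dots,i_k}(Q)\,q^{\ell(Q)+|\mu|}\in\mathbb{Q}(s_1,s_2,s_3)((q)),$$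 the sum over all such $Q$. *)

theory Defs
  imports Complex_Main "HOL-Computational_Algebra.Polynomial" "HOL-Computational_Algebra.Fraction_Field"
begin

text \<open>Q[s1,s2,s3] is modelled as rat poly poly poly (innermost variable s1, then s2,
outermost s3); Q(s1,s2,s3) is its fraction field.  The same type is used for the
torus characters Q(t1,t2,t3) (t_i in place of s_i).  Q(s1,s2) is rat poly poly fract.\<close>

type_synonym rf3 = "rat poly poly poly fract"
type_synonym rf2 = "rat poly poly fract"

definition V1 :: rf3 where "V1 = Fract [:[:[:0, 1:]:]:] 1"
definition V2 :: rf3 where "V2 = Fract [:[:0, 1:]:] 1"
definition V3 :: rf3 where "V3 = Fract [:0, 1:] 1"

text \<open>Laurent polynomials in three variables: integer coefficient functions with finite support.\<close>
type_synonym lpoly = "int \<times> int \<times> int \<Rightarrow> int"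

definition lsupp :: "lpoly \<Rightarrow> (int \<times> int \<times> int) set" where
  "lsupp L = {w. L w \<noteq> 0}"

definition mono3 :: "int \<times> int \<times> int \<Rightarrow> rf3" where
  "mono3 w = (case w of (w1, w2, w3) \<Rightarrow> V1 powi w1 * V2 powi w2 * V3 powi w3)"

definition lp_to_rf :: "lpoly \<Rightarrow> rf3" where
  "lp_to_rf L = (\<Sum>w\<in>lsupp L. of_int (L w) * mono3 w)"

definition laurent_coeffs :: "rf3 \<Rightarrow> lpoly" where
  "laurent_coeffs F = (THE L. finite (lsupp L) \<and> lp_to_rf L = F)"

text \<open>Equivariant first Chern class w1 s1 + w2 s2 + w3 s3 of the weight t^w.\<close>
definition c1w :: "int \<times> int \<times> int \<Rightarrow> rf3" where
  "c1w w = (case w of (w1, w2, w3) \<Rightarrow> of_int w1 * V1 + of_int w2 * V2 + of_int w3 * V3)"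

text \<open>e(-V) for V = sum_w c_w t^w.\<close>
definition euler_neg :: "lpoly \<Rightarrow> rf3" where
  "euler_neg c = (\<Prod>w\<in>lsupp c. c1w w powi (- c w))"

definition ch :: "nat \<Rightarrow> lpoly \<Rightarrow> rf3" where
  "ch m W = (\<Sum>w\<in>lsupp W. of_int (W w) * c1w w ^ m / of_nat (fact m))"

definition is_partition :: "(nat \<times> nat) set \<Rightarrow> bool" where
  "is_partition mu \<longleftrightarrow> finite mu \<and>
     (\<forall>k1 k2 j1 j2. (k1, k2) \<in> mu \<and> j1 \<le> k1 \<and> j2 \<le> k2 \<longrightarrow> (j1, j2) \<in> mu)"

text \<open>Weights of the monomial basis x1^k1 x2^k2 x3^k3 ((k1,k2) in mu, k3 < 0) of M_3/<1>.\<close>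
definition Bw :: "(nat \<times> nat) set \<Rightarrow> (int \<times> int \<times> int) set" where
  "Bw mu = {(k1, k2, k3). 0 \<le> k1 \<and> 0 \<le> k2 \<and> (nat k1, nat k2) \<in> mu \<and> k3 < 0}"

text \<open>Vectors of M_3/<1>: complex coefficient functions on the basis with finite support.\<close>
type_synonym vec = "int \<times> int \<times> int \<Rightarrow> complex"

definition is_vec :: "(nat \<times> nat) set \<Rightarrow> vec \<Rightarrow> bool" where
  "is_vec mu v \<longleftrightarrow> finite {w. v w \<noteq> 0} \<and> {w. v w \<noteq> 0} \<subseteq> Bw mu"

definition sub_ei :: "nat \<Rightarrow> int \<times> int \<times> int \<Rightarrow> int \<times> int \<times> int" where
  "sub_ei i w = (case w of (w1, w2, w3) \<Rightarrow>
     (if i = 1 then (w1 - 1, w2, w3) else if i = 2 then (w1, w2 - 1, w3) else (w1, w2, w3 - 1)))"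

definition xmul :: "(nat \<times> nat) set \<Rightarrow> nat \<Rightarrow> vec \<Rightarrow> vec" where
  "xmul mu i v = (\<lambda>w. if w \<in> Bw mu then v (sub_ei i w) else 0)"

definition tact :: "complex \<times> complex \<times> complex \<Rightarrow> vec \<Rightarrow> vec" where
  "tact t v = (\<lambda>w. (case t of (t1, t2, t3) \<Rightarrow> case w of (w1, w2, w3) \<Rightarrow>
      t1 powi w1 * t2 powi w2 * t3 powi w3) * v w)"

definition lincomb :: "vec set \<Rightarrow> (vec \<Rightarrow> complex) \<Rightarrow> vec" where
  "lincomb S c = (\<lambda>w. \<Sum>s\<in>S. c s * s w)"

definition cspan :: "vec set \<Rightarrow> vec set" where
  "cspan S = {lincomb S c | c. True}"

definition cdim :: "vec set \<Rightarrow> nat" where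
  "cdim Q = (LEAST n. \<exists>S. finite S \<and> card S = n \<and> S \<subseteq> Q \<and> Q \<subseteq> cspan S)"

definition fin_dim :: "vec set \<Rightarrow> bool" where
  "fin_dim Q \<longleftrightarrow> (\<exists>S. finite S \<and> S \<subseteq> Q \<and> Q \<subseteq> cspan S)"

definition admissible :: "(nat \<times> nat) set \<Rightarrow> vec set \<Rightarrow> bool" where
  "admissible mu Q \<longleftrightarrow>
     (\<forall>v\<in>Q. is_vec mu v) \<and> (\<lambda>_. 0) \<in> Q \<and>
     (\<forall>u\<in>Q. \<forall>v\<in>Q. (\<lambda>w. u w + v w) \<in> Q) \<and>
     (\<forall>c. \<forall>v\<in>Q. (\<lambda>w. c * v w) \<in> Q) \<and>
     (\<forall>i\<in>{1, 2, 3}. \<forall>v\<in>Q. xmul mu i v \<in> Q) \<and>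
     (\<forall>t1 t2 t3. t1 \<noteq> 0 \<and> t2 \<noteq> 0 \<and> t3 \<noteq> 0 \<longrightarrow> (\<forall>v\<in>Q. tact (t1, t2, t3) v \<in> Q)) \<and>
     fin_dim Q"

definition wspace :: "vec set \<Rightarrow> int \<times> int \<times> int \<Rightarrow> vec set" where
  "wspace Q w = {v\<in>Q. \<forall>u. u \<noteq> w \<longrightarrow> v u = 0}"

definition charQ :: "vec set \<Rightarrow> lpoly" where
  "charQ Q = (\<lambda>w. int (cdim (wspace Q w)))"

definition Fmu :: "(nat \<times> nat) set \<Rightarrow> rf3" where
  "Fmu mu = (\<Sum>(k1, k2)\<in>mu. V1 ^ k1 * V2 ^ k2)"

definition Fmu_bar :: "(nat \<times> nat) set \<Rightarrow> rf3" where
  "Fmu_bar mu = (\<Sum>(k1, k2)\<in>mu. (1 / V1) ^ k1 * (1 / V2) ^ k2)"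

definition FQ :: "(nat \<times> nat) set \<Rightarrow> vec set \<Rightarrow> rf3" where
  "FQ mu Q = Fmu mu / (1 - V3) + lp_to_rf (charQ Q)"

definition FQ_bar :: "(nat \<times> nat) set \<Rightarrow> vec set \<Rightarrow> rf3" where
  "FQ_bar mu Q = Fmu_bar mu / (1 - 1 / V3) + lp_to_rf (\<lambda>w. charQ Q (case w of (w1, w2, w3) \<Rightarrow> (- w1, - w2, - w3)))"

definition Gmu :: "(nat \<times> nat) set \<Rightarrow> rf3" where
  "Gmu mu = - Fmu mu - Fmu_bar mu / (V1 * V2)
            + Fmu mu * Fmu_bar mu * (1 - V1) * (1 - V2) / (V1 * V2)"

definition VQ :: "(nat \<times> nat) set \<Rightarrow> vec set \<Rightarrow> rf3" where
  "VQ mu Q = FQ mu Q - FQ_bar mu Q / (V1 * V2 * V3)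
     + FQ mu Q * FQ_bar mu Q * (1 - V1) * (1 - V2) * (1 - V3) / (V1 * V2 * V3)
     + Gmu mu / (1 - V3)"

definition wQ :: "(nat \<times> nat) set \<Rightarrow> nat list \<Rightarrow> vec set \<Rightarrow> rf3" where
  "wQ mu is Q = euler_neg (laurent_coeffs (VQ mu Q)) *
     (\<Prod>j<length is. ch (2 + is ! j)
        (laurent_coeffs (FQ mu Q * (1 - V1) * (1 - V2) * (1 - V3))))"

definition Wvert_coeff :: "(nat \<times> nat) set \<Rightarrow> nat list \<Rightarrow> nat \<Rightarrow> rf3" where
  "Wvert_coeff mu is n = (1 / (V1 * V2)) ^ length is *
     (\<Sum>Q\<in>{Q. admissible mu Q \<and> cdim Q + card mu = n}. wQ mu is Q)"

definition sub_s3 :: "int \<Rightarrow> rat poly poly poly \<Rightarrow> rat poly poly" where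
  "sub_s3 a p = poly p (smult [:1 / of_int a :: rat:] ([:[:0, 1:]:] + [:0, 1:]))"

definition regular_sub :: "int \<Rightarrow> rf3 \<Rightarrow> bool" where
  "regular_sub a F \<longleftrightarrow> (\<exists>N D. F = Fract N D \<and> sub_s3 a D \<noteq> 0)"

definition eval_sub :: "int \<Rightarrow> rf3 \<Rightarrow> rf2" where
  "eval_sub a F = (SOME r. \<exists>N D. F = Fract N D \<and> sub_s3 a D \<noteq> 0 \<and>
                          r = Fract (sub_s3 a N) (sub_s3 a D))"

end

(* The invariant submodules Q correspond to the reverse plane partitions h on mu.  Put
   eps = s1 + s2 - a s3.  The factors of e(-V_Q) that vanish or blow up on the hyperplane eps = 0 are
   multiples of eps, and every other factor is a unit there.  Height functions with the same multiset of
   (diagonal, level) form a finite class; the product "wt" of the eps-factors depends on h only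
   through relative positions of the boxes.

   Adding a box multiplies wt by the residue of a rational function at the position of the box, and by
   a further factor that is polynomial in this position if the new box is a lowest one.  The
   remaining ("spurious") poles of the rational function correspond to removing a box one step
   further, so the residue theorem yields a recursion between class sums weighted by symmetric functions of the
   box positions.  By induction on the number of boxes all class sums are regular at eps = 0, although
   single summands are not.  If a class splits into high columns and low columns far below them, the
   same recursion pushes the low columns together until all their levels are congruent modulo a + 1.
   Then they are rigid, and they contribute a power of eps whose exponent is a sum of values
   (1/2) sum_d (w_d - w_(d+1))^2 > 0, so the class sum vanishes on the hyperplane.  All but finitely many
   height functions lie in such classes.  The unit factors and the descendents are handled by
   expanding them in eps, modulo an arbitrarily high power, into symmetric functions of the class. *)
theory Submission
  imports Defs "HOL-Library.Multiset" "HOL-Computational_Algebra.Formal_Power_Series"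
begin

section \<open>Products with integer exponents\<close>

text \<open>The modulus \<open>a + 1\<close> comes from the vector (1,1,1): its Chern class s1 + s2
  + s3 equals (a + 1) s3 + \<open>eps\<close>. A spurious pole for a box on diagonal d at level n
  therefore points to a removable box on the same diagonal at level n + a + 1, and iterating the
  recursion touches only levels congruent to n. The obstacle is that the weight of a single height
  function may have a pole along \<open>eps\<close> = 0, so neither regularity nor vanishing can be
  read off termwise. Both are claimed for whole classes and for all symmetric functions at once:
  residues weighted by powers of the position are, by Newton's identities, polynomials in power sums
  of the positions, so this family of claims reproduces itself under the recursion. The recursion is
  stated for an abstract target, used with the ring \<open>R\<close> for regularity and with the
  ideal \<open>epsR\<close> for vanishing. In a rigid class nothing is known about the high columns.
  They form a smaller partition, and regularity for that partition is what allows the positive power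
  of \<open>eps\<close> from the low columns to decide.\<close>

definition zprod :: "(int \<Rightarrow> 'k::field) \<Rightarrow> (int \<Rightarrow> int) \<Rightarrow> 'k" where
  "zprod f s = (\<Prod>l\<in>{l. s l \<noteq> 0}. f l powi s l)"

lemma zprod_window:
  assumes "finite S" "{l. s l \<noteq> 0} \<subseteq> S"
  shows "zprod f s = (\<Prod>l\<in>S. f l powi s l)"
  unfolding zprod_def using assms by (intro prod.mono_neutral_left) auto

lemma finite_supp_add:
  fixes s t :: "int \<Rightarrow> int"
  assumes "finite {l. s l \<noteq> 0}" "finite {l. t l \<noteq> 0}"
  shows "finite {l. s l + t l \<noteq> 0}"
  by (rule finite_subset[of _ "{l. s l \<noteq> 0} \<union> {l. t l \<noteq> 0}"]) (use assms in auto)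

text \<open>The exponent law for \<open>powi\<close> fails only at base zero, and an index in just
  one of the supports contributes the exponent 0 to the other product. So only common indices need a
  nonzero base.\<close>

lemma zprod_add:
  assumes "finite {l. s l \<noteq> 0}" "finite {l. t l \<noteq> 0}"
    and "\<And>l. s l \<noteq> 0 \<Longrightarrow> t l \<noteq> 0 \<Longrightarrow> f l \<noteq> 0"
  shows "zprod f (\<lambda>l. s l + t l) = zprod f s * zprod f t"
proof -
  let ?S = "{l. s l \<noteq> 0} \<union> {l. t l \<noteq> 0}"
  have fin: "finite ?S" using assms by simp
  have "f l powi (s l + t l) = f l powi s l * f l powi t l" if "l \<in> ?S" for l
    using assms(3)[of l] by (cases "s l = 0"; cases "t l = 0") (auto simp: power_int_add)
  hence "(\<Prod>l\<in>?S. f l powi (s l + t l)) = (\<Prod>l\<in>?S. f l powi s l * f l powi t l)"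
    by (intro prod.cong) auto
  thus ?thesis
    by (subst (1 2 3) zprod_window[OF fin]) (auto simp: prod.distrib)
qed

lemma zprod_minus:
  "zprod f (\<lambda>l. - s l) = inverse (zprod f s)"
  by (simp add: zprod_def power_int_minus prod_inversef[symmetric, unfolded comp_def])

lemma zprod_nonzero:
  assumes "\<And>l. s l \<noteq> 0 \<Longrightarrow> f l \<noteq> 0"
  shows "zprod f s \<noteq> 0"
  using assms by (cases "finite {l. s l \<noteq> 0}") (auto simp: zprod_def)

lemma zprod_cong:
  assumes "\<And>l. s l = t l" "\<And>l. s l \<noteq> 0 \<Longrightarrow> f l = g l"
  shows "zprod f s = zprod g t"
  unfolding zprod_def using assms by (intro prod.cong) auto

lemma zprod_reindex:
  assumes "bij g"
  shows "zprod f (\<lambda>l. s (g l)) = zprod (\<lambda>l. f (inv g l)) s"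
  unfolding zprod_def
  by (rule prod.reindex_bij_witness[where i = "inv g" and j = g])
     (use assms in \<open>auto simp: bij_is_inj bij_is_surj surj_f_inv_f\<close>)

lemma zprod_neg:
  assumes "finite {l. s l \<noteq> 0}"
  shows "zprod (\<lambda>l. - f l) s = (-1) powi (\<Sum>l\<in>{l. s l \<noteq> 0}. s l) * zprod f s"
proof -
  have sgn: "(\<Prod>l\<in>A. (-1::'a::field) powi s l) = (-1) powi (\<Sum>l\<in>A. s l)" if "finite A" for A
    using that by (induction A) (auto simp: power_int_add)
  have "(- f l) powi s l = (-1) powi s l * f l powi s l" for l
    using power_int_mult_distrib[of "-1" "f l" "s l"] by simp
  thus ?thesis using sgn[OF assms] by (simp add: zprod_def prod.distrib)
qed

section \<open>Newton's identities\<close>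

text \<open>The coefficients of exp(- sum_k M_k X^k / k). If \<open>M\<close> is the sequence of
  power sums of roots e with integer multiplicities s, this series is the product of the (1 - e
  X)^s.\<close>

fun newton :: "(nat \<Rightarrow> 'k::field_char_0) \<Rightarrow> nat \<Rightarrow> 'k" where
  "newton M 0 = 1"
| "newton M (Suc n) = - (\<Sum>k\<le>n. M (Suc k) * newton M (n - k)) / of_nat (Suc n)"

declare newton.simps(2) [simp del]

definition newton_fps :: "(nat \<Rightarrow> 'k::field_char_0) \<Rightarrow> 'k fps" where
  "newton_fps M = Abs_fps (newton M)"

definition tail_fps :: "(nat \<Rightarrow> 'k::field_char_0) \<Rightarrow> 'k fps" where
  "tail_fps M = Abs_fps (\<lambda>k. M (Suc k))"

lemma newton_fps_deriv: "fps_deriv (newton_fps M) = - (newton_fps M * tail_fps M)"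
proof (rule fps_ext)
  fix n
  have "of_nat (Suc n) * newton M (Suc n) = - (\<Sum>k\<le>n. M (Suc k) * newton M (n - k))"
    unfolding newton.simps(2) by (simp del: of_nat_Suc)
  also have "(\<Sum>k\<le>n. M (Suc k) * newton M (n - k)) = fps_nth (tail_fps M * newton_fps M) n"
    by (simp add: fps_mult_nth tail_fps_def newton_fps_def atLeast0AtMost)
  finally show "fps_nth (fps_deriv (newton_fps M)) n = fps_nth (- (newton_fps M * tail_fps M)) n"
    by (simp add: newton_fps_def mult.commute)
qed

text \<open>In characteristic 0 a linear differential equation determines a power series from its
  constant term; products of \<open>newton_fps\<close> are identified in this way.\<close>

lemma newton_fps_unique:
  fixes G :: "'k::field_char_0 fps"
  assumes "fps_deriv G = - (G * tail_fps M)" "fps_nth G 0 = 1"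
  shows "G = newton_fps M"
proof -
  have "fps_nth G n = newton M n" for n
  proof (induction n rule: less_induct)
    case (less n)
    show ?case
    proof (cases n)
      case 0 thus ?thesis using assms by simp
    next
      case (Suc m)
      have "of_nat (Suc m) * fps_nth G (Suc m) = fps_nth (fps_deriv G) m" by (simp del: of_nat_Suc)
      also have "\<dots> = - fps_nth (tail_fps M * G) m" by (simp add: assms mult.commute)
      also have "fps_nth (tail_fps M * G) m = (\<Sum>k\<le>m. M (Suc k) * fps_nth G (m - k))"
        by (simp add: fps_mult_nth tail_fps_def atLeast0AtMost)
      also have "\<dots> = (\<Sum>k\<le>m. M (Suc k) * newton M (m - k))"
        using less Suc by (intro sum.cong) auto
      finally have "fps_nth G (Suc m) = - (\<Sum>k\<le>m. M (Suc k) * newton M (m - k)) / of_nat (Suc m)"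
        by (simp add: field_simps del: of_nat_Suc)
      thus ?thesis by (simp add: Suc newton.simps(2))
    qed
  qed
  thus ?thesis by (simp add: newton_fps_def fps_eq_iff)
qed

text \<open>Logarithmic derivatives add up, and that of 1 - e X is minus the geometric series with
  coefficients e^(k+1).\<close>

lemma newton_fps_add_root:
  fixes e :: "'k::field_char_0"
  shows "newton_fps (\<lambda>k. M k + e ^ k) = newton_fps M * (1 - fps_const e * fps_X)"
proof (rule newton_fps_unique[symmetric])
  let ?R = "1 - fps_const e * fps_X :: 'k fps"
  let ?T = "Abs_fps (\<lambda>k. e ^ Suc k)"
  have T: "?R * ?T = fps_const e"
  proof (rule fps_ext)
    fix n show "fps_nth (?R * ?T) n = fps_nth (fps_const e) n"
      by (cases n) (auto simp: ring_distribs mult.assoc)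
  qed
  have tail: "tail_fps (\<lambda>k. M k + e ^ k) = tail_fps M + ?T"
    by (simp add: tail_fps_def fps_eq_iff)
  have "fps_deriv (newton_fps M * ?R) = - (newton_fps M * tail_fps M) * ?R - newton_fps M * fps_const e"
    by (simp add: newton_fps_deriv algebra_simps)
  also have "\<dots> = - (newton_fps M * ?R * tail_fps (\<lambda>k. M k + e ^ k))"
  proof -
    have "newton_fps M * ?R * (tail_fps M + ?T) = newton_fps M * ?R * tail_fps M + newton_fps M * (?R * ?T)"
      by (simp add: algebra_simps)
    thus ?thesis unfolding tail T by (simp add: algebra_simps)
  qed
  finally show "fps_deriv (newton_fps M * ?R) = - (newton_fps M * ?R * tail_fps (\<lambda>k. M k + e ^ k))" .
qed (simp add: newton_fps_def)

lemma newton_zero_moments: "newton (\<lambda>_. 0) n = of_bool (n = 0)"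
  by (cases n) (auto simp: newton.simps(2))

text \<open>Zero at negative indices: such an index belongs to a rational function that decays
  faster than 1/x at infinity, whose residues add up to zero. It also lets the recurrence for a new
  root hold for every integer index.\<close>

definition newton_int :: "(nat \<Rightarrow> 'k::field_char_0) \<Rightarrow> int \<Rightarrow> 'k" where
  "newton_int M n = (if n < 0 then 0 else newton M (nat n))"

lemma newton_int_add_root:
  "newton_int (\<lambda>k. M k + e ^ k) n = newton_int M n - e * newton_int M (n - 1)"
proof (cases "n < 0")
  case False
  have *: "newton (\<lambda>k. M k + e ^ k) m = newton M m - (if m = 0 then 0 else e * newton M (m - 1))" for m
  proof -
    have "newton (\<lambda>k. M k + e ^ k) m = fps_nth (newton_fps (\<lambda>k. M k + e ^ k)) m"
      by (simp add: newton_fps_def)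
    also have "\<dots> = fps_nth (newton_fps M - fps_X * (fps_const e * newton_fps M)) m"
      by (simp add: newton_fps_add_root algebra_simps)
    also have "\<dots> = newton M m - (if m = 0 then 0 else e * newton M (m - 1))"
      by (simp add: newton_fps_def)
    finally show ?thesis .
  qed
  show ?thesis using False *[of "nat n"]
    by (auto simp: newton_int_def nat_diff_distrib)
qed (simp add: newton_int_def)

definition moment :: "(int \<Rightarrow> 'k) \<Rightarrow> (int \<Rightarrow> int) \<Rightarrow> nat \<Rightarrow> 'k::field_char_0" where
  "moment e s k = (\<Sum>l\<in>{l. s l \<noteq> 0}. of_int (s l) * e l ^ k)"

lemma moment_window:
  assumes "finite S" "{l. s l \<noteq> 0} \<subseteq> S"
  shows "moment e s k = (\<Sum>l\<in>S. of_int (s l) * e l ^ k)"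
  unfolding moment_def using assms by (intro sum.mono_neutral_left) auto

lemma moment_upd:
  assumes "finite {l. s l \<noteq> 0}"
  shows "moment e (s(t := s t + 1)) k = moment e s k + e t ^ k"
proof -
  let ?S = "insert t {l. s l \<noteq> 0}"
  have "moment e (s(t := s t + 1)) k = (\<Sum>l\<in>?S. of_int ((s(t := s t + 1)) l) * e l ^ k)"
    using assms by (intro moment_window) auto
  also have "\<dots> = (\<Sum>l\<in>?S. of_int (s l) * e l ^ k + (if l = t then e t ^ k else 0))"
    by (intro sum.cong) (auto simp: algebra_simps)
  also have "\<dots> = (\<Sum>l\<in>?S. of_int (s l) * e l ^ k) + e t ^ k"
    using assms by (simp add: sum.distrib sum.delta)
  also have "(\<Sum>l\<in>?S. of_int (s l) * e l ^ k) = moment e s k"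
    using assms by (intro moment_window[symmetric]) auto
  finally show ?thesis .
qed

definition total :: "(int \<Rightarrow> int) \<Rightarrow> int" where
  "total s = (\<Sum>l\<in>{l. s l \<noteq> 0}. s l)"

lemma total_window:
  assumes "finite S" "{l. s l \<noteq> 0} \<subseteq> S"
  shows "total s = (\<Sum>l\<in>S. s l)"
  unfolding total_def using assms by (intro sum.mono_neutral_left) auto

lemma total_upd:
  assumes "finite {l. s l \<noteq> 0}"
  shows "total (s(t := s t + 1)) = total s + 1"
proof -
  let ?S = "insert t {l. s l \<noteq> 0}"
  have "total (s(t := s t + 1)) = (\<Sum>l\<in>?S. s l + (if l = t then 1 else 0))"
    using assms by (subst total_window[of ?S]) (auto intro!: sum.cong)
  also have "\<dots> = (\<Sum>l\<in>?S. s l) + 1"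
    using assms by (simp add: sum.distrib sum.delta)
  also have "(\<Sum>l\<in>?S. s l) = total s"
    using assms by (intro total_window[symmetric]) auto
  finally show ?thesis .
qed

section \<open>Sums of residues\<close>

text \<open>If \<open>s i = -1\<close>, this is the residue at \<open>e i\<close> of the product of
  the (x - e l)^(s l). If \<open>s i = 0\<close>, it is simply the value there, a second use made of
  it below.\<close>

definition res_at :: "(int \<Rightarrow> 'k::field) \<Rightarrow> (int \<Rightarrow> int) \<Rightarrow> int \<Rightarrow> 'k" where
  "res_at e s i = zprod (\<lambda>l. e i - e l) (\<lambda>l. if l = i then 0 else s l)"

definition res_sum :: "(int \<Rightarrow> 'k::field) \<Rightarrow> (int \<Rightarrow> int) \<Rightarrow> nat \<Rightarrow> 'k" where
  "res_sum e s k = (\<Sum>i\<in>{i. s i = -1}. e i ^ k * res_at e s i)"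

lemma res_at_upd:
  assumes "inj e" "finite {l. s l \<noteq> 0}" "t \<noteq> i"
  shows "res_at e (s(t := s t + 1)) i = (e i - e t) * res_at e s i"
proof -
  let ?g = "\<lambda>l. if l = i then 0 else s l" and ?d = "\<lambda>l. if l = t then 1 else (0::int)"
  have ne: "e i - e l \<noteq> 0" if "l \<noteq> i" for l using assms(1) that by (auto dest: injD)
  have "res_at e (s(t := s t + 1)) i = zprod (\<lambda>l. e i - e l) (\<lambda>l. ?g l + ?d l)"
    unfolding res_at_def using assms(3) by (intro zprod_cong) auto
  also have "\<dots> = zprod (\<lambda>l. e i - e l) ?g * zprod (\<lambda>l. e i - e l) ?d"
    using assms ne by (intro zprod_add) (auto intro: finite_subset[OF _ assms(2)] split: if_splits)
  also have "zprod (\<lambda>l. e i - e l) ?d = e i - e t"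
    by (subst zprod_window[of "{t}"]) auto
  finally show ?thesis by (simp only: res_at_def[of e s i] mult.commute)
qed

lemma res_sum_zero_step:
  assumes "inj e" "finite {l. s l \<noteq> 0}" "s t \<ge> 0"
  shows "res_sum e (s(t := s t + 1)) k = res_sum e s (Suc k) - e t * res_sum e s k"
proof -
  have eq: "{i. (s(t := s t + 1)) i = -1} = {i. s i = -1}" using assms(3) by auto
  have "res_sum e (s(t := s t + 1)) k = (\<Sum>i\<in>{i. s i = -1}. e i ^ k * ((e i - e t) * res_at e s i))"
    unfolding res_sum_def eq
  proof (intro sum.cong refl)
    fix i assume "i \<in> {i. s i = -1}"
    hence "t \<noteq> i" using assms(3) by auto
    thus "e i ^ k * res_at e (s(t := s t + 1)) i = e i ^ k * ((e i - e t) * res_at e s i)"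
      by (simp add: res_at_upd[OF assms(1,2)])
  qed
  also have "\<dots> = res_sum e s (Suc k) - e t * res_sum e s k"
    unfolding res_sum_def by (simp add: sum_distrib_left sum_subtractf[symmetric] algebra_simps)
  finally show ?thesis .
qed

text \<open>Multiplication by x - e t cancels the pole at t. The term of t on the right carries the
  factor e t - e t = 0, so the sum may still run over all former poles.\<close>

lemma res_sum_pole_step:
  assumes "inj e" "finite {l. s l \<noteq> 0}" "s t = -1"
  shows "res_sum e (s(t := 0)) k = res_sum e s (Suc k) - e t * res_sum e s k"
proof -
  have fin: "finite {i. s i = -1}" by (rule finite_subset[OF _ assms(2)]) auto
  have eq: "{i. (s(t := 0)) i = -1} = {i. s i = -1} - {t}" by auto
  have *: "res_at e (s(t := 0)) i = (e i - e t) * res_at e s i" if "i \<noteq> t" for i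
    using res_at_upd[OF assms(1,2), of t i] that assms(3) by auto
  have "res_sum e (s(t := 0)) k = (\<Sum>i\<in>{i. s i = -1} - {t}. e i ^ k * ((e i - e t) * res_at e s i))"
    unfolding res_sum_def eq by (intro sum.cong) (auto simp: *)
  also have "\<dots> = (\<Sum>i\<in>{i. s i = -1}. e i ^ k * ((e i - e t) * res_at e s i))"
    using assms(3) fin by (subst (2) sum.remove[of _ t]) auto
  also have "\<dots> = res_sum e s (Suc k) - e t * res_sum e s k"
    unfolding res_sum_def by (simp add: sum_distrib_left sum_subtractf[symmetric] algebra_simps)
  finally show ?thesis .
qed

text \<open>Without zeros, poles are cancelled one at a time. This fixes only a combination of the
  sums for k + 1 and k, so the start k = 0 needs its own argument; a single pole gives the powers of
  its root.\<close>

lemma res_sum_poles: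
  fixes e :: "int \<Rightarrow> 'k::field_char_0"
  assumes "inj e" "finite A" "\<And>l. s l = - of_bool (l \<in> A)"
  shows "res_sum e s k = newton_int (moment e s) (int k + 1 - int (card A))"
  using assms(2,3)
proof (induction "card A" arbitrary: A s k rule: less_induct)
  case (less A s k)
  have supp: "{l. s l \<noteq> 0} = A" "{l. s l = -1} = A" using less.prems by auto
  have fin: "finite {l. s l \<noteq> 0}" using less.prems by (simp add: supp)
  have step: "res_sum e s (Suc k) - e t * res_sum e s k = newton_int (moment e (s(t := 0))) (int k + 1 - int (card (A - {t})))"
    if t: "t \<in> A" for t k
  proof -
    have "res_sum e (s(t := 0)) k = newton_int (moment e (s(t := 0))) (int k + 1 - int (card (A - {t})))"
      using t less.prems by (intro less.hyps card_Diff1_less) auto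
    moreover have "s t = -1" using less.prems t by simp
    ultimately show ?thesis using res_sum_pole_step[OF assms(1) fin, of t k] by simp
  qed
  have mom: "newton_int (moment e (s(t := 0))) n = newton_int (moment e s) n - e t * newton_int (moment e s) (n - 1)"
    if t: "t \<in> A" for t n
  proof -
    have "s(t := 0) = s(t := s t + 1)" using less.prems t by auto
    hence "moment e (s(t := 0)) = (\<lambda>k. moment e s k + e t ^ k)" using moment_upd[OF fin] by auto
    thus ?thesis by (simp add: newton_int_add_root)
  qed
  consider "A = {}" | t where "A = {t}" | t u where "t \<in> A" "u \<in> A" "t \<noteq> u" by blast
  thus ?case
  proof cases
    case 1
    hence "moment e s = (\<lambda>_. 0)" using supp by (auto simp: moment_def)
    thus ?thesis using 1 supp by (simp add: res_sum_def newton_int_def newton_zero_moments)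
  next
    case (2 t)
    have r: "res_sum e s k = e t ^ k" for k
      using 2 supp less.prems by (simp add: res_sum_def res_at_def zprod_def cong: if_cong)
    have "newton_int (moment e s) (int k) = e t ^ k" for k
    proof (induction k)
      case 0 show ?case by (simp add: newton_int_def)
    next
      case (Suc k)
      have z: "moment e (s(t := 0)) = (\<lambda>_. 0)" using 2 less.prems by (auto simp: moment_def)
      have "newton_int (moment e (s(t := 0))) (int (Suc k)) = newton_int (moment e s) (int (Suc k)) - e t * newton_int (moment e s) (int k)"
        using mom[of t "int (Suc k)"] 2 by simp
      thus ?case using Suc unfolding z newton_int_def newton_zero_moments by simp
    qed
    thus ?thesis using 2 r by simp
  next
    case (3 t u)
    have card2: "card A \<ge> 2"
    proof -
      have "card {t,u} \<le> card A" using 3 less.prems by (intro card_mono) auto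
      thus ?thesis using 3 by simp
    qed
    have c: "int (card (A - {x})) = int (card A) - 1" if "x \<in> A" for x
      using that less.prems card2 by (simp add: card_Diff_singleton of_nat_diff)
    \<comment> \<open>Two poles t and u give two equations for \<open>res_sum e s 1\<close>.
      Subtracting them isolates (e u - e t) times the sum for k = 0, while the right sides agree:
      both are 1 for two poles and 0 for more.\<close>
    have base: "res_sum e s 0 = 0"
    proof -
      have "e u * res_sum e s 0 - e t * res_sum e s 0
          = newton_int (moment e (s(t := 0))) (2 - int (card A)) - newton_int (moment e (s(u := 0))) (2 - int (card A))"
        using step[OF 3(1), of 0] step[OF 3(2), of 0] c[OF 3(1)] c[OF 3(2)] by (simp add: algebra_simps)
      also have "\<dots> = 0"
        using card2 by (cases "card A = 2") (auto simp: newton_int_def)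
      finally have "(e u - e t) * res_sum e s 0 = 0" by (simp add: algebra_simps)
      thus ?thesis using 3 assms(1) by (auto dest: injD)
    qed
    show ?thesis
    proof (induction k)
      case 0 thus ?case using base card2 by (simp add: newton_int_def)
    next
      case (Suc k)
      have "res_sum e s (Suc k) = e t * newton_int (moment e s) (int k + 1 - int (card A))
         + (newton_int (moment e s) (int k + 2 - int (card A)) - e t * newton_int (moment e s) (int k + 1 - int (card A)))"
        using step[OF 3(1), of k] Suc mom[OF 3(1), of "int k + 2 - int (card A)"] c[OF 3(1)]
        by (simp add: algebra_simps)
      thus ?case by (simp add: algebra_simps)
    qed
  qed
qed

text \<open>The residues of a rational function with simple poles add up to the coefficient of
  \<open>1/x\<close> in its expansion at infinity, which Newton's identities express through power sums.\<close>

theorem res_sum_eq: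
  fixes e :: "int \<Rightarrow> 'k::field_char_0"
  assumes "inj e" "finite {l. s l \<noteq> 0}" "\<And>l. s l \<ge> -1"
  shows "res_sum e s k = newton_int (moment e s) (int k + 1 + total s)"
  using assms(2,3)
proof (induction "nat (\<Sum>l\<in>{l. s l > 0}. s l)" arbitrary: s k rule: less_induct)
  case (less s k)
  have finp: "finite {l. s l > 0}" by (rule finite_subset[OF _ less.prems(1)]) auto
  show ?case
  proof (cases "\<exists>t. s t > 0")
    case False
    let ?A = "{l. s l \<noteq> 0}"
    have m1: "s l = -1" if "s l \<noteq> 0" for l
      using False less.prems(2)[of l] that by (smt (verit))
    hence s: "s l = - of_bool (l \<in> ?A)" for l by (cases "s l = 0") auto
    have "total s = (\<Sum>l\<in>?A. -1)" unfolding total_def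
      by (intro sum.cong refl m1) simp
    hence "total s = - int (card ?A)" by simp
    thus ?thesis using res_sum_poles[OF assms(1) less.prems(1) s] by simp
  next
    case True
    then obtain t where t: "s t > 0" by auto
    define s' where "s' = s(t := s t - 1)"
    have s: "s = s'(t := s' t + 1)" by (auto simp: s'_def)
    have fin': "finite {l. s' l \<noteq> 0}"
      by (rule finite_subset[of _ "insert t {l. s l \<noteq> 0}"]) (use less.prems in \<open>auto simp: s'_def\<close>)
    have pos: "(\<Sum>l\<in>{l. s' l > 0}. s' l) = (\<Sum>l\<in>{l. s l > 0}. s' l)"
      using finp t by (intro sum.mono_neutral_left) (auto simp: s'_def split: if_splits)
    also have "\<dots> < (\<Sum>l\<in>{l. s l > 0}. s l)"
      using finp t by (intro sum_strict_mono_ex1) (auto simp: s'_def)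
    finally have dec: "nat (\<Sum>l\<in>{l. s' l > 0}. s' l) < nat (\<Sum>l\<in>{l. s l > 0}. s l)"
      using sum_nonneg[of "{l. s' l > 0}" s'] by auto
    have ih: "res_sum e s' k = newton_int (moment e s') (int k + 1 + total s')" for k
      using dec fin' less.prems(2) t
      by (intro less.hyps) (auto simp: s'_def)
    have tot: "total s = total s' + 1" by (subst s) (rule total_upd[OF fin'])
    have mo: "moment e s = (\<lambda>k. moment e s' k + e t ^ k)"
      by (rule ext, subst s) (rule moment_upd[OF fin'])
    have "res_sum e s k = res_sum e s' (Suc k) - e t * res_sum e s' k"
      by (subst s) (rule res_sum_zero_step[OF assms(1) fin'], use t in \<open>auto simp: s'_def\<close>)
    also have "\<dots> = newton_int (moment e s) (int k + 2 + total s')"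
      unfolding mo newton_int_add_root ih by (simp add: algebra_simps)
    finally show ?thesis by (simp add: tot algebra_simps)
  qed
qed

text \<open>Newton's identities compute the coefficients of a product of linear factors from its
  power sums. The vanishing beyond the degree is carried along because the induction step enlarges
  the summation range by one.\<close>

lemma zprod_polynomial:
  fixes e :: "int \<Rightarrow> 'k::field_char_0"
  assumes "finite {l. s l \<noteq> 0}" "\<And>l. s l \<ge> 0"
  shows "zprod (\<lambda>l. x - e l) s = (\<Sum>r\<le>nat (total s). newton (moment e s) r * x ^ (nat (total s) - r))
       \<and> (\<forall>r>nat (total s). newton (moment e s) r = 0)"
  using assms
proof (induction "nat (total s)" arbitrary: s)
  case 0
  have "total s \<ge> 0" unfolding total_def using "0.prems"(2) by (simp add: sum_nonneg)
  hence "total s = 0" using 0 by simp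
  hence z: "s l = 0" for l
    using 0 sum_nonneg_eq_0_iff[of "{l. s l \<noteq> 0}" s] unfolding total_def by auto
  hence "s = (\<lambda>_. 0)" by auto
  moreover have "moment e (\<lambda>_. 0) = (\<lambda>_. 0)" by (simp add: fun_eq_iff moment_def)
  moreover have "total (\<lambda>_. 0) = 0" by (simp add: total_def)
  ultimately show ?case by (simp add: newton_zero_moments zprod_def)
next
  case (Suc n)
  have "\<exists>t. s t > 0"
  proof (rule ccontr)
    assume "\<not> ?thesis"
    hence "s l = 0" for l using Suc.prems(2)[of l] by (meson antisym not_less)
    thus False using Suc(2) by (simp add: total_def)
  qed
  then obtain t where t: "s t > 0" by auto
  define s' where "s' = s(t := s t - 1)"
  have s: "s = s'(t := s' t + 1)" by (auto simp: s'_def)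
  have fin': "finite {l. s' l \<noteq> 0}"
    by (rule finite_subset[of _ "insert t {l. s l \<noteq> 0}"]) (use Suc.prems in \<open>auto simp: s'_def\<close>)
  have tot: "total s = total s' + 1" by (subst s) (rule total_upd[OF fin'])
  have nn: "\<And>l. s' l \<ge> 0" using t Suc.prems(2) by (simp add: s'_def)
  have n: "n = nat (total s')" using Suc(2) tot by simp
  have mo: "moment e s = (\<lambda>k. moment e s' k + e t ^ k)"
    by (rule ext, subst s) (rule moment_upd[OF fin'])
  note ih = Suc.hyps(1)[OF n fin' nn, folded n]
  have nt: "newton (moment e s) r = newton (moment e s') r - (if r = 0 then 0 else e t * newton (moment e s') (r - 1))" for r
    using newton_int_add_root[of "moment e s'" "e t" "int r"]
    by (cases r) (auto simp: newton_int_def mo nat_diff_distrib nat_add_distrib)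
  have "zprod (\<lambda>l. x - e l) s = zprod (\<lambda>l. x - e l) (\<lambda>l. s' l + (if l = t then 1 else 0))"
    by (intro zprod_cong) (auto simp: s'_def)
  also have "\<dots> = (x - e t) * zprod (\<lambda>l. x - e l) s'"
  \<comment> \<open>A zero base in both supports is excluded from \<open>zprod_add\<close>; in that
    case both sides are 0.\<close>
  proof (cases "x = e t \<and> s' t \<noteq> 0")
    case False
    have "zprod (\<lambda>l. x - e l) (\<lambda>l. s' l + (if l = t then 1 else 0)) = zprod (\<lambda>l. x - e l) s' * zprod (\<lambda>l. x - e l) (\<lambda>l. if l = t then 1 else 0)"
      using False fin' by (intro zprod_add) (auto split: if_splits)
    also have "zprod (\<lambda>l. x - e l) (\<lambda>l. if l = t then 1 else 0) = x - e t"
      by (subst zprod_window[of "{t}"]) auto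
    finally show ?thesis by simp
  next
    case True
    have "zprod (\<lambda>l. x - e l) (\<lambda>l. s' l + (if l = t then 1 else 0)) = 0"
      using True fin' nn[of t]
      by (subst zprod_window[of "insert t {l. s' l \<noteq> 0}"]) (auto simp: power_int_0_left_if)
    thus ?thesis using True by simp
  qed
  also have "\<dots> = (x - e t) * (\<Sum>r\<le>n. newton (moment e s') r * x ^ (n - r))"
    using ih by simp
  also have "\<dots> = (\<Sum>r\<le>Suc n. newton (moment e s) r * x ^ (Suc n - r))"
  proof -
    have "x * (\<Sum>r\<le>n. newton (moment e s') r * x ^ (n - r)) = (\<Sum>r\<le>n. newton (moment e s') r * x ^ (Suc n - r))"
      by (auto simp: sum_distrib_left Suc_diff_le intro!: sum.cong)
    also have "\<dots> = (\<Sum>r\<le>Suc n. newton (moment e s') r * x ^ (Suc n - r))"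
      using ih by simp
    finally have 1: "x * (\<Sum>r\<le>n. newton (moment e s') r * x ^ (n - r)) = (\<Sum>r\<le>Suc n. newton (moment e s') r * x ^ (Suc n - r))" .
    have 2: "e t * (\<Sum>r\<le>n. newton (moment e s') r * x ^ (n - r))
        = (\<Sum>r\<le>Suc n. (if r = 0 then 0 else e t * newton (moment e s') (r - 1)) * x ^ (Suc n - r))"
      by (subst sum.atMost_Suc_shift) (simp add: sum_distrib_left mult.assoc)
    show ?thesis unfolding left_diff_distrib 1 2
      by (simp only: sum_subtractf[symmetric] nt left_diff_distrib)
  qed
  finally have main: "zprod (\<lambda>l. x - e l) s = (\<Sum>r\<le>Suc n. newton (moment e s) r * x ^ (Suc n - r))" .
  have "newton (moment e s) r = 0" if "r > Suc n" for r
    using that ih by (auto simp: nt)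
  thus ?case using main Suc(2) by simp
qed

section \<open>Height functions\<close>

type_synonym cfg = "nat \<times> nat \<Rightarrow> nat"

text \<open>A height function \<open>h\<close> stands for the submodule spanned by the \<open>x\<^sub>1\<^sup>i x\<^sub>2\<^sup>j x\<^sub>3\<^sup>k\<close> with
  \<open>- h (i, j) \<le> k < 0\<close>. For \<open>p = (i, j)\<close> and \<open>k = - h p\<close> this monomial has Chern class
  \<open>dg p s\<^sub>1 + lv a h p s\<^sub>3 + jj p (s\<^sub>1 + s\<^sub>2 - a s\<^sub>3)\<close>.\<close>

definition dg :: "nat \<times> nat \<Rightarrow> int" where "dg p = int (fst p) - int (snd p)"
definition jj :: "nat \<times> nat \<Rightarrow> int" where "jj p = int (snd p)"
definition lv :: "int \<Rightarrow> cfg \<Rightarrow> nat \<times> nat \<Rightarrow> int" where "lv a h p = a * jj p - int (h p)"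

definition valid :: "(nat \<times> nat) set \<Rightarrow> cfg \<Rightarrow> bool" where
  "valid mu h \<longleftrightarrow> (\<forall>p. p \<notin> mu \<longrightarrow> h p = 0)
     \<and> (\<forall>i j. (Suc i, j) \<in> mu \<longrightarrow> h (i, j) \<le> h (Suc i, j))
     \<and> (\<forall>i j. (i, Suc j) \<in> mu \<longrightarrow> h (i, j) \<le> h (i, Suc j))"

text \<open>For \<open>B = w3 + a * y\<close> and \<open>v = c + a * y\<close> this is [w3 < c] -
  [w3 < 0], the coefficient of t3^w3 in (t3^c - 1)/(1 - t3) up to sign, uniformly for both signs of
  c.\<close>

definition step_ind :: "int \<Rightarrow> int \<Rightarrow> int \<Rightarrow> int \<Rightarrow> int" where
  "step_ind a B y v = of_bool (B < v) - of_bool (B < a * y)"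

text \<open>The four terms are 1, 1/(t1 t2), -1/t1 and -1/t2 of (1 - t1)(1 - t2)/(t1 t2), applied to
  a product of a column with a conjugate column. Division by t2 lowers y by one and the level by
  a.\<close>

definition pair_coef :: "int \<Rightarrow> int \<Rightarrow> int \<Rightarrow> int \<Rightarrow> int \<Rightarrow> int \<Rightarrow> int \<Rightarrow> int" where
  "pair_coef a D B y \<delta> \<eta> \<beta> =
     of_bool (\<delta> = D \<and> \<eta> = y) * step_ind a B y \<beta>
   + of_bool (\<delta> = D \<and> \<eta> - 1 = y) * step_ind a B y (\<beta> - a)
   - of_bool (\<delta> - 1 = D \<and> \<eta> = y) * step_ind a B y \<beta>
   - of_bool (\<delta> + 1 = D \<and> \<eta> - 1 = y) * step_ind a B y (\<beta> - a)"

text \<open>The terms of V that are linear in the character and in its conjugate; the latter comes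
  with 1/(t1 t2), hence the reflected arguments.\<close>

definition frame_coef :: "int \<Rightarrow> int \<Rightarrow> int \<Rightarrow> int \<Rightarrow> int \<Rightarrow> int \<Rightarrow> int \<Rightarrow> int" where
  "frame_coef a D B y \<delta> \<eta> \<beta> =
     of_bool (\<delta> = D \<and> \<eta> = y) * step_ind a B y \<beta>
   + of_bool (- \<delta> = D \<and> - \<eta> - 1 = y) * step_ind a B y (- \<beta> - a)"

text \<open>With \<open>w = (w\<^sub>1, w\<^sub>2, w\<^sub>3)\<close>, the number \<open>vcoef mu a h D B y\<close> is the coefficient of
  \<open>t\<^sup>w\<close> in \<open>V\<^sub>Q\<close> for \<open>D = w\<^sub>1 - w\<^sub>2\<close>, \<open>B = w\<^sub>3 + a w\<^sub>2\<close>, \<open>y = w\<^sub>2\<close>; on the hyperplane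
  \<open>a s\<^sub>3 = s\<^sub>1 + s\<^sub>2\<close> the Chern class of \<open>t\<^sup>w\<close> is \<open>D s\<^sub>1 + B s\<^sub>3\<close>.\<close>

definition vcoef :: "(nat \<times> nat) set \<Rightarrow> int \<Rightarrow> cfg \<Rightarrow> int \<Rightarrow> int \<Rightarrow> int \<Rightarrow> int" where
  "vcoef mu a h D B y =
     (\<Sum>p\<in>mu. \<Sum>q\<in>mu. pair_coef a D B y (dg p - dg q) (jj p - jj q) (lv a h p - lv a h q))
   - (\<Sum>p\<in>mu. frame_coef a D B y (dg p) (jj p) (lv a h p))"

text \<open>\<open>corner mu a h d n i\<close> is minus the order, at the box with \<open>x\<^sub>2\<close>-exponent \<open>i\<close> on the
  torus weight \<open>(d, n)\<close>, of the factor that \<open>e(-V)\<close> acquires when a box is added there.\<close>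

definition corner :: "(nat \<times> nat) set \<Rightarrow> int \<Rightarrow> cfg \<Rightarrow> int \<Rightarrow> int \<Rightarrow> int \<Rightarrow> int" where
  "corner mu a h d n i =
     (\<Sum>p\<in>mu. of_bool (dg p = d \<and> jj p = i \<and> lv a h p = n + 1)
            + of_bool (dg p = d \<and> jj p = i + 1 \<and> lv a h p = n + a + 1)
            - of_bool (dg p = d + 1 \<and> jj p = i \<and> lv a h p = n + 1)
            - of_bool (dg p = d - 1 \<and> jj p = i + 1 \<and> lv a h p = n + a + 1))
     - of_bool (d = 0 \<and> n = - a - 1 \<and> i = - 1)"

lemma pair_coef_step_left:
  fixes l n a i y j dq d :: int
  shows "pair_coef a 0 0 y (dq - d) (j - i) (l - n) - pair_coef a 0 0 y (dq - d) (j - i) (l - (n + 1))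
     = of_bool (dq = d \<and> j = i + y \<and> l = n + 1) + of_bool (dq = d \<and> j = i + y + 1 \<and> l = n + a + 1)
     - of_bool (dq = d + 1 \<and> j = i + y \<and> l = n + 1) - of_bool (dq = d - 1 \<and> j = i + y + 1 \<and> l = n + a + 1)"
proof -
  have *: "step_ind a 0 y (v - n) - step_ind a 0 y (v - (n + 1)) = of_bool (v = n + 1)" for v
    by (auto simp: step_ind_def)
  have 1: "of_bool P * step_ind a 0 y (l - n) - of_bool P * step_ind a 0 y (l - (n + 1)) = of_bool (P \<and> l = n + 1)" for P
    using *[of l] by (cases P) auto
  have 2: "of_bool P * step_ind a 0 y (l - n - a) - of_bool P * step_ind a 0 y (l - (n + 1) - a) = of_bool (P \<and> l = n + a + 1)" for P
    using *[of "l - a"] by (cases P) (auto simp: algebra_simps)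
  have c: "(dq - d = 0 \<and> j - i = y) = (dq = d \<and> j = i + y)" "(dq - d = 0 \<and> j - i - 1 = y) = (dq = d \<and> j = i + y + 1)"
    "(dq - d - 1 = 0 \<and> j - i = y) = (dq = d + 1 \<and> j = i + y)" "(dq - d + 1 = 0 \<and> j - i - 1 = y) = (dq = d - 1 \<and> j = i + y + 1)"
    by auto
  show ?thesis
    unfolding pair_coef_def c
    using 1[of "dq = d \<and> j = i + y"] 2[of "dq = d \<and> j = i + y + 1"] 1[of "dq = d + 1 \<and> j = i + y"] 2[of "dq = d - 1 \<and> j = i + y + 1"]
    by (simp only: conj_assoc)
qed

lemma pair_coef_step_right:
  fixes l n a i y j dq d :: int
  shows "pair_coef a 0 0 y (d - dq) (i - j) (n - l) - pair_coef a 0 0 y (d - dq) (i - j) (n + 1 - l)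
     = - (of_bool (dq = d \<and> j = i - y - 1 \<and> l = n - a) + of_bool (dq = d \<and> j = i - y \<and> l = n)
     - of_bool (dq = d + 1 \<and> j = i - y - 1 \<and> l = n - a) - of_bool (dq = d - 1 \<and> j = i - y \<and> l = n))"
proof -
  have *: "step_ind a 0 y (n - v) - step_ind a 0 y (n + 1 - v) = - of_bool (v = n)" for v
    by (auto simp: step_ind_def)
  have 1: "of_bool P * step_ind a 0 y (n - l) - of_bool P * step_ind a 0 y (n + 1 - l) = - of_bool (P \<and> l = n)" for P
    using *[of l] by (cases P) auto
  have 2: "of_bool P * step_ind a 0 y (n - l - a) - of_bool P * step_ind a 0 y (n + 1 - l - a) = - of_bool (P \<and> l = n - a)" for P
    using *[of "l + a"] by (cases P) (auto simp: algebra_simps)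
  have c: "(d - dq = 0 \<and> i - j = y) = (dq = d \<and> j = i - y)" "(d - dq = 0 \<and> i - j - 1 = y) = (dq = d \<and> j = i - y - 1)"
    "(d - dq - 1 = 0 \<and> i - j = y) = (dq = d - 1 \<and> j = i - y)" "(d - dq + 1 = 0 \<and> i - j - 1 = y) = (dq = d + 1 \<and> j = i - y - 1)"
    by auto
  show ?thesis
    unfolding pair_coef_def c
    using 1[of "dq = d \<and> j = i - y"] 2[of "dq = d \<and> j = i - y - 1"] 1[of "dq = d - 1 \<and> j = i - y"] 2[of "dq = d + 1 \<and> j = i - y - 1"]
    by (simp only: conj_assoc)
qed

lemma double_sum_remove:
  fixes F :: "'b \<Rightarrow> 'b \<Rightarrow> 'c::ab_group_add"
  assumes "finite A" "p \<in> A"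
  shows "(\<Sum>q\<in>A. \<Sum>r\<in>A. F q r) = F p p + (\<Sum>q\<in>A-{p}. F q p + F p q) + (\<Sum>q\<in>A-{p}. \<Sum>r\<in>A-{p}. F q r)"
  using assms by (simp add: sum.remove[of A p] sum.distrib algebra_simps)

text \<open>Only pairs containing p and the frame term of p change. Pairs with p in second place
  assemble to the corner function at level n, pairs with p in first place to the one at level n - a
  - 1, reflected. The pair (p,p) never changes, but p itself is counted in the first corner function
  at y = 0, and this is subtracted.\<close>

lemma vcoef_add_box:
  assumes "finite mu" "p \<in> mu" "lv a h p = n + 1" "dg p = d" "jj p = i" "a > 0"
  shows "vcoef mu a (h(p := Suc (h p))) 0 0 y
       = vcoef mu a h 0 0 y + corner mu a h d n (i + y) - corner mu a h d (n - a - 1) (i - y - 1) - of_bool (y = 0)"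
proof -
  let ?h = "h(p := Suc (h p))"
  let ?K = "\<lambda>h q r. pair_coef a 0 0 y (dg q - dg r) (jj q - jj r) (lv a h q - lv a h r)"
  let ?R = "\<lambda>h q. frame_coef a 0 0 y (dg q) (jj q) (lv a h q)"
  let ?U = "\<lambda>q. of_bool (dg q = d \<and> jj q = i + y \<and> lv a h q = n + 1) + of_bool (dg q = d \<and> jj q = i + y + 1 \<and> lv a h q = n + a + 1)
     - of_bool (dg q = d + 1 \<and> jj q = i + y \<and> lv a h q = n + 1) - of_bool (dg q = d - 1 \<and> jj q = i + y + 1 \<and> lv a h q = n + a + 1) :: int"
  let ?W = "\<lambda>q. of_bool (dg q = d \<and> jj q = i - y - 1 \<and> lv a h q = n - a) + of_bool (dg q = d \<and> jj q = i - y \<and> lv a h q = n)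
     - of_bool (dg q = d + 1 \<and> jj q = i - y - 1 \<and> lv a h q = n - a) - of_bool (dg q = d - 1 \<and> jj q = i - y \<and> lv a h q = n) :: int"
  have lvp: "lv a ?h p = n" using assms by (simp add: lv_def)
  have lvq: "lv a ?h q = lv a h q" if "q \<noteq> p" for q using that by (simp add: lv_def)
  have A: "?K ?h q p + ?K ?h p q = ?K h q p + ?K h p q + (?U q - ?W q)" if "q \<noteq> p" for q
    using pair_coef_step_left[of a y "dg q" d "jj q" i "lv a h q" n]
      pair_coef_step_right[of a y d "dg q" i "jj q" n "lv a h q"]
    unfolding lvp lvq[OF that] assms(3-5) by linarith
  have Up: "?U p = of_bool (y = 0)" and Wp: "?W p = 0" using assms by auto
  have "(\<Sum>q\<in>mu. \<Sum>r\<in>mu. ?K ?h q r) = ?K h p p + (\<Sum>q\<in>mu-{p}. ?K h q p + ?K h p q + (?U q - ?W q)) + (\<Sum>q\<in>mu-{p}. \<Sum>r\<in>mu-{p}. ?K h q r)"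
  proof -
    have "?K ?h p p = ?K h p p" by (simp only: diff_self)
    moreover have "(\<Sum>q\<in>mu-{p}. ?K ?h q p + ?K ?h p q) = (\<Sum>q\<in>mu-{p}. ?K h q p + ?K h p q + (?U q - ?W q))"
      by (rule sum.cong[OF refl], rule A) blast
    moreover have "(\<Sum>q\<in>mu-{p}. \<Sum>r\<in>mu-{p}. ?K ?h q r) = (\<Sum>q\<in>mu-{p}. \<Sum>r\<in>mu-{p}. ?K h q r)"
    proof (rule sum.cong[OF refl], rule sum.cong[OF refl])
      fix q r assume "q \<in> mu - {p}" "r \<in> mu - {p}"
      hence qp: "q \<noteq> p" and rp: "r \<noteq> p" by auto
      show "?K ?h q r = ?K h q r" by (simp only: lvq[OF qp] lvq[OF rp])
    qed
    ultimately show ?thesis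
      unfolding double_sum_remove[OF assms(1,2), of "?K ?h"] by (simp only:)
  qed
  also have "\<dots> = (\<Sum>q\<in>mu. \<Sum>r\<in>mu. ?K h q r) + (\<Sum>q\<in>mu-{p}. ?U q - ?W q)"
    unfolding double_sum_remove[OF assms(1,2), of "?K h"] by (simp add: sum.distrib)
  also have "(\<Sum>q\<in>mu-{p}. ?U q - ?W q) = (\<Sum>q\<in>mu. ?U q) - (\<Sum>q\<in>mu. ?W q) - of_bool (y = 0)"
    using assms(1,2) Up Wp by (simp only: sum_subtractf sum.remove[OF assms(1,2)])
  finally have 1: "(\<Sum>q\<in>mu. \<Sum>r\<in>mu. ?K ?h q r) = (\<Sum>q\<in>mu. \<Sum>r\<in>mu. ?K h q r) + ((\<Sum>q\<in>mu. ?U q) - (\<Sum>q\<in>mu. ?W q) - of_bool (y = 0))" .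
  have "(\<Sum>q\<in>mu. ?R ?h q) = ?R ?h p + (\<Sum>q\<in>mu-{p}. ?R ?h q)"
    by (rule sum.remove[OF assms(1,2)])
  also have "(\<Sum>q\<in>mu-{p}. ?R ?h q) = (\<Sum>q\<in>mu-{p}. ?R h q)" 
  proof (rule sum.cong[OF refl])
    fix q assume "q \<in> mu - {p}"
    hence qp: "q \<noteq> p" by auto
    show "?R ?h q = ?R h q" by (simp only: lvq[OF qp])
  qed
  also have "\<dots> = (\<Sum>q\<in>mu. ?R h q) - ?R h p" using sum.remove[OF assms(1,2), of "?R h"] by simp
  finally have 2: "(\<Sum>q\<in>mu. ?R ?h q) = (\<Sum>q\<in>mu. ?R h q) + (?R ?h p - ?R h p)" by linarith
  have 3: "?R ?h p - ?R h p = of_bool (d = 0 \<and> n = - a - 1 \<and> i + y = - 1) - of_bool (d = 0 \<and> n - a - 1 = - a - 1 \<and> i - y - 1 = - 1)"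
    unfolding lvp assms(3-5) by (auto simp: frame_coef_def step_ind_def)
  have 4: "corner mu a h d n (i + y) = (\<Sum>q\<in>mu. ?U q) - of_bool (d = 0 \<and> n = - a - 1 \<and> i + y = - 1)"
    unfolding corner_def by (simp only: add.assoc)
  have 5: "corner mu a h d (n - a - 1) (i - y - 1) = (\<Sum>q\<in>mu. ?W q) - of_bool (d = 0 \<and> n - a - 1 = - a - 1 \<and> i - y - 1 = - 1)"
    unfolding corner_def by simp
  show ?thesis unfolding vcoef_def 1 2 3 4 5 by simp
qed

section \<open>Corners of the level sets of a height function\<close>

definition inn :: "(nat \<times> nat) set \<Rightarrow> int \<Rightarrow> int \<Rightarrow> bool" where
  "inn mu x y \<longleftrightarrow> 0 \<le> x \<and> 0 \<le> y \<and> (nat x, nat y) \<in> mu"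

definition hh :: "cfg \<Rightarrow> int \<Rightarrow> int \<Rightarrow> int" where "hh h x y = int (h (nat x, nat y))"

lemma sum_column:
  assumes "finite mu"
  shows "(\<Sum>p\<in>mu. of_bool (dg p = d \<and> jj p = i \<and> lv a h p = n)) = (of_bool (inn mu (i + d) i \<and> hh h (i + d) i = a * i - n) :: int)"
proof -
  let ?p = "(nat (i + d), nat i)"
  have "(\<Sum>p\<in>mu. of_bool (dg p = d \<and> jj p = i \<and> lv a h p = n))
      = (\<Sum>p\<in>mu. if p = ?p then of_bool (inn mu (i + d) i \<and> hh h (i + d) i = a * i - n) else (0::int))"
    by (intro sum.cong refl) (auto simp: dg_def jj_def lv_def inn_def hh_def)
  also have "\<dots> = of_bool (inn mu (i + d) i \<and> hh h (i + d) i = a * i - n)"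
    using assms by (auto simp: sum.delta inn_def)
  finally show ?thesis .
qed

text \<open>In the coordinates (x, i) the four terms of \<open>corner\<close> sit on a unit square,
  and all of them ask for the same height c, because a step in the second direction raises the
  reference level by a. The last term is a virtual corner at (-1,-1).\<close>

lemma corner_xy:
  assumes "finite mu" "x = i + d" "c = a * i - n - 1"
  shows "corner mu a h d n i = of_bool (inn mu x i \<and> hh h x i = c) + of_bool (inn mu (x + 1) (i + 1) \<and> hh h (x + 1) (i + 1) = c)
    - of_bool (inn mu (x + 1) i \<and> hh h (x + 1) i = c) - of_bool (inn mu x (i + 1) \<and> hh h x (i + 1) = c)
    - of_bool (x = -1 \<and> i = -1 \<and> c = 0)"
proof -
  have e: "i + 1 + d = x + 1" "i + (d + 1) = x + 1" "i + 1 + (d - 1) = x" "i + d = x" "a * i - (n + 1) = c"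
    "a * (i + 1) - (n + a + 1) = c" using assms by (auto simp: algebra_simps)
  have f: "(d = 0 \<and> n = - a - 1 \<and> i = - 1) = (x = -1 \<and> i = -1 \<and> c = 0)" using assms by auto
  show ?thesis
    unfolding corner_def sum.distrib sum_subtractf sum_column[OF assms(1)] e f by simp
qed

lemma inn_down:
  assumes "is_partition mu"
  shows "inn mu (x + 1) y \<Longrightarrow> 0 \<le> x \<Longrightarrow> inn mu x y" "inn mu x (y + 1) \<Longrightarrow> 0 \<le> y \<Longrightarrow> inn mu x y"
  using assms unfolding is_partition_def inn_def
  by (meson le_add_same_cancel1 nat_mono order_refl zero_le_one zle_add1_eq_le less_imp_le zless_add1_eq)+

lemma hh_mono:
  assumes "valid mu h"
  shows "inn mu (x + 1) y \<Longrightarrow> 0 \<le> x \<Longrightarrow> hh h x y \<le> hh h (x + 1) y" "inn mu x (y + 1) \<Longrightarrow> 0 \<le> y \<Longrightarrow> hh h x y \<le> hh h x (y + 1)"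
  using assms unfolding valid_def inn_def hh_def by (auto simp: nat_add_distrib)

text \<open>A, B, C, D stand for the corners (x,i), (x+1,i), (x,i+1), (x+1,i+1) of the square; X and
  Y say that x and i are nonnegative, and E is the virtual corner. If the two diagonal corners both
  have height c, monotonicity squeezes the other two to c as well, so the positive terms never win
  by more than one.\<close>

lemma corner_cases_aux:
  fixes ha hb hc hd c :: int
  assumes "A \<longrightarrow> X \<and> Y" "B \<longrightarrow> Y" "C \<longrightarrow> X" "B \<and> X \<longrightarrow> A \<and> ha \<le> hb" "C \<and> Y \<longrightarrow> A \<and> ha \<le> hc"
    "D \<and> Y \<longrightarrow> B \<and> hb \<le> hd" "D \<and> X \<longrightarrow> C \<and> hc \<le> hd" "E \<longrightarrow> \<not> X \<and> \<not> Y"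
    "m = of_bool (A \<and> ha = c) + of_bool (D \<and> hd = c) - of_bool (B \<and> hb = c) - of_bool (C \<and> hc = c) - (of_bool E :: int)"
  shows "m \<le> 1 \<and> (m = 1 \<longleftrightarrow> (A \<and> ha = c \<and> (B \<longrightarrow> hb > c) \<and> (C \<longrightarrow> hc > c))
     \<or> (D \<and> hd = c \<and> (B \<longrightarrow> hb < c) \<and> (C \<longrightarrow> hc < c) \<and> \<not> E))"
proof -
  define pa pb pc pd where "pa \<longleftrightarrow> A \<and> ha = c" and "pb \<longleftrightarrow> B \<and> hb = c" and "pc \<longleftrightarrow> C \<and> hc = c" and "pd \<longleftrightarrow> D \<and> hd = c"
  note defs = pa_def pb_def pc_def pd_def
  have m: "m = of_bool pa + of_bool pd - of_bool pb - of_bool pc - of_bool E"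
    using assms(9) by (simp add: defs)
  have f: "pa \<and> pd \<longrightarrow> pb \<and> pc"
    using assms(1,4-7) unfolding defs by (metis antisym)
  have m1: "m = 1 \<longleftrightarrow> (pa \<and> \<not> pd \<or> pd \<and> \<not> pa) \<and> \<not> pb \<and> \<not> pc \<and> \<not> E"
    using f unfolding m by (cases pa; cases pb; cases pc; cases pd; cases E) simp_all
  have add: "pa \<and> \<not> pd \<and> \<not> pb \<and> \<not> pc \<and> \<not> E \<longleftrightarrow> A \<and> ha = c \<and> (B \<longrightarrow> hb > c) \<and> (C \<longrightarrow> hc > c)" (is "_ \<longleftrightarrow> ?R")
  proof
    assume L: "pa \<and> \<not> pd \<and> \<not> pb \<and> \<not> pc \<and> \<not> E"
    thus ?R using assms(1-5) unfolding defs by (metis order_less_le)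
  next
    assume R: ?R
    hence "\<not> pb" "\<not> pc" "pa" "\<not> E" using assms(1,8) unfolding defs by auto
    thus "pa \<and> \<not> pd \<and> \<not> pb \<and> \<not> pc \<and> \<not> E" using f by blast
  qed
  have spur: "pd \<and> \<not> pa \<and> \<not> pb \<and> \<not> pc \<and> \<not> E \<longleftrightarrow> D \<and> hd = c \<and> (B \<longrightarrow> hb < c) \<and> (C \<longrightarrow> hc < c) \<and> \<not> E" (is "_ \<longleftrightarrow> ?R")
  proof
    assume L: "pd \<and> \<not> pa \<and> \<not> pb \<and> \<not> pc \<and> \<not> E"
    thus ?R using assms(2,3,6,7) unfolding defs by (metis order_less_le)
  next
    assume R: ?R
    hence "\<not> pb" "\<not> pc" "pd" "\<not> E" unfolding defs by auto
    thus "pd \<and> \<not> pa \<and> \<not> pb \<and> \<not> pc \<and> \<not> E" using f by blast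
  qed
  have "m \<le> 1" using f unfolding m by (cases pa; cases pb; cases pc; cases pd; cases E) simp_all
  thus ?thesis using m1 add spur by blast
qed

text \<open>The first alternative says that a box can be added to the column (x, i), the second that
  the column (x+1, i+1) has a removable box; excluding the virtual corner is what makes that column
  nonempty at the origin. The bound 1 makes all poles simple.\<close>

lemma corner_cases:
  assumes "is_partition mu" "valid mu h" "x = i + d" "c = a * i - n - 1"
  shows "corner mu a h d n i \<le> 1"
    and "corner mu a h d n i = 1 \<longleftrightarrow>
      (inn mu x i \<and> hh h x i = c \<and> (inn mu (x + 1) i \<longrightarrow> hh h (x + 1) i > c) \<and> (inn mu x (i + 1) \<longrightarrow> hh h x (i + 1) > c))
    \<or> (inn mu (x + 1) (i + 1) \<and> hh h (x + 1) (i + 1) = c \<and> (inn mu (x + 1) i \<longrightarrow> hh h (x + 1) i < c)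
        \<and> (inn mu x (i + 1) \<longrightarrow> hh h x (i + 1) < c) \<and> \<not> (x = -1 \<and> i = -1 \<and> c = 0))" (is "_ \<longleftrightarrow> ?A \<or> ?S")
proof -
  have fin: "finite mu" using assms(1) by (simp add: is_partition_def)
  note cxy = corner_xy[OF fin assms(3,4), of h]
  note nn = inn_def[of mu x i] inn_def[of mu "x+1" i] inn_def[of mu x "i+1"]
  have "corner mu a h d n i \<le> 1 \<and> (corner mu a h d n i = 1 \<longleftrightarrow> ?A \<or> ?S)"
    by (rule corner_cases_aux[where X = "0 \<le> x" and Y = "0 \<le> i", OF _ _ _ _ _ _ _ _ cxy])
       (use inn_down[OF assms(1), of x i] inn_down[OF assms(1), of x "i+1"] inn_down[OF assms(1), of "x+1" i]
         hh_mono[OF assms(2), of x i] hh_mono[OF assms(2), of x "i+1"] hh_mono[OF assms(2), of "x+1" i] nn in auto)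
  thus "corner mu a h d n i \<le> 1" "corner mu a h d n i = 1 \<longleftrightarrow> ?A \<or> ?S" by auto
qed

lemma valid_raise:
  assumes "valid mu h" "p \<in> mu"
  shows "valid mu (h(p := Suc (h p))) \<longleftrightarrow>
    ((Suc (fst p), snd p) \<in> mu \<longrightarrow> h p < h (Suc (fst p), snd p)) \<and>
    ((fst p, Suc (snd p)) \<in> mu \<longrightarrow> h p < h (fst p, Suc (snd p)))" (is "?L \<longleftrightarrow> ?R")
proof
  assume L: ?L
  have 1: "\<And>i j. (Suc i, j) \<in> mu \<Longrightarrow> (h(p := Suc (h p))) (i, j) \<le> (h(p := Suc (h p))) (Suc i, j)"
    and 2: "\<And>i j. (i, Suc j) \<in> mu \<Longrightarrow> (h(p := Suc (h p))) (i, j) \<le> (h(p := Suc (h p))) (i, Suc j)"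
    using L unfolding valid_def by blast+
  show ?R using 1[of "fst p" "snd p"] 2[of "fst p" "snd p"]
    by (cases p) (auto simp: Suc_le_eq)
next
  assume R: ?R
  show ?L using assms R unfolding valid_def
    by (cases p) (auto simp: Suc_le_eq le_Suc_eq)
qed

lemma valid_lower:
  assumes "valid mu h" "p \<in> mu" "h p > 0"
  shows "valid mu (h(p := h p - 1)) \<longleftrightarrow>
    (\<forall>i. fst p = Suc i \<longrightarrow> h (i, snd p) < h p) \<and> (\<forall>j. snd p = Suc j \<longrightarrow> h (fst p, j) < h p)" (is "?L \<longleftrightarrow> ?R")
proof
  assume L: ?L
  have 1: "\<And>i j. (Suc i, j) \<in> mu \<Longrightarrow> (h(p := h p - 1)) (i, j) \<le> (h(p := h p - 1)) (Suc i, j)"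
    and 2: "\<And>i j. (i, Suc j) \<in> mu \<Longrightarrow> (h(p := h p - 1)) (i, j) \<le> (h(p := h p - 1)) (i, Suc j)"
    using L unfolding valid_def by blast+
  show ?R
  proof (intro conjI allI impI)
    fix i assume "fst p = Suc i"
    thus "h (i, snd p) < h p" using 1[of i "snd p"] assms by (cases p) auto
  next
    fix j assume "snd p = Suc j"
    thus "h (fst p, j) < h p" using 2[of "fst p" j] assms by (cases p) auto
  qed
next
  assume R: ?R
  have a: "\<And>p. p \<notin> mu \<Longrightarrow> h p = 0" "\<And>i j. (Suc i, j) \<in> mu \<Longrightarrow> h (i, j) \<le> h (Suc i, j)"
    "\<And>i j. (i, Suc j) \<in> mu \<Longrightarrow> h (i, j) \<le> h (i, Suc j)"
    using assms(1) unfolding valid_def by blast+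
  show ?L unfolding valid_def
  proof (intro conjI allI impI)
    fix q assume "q \<notin> mu" thus "(h(p := h p - 1)) q = 0" using a(1) assms(2) by auto
  next
    fix i j assume m: "(Suc i, j) \<in> mu"
    show "(h(p := h p - 1)) (i, j) \<le> (h(p := h p - 1)) (Suc i, j)"
    proof (cases "p = (Suc i, j)")
      case True thus ?thesis using R by auto
    next
      case False
      have "(h(p := h p - 1)) (i, j) \<le> h (i, j)" by auto
      also have "\<dots> \<le> h (Suc i, j)" using a(2) m .
      finally show ?thesis using False by simp
    qed
  next
    fix i j assume m: "(i, Suc j) \<in> mu"
    show "(h(p := h p - 1)) (i, j) \<le> (h(p := h p - 1)) (i, Suc j)"
    proof (cases "p = (i, Suc j)")
      case True thus ?thesis using R by auto
    next
      case False
      have "(h(p := h p - 1)) (i, j) \<le> h (i, j)" by auto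
      also have "\<dots> \<le> h (i, Suc j)" using a(3) m .
      finally show ?thesis using False by simp
    qed
  qed
qed

definition addable :: "(nat \<times> nat) set \<Rightarrow> int \<Rightarrow> cfg \<Rightarrow> int \<Rightarrow> int \<Rightarrow> (nat \<times> nat) set" where
  "addable mu a h d n = {p \<in> mu. dg p = d \<and> lv a h p = n + 1 \<and> valid mu (h(p := Suc (h p)))}"

definition removable :: "(nat \<times> nat) set \<Rightarrow> int \<Rightarrow> cfg \<Rightarrow> int \<Rightarrow> int \<Rightarrow> (nat \<times> nat) set" where
  "removable mu a h d n = {p \<in> mu. dg p = d \<and> lv a h p = n \<and> h p > 0 \<and> valid mu (h(p := h p - 1))}"

lemma inj_on_jj: "inj_on jj {p. dg p = d}"
  by (auto simp: inj_on_def jj_def dg_def)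

lemma inn_of_nat:
  "inn mu (int i) (int j) \<longleftrightarrow> (i, j) \<in> mu" "inn mu (int i + 1) (int j) \<longleftrightarrow> (Suc i, j) \<in> mu"
  "inn mu (int i) (int j + 1) \<longleftrightarrow> (i, Suc j) \<in> mu"
  by (auto simp: inn_def nat_add_distrib)

lemma hh_of_nat:
  "hh h (int i) (int j) = int (h (i, j))" "hh h (int i + 1) (int j) = int (h (Suc i, j))"
  "hh h (int i) (int j + 1) = int (h (i, Suc j))"
  by (auto simp: hh_def nat_add_distrib)

lemma corner_addable:
  assumes "is_partition mu" "valid mu h" "p \<in> addable mu a h d n"
  shows "corner mu a h d n (jj p) = 1"
proof -
  obtain i j where p: "p = (i, j)" by (cases p)
  have v: "(Suc i, j) \<in> mu \<longrightarrow> h (i, j) < h (Suc i, j)" "(i, Suc j) \<in> mu \<longrightarrow> h (i, j) < h (i, Suc j)"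
    and m: "(i, j) \<in> mu" and d: "int i = int j + d" and c: "int (h (i, j)) = a * int j - n - 1"
    using assms valid_raise[OF assms(2), of p] by (auto simp: addable_def p dg_def lv_def jj_def)
  show ?thesis
    unfolding p jj_def snd_conv corner_cases(2)[OF assms(1,2) d c]
    using v m by (auto simp: inn_of_nat hh_of_nat)
qed

lemma corner_removable:
  assumes "is_partition mu" "valid mu h" "p \<in> removable mu a h d (n + a + 1)"
  shows "corner mu a h d n (jj p - 1) = 1"
proof -
  obtain i j where p: "p = (i, j)" by (cases p)
  have m: "(i, j) \<in> mu" and pos: "h (i, j) > 0" using assms(3) by (auto simp: removable_def p)
  have v: "\<forall>k. i = Suc k \<longrightarrow> h (k, j) < h (i, j)" "\<forall>k. j = Suc k \<longrightarrow> h (i, k) < h (i, j)"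
    and d: "int i - 1 = int j - 1 + d" and c: "int (h (i, j)) = a * (int j - 1) - n - 1"
    using assms valid_lower[OF assms(2), of p] pos by (auto simp: removable_def p dg_def lv_def jj_def algebra_simps)
  have "inn mu (int i - 1 + 1) (int j - 1) \<longrightarrow> hh h (int i - 1 + 1) (int j - 1) < int (h (i, j))"
    using v(2) by (cases j) (auto simp: inn_def hh_def)
  moreover have "inn mu (int i - 1) (int j - 1 + 1) \<longrightarrow> hh h (int i - 1) (int j - 1 + 1) < int (h (i, j))"
    using v(1) by (cases i) (auto simp: inn_def hh_def)
  moreover have "inn mu (int i - 1 + 1) (int j - 1 + 1)" "hh h (int i - 1 + 1) (int j - 1 + 1) = int (h (i, j))"
    using m by (auto simp: inn_def hh_def)
  ultimately show ?thesis
    unfolding p jj_def snd_conv corner_cases(2)[OF assms(1,2) d c] using pos by auto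
qed

lemma corner_pole_cases:
  assumes "is_partition mu" "valid mu h" "corner mu a h d n i = 1"
  shows "(\<exists>p\<in>addable mu a h d n. i = jj p) \<or> (\<exists>p\<in>removable mu a h d (n + a + 1). i = jj p - 1)"
proof -
  define x c where "x = i + d" and "c = a * i - n - 1"
  consider (A) "inn mu x i" "hh h x i = c" "inn mu (x + 1) i \<longrightarrow> hh h (x + 1) i > c" "inn mu x (i + 1) \<longrightarrow> hh h x (i + 1) > c"
    | (S) "inn mu (x + 1) (i + 1)" "hh h (x + 1) (i + 1) = c" "inn mu (x + 1) i \<longrightarrow> hh h (x + 1) i < c"
        "inn mu x (i + 1) \<longrightarrow> hh h x (i + 1) < c" "\<not> (x = -1 \<and> i = -1 \<and> c = 0)"
    using assms(3) corner_cases(2)[OF assms(1,2) x_def c_def] by blast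
  thus ?thesis
  proof cases
    case A
    then obtain u v where uv: "x = int u" "i = int v" "(u, v) \<in> mu"
      unfolding inn_def by (metis int_nat_eq)
    have "(u, v) \<in> addable mu a h d n"
      using A uv valid_raise[OF assms(2), of "(u, v)"] x_def c_def
      unfolding addable_def uv(1,2) inn_of_nat hh_of_nat by (auto simp: dg_def lv_def jj_def)
    thus ?thesis using uv by (auto simp: jj_def intro!: bexI[of _ "(u, v)"])
  next
    case S
    then obtain u v where uv: "x + 1 = int u" "i + 1 = int v" "(u, v) \<in> mu"
      unfolding inn_def by (metis int_nat_eq)
    have c: "int (h (u, v)) = c" using S(2) unfolding uv(1,2) hh_of_nat .
    have k1: "h (k, v) < h (u, v)" if "u = Suc k" for k
    proof -
      have x: "x = int k" using that uv by simp
      have "inn mu x (i + 1)" using assms(1) uv that unfolding x uv(2) inn_of_nat is_partition_def by (meson le_refl le_SucI)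
      thus ?thesis using S(4) c unfolding x uv(2) hh_of_nat by simp
    qed
    have k2: "h (u, k) < h (u, v)" if "v = Suc k" for k
    proof -
      have x: "i = int k" using that uv by simp
      have "inn mu (x + 1) i" using assms(1) uv that unfolding x uv(1) inn_of_nat is_partition_def by (meson le_refl le_SucI)
      thus ?thesis using S(3) c unfolding x uv(1) hh_of_nat by simp
    qed
    \<comment> \<open>At the origin the virtual corner excludes height 0; elsewhere some predecessor
      is strictly shorter.\<close>
    have pos: "h (u, v) > 0"
    proof (cases "u = 0 \<and> v = 0")
      case True
      hence "x = -1" "i = -1" using uv by auto
      thus ?thesis using S(5) c by (cases "h (u, v)") auto
    next
      case False thus ?thesis using k1[of "u - 1"] k2[of "v - 1"] by (cases u; cases v) auto
    qed
    have "a * int v = a * i + a" unfolding uv(2)[symmetric] by (simp add: algebra_simps)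
    hence "(u, v) \<in> removable mu a h d (n + a + 1)"
      using uv c pos k1 k2 valid_lower[OF assms(2), of "(u, v)"] x_def c_def
      unfolding removable_def by (auto simp: dg_def lv_def jj_def algebra_simps)
    thus ?thesis using uv by (auto simp: jj_def intro!: bexI[of _ "(u, v)"])
  qed
qed

text \<open>Equal positions would make q the diagonal successor of p with the same height, whereas
  adding a box to p needs a strict increase on the way from p to q.\<close>

lemma addable_removable_disjoint:
  assumes "is_partition mu" "valid mu h" "p \<in> addable mu a h d n" "q \<in> removable mu a h d (n + a + 1)"
  shows "jj p \<noteq> jj q - 1"
proof
  assume e: "jj p = jj q - 1"
  obtain i j where p: "p = (i, j)" by (cases p)
  have q: "q = (Suc i, Suc j)"
    using e assms(3,4) by (cases q) (auto simp: p addable_def removable_def dg_def jj_def)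
  have "(Suc i, j) \<in> mu"
  proof -
    have "(Suc i, Suc j) \<in> mu" using assms(4) unfolding q removable_def by blast
    thus ?thesis using assms(1) unfolding is_partition_def by (meson le_refl le_SucI)
  qed
  hence "h (i, j) < h (Suc i, j)"
    using assms(2,3) valid_raise[OF assms(2), of p] by (auto simp: addable_def p)
  also have "h (Suc i, j) \<le> h (Suc i, Suc j)"
    using assms(2,4) unfolding valid_def removable_def q by auto
  finally show False using assms(3,4)
    by (auto simp: p q addable_def removable_def lv_def jj_def algebra_simps)
qed

section \<open>Weights of fixed points\<close>

lemma finite_supp_corner:
  assumes "finite mu"
  shows "finite {l. corner mu a h d n l \<noteq> 0}"
proof (rule finite_subset)
  show "{l. corner mu a h d n l \<noteq> 0} \<subseteq> jj ` mu \<union> (\<lambda>p. jj p - 1) ` mu \<union> {-1}"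
  proof
    fix l assume "l \<in> {l. corner mu a h d n l \<noteq> 0}"
    hence ne: "corner mu a h d n l \<noteq> 0" by simp
    show "l \<in> jj ` mu \<union> (\<lambda>p. jj p - 1) ` mu \<union> {-1}"
    proof (rule ccontr)
      assume n: "l \<notin> jj ` mu \<union> (\<lambda>p. jj p - 1) ` mu \<union> {-1}"
      hence "p \<in> mu \<Longrightarrow> jj p \<noteq> l \<and> jj p \<noteq> l + 1" for p by force
      hence "corner mu a h d n l = (\<Sum>p\<in>mu. 0)"
        using n unfolding corner_def by (auto intro!: sum.neutral)
      thus False using ne by simp
    qed
  qed
qed (use assms in auto)

text \<open>Independent of the height function and of D and B, so that all sums over y can be taken
  over one finite set.\<close>

definition window :: "(nat \<times> nat) set \<Rightarrow> int set" where
  "window mu = (\<lambda>(p, q). jj p - jj q) ` (mu \<times> mu) \<union> (\<lambda>(p, q). jj p - jj q - 1) ` (mu \<times> mu) \<union> jj ` mu \<union> (\<lambda>p. - jj p - 1) ` mu"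

lemma window:
  "finite mu \<Longrightarrow> finite (window mu)"
  "p \<in> mu \<Longrightarrow> q \<in> mu \<Longrightarrow> jj p - jj q \<in> window mu"
  "p \<in> mu \<Longrightarrow> q \<in> mu \<Longrightarrow> jj p - jj q - 1 \<in> window mu"
  "p \<in> mu \<Longrightarrow> jj p \<in> window mu" "p \<in> mu \<Longrightarrow> - jj p - 1 \<in> window mu"
  unfolding window_def by (auto simp: image_iff)

lemma vcoef_window: "{y. vcoef mu a h D B y \<noteq> 0} \<subseteq> window mu"
proof
  fix y assume "y \<in> {y. vcoef mu a h D B y \<noteq> 0}"
  hence ne: "vcoef mu a h D B y \<noteq> 0" by simp
  show "y \<in> window mu"
  proof (rule ccontr)
    assume n: "y \<notin> window mu"
    have "pair_coef a D B y (dg p - dg q) (jj p - jj q) \<beta> = 0" if "p \<in> mu" "q \<in> mu" for p q \<beta>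
      using window(2,3)[OF that] n by (auto simp: pair_coef_def)
    moreover have "frame_coef a D B y (dg p) (jj p) \<beta> = 0" if "p \<in> mu" for p \<beta>
      using window(4,5)[OF that] n by (auto simp: frame_coef_def)
    ultimately show False using ne by (simp add: vcoef_def)
  qed
qed

lemma finite_supp_vcoef:
  assumes "finite mu"
  shows "finite {y. vcoef mu a h D B y \<noteq> 0}"
  by (rule finite_subset[OF vcoef_window window(1)[OF assms]])

text \<open>\<open>R\<close> abstracts the functions regular on the hyperplane. Integers have to be
  invertible for Newton's identities and for the numerical factors left over when powers of
  \<open>eps\<close> are extracted.\<close>

locale eps_ring =
  fixes R :: "'k::field_char_0 set" and eps :: 'k
  assumes one_R: "1 \<in> R"
    and add_R: "x \<in> R \<Longrightarrow> y \<in> R \<Longrightarrow> x + y \<in> R"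
    and mult_R: "x \<in> R \<Longrightarrow> y \<in> R \<Longrightarrow> x * y \<in> R"
    and uminus_R: "x \<in> R \<Longrightarrow> - x \<in> R"
    and inverse_int_R: "m \<noteq> 0 \<Longrightarrow> inverse (of_int m) \<in> R"
    and eps_R: "eps \<in> R" and eps_nz: "eps \<noteq> 0"
begin

lemma zero_R: "0 \<in> R" using add_R[OF one_R uminus_R[OF one_R]] by simp

lemma of_nat_R: "of_nat n \<in> R" by (induction n) (auto intro: zero_R add_R one_R)

lemma of_int_R: "of_int n \<in> R"
  by (cases n rule: int_cases2) (auto intro: of_nat_R uminus_R)

lemma diff_R: "x \<in> R \<Longrightarrow> y \<in> R \<Longrightarrow> x - y \<in> R"
  using add_R[of x "- y"] uminus_R by simp

lemma power_R: "x \<in> R \<Longrightarrow> x ^ n \<in> R" by (induction n) (auto intro: one_R mult_R)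

lemma sum_R: "(\<And>i. i \<in> A \<Longrightarrow> f i \<in> R) \<Longrightarrow> sum f A \<in> R"
  by (induction A rule: infinite_finite_induct) (auto intro: zero_R add_R)

lemma prod_R: "(\<And>i. i \<in> A \<Longrightarrow> f i \<in> R) \<Longrightarrow> prod f A \<in> R"
  by (induction A rule: infinite_finite_induct) (auto intro: one_R mult_R)

definition pos :: "int \<Rightarrow> 'k" where "pos l = of_int l * eps"

lemma inj_pos: "inj pos" using eps_nz by (auto simp: inj_def pos_def)

lemma pos_nz: "l \<noteq> 0 \<Longrightarrow> pos l \<noteq> 0" using eps_nz by (auto simp: pos_def)

lemma pos_diff: "pos i - pos l = pos (i - l)" by (simp add: pos_def algebra_simps)

lemma pos_R: "pos l \<in> R" unfolding pos_def by (intro mult_R of_int_R eps_R)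

lemma res_at_pos_inverse: "res_at pos (\<lambda>l. - s l) i * res_at pos s i = 1"
proof -
  have "res_at pos s i \<noteq> 0" unfolding res_at_def
    by (rule zprod_nonzero) (auto simp: pos_diff pos_nz split: if_splits)
  moreover have "res_at pos (\<lambda>l. - s l) i = inverse (res_at pos s i)"
    unfolding res_at_def zprod_minus[symmetric] by (intro zprod_cong) auto
  ultimately show ?thesis by simp
qed

end

locale boxes = eps_ring R eps for R :: "'k::field_char_0 set" and eps +
  fixes mu :: "(nat \<times> nat) set" and a :: int
  assumes part: "is_partition mu" and a_pos: "a > 0"
begin

lemma fin_mu: "finite mu" using part by (simp add: is_partition_def)

text \<open>The weights with D = B = 0 have Chern class \<open>y * eps\<close>. The weight 0 is left
  out to avoid powers of zero; \<open>vcoef_zero_weight\<close> shows that it has multiplicity 0 in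
  V.\<close>

definition wt :: "cfg \<Rightarrow> 'k" where
  "wt h = zprod pos (\<lambda>y. if y = 0 then 0 else - vcoef mu a h 0 0 y)"

text \<open>\<open>up\<close> and \<open>down\<close> are the two halves of the change of
  \<open>wt\<close> under adding a box: \<open>up\<close> involves the columns around the new box,
  \<open>down\<close> those one step (1,1,1) away, hence its shifts by one in position and by a + 1
  in level.\<close>

definition up :: "cfg \<Rightarrow> int \<Rightarrow> int \<Rightarrow> int \<Rightarrow> 'k" where
  "up h d n i = res_at pos (\<lambda>l. - corner mu a h d n l) i"

definition down :: "cfg \<Rightarrow> int \<Rightarrow> int \<Rightarrow> int \<Rightarrow> 'k" where
  "down h d n i = res_at pos (\<lambda>l. corner mu a h d (n - a - 1) (l - 1)) i"

text \<open>This is \<open>vcoef_add_box\<close> in exponential form. The substitutions l = i + y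
  and l = i - y turn weights into differences of positions; the first one reverses every difference,
  which produces the sign. Its exponent will depend only on the class.\<close>

lemma wt_add_box:
  assumes p: "p \<in> mu" "lv a h p = n + 1" "dg p = d" and c1: "corner mu a h d n (jj p) = 1"
  shows "wt (h(p := Suc (h p))) = (-1) powi (1 - total (corner mu a h d n)) * wt h * up h d n (jj p) * down h d n (jj p)"
proof -
  let ?i = "jj p"
  let ?c = "\<lambda>l. corner mu a h d n l" and ?c' = "\<lambda>l. corner mu a h d (n - a - 1) l"
  let ?A = "\<lambda>y. if y = 0 then 0 else - vcoef mu a h 0 0 y"
  let ?B = "\<lambda>y. if y = 0 then 0 else - ?c (?i + y)"
  let ?C = "\<lambda>y. if y = 0 then 0 else ?c' (?i - y - 1)"
  have fA: "finite {y. ?A y \<noteq> 0}"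
    by (rule finite_subset[OF _ finite_supp_vcoef[OF fin_mu, of a h 0 0]]) auto
  have fc: "finite {l. ?c l \<noteq> 0}" "finite {l. ?c' l \<noteq> 0}" by (auto intro: finite_supp_corner fin_mu)
  have fB: "finite {y. ?B y \<noteq> 0}"
    by (rule finite_subset[of _ "(\<lambda>l. l - ?i) ` {l. ?c l \<noteq> 0}"]) (use fc in \<open>auto simp: image_iff intro!: exI[of _ "?i + _"]\<close>)
  have fC: "finite {y. ?C y \<noteq> 0}"
    by (rule finite_subset[of _ "(\<lambda>l. ?i - l - 1) ` {l. ?c' l \<noteq> 0}"]) (use fc in \<open>auto simp: image_iff intro!: exI[of _ "?i - _ - 1"]\<close>)
  have "wt (h(p := Suc (h p))) = zprod pos (\<lambda>y. (?A y + ?B y) + ?C y)"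
    unfolding wt_def vcoef_add_box[OF fin_mu p refl a_pos] by (intro zprod_cong) auto
  also have "\<dots> = zprod pos (\<lambda>y. ?A y + ?B y) * zprod pos ?C"
    by (rule zprod_add[OF finite_supp_add[OF fA fB] fC]) (auto dest: pos_nz split: if_splits)
  also have "zprod pos (\<lambda>y. ?A y + ?B y) = wt h * zprod pos ?B"
    unfolding wt_def by (rule zprod_add[OF fA fB]) (auto dest: pos_nz split: if_splits)
  also have "zprod pos ?B = (-1) powi (1 - total (corner mu a h d n)) * up h d n ?i"
  proof -
    let ?s = "\<lambda>l. if l = ?i then 0 else - ?c l"
    have bij: "bij (\<lambda>y. ?i + y)" by (rule o_bij[of "\<lambda>y. y - ?i"]) auto
    have inv: "inv (\<lambda>y. ?i + y) = (\<lambda>l. l - ?i)" by (rule inv_unique_comp) auto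
    have "zprod pos ?B = zprod pos (\<lambda>y. ?s (?i + y))" by (intro zprod_cong) auto
    also have "\<dots> = zprod (\<lambda>l. pos (l - ?i)) ?s" unfolding zprod_reindex[OF bij, of _ ?s] inv ..
    also have "\<dots> = zprod (\<lambda>l. - (pos ?i - pos l)) ?s" by (intro zprod_cong) (auto simp: pos_diff pos_def algebra_simps)
    also have "\<dots> = (-1) powi (\<Sum>l\<in>{l. ?s l \<noteq> 0}. ?s l) * zprod (\<lambda>l. pos ?i - pos l) ?s"
      by (rule zprod_neg) (rule finite_subset[OF _ fc(1)], auto)
    also have "(\<Sum>l\<in>{l. ?s l \<noteq> 0}. ?s l) = (\<Sum>l\<in>insert ?i {l. ?c l \<noteq> 0}. ?s l)"
      using fc by (intro sum.mono_neutral_left) auto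
    also have "\<dots> = (\<Sum>l\<in>insert ?i {l. ?c l \<noteq> 0}. (if l = ?i then 1 else 0) - ?c l)"
      using c1 by (intro sum.cong) auto
    also have "\<dots> = 1 - (\<Sum>l\<in>insert ?i {l. ?c l \<noteq> 0}. ?c l)"
      using fc by (simp add: sum_subtractf sum.delta)
    also have "(\<Sum>l\<in>insert ?i {l. ?c l \<noteq> 0}. ?c l) = total (corner mu a h d n)"
      using fc by (intro total_window[symmetric]) auto
    finally show ?thesis unfolding up_def res_at_def .
  qed
  also have "zprod pos ?C = down h d n ?i"
  proof -
    let ?s = "\<lambda>l. if l = ?i then 0 else ?c' (l - 1)"
    have bij: "bij (\<lambda>y. ?i - y)" by (rule o_bij[of "\<lambda>y. ?i - y"]) auto
    have inv: "inv (\<lambda>y. ?i - y) = (\<lambda>l. ?i - l)" by (rule inv_unique_comp) auto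
    have "zprod pos ?C = zprod pos (\<lambda>y. ?s (?i - y))" by (intro zprod_cong) auto
    also have "\<dots> = zprod (\<lambda>l. pos (?i - l)) ?s" unfolding zprod_reindex[OF bij, of _ ?s] inv ..
    also have "\<dots> = down h d n ?i" unfolding down_def res_at_def by (intro zprod_cong) (auto simp: pos_diff)
    finally show ?thesis .
  qed
  finally show ?thesis by (simp only: ac_simps)
qed

lemma addable_of_removable:
  assumes "p \<in> removable mu a h d n" "valid mu h"
  shows "p \<in> addable mu a (h(p := h p - 1)) d n" "valid mu (h(p := h p - 1))"
    "(h(p := h p - 1))(p := Suc ((h(p := h p - 1)) p)) = h"
  using assms by (auto simp: addable_def removable_def lv_def)

lemma removable_of_addable:
  assumes "p \<in> addable mu a h d n" "valid mu h"
  shows "p \<in> removable mu a (h(p := Suc (h p))) d n" "valid mu (h(p := Suc (h p)))"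
    "(h(p := Suc (h p)))(p := (h(p := Suc (h p))) p - 1) = h"
  using assms by (auto simp: addable_def removable_def lv_def)

text \<open>On diagonal d the level n + a + 1 is seen by \<open>corner mu a h d n\<close> at
  position \<open>jj p - 1\<close> only, and the level n + a + 2 nowhere.\<close>

lemma corner_below:
  assumes "p \<in> mu" "dg p = d" "lv a h p = n + a + 1" "lv a h' p = n + a + 2" "\<And>q. q \<noteq> p \<Longrightarrow> h' q = h q" "l \<noteq> jj p - 1"
  shows "corner mu a h' d n l = corner mu a h d n l"
proof -
  have lvq: "lv a h' q = lv a h q" if "q \<noteq> p" for q using assms(5)[OF that] by (simp add: lv_def)
  show ?thesis unfolding corner_def
  proof (rule arg_cong2[where f = "(-)", OF sum.cong[OF refl] refl])
    fix q assume "q \<in> mu"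
    show "of_bool (dg q = d \<and> jj q = l \<and> lv a h' q = n + 1) + of_bool (dg q = d \<and> jj q = l + 1 \<and> lv a h' q = n + a + 1)
        - of_bool (dg q = d + 1 \<and> jj q = l \<and> lv a h' q = n + 1) - of_bool (dg q = d - 1 \<and> jj q = l + 1 \<and> lv a h' q = n + a + 1)
      = of_bool (dg q = d \<and> jj q = l \<and> lv a h q = n + 1) + of_bool (dg q = d \<and> jj q = l + 1 \<and> lv a h q = n + a + 1)
        - of_bool (dg q = d + 1 \<and> jj q = l \<and> lv a h q = n + 1) - (of_bool (dg q = d - 1 \<and> jj q = l + 1 \<and> lv a h q = n + a + 1) :: int)"
      using lvq assms a_pos by (cases "q = p") auto
  qed
qed

text \<open>The spurious poles of the box-adding factor sit one step \<open>(1,1,1)\<close> below the generators of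
  the module; this identity turns their residues into residues for the module with that generator
  removed.\<close>

lemma wt_spurious:
  assumes "p \<in> removable mu a h d (n + a + 1)" "valid mu h"
  defines "h' \<equiv> h(p := h p - 1)"
  shows "wt h * up h d n (jj p - 1)
       = (-1) powi (1 - total (corner mu a h' d (n + a + 1))) * wt h' * up h' d (n + a + 1) (jj p)"
proof -
  note h' = addable_of_removable[OF assms(1,2), folded h'_def]
  have p: "p \<in> mu" "lv a h' p = n + a + 1 + 1" "dg p = d" "lv a h p = n + a + 1" "h p > 0"
    using h'(1) assms(1) by (auto simp: addable_def removable_def)
  have c1: "corner mu a h' d (n + a + 1) (jj p) = 1"
    by (rule corner_addable[OF part h'(2,1)])
  have "wt h = wt (h'(p := Suc (h' p)))" using h'(3) by simp
  also have "\<dots> = (-1) powi (1 - total (corner mu a h' d (n + a + 1))) * wt h' * up h' d (n + a + 1) (jj p) * down h' d (n + a + 1) (jj p)"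
    by (rule wt_add_box[OF p(1,2,3) c1])
  also have "down h' d (n + a + 1) (jj p) = res_at pos (\<lambda>l. corner mu a h d n l) (jj p - 1)"
  proof -
    let ?s = "\<lambda>l. if l = jj p - 1 then 0 else corner mu a h d n l"
    have bij: "bij (\<lambda>l. l - 1 :: int)" by (rule o_bij[of "\<lambda>l. l + 1"]) auto
    have inv: "inv (\<lambda>l. l - 1 :: int) = (\<lambda>l. l + 1)" by (rule inv_unique_comp) auto
    have "down h' d (n + a + 1) (jj p) = zprod (\<lambda>l. pos (jj p) - pos l) (\<lambda>l. ?s (l - 1))"
      unfolding down_def res_at_def
    proof (intro zprod_cong refl)
      fix l show "(if l = jj p then 0 else corner mu a h' d (n + a + 1 - a - 1) (l - 1)) = ?s (l - 1)"
        using corner_below[OF p(1,3,4), of h' "l - 1"] p(2) by (simp add: h'_def)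
    qed
    also have "\<dots> = zprod (\<lambda>l. pos (jj p) - pos (l + 1)) ?s"
      unfolding zprod_reindex[OF bij, of _ ?s] inv ..
    also have "\<dots> = res_at pos (\<lambda>l. corner mu a h d n l) (jj p - 1)"
      unfolding res_at_def by (intro zprod_cong) (auto simp: pos_def algebra_simps)
    finally show ?thesis .
  qed
  finally show ?thesis
    using res_at_pos_inverse[of "\<lambda>l. corner mu a h d n l" "jj p - 1"] by (simp add: up_def algebra_simps)
qed

end

context boxes
begin

section \<open>Symmetric functions of the boxes\<close>

definition psum :: "nat \<Rightarrow> int \<Rightarrow> int \<Rightarrow> cfg \<Rightarrow> 'k" where
  "psum m d n h = (\<Sum>p\<in>mu. of_bool (dg p = d \<and> lv a h p = n) * pos (jj p) ^ m)"

text \<open>Polynomials in the power sums of the positions, separately for each diagonal and level: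
  all that a class may know about the individual positions. Values lie in \<open>R\<close>, and
  Newton's identities do not leave this family.\<close>

inductive_set symf :: "(cfg \<Rightarrow> 'k) set" where
  const: "c \<in> R \<Longrightarrow> (\<lambda>_. c) \<in> symf"
| psum: "psum m d n \<in> symf"
| add: "\<phi> \<in> symf \<Longrightarrow> \<psi> \<in> symf \<Longrightarrow> (\<lambda>h. \<phi> h + \<psi> h) \<in> symf"
| mult: "\<phi> \<in> symf \<Longrightarrow> \<psi> \<in> symf \<Longrightarrow> (\<lambda>h. \<phi> h * \<psi> h) \<in> symf"

lemma sym_scale: "c \<in> R \<Longrightarrow> \<phi> \<in> symf \<Longrightarrow> (\<lambda>h. c * \<phi> h) \<in> symf"
  by (rule symf.mult[OF symf.const])

lemma sym_uminus: "\<phi> \<in> symf \<Longrightarrow> (\<lambda>h. - \<phi> h) \<in> symf"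
  using sym_scale[of "-1" \<phi>] uminus_R[OF one_R] by simp

lemma sym_diff: "\<phi> \<in> symf \<Longrightarrow> \<psi> \<in> symf \<Longrightarrow> (\<lambda>h. \<phi> h - \<psi> h) \<in> symf"
  using symf.add[OF _ sym_uminus, of \<phi> \<psi>] by simp

lemma sym_sum: "(\<And>i. i \<in> A \<Longrightarrow> f i \<in> symf) \<Longrightarrow> (\<lambda>h. \<Sum>i\<in>A. f i h) \<in> symf"
  by (induction A rule: infinite_finite_induct) (auto intro: symf.add symf.const zero_R)

lemma sym_R: "\<phi> \<in> symf \<Longrightarrow> \<phi> h \<in> R"
  by (induction rule: symf.induct)
     (auto intro!: add_R mult_R sum_R power_R pos_R one_R zero_R simp: psum_def of_bool_def)

text \<open>Stated for an arbitrary algebra of functions, since it serves \<open>symf\<close> and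
  later the functions that are symmetric on a single class.\<close>

lemma newton_closed:
  assumes const: "\<And>c. c \<in> R \<Longrightarrow> (\<lambda>_. c) \<in> A"
    and add: "\<And>f g. f \<in> A \<Longrightarrow> g \<in> A \<Longrightarrow> (\<lambda>h. f h + g h) \<in> A"
    and mult: "\<And>f g. f \<in> A \<Longrightarrow> g \<in> A \<Longrightarrow> (\<lambda>h. f h * g h) \<in> A"
    and M: "\<And>k. k > 0 \<Longrightarrow> (\<lambda>h. M h k) \<in> A"
  shows "(\<lambda>h. newton (M h) n) \<in> A"
proof (induction n rule: less_induct)
  case (less n)
  have sum: "(\<And>i. i \<in> K \<Longrightarrow> f i \<in> A) \<Longrightarrow> (\<lambda>h. \<Sum>i\<in>K. f i h) \<in> A" for K :: "nat set" and f
    by (induction K rule: infinite_finite_induct) (auto intro: add const zero_R)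
  show ?case
  proof (cases n)
    case 0 thus ?thesis by (auto intro: const one_R)
  next
    case (Suc m)
    have "(\<lambda>h. newton (M h) (Suc m)) = (\<lambda>h. inverse (of_int (- int (Suc m))) * (\<Sum>k\<le>m. M h (Suc k) * newton (M h) (m - k)))"
      by (rule ext) (simp add: newton.simps(2) field_simps del: of_nat_Suc)
    moreover have "(\<lambda>h. \<Sum>k\<le>m. M h (Suc k) * newton (M h) (m - k)) \<in> A"
      using less Suc M by (intro sum mult) auto
    ultimately show ?thesis unfolding Suc
      using mult[OF const[OF inverse_int_R[of "- int (Suc m)"]]] by simp
  qed
qed

lemma sym_newton:
  "(\<And>k. k > 0 \<Longrightarrow> (\<lambda>h. M h k) \<in> symf) \<Longrightarrow> (\<lambda>h. newton (M h) n) \<in> symf"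
  by (rule newton_closed[OF symf.const symf.add symf.mult])

lemma sym_newton_int:
  assumes "\<And>k. k > 0 \<Longrightarrow> (\<lambda>h. M h k) \<in> symf"
  shows "(\<lambda>h. newton_int (M h) n) \<in> symf"
  using sym_newton[of M "nat n"] assms
  by (cases "n < 0") (auto simp: newton_int_def intro: symf.const[OF zero_R])

lemma psum_shift_sym:
  "(\<lambda>h. \<Sum>p\<in>mu. of_bool (dg p = d \<and> lv a h p = n) * pos (jj p + c) ^ m) \<in> symf"
proof -
  have "pos (jj p + c) ^ m = (\<Sum>r\<le>m. of_nat (m choose r) * pos (jj p) ^ r * pos c ^ (m - r))" for p
    unfolding binomial_ring[symmetric] by (simp add: pos_def algebra_simps)
  hence "(\<lambda>h. \<Sum>p\<in>mu. of_bool (dg p = d \<and> lv a h p = n) * pos (jj p + c) ^ m)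
       = (\<lambda>h. \<Sum>r\<le>m. (of_nat (m choose r) * pos c ^ (m - r)) * psum r d n h)"
    by (intro ext) (simp add: psum_def sum_distrib_left sum.swap[of _ mu] ac_simps)
  thus ?thesis by (auto intro!: sym_sum sym_scale symf.psum mult_R of_nat_R power_R pos_R)
qed

lemma moment_column:
  assumes "finite S" "jj ` mu \<subseteq> (\<lambda>l. l + c) ` S"
  shows "(\<Sum>l\<in>S. of_int (\<Sum>p\<in>mu. of_bool (dg p = d \<and> jj p = l + c \<and> lv a h p = n)) * pos l ^ k)
    = (\<Sum>p\<in>mu. of_bool (dg p = d \<and> lv a h p = n) * pos (jj p - c) ^ k)"
proof -
  have "(\<Sum>l\<in>S. of_int (\<Sum>p\<in>mu. of_bool (dg p = d \<and> jj p = l + c \<and> lv a h p = n)) * pos l ^ k)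
      = (\<Sum>p\<in>mu. \<Sum>l\<in>S. of_bool (dg p = d \<and> jj p = l + c \<and> lv a h p = n) * pos l ^ k)"
    by (simp add: sum_distrib_right sum.swap[of _ mu])
  also have "\<dots> = (\<Sum>p\<in>mu. of_bool (dg p = d \<and> lv a h p = n) * pos (jj p - c) ^ k)"
  proof (rule sum.cong[OF refl])
    fix p assume "p \<in> mu"
    hence "jj p - c \<in> S" using assms(2) by (auto simp: image_iff)
    have "(\<Sum>l\<in>S. of_bool (dg p = d \<and> jj p = l + c \<and> lv a h p = n) * pos l ^ k)
      = (\<Sum>l\<in>S. if l = jj p - c then of_bool (dg p = d \<and> lv a h p = n) * pos (jj p - c) ^ k else 0)"
      by (intro sum.cong) auto
    also have "\<dots> = of_bool (dg p = d \<and> lv a h p = n) * pos (jj p - c) ^ k"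
      using assms(1) \<open>jj p - c \<in> S\<close> by (simp add: sum.delta)
    finally show "(\<Sum>l\<in>S. of_bool (dg p = d \<and> jj p = l + c \<and> lv a h p = n) * pos l ^ k)
      = of_bool (dg p = d \<and> lv a h p = n) * pos (jj p - c) ^ k" .
  qed
  finally show ?thesis .
qed

text \<open>\<open>corner\<close> is a signed count of four groups of columns and one constant
  point, so its moments are shifted power sums. This is what makes sums of residues
  symmetric.\<close>

lemma moment_corner:
  "moment pos (\<lambda>l. corner mu a h d n (l - c)) k
     = (\<Sum>p\<in>mu. of_bool (dg p = d \<and> lv a h p = n + 1) * pos (jj p + c) ^ k)
     + (\<Sum>p\<in>mu. of_bool (dg p = d \<and> lv a h p = n + a + 1) * pos (jj p + (c - 1)) ^ k)
     - (\<Sum>p\<in>mu. of_bool (dg p = d + 1 \<and> lv a h p = n + 1) * pos (jj p + c) ^ k)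
     - (\<Sum>p\<in>mu. of_bool (dg p = d - 1 \<and> lv a h p = n + a + 1) * pos (jj p + (c - 1)) ^ k)
     - of_bool (d = 0 \<and> n = - a - 1) * pos (c - 1) ^ k"
proof -
  define S where "S = (\<lambda>l. l + c) ` (jj ` mu \<union> (\<lambda>p. jj p - 1) ` mu \<union> {-1} \<union> {l. corner mu a h d n l \<noteq> 0})"
  have fin: "finite S" unfolding S_def using fin_mu finite_supp_corner[OF fin_mu] by auto
  have sub: "jj ` mu \<subseteq> (\<lambda>l. l + - c) ` S" "jj ` mu \<subseteq> (\<lambda>l. l + (1 - c)) ` S"
    unfolding S_def by (force simp: image_iff)+
  have "moment pos (\<lambda>l. corner mu a h d n (l - c)) k = (\<Sum>l\<in>S. of_int (corner mu a h d n (l - c)) * pos l ^ k)"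
  proof (rule moment_window[OF fin], rule subsetI)
    fix l assume "l \<in> {l. corner mu a h d n (l - c) \<noteq> 0}"
    thus "l \<in> S" unfolding S_def by (intro image_eqI[of _ _ "l - c"]) auto
  qed
  also have "\<dots> = (\<Sum>l\<in>S. of_int (\<Sum>p\<in>mu. of_bool (dg p = d \<and> jj p = l + - c \<and> lv a h p = n + 1)) * pos l ^ k)
      + (\<Sum>l\<in>S. of_int (\<Sum>p\<in>mu. of_bool (dg p = d \<and> jj p = l + (1 - c) \<and> lv a h p = n + a + 1)) * pos l ^ k)
      - (\<Sum>l\<in>S. of_int (\<Sum>p\<in>mu. of_bool (dg p = d + 1 \<and> jj p = l + - c \<and> lv a h p = n + 1)) * pos l ^ k)
      - (\<Sum>l\<in>S. of_int (\<Sum>p\<in>mu. of_bool (dg p = d - 1 \<and> jj p = l + (1 - c) \<and> lv a h p = n + a + 1)) * pos l ^ k)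
      - (\<Sum>l\<in>S. of_int (of_bool (d = 0 \<and> n = - a - 1 \<and> l - c = -1)) * pos l ^ k)"
  proof -
    have "corner mu a h d n (l - c) = (\<Sum>p\<in>mu. of_bool (dg p = d \<and> jj p = l + - c \<and> lv a h p = n + 1))
      + (\<Sum>p\<in>mu. of_bool (dg p = d \<and> jj p = l + (1 - c) \<and> lv a h p = n + a + 1))
      - (\<Sum>p\<in>mu. of_bool (dg p = d + 1 \<and> jj p = l + - c \<and> lv a h p = n + 1))
      - (\<Sum>p\<in>mu. of_bool (dg p = d - 1 \<and> jj p = l + (1 - c) \<and> lv a h p = n + a + 1))
      - of_bool (d = 0 \<and> n = - a - 1 \<and> l - c = -1)" for l
    proof -
      have e: "l - c = l + - c" "l - c + 1 = l + (1 - c)" by auto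
      show ?thesis unfolding corner_def sum.distrib sum_subtractf e(2) unfolding e(1) ..
    qed
    thus ?thesis by (simp only: of_int_add of_int_diff left_diff_distrib distrib_right sum.distrib sum_subtractf)
  qed
  also have "(\<Sum>l\<in>S. of_int (of_bool (d = 0 \<and> n = - a - 1 \<and> l - c = -1)) * pos l ^ k)
      = (\<Sum>l\<in>S. if l = c - 1 then of_bool (d = 0 \<and> n = - a - 1) * pos (c - 1) ^ k else 0)"
    by (intro sum.cong) auto
  also have "\<dots> = of_bool (d = 0 \<and> n = - a - 1) * pos (c - 1) ^ k"
    using fin by (simp add: sum.delta S_def)
  moreover have "x - (1 - c) = x + (c - 1)" "x - - c = x + c" for x by auto
  ultimately show ?thesis
    unfolding moment_column[OF fin sub(1)] moment_column[OF fin sub(2)] by simp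
qed

lemma moment_corner_sym: "(\<lambda>h. moment pos (\<lambda>l. corner mu a h d n (l - c)) k) \<in> symf"
  unfolding moment_corner by (intro sym_diff symf.add psum_shift_sym symf.const mult_R power_R pos_R) (auto simp: of_bool_def intro: one_R zero_R)

lemma moment_uminus: "moment e (\<lambda>l. - s l) k = - moment e s k"
  by (simp add: moment_def sum_negf)

section \<open>Polynomials in the position of an added box\<close>

text \<open>The variable x is the position of the box being added, which is not a symmetric function
  of the class.\<close>

inductive_set poly_sym :: "(cfg \<Rightarrow> 'k \<Rightarrow> 'k) set" where
  monom: "\<phi> \<in> symf \<Longrightarrow> (\<lambda>h x. \<phi> h * x ^ k) \<in> poly_sym"
| add: "f \<in> poly_sym \<Longrightarrow> g \<in> poly_sym \<Longrightarrow> (\<lambda>h x. f h x + g h x) \<in> poly_sym"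

lemma poly_sym_mult:
  assumes "f \<in> poly_sym" "g \<in> poly_sym"
  shows "(\<lambda>h x. f h x * g h x) \<in> poly_sym"
  using assms(1)
proof induction
  case (monom \<phi> k)
  show ?case using assms(2)
  proof induction
    case (monom \<psi> l)
    have "(\<lambda>h x. \<phi> h * x ^ k * (\<psi> h * x ^ l)) = (\<lambda>h x. (\<phi> h * \<psi> h) * x ^ (k + l))"
      by (intro ext) (simp add: power_add ac_simps)
    thus ?case using \<open>\<phi> \<in> symf\<close> monom by (metis poly_sym.monom symf.mult)
  next
    case (add f g) thus ?case by (simp add: distrib_left poly_sym.add)
  qed
next
  case (add f g) thus ?case by (simp add: distrib_right poly_sym.add)
qed

lemma poly_sym_const: "\<phi> \<in> symf \<Longrightarrow> (\<lambda>h x. \<phi> h) \<in> poly_sym"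
  using poly_sym.monom[of \<phi> 0] by simp

lemma poly_sym_scalar: "c \<in> R \<Longrightarrow> (\<lambda>h x. c) \<in> poly_sym"
  by (rule poly_sym_const[OF symf.const])

lemma poly_sym_var: "(\<lambda>h x. x ^ k) \<in> poly_sym"
  using poly_sym.monom[OF symf.const[OF one_R], of k] by simp

lemma poly_sym_sum: "(\<And>i. i \<in> A \<Longrightarrow> f i \<in> poly_sym) \<Longrightarrow> (\<lambda>h x. \<Sum>i\<in>A. f i h x) \<in> poly_sym"
  by (induction A rule: infinite_finite_induct)
     (auto intro: poly_sym.add poly_sym_scalar[OF zero_R])

lemma poly_sym_power: "f \<in> poly_sym \<Longrightarrow> (\<lambda>h x. f h x ^ k) \<in> poly_sym"
  by (induction k) (auto intro: poly_sym_mult poly_sym_scalar[OF one_R])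

lemma poly_sym_shift: "(\<lambda>h x. (x - eps) ^ k) \<in> poly_sym"
proof (rule poly_sym_power)
  have "(\<lambda>h x. x + (- eps)) \<in> poly_sym"
    using poly_sym_var[of 1] by (intro poly_sym.add poly_sym_const symf.const uminus_R eps_R) simp
  thus "(\<lambda>h x. x - eps) \<in> poly_sym" by simp
qed

lemma psum_add_box:
  assumes "p \<in> mu" "lv a h p = n + 1" "dg p = d"
  shows "psum m d' n' (h(p := Suc (h p))) = psum m d' n' h
     + (of_bool (d' = d \<and> n' = n) - of_bool (d' = d \<and> n' = n + 1)) * pos (jj p) ^ m"
proof -
  have "lv a (h(p := Suc (h p))) p = n" using assms by (simp add: lv_def)
  moreover have "lv a (h(p := Suc (h p))) q = lv a h q" if "q \<noteq> p" for q using that by (simp add: lv_def)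
  ultimately show ?thesis
    unfolding psum_def sum.remove[OF fin_mu assms(1)] using assms
    by (auto simp: algebra_simps intro!: sum.cong)
qed

text \<open>Adding a box moves one column from the group (d, n + 1) to the group (d, n), which
  changes the power sums of these groups by powers of its position.\<close>

lemma sym_add_box:
  assumes "\<phi> \<in> symf"
  shows "\<exists>g\<in>poly_sym. \<forall>h p. p \<in> mu \<longrightarrow> dg p = d \<longrightarrow> lv a h p = n + 1 \<longrightarrow> \<phi> (h(p := Suc (h p))) = g h (pos (jj p))"
  using assms
proof induction
  case (const c)
  show ?case by (rule bexI[of _ "\<lambda>h x. c"]) (auto intro: poly_sym_scalar[OF const])
next
  case (psum m d' n')
  let ?c = "of_bool (d' = d \<and> n' = n) - of_bool (d' = d \<and> n' = n + 1) :: 'k"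
  have "(\<lambda>h x. psum m d' n' h + ?c * x ^ m) \<in> poly_sym"
    by (intro poly_sym.add poly_sym_const symf.psum poly_sym.monom symf.const diff_R)
       (auto simp: of_bool_def intro: one_R zero_R)
  thus ?case by (rule bexI[rotated]) (intro allI impI psum_add_box)
next
  case (add \<phi> \<psi>)
  then obtain f g where "f \<in> poly_sym" "g \<in> poly_sym"
    "\<forall>h p. p \<in> mu \<longrightarrow> dg p = d \<longrightarrow> lv a h p = n + 1 \<longrightarrow> \<phi> (h(p := Suc (h p))) = f h (pos (jj p))"
    "\<forall>h p. p \<in> mu \<longrightarrow> dg p = d \<longrightarrow> lv a h p = n + 1 \<longrightarrow> \<psi> (h(p := Suc (h p))) = g h (pos (jj p))" by blast
  thus ?case by (intro bexI[OF _ poly_sym.add[of f g]]) (auto simp del: fun_upd_apply)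
next
  case (mult \<phi> \<psi>)
  then obtain f g where "f \<in> poly_sym" "g \<in> poly_sym"
    "\<forall>h p. p \<in> mu \<longrightarrow> dg p = d \<longrightarrow> lv a h p = n + 1 \<longrightarrow> \<phi> (h(p := Suc (h p))) = f h (pos (jj p))"
    "\<forall>h p. p \<in> mu \<longrightarrow> dg p = d \<longrightarrow> lv a h p = n + 1 \<longrightarrow> \<psi> (h(p := Suc (h p))) = g h (pos (jj p))" by blast
  thus ?case by (intro bexI[OF _ poly_sym_mult[of f g]]) (auto simp del: fun_upd_apply)
qed

end

context boxes
begin

section \<open>Classes of fixed points\<close>

text \<open>Diagonal and level determine the Chern class of a column on the hyperplane, so height
  functions with equal \<open>sig\<close> cannot be told apart there.\<close>

definition sig :: "cfg \<Rightarrow> (int \<times> int) multiset" where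
  "sig h = image_mset (\<lambda>p. (dg p, lv a h p)) (mset_set mu)"

definition configs :: "(int \<times> int) multiset \<Rightarrow> cfg set" where
  "configs X = {h. valid mu h \<and> sig h = X}"

definition hgt :: "(int \<times> int) multiset \<Rightarrow> int" where
  "hgt X = (\<Sum>p\<in>mu. a * jj p) - (\<Sum>v\<in>#X. snd v)"

lemma sum_sig: "(\<Sum>v\<in>#sig h. F v) = (\<Sum>p\<in>mu. F (dg p, lv a h p))"
  by (simp add: sig_def image_mset.compositionality comp_def sum_unfold_sum_mset)

lemma card_count_sig: "card {p\<in>mu. dg p = d \<and> lv a h p = n} = count (sig h) (d, n)"
proof -
  have "count M (d, n) = (\<Sum>v\<in>#M. if v = (d, n) then 1 else 0)" for M :: "(int \<times> int) multiset"
    by (induction M) auto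
  hence "count (sig h) (d, n) = (\<Sum>p\<in>mu. if dg p = d \<and> lv a h p = n then 1 else 0)"
    by (simp add: sum_sig)
  also have "\<dots> = card {p\<in>mu. dg p = d \<and> lv a h p = n}"
    using fin_mu by (simp add: sum.If_cases Int_def)
  finally show ?thesis ..
qed

lemma card_sig:
  "card {p\<in>mu. P (dg p) (lv a h p)} = size (filter_mset (\<lambda>v. P (fst v) (snd v)) (sig h))"
proof -
  have "size (filter_mset (\<lambda>v. P (fst v) (snd v)) M) = (\<Sum>v\<in>#M. if P (fst v) (snd v) then 1 else 0)" for M
    by (induction M) auto
  thus ?thesis using fin_mu by (simp add: sum_sig sum.If_cases Int_def)
qed

lemma hgt_sig: "hgt (sig h) = int (\<Sum>p\<in>mu. h p)"
proof -
  have "hgt (sig h) = (\<Sum>p\<in>mu. a * jj p - lv a h p)"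
    by (simp add: hgt_def sum_sig sum_subtractf)
  thus ?thesis by (simp add: lv_def)
qed

lemma hgt_move:
  assumes "(d, n) \<in># X"
  shows "hgt (X - {#(d, n)#} + {#(d, n + 1)#}) = hgt X - 1"
proof -
  obtain Y where "X = add_mset (d, n) Y" using assms by (metis multi_member_split)
  thus ?thesis by (simp add: hgt_def)
qed

lemma finite_configs: "finite (configs X)"
proof (rule finite_subset)
  show "configs X \<subseteq> {h. (\<forall>p. p \<in> mu \<longrightarrow> h p \<in> {..nat (hgt X)}) \<and> (\<forall>p. p \<notin> mu \<longrightarrow> h p = 0)}"
  proof
    fix h assume h: "h \<in> configs X"
    have "h p \<le> nat (hgt X)" if "p \<in> mu" for p
    proof -
      have "h p \<le> (\<Sum>p\<in>mu. h p)" using fin_mu that by (intro member_le_sum) auto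
      moreover have "hgt X = int (\<Sum>p\<in>mu. h p)" using hgt_sig[of h] h by (auto simp: configs_def)
      ultimately show ?thesis by linarith
    qed
    moreover have "h p = 0" if "p \<notin> mu" for p using h that unfolding configs_def valid_def by blast
    ultimately show "h \<in> {h. (\<forall>p. p \<in> mu \<longrightarrow> h p \<in> {..nat (hgt X)}) \<and> (\<forall>p. p \<notin> mu \<longrightarrow> h p = 0)}" by auto
  qed
  show "finite {h. (\<forall>p. p \<in> mu \<longrightarrow> h p \<in> {..nat (hgt X)}) \<and> (\<forall>p. p \<notin> mu \<longrightarrow> h p = (0::nat))}"
    by (rule finite_subset[OF _ finite_set_of_finite_funs[OF fin_mu, of "{..nat (hgt X)}" 0]]) auto
qed

lemma sig_raise:
  assumes "p \<in> mu" "dg p = d" "lv a h p = n + 1"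
  shows "(d, n + 1) \<in># sig h" "sig (h(p := Suc (h p))) = sig h - {#(d, n + 1)#} + {#(d, n)#}"
proof -
  have mu: "mset_set mu = add_mset p (mset_set (mu - {p}))"
    using fin_mu assms by (simp add: mset_set.remove)
  have l: "lv a (h(p := Suc (h p))) p = n" using assms by (simp add: lv_def)
  have "image_mset (\<lambda>q. (dg q, lv a (h(p := Suc (h p))) q)) (mset_set (mu - {p}))
      = image_mset (\<lambda>q. (dg q, lv a h q)) (mset_set (mu - {p}))"
    using fin_mu by (intro image_mset_cong) (auto simp: lv_def)
  thus "sig (h(p := Suc (h p))) = sig h - {#(d, n + 1)#} + {#(d, n)#}" "(d, n + 1) \<in># sig h"
    unfolding sig_def mu using assms l by (auto simp del: fun_upd_apply)
qed

definition tot :: "(int \<times> int) multiset \<Rightarrow> int \<Rightarrow> int \<Rightarrow> int" where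
  "tot X d n = int (count X (d, n + 1)) + int (count X (d, n + a + 1)) - int (count X (d + 1, n + 1))
     - int (count X (d - 1, n + a + 1)) - of_bool (d = 0 \<and> n = - a - 1)"

lemma total_corner: "total (\<lambda>l. corner mu a h d n (l - c)) = tot (sig h) d n"
proof -
  have "(of_int (total (\<lambda>l. corner mu a h d n (l - c))) :: 'k) = moment pos (\<lambda>l. corner mu a h d n (l - c)) 0"
    by (simp add: total_def moment_def)
  also have "\<dots> = of_int (tot (sig h) d n)"
    unfolding moment_corner tot_def card_count_sig[symmetric]
    using fin_mu by (simp add: sum.inter_filter[symmetric] of_bool_def sum.If_cases Int_def)
  finally show ?thesis by simp
qed

lemma total_corner0: "total (corner mu a h d n) = tot (sig h) d n"
  using total_corner[of h d n 0] by simp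

definition class_sum :: "(int \<times> int) multiset \<Rightarrow> (cfg \<Rightarrow> 'k) \<Rightarrow> 'k" where
  "class_sum X \<phi> = (\<Sum>h\<in>configs X. wt h * \<phi> h)"

text \<open>Of the factor for the added box only the half \<open>up\<close> is explicit. The half
  \<open>down\<close> goes into \<open>g\<close> where it is polynomial, and cancels at spurious
  poles.\<close>

definition addable_sum :: "(int \<times> int) multiset \<Rightarrow> int \<Rightarrow> int \<Rightarrow> (cfg \<Rightarrow> 'k \<Rightarrow> 'k) \<Rightarrow> 'k" where
  "addable_sum X d n g = (\<Sum>h\<in>configs X. \<Sum>p\<in>addable mu a h d n. wt h * up h d n (jj p) * g h (pos (jj p)))"

lemma finite_addable: "finite (addable mu a h d n)" "finite (removable mu a h d n)"
  using fin_mu by (simp_all add: addable_def removable_def)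

lemma addable_sum_add: "addable_sum X d n (\<lambda>h x. f h x + g h x) = addable_sum X d n f + addable_sum X d n g"
  by (simp add: addable_sum_def distrib_left sum.distrib)

lemma addable_sum_scale: "addable_sum X d n (\<lambda>h x. c * f h x) = c * addable_sum X d n f"
  by (simp add: addable_sum_def sum_distrib_left ac_simps)

abbreviation move :: "(int \<times> int) multiset \<Rightarrow> int \<Rightarrow> int \<Rightarrow> (int \<times> int) multiset" where
  "move X d n \<equiv> X - {#(d, n)#} + {#(d, n + 1)#}"

lemma sum_removable_addable:
  fixes G :: "cfg \<Rightarrow> nat \<times> nat \<Rightarrow> 'c::comm_monoid_add"
  assumes "(d, n) \<in># X"
  shows "(\<Sum>h\<in>configs X. \<Sum>p\<in>removable mu a h d n. G h p)
       = (\<Sum>h\<in>configs (move X d n). \<Sum>p\<in>addable mu a h d n. G (h(p := Suc (h p))) p)"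
proof -
  let ?r = "\<lambda>(h, p). (h(p := h p - Suc 0), p)" and ?i = "\<lambda>(h, p). (h(p := Suc (h p)), p)"
  have "(\<Sum>(h, p)\<in>(SIGMA h:configs X. removable mu a h d n). G h p)
      = (\<Sum>(h, p)\<in>(SIGMA h:configs (move X d n). addable mu a h d n). G (h(p := Suc (h p))) p)"
  proof (rule sum.reindex_bij_witness[of _ ?i ?r])
    fix z assume "z \<in> (SIGMA h:configs X. removable mu a h d n)"
    then obtain h p where z: "z = (h, p)" and h: "h \<in> configs X" and p: "p \<in> removable mu a h d n" by auto
    have v: "valid mu h" "sig h = X" using h by (auto simp: configs_def)
    note A = addable_of_removable[OF p v(1)]
    have "p \<in> mu" "dg p = d" "lv a (h(p := h p - 1)) p = n + 1" using A(1) by (auto simp: addable_def)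
    from sig_raise[OF this] have "(d, n + 1) \<in># sig (h(p := h p - 1))" "X = sig (h(p := h p - 1)) - {#(d, n + 1)#} + {#(d, n)#}"
      unfolding A(3) v(2) by auto
    hence "sig (h(p := h p - 1)) = move X d n"
      by (metis add_diff_cancel_right' diff_union_swap insert_DiffM2)
    hence "h(p := h p - 1) \<in> configs (move X d n)" using A(2) by (simp add: configs_def)
    thus "?r z \<in> (SIGMA h:configs (move X d n). addable mu a h d n)" using A(1) z by auto
    show "?i (?r z) = z" using A(3) z by auto
    show "(case ?r z of (h, p) \<Rightarrow> G (h(p := Suc (h p))) p) = (case z of (h, p) \<Rightarrow> G h p)" using A(3) z by auto
  next
    fix z assume "z \<in> (SIGMA h:configs (move X d n). addable mu a h d n)"
    then obtain h p where z: "z = (h, p)" and h: "h \<in> configs (move X d n)" and p: "p \<in> addable mu a h d n" by auto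
    have v: "valid mu h" "sig h = move X d n" using h by (auto simp: configs_def)
    note A = removable_of_addable[OF p v(1)]
    have "p \<in> mu" "dg p = d" "lv a h p = n + 1" using p by (auto simp: addable_def)
    from sig_raise(2)[OF this] have "sig (h(p := Suc (h p))) = X" using assms unfolding v(2) by simp
    hence "h(p := Suc (h p)) \<in> configs X" using A(2) by (simp add: configs_def)
    thus "?i z \<in> (SIGMA h:configs X. removable mu a h d n)" using A(1) z by auto
    show "?r (?i z) = z" using A(3) z by auto
  qed
  thus ?thesis using finite_configs finite_addable by (simp add: sum.Sigma)
qed

lemma removable_in_sig: "p \<in> removable mu a h d n \<Longrightarrow> (d, n) \<in># sig h"
  using fin_mu by (force simp: removable_def sig_def)

section \<open>The recursion\<close>

text \<open>The poles of the rational function behind \<open>up\<close> are the addable boxes and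
  the points one step before the removable boxes at level n + a + 1. All are simple and distinct, so
  \<open>res_sum_eq\<close> evaluates the sum of residues.\<close>

lemma poles_sum:
  assumes v: "valid mu h"
  shows "(\<Sum>p\<in>addable mu a h d n. pos (jj p) ^ k * up h d n (jj p))
      + (\<Sum>p\<in>removable mu a h d (n + a + 1). pos (jj p - 1) ^ k * up h d n (jj p - 1))
      = newton_int (\<lambda>k. - moment pos (\<lambda>l. corner mu a h d n (l - 0)) k) (int k + 1 - tot (sig h) d n)"
proof -
  let ?s = "\<lambda>l. - corner mu a h d n l"
  let ?A = "addable mu a h d n" and ?B = "removable mu a h d (n + a + 1)"
  have poles: "{i. ?s i = -1} = jj ` ?A \<union> (\<lambda>p. jj p - 1) ` ?B"
    using corner_addable[OF part v] corner_removable[OF part v] corner_pole_cases[OF part v]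
    by (fastforce simp: image_iff)
  have disj: "jj ` ?A \<inter> (\<lambda>p. jj p - 1) ` ?B = {}"
    using addable_removable_disjoint[OF part v] by (auto simp: image_iff)
  have inj: "inj_on jj ?A" "inj_on (\<lambda>p. jj p - 1) ?B"
    using inj_on_jj[of d] by (auto simp: inj_on_def addable_def removable_def)
  have "res_sum pos ?s k = (\<Sum>p\<in>?A. pos (jj p) ^ k * up h d n (jj p)) + (\<Sum>p\<in>?B. pos (jj p - 1) ^ k * up h d n (jj p - 1))"
    unfolding res_sum_def poles using finite_addable disj inj
    by (simp add: sum.union_disjoint sum.reindex up_def)
  moreover have "res_sum pos ?s k = newton_int (moment pos ?s) (int k + 1 + total ?s)"
  proof (rule res_sum_eq[OF inj_pos])
    show "finite {l. ?s l \<noteq> 0}" using finite_supp_corner[OF fin_mu] by simp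
    show "- 1 \<le> ?s l" for l using corner_cases(1)[OF part v refl refl, where i = l and d = d and n = n and a = a] by simp
  qed
  moreover have "total ?s = - tot (sig h) d n"
    unfolding total_corner0[symmetric] by (simp add: total_def sum_negf)
  moreover have "moment pos ?s = (\<lambda>k. - moment pos (\<lambda>l. corner mu a h d n (l - 0)) k)"
    by (auto simp: moment_uminus)
  ultimately show ?thesis by simp
qed

lemma sign_R: "(-1) powi (m::int) \<in> R"
  by (cases "even m") (auto simp: power_int_minus_left intro: one_R uminus_R)

text \<open>The residue theorem is summed over the class. By \<open>wt_spurious\<close> the spurious
  residues are again of the form \<open>wt\<close> times \<open>up\<close>, for the class with one
  box fewer, so the error term has the same shape as the sum under study.\<close>

lemma addable_sum_step:
  assumes \<phi>: "\<phi> \<in> symf"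
  shows "\<exists>\<psi>\<in>symf. \<exists>g\<in>poly_sym. addable_sum X d n (\<lambda>h x. \<phi> h * x ^ k)
     = class_sum X \<psi> - (if (d, n + a + 1) \<in># X then addable_sum (move X d (n + a + 1)) d (n + a + 1) g else 0)"
proof -
  let ?m = "n + a + 1"
  let ?X' = "move X d ?m"
  define \<psi> where "\<psi> = (\<lambda>h. \<phi> h * newton_int (\<lambda>k. - moment pos (\<lambda>l. corner mu a h d n (l - 0)) k) (int k + 1 - tot X d n))"
  have \<psi>: "\<psi> \<in> symf" unfolding \<psi>_def
    by (intro symf.mult \<phi> sym_newton_int sym_uminus moment_corner_sym)
  obtain f where f: "f \<in> poly_sym" "\<And>h p. p \<in> mu \<Longrightarrow> dg p = d \<Longrightarrow> lv a h p = ?m + 1 \<Longrightarrow> \<phi> (h(p := Suc (h p))) = f h (pos (jj p))"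
    using sym_add_box[OF \<phi>, of d ?m] by blast
  define g where "g = (\<lambda>h x. ((-1) powi (1 - tot ?X' d ?m)) * (f h x * (x - eps) ^ k))"
  have g: "g \<in> poly_sym" unfolding g_def
    by (intro poly_sym_mult poly_sym_scalar sign_R f poly_sym_shift)
  have "addable_sum X d n (\<lambda>h x. \<phi> h * x ^ k) + (\<Sum>h\<in>configs X. \<Sum>p\<in>removable mu a h d ?m. wt h * up h d n (jj p - 1) * (\<phi> h * pos (jj p - 1) ^ k)) = class_sum X \<psi>"
    unfolding addable_sum_def class_sum_def sum.distrib[symmetric]
  proof (intro sum.cong refl)
    fix h assume "h \<in> configs X"
    hence v: "valid mu h" "sig h = X" by (auto simp: configs_def)
    show "(\<Sum>p\<in>addable mu a h d n. wt h * up h d n (jj p) * (\<phi> h * pos (jj p) ^ k))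
      + (\<Sum>p\<in>removable mu a h d ?m. wt h * up h d n (jj p - 1) * (\<phi> h * pos (jj p - 1) ^ k)) = wt h * \<psi> h"
      unfolding \<psi>_def poles_sum[OF v(1), where d = d and n = n and k = k, unfolded v(2), symmetric]
      by (simp add: sum_distrib_left distrib_left ac_simps)
  qed
  moreover have "(\<Sum>h\<in>configs X. \<Sum>p\<in>removable mu a h d ?m. wt h * up h d n (jj p - 1) * (\<phi> h * pos (jj p - 1) ^ k))
      = (if (d, ?m) \<in># X then addable_sum ?X' d ?m g else 0)"
  proof (cases "(d, ?m) \<in># X")
    case False
    hence "removable mu a h d ?m = {}" if "h \<in> configs X" for h
      using that removable_in_sig[of _ h d ?m] by (auto simp: configs_def)
    thus ?thesis using False by simp
  next
    case True
    have "(\<Sum>h\<in>configs X. \<Sum>p\<in>removable mu a h d ?m. wt h * up h d n (jj p - 1) * (\<phi> h * pos (jj p - 1) ^ k)) = addable_sum ?X' d ?m g"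
      unfolding sum_removable_addable[OF True] addable_sum_def
    proof (intro sum.cong refl)
      fix h p assume h: "h \<in> configs ?X'" and p: "p \<in> addable mu a h d ?m"
      have v: "valid mu h" "sig h = ?X'" using h by (auto simp: configs_def)
      have pm: "p \<in> mu" "dg p = d" "lv a h p = ?m + 1" using p by (auto simp: addable_def)
      note A = removable_of_addable[OF p v(1)]
      have "pos (jj p - 1) = pos (jj p) - eps" by (simp add: pos_def algebra_simps)
      thus "wt (h(p := Suc (h p))) * up (h(p := Suc (h p))) d n (jj p - 1) * (\<phi> (h(p := Suc (h p))) * pos (jj p - 1) ^ k)
          = wt h * up h d ?m (jj p) * g h (pos (jj p))"
        unfolding wt_spurious[OF A(1,2)] A(3) f(2)[OF pm] g_def total_corner0 v(2)
        by (simp only: ac_simps)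
    qed
    thus ?thesis using True by simp
  qed
  ultimately have "addable_sum X d n (\<lambda>h x. \<phi> h * x ^ k) = class_sum X \<psi> - (if (d, ?m) \<in># X then addable_sum ?X' d ?m g else 0)"
    by (simp add: algebra_simps)
  thus ?thesis using \<psi> g by blast
qed

text \<open>The classes whose sums appear when the previous lemma is applied repeatedly.\<close>

inductive chain :: "int \<Rightarrow> int \<Rightarrow> (int \<times> int) multiset \<Rightarrow> (int \<times> int) multiset \<Rightarrow> bool" where
  chain_refl: "chain d n X X"
| chain_step: "(d, n + a + 1) \<in># X \<Longrightarrow> chain d (n + a + 1) (move X d (n + a + 1)) Y \<Longrightarrow> chain d n X Y"

lemma hgt_chain: "chain d n X Y \<Longrightarrow> hgt Y \<le> hgt X"
  by (induction rule: chain.induct) (simp, metis (no_types, lifting) hgt_move diff_ge_0_iff_ge zle_diff1_eq order_less_imp_le order.trans)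

definition sums_in :: "'k set \<Rightarrow> (int \<times> int) multiset \<Rightarrow> bool" where
  "sums_in I X \<longleftrightarrow> (\<forall>\<phi>\<in>symf. class_sum X \<phi> \<in> I)"

lemma hgt_nonneg: "configs X \<noteq> {} \<Longrightarrow> hgt X \<ge> 0"
  by (metis (mono_tags, lifting) configs_def all_not_in_conv hgt_sig mem_Collect_eq of_nat_0_le_iff)

text \<open>Each application of \<open>addable_sum_step\<close> lowers the number of boxes, so the
  recursion ends, and only class sums along the chain remain.\<close>

lemma addable_sum_mem:
  assumes I: "0 \<in> I" "\<And>x y. x \<in> I \<Longrightarrow> y \<in> I \<Longrightarrow> x + y \<in> I" "\<And>x y. x \<in> I \<Longrightarrow> y \<in> I \<Longrightarrow> x - y \<in> I"
    and "\<And>Y. chain d n X Y \<Longrightarrow> sums_in I Y" and g: "g \<in> poly_sym"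
  shows "addable_sum X d n g \<in> I"
  using assms(4) g
proof (induction "nat (hgt X)" arbitrary: X n g rule: less_induct)
  case (less X n g)
  show ?case
  proof (cases "configs X = {}")
    case True thus ?thesis using I(1) by (simp add: addable_sum_def)
  next
    case ne: False
    show ?thesis using less.prems(2)
    proof induction
      case (add f g)
      thus ?case using I(2) by (simp add: addable_sum_add)
    next
      case (monom \<phi> k)
      obtain \<psi> g where "\<psi> \<in> symf" and g: "g \<in> poly_sym"
        and eq: "addable_sum X d n (\<lambda>h x. \<phi> h * x ^ k)
         = class_sum X \<psi> - (if (d, n + a + 1) \<in># X then addable_sum (move X d (n + a + 1)) d (n + a + 1) g else 0)"
        using addable_sum_step[OF monom] by blast
      have "class_sum X \<psi> \<in> I" using less.prems(1)[OF chain_refl] \<open>\<psi> \<in> symf\<close> by (auto simp: sums_in_def)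
      moreover have "addable_sum (move X d (n + a + 1)) d (n + a + 1) g \<in> I" if m: "(d, n + a + 1) \<in># X"
      proof (cases "configs (move X d (n + a + 1)) = {}")
        case True thus ?thesis using I(1) by (simp add: addable_sum_def)
      next
        case False
        hence "nat (hgt (move X d (n + a + 1))) < nat (hgt X)"
          using hgt_nonneg[OF False] hgt_move[OF m] by simp
        thus ?thesis by (rule less.hyps[OF _ _ g]) (use less.prems(1) chain_step[OF m] in blast)
      qed
      ultimately show ?case unfolding eq using I by auto
    qed
  qed
qed

section \<open>Removing a lowest box\<close>

text \<open>The boxes of column p occupy the levels from \<open>lv a h p\<close> to
  \<open>a * jj p - 1\<close>, so these are the columns of diagonal d that contain a box at level
  n.\<close>

definition deep :: "cfg \<Rightarrow> int \<Rightarrow> int \<Rightarrow> (nat \<times> nat) set" where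
  "deep h d n = {p\<in>mu. dg p = d \<and> lv a h p \<le> n \<and> n < a * jj p}"

lemma finite_deep: "finite (deep h d n)"
  using fin_mu by (simp add: deep_def)

text \<open>A level never exceeds \<open>a * jj p\<close>. So among the columns with level at most
  n, those without a box at level n are the ones with \<open>a * jj p\<close> at most n, a number
  that does not depend on h.\<close>

lemma card_deep:
  "int (card (deep h d n)) = int (size (filter_mset (\<lambda>v. fst v = d \<and> snd v \<le> n) (sig h)))
     - int (card {p\<in>mu. dg p = d \<and> a * jj p \<le> n})"
proof -
  have "{p\<in>mu. dg p = d \<and> lv a h p \<le> n} = deep h d n \<union> {p\<in>mu. dg p = d \<and> a * jj p \<le> n}"
    by (auto simp: deep_def lv_def)
  moreover have "deep h d n \<inter> {p\<in>mu. dg p = d \<and> a * jj p \<le> n} = {}" by (auto simp: deep_def)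
  ultimately have "card {p\<in>mu. dg p = d \<and> lv a h p \<le> n} = card (deep h d n) + card {p\<in>mu. dg p = d \<and> a * jj p \<le> n}"
    using fin_mu by (simp add: card_Un_disjoint deep_def)
  thus ?thesis using card_sig[of "\<lambda>d' n'. d' = d \<and> n' \<le> n" h] by simp
qed

lemma card_deep_sig: "sig h = sig h' \<Longrightarrow> card (deep h d n) = card (deep h' d n)"
  using card_deep[of h d n] card_deep[of h' d n] by simp

lemma deep_empty_sig: "sig h = sig h' \<Longrightarrow> deep h d n = {} \<longleftrightarrow> deep h' d n = {}"
  using card_deep_sig[of h h' d n] finite_deep by (metis card_eq_0_iff)

text \<open>The tie is broken towards small diagonals because the neighbour (i - 1, j) may share the
  level, and it lies on diagonal d - 1. The neighbour (i, j - 1) of equal height would already be a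
  levels lower.\<close>

definition bottom :: "cfg \<Rightarrow> int \<Rightarrow> int \<Rightarrow> bool" where
  "bottom h d n \<longleftrightarrow> (\<forall>p\<in>mu. h p > 0 \<longrightarrow> n \<le> lv a h p \<and> (lv a h p = n \<longrightarrow> d \<le> dg p))
     \<and> (\<exists>p\<in>mu. h p > 0 \<and> lv a h p = n \<and> dg p = d)"

lemma bottom_deep:
  "bottom h d n \<longleftrightarrow> (\<forall>d' n'. n' < n \<or> n' = n \<and> d' < d \<longrightarrow> deep h d' n' = {}) \<and> deep h d n \<noteq> {}"
proof -
  have pos: "h p > 0 \<longleftrightarrow> lv a h p < a * jj p" for p by (simp add: lv_def)
  have D: "p \<in> mu \<and> h p > 0 \<and> (lv a h p < n \<or> lv a h p = n \<and> dg p < d) \<Longrightarrow> deep h (dg p) (lv a h p) \<noteq> {}" for p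
    unfolding deep_def pos by blast
  hence *: "(\<forall>p\<in>mu. h p > 0 \<longrightarrow> n \<le> lv a h p \<and> (lv a h p = n \<longrightarrow> d \<le> dg p))
    \<longleftrightarrow> (\<forall>d' n'. n' < n \<or> n' = n \<and> d' < d \<longrightarrow> deep h d' n' = {})" (is "?L \<longleftrightarrow> ?R")
  proof (intro iffI)
    assume L: ?L
    show ?R
    proof (intro allI impI)
      fix d' n' assume n': "n' < n \<or> n' = n \<and> d' < d"
      show "deep h d' n' = {}"
      proof (rule ccontr)
        assume "deep h d' n' \<noteq> {}"
        then obtain p where "p \<in> mu" "dg p = d'" "lv a h p \<le> n'" "n' < a * jj p" unfolding deep_def by auto
        thus False using L n' by (force simp: pos)
      qed
    qed
  next
    assume R: ?R
    show ?L using D R by (meson not_le)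
  qed
  have "?L \<Longrightarrow> (\<exists>p\<in>mu. h p > 0 \<and> lv a h p = n \<and> dg p = d) \<longleftrightarrow> deep h d n \<noteq> {}"
    unfolding deep_def pos by force
  thus ?thesis unfolding bottom_def using * by blast
qed

lemma bottom_sig:
  assumes "sig h = sig h'"
  shows "bottom h d n \<longleftrightarrow> bottom h' d n"
  unfolding bottom_deep by (simp only: deep_empty_sig[OF assms])

lemma bottom_exists:
  assumes "p \<in> mu" "h p > 0"
  shows "\<exists>d n. bottom h d n"
proof -
  let ?A = "{p\<in>mu. h p > 0}"
  have fin: "finite ?A" "?A \<noteq> {}" using fin_mu assms by (simp, blast)
  define n where "n = Min (lv a h ` ?A)"
  have n: "n \<in> lv a h ` ?A" "\<And>p. p \<in> ?A \<Longrightarrow> n \<le> lv a h p" unfolding n_def using fin by auto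
  let ?B = "{p\<in>?A. lv a h p = n}"
  have finB: "finite ?B" "?B \<noteq> {}" using finite_subset[OF _ fin(1), of ?B] n(1) by auto
  define d where "d = Min (dg ` ?B)"
  have d: "d \<in> dg ` ?B" "\<And>p. p \<in> ?B \<Longrightarrow> d \<le> dg p" unfolding d_def using finB by auto
  show ?thesis using n d unfolding bottom_def by (intro exI[of _ d] exI[of _ n]) auto
qed

lemma removable_bottom:
  assumes "valid mu h" "bottom h d n"
  shows "removable mu a h d n = deep h d n"
proof -
  have "p \<in> removable mu a h d n \<longleftrightarrow> p \<in> deep h d n" for p
  proof (cases "p \<in> mu \<and> dg p = d \<and> h p > 0 \<and> lv a h p = n")
    case True
    have "valid mu (h(p := h p - 1))"
      unfolding valid_lower[OF assms(1) conjunct1[OF True] conjunct1[OF conjunct2[OF conjunct2[OF True]]]]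
    proof (intro conjI allI impI)
      fix i assume i: "fst p = Suc i"
      let ?q = "(i, snd p)"
      have "?q \<in> mu" using True i part unfolding is_partition_def by (metis le_SucI le_refl prod.collapse)
      moreover have "h ?q \<le> h p" using assms(1) True i by (cases p) (auto simp: valid_def)
      moreover have "dg ?q = d - 1" using True i by (simp add: dg_def)
      moreover have "h ?q = h p \<Longrightarrow> lv a h ?q = n" using True by (simp add: lv_def jj_def)
      ultimately show "h ?q < h p" using assms(2) True unfolding bottom_def by force
    next
      fix j assume j: "snd p = Suc j"
      let ?q = "(fst p, j)"
      have "?q \<in> mu" using True j part unfolding is_partition_def by (metis le_SucI le_refl prod.collapse)
      moreover have "h ?q \<le> h p" using assms(1) True j by (cases p) (auto simp: valid_def)
      moreover have "h ?q = h p \<Longrightarrow> lv a h ?q = n - a" using True j by (auto simp: lv_def jj_def algebra_simps)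
      ultimately show "h ?q < h p" using assms(2) True a_pos unfolding bottom_def by force
    qed
    thus ?thesis using True by (auto simp: removable_def deep_def lv_def)
  next
    case False
    have "p \<notin> deep h d n"
    proof
      assume p: "p \<in> deep h d n"
      hence "h p > 0" by (auto simp: deep_def lv_def)
      hence "n \<le> lv a h p" using assms(2) p by (auto simp: bottom_def deep_def)
      thus False using False p \<open>h p > 0\<close> by (auto simp: deep_def)
    qed
    thus ?thesis using False by (auto simp: removable_def)
  qed
  thus ?thesis by blast
qed

text \<open>The height tested on the unit square is c = a l - n. For c > 0 the three corners other
  than (x + 1, l) would have a level below n, or level n on diagonal d - 1, both excluded for a
  lowest box. For c = 0 the square lies in the empty part of the module, where its terms cancel
  against the virtual corner; c < 0 cannot occur as a height.\<close>

lemma corner_under_bottom: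
  assumes v: "valid mu h" and b: "bottom h d n" and p: "p \<in> removable mu a h d n"
  defines "h' \<equiv> h(p := h p - 1)"
  shows "corner mu a h' d (n - a - 1) (l - 1) \<ge> 0" "l = jj p \<Longrightarrow> corner mu a h' d (n - a - 1) (l - 1) = 0"
proof -
  have pm: "p \<in> mu" "dg p = d" "lv a h p = n" "h p > 0" using p by (auto simp: removable_def)
  have v': "valid mu h'" using addable_of_removable(2)[OF p v] by (simp add: h'_def)
  define x c where "x = l - 1 + d" and "c = a * l - n"
  have cxy: "corner mu a h' d (n - a - 1) (l - 1) = of_bool (inn mu x (l - 1) \<and> hh h' x (l - 1) = c)
     + of_bool (inn mu (x + 1) l \<and> hh h' (x + 1) l = c) - of_bool (inn mu (x + 1) (l - 1) \<and> hh h' (x + 1) (l - 1) = c)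
     - of_bool (inn mu x l \<and> hh h' x l = c) - of_bool (x = - 1 \<and> l = 0 \<and> c = 0)"
    using corner_xy[OF fin_mu, of x "l - 1" d c a "n - a - 1" h'] by (simp add: x_def c_def algebra_simps)
  have low: "n < lv a h' q \<or> n = lv a h' q \<and> d \<le> dg q" if "q \<in> mu" "h' q > 0" for q
  proof (cases "q = p")
    case True thus ?thesis using pm by (auto simp: h'_def lv_def)
  next
    case False thus ?thesis using b that by (auto simp: h'_def bottom_def lv_def)
  qed
  have low': "c \<noteq> hh h' u w" if "inn mu u w" "c > 0" "w < l \<or> w = l \<and> u < l + d" for u w
  proof
    assume e: "c = hh h' u w"
    let ?q = "(nat u, nat w)"
    have q: "?q \<in> mu" "u \<ge> 0" "w \<ge> 0" "h' ?q > 0" "int (h' ?q) = c" using that e by (auto simp: inn_def hh_def)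
    have "lv a h' ?q = a * w - a * l + n" "dg ?q = u - w" using q by (auto simp: lv_def jj_def dg_def c_def)
    moreover have "a * w < a * l" if "w < l" using that a_pos by simp
    ultimately show False using low[OF q(1,4)] that by (cases "w < l") auto
  qed
  have main: "corner mu a h' d (n - a - 1) (l - 1) = of_bool (c > 0 \<and> inn mu (x + 1) l \<and> hh h' (x + 1) l = c)"
  proof (cases "c > 0")
    case True
    have "\<not> (inn mu x (l - 1) \<and> hh h' x (l - 1) = c)" "\<not> (inn mu (x + 1) (l - 1) \<and> hh h' (x + 1) (l - 1) = c)"
      "\<not> (inn mu x l \<and> hh h' x l = c)"
      using low'[of x "l - 1"] low'[of "x + 1" "l - 1"] low'[of x l] True by (auto simp: x_def)
    thus ?thesis unfolding cxy using True by (auto simp: of_bool_def)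
  next
    case False
    show ?thesis
    proof (cases "c = 0")
      case c0: True
      \<comment> \<open>Here n = a l, and p has a box at level n, so p lies further along its
        diagonal than (x + 1, l). Hence that point is in the partition once its coordinates are
        nonnegative, and its column is empty.\<close>
      have "a * l < a * jj p" using c0 pm by (auto simp: c_def lv_def)
      hence lj: "l < jj p" using a_pos by simp
      have D: "inn mu (x + 1) l \<and> hh h' (x + 1) l = 0" if "x + 1 \<ge> 0" "l \<ge> 0"
      proof -
        have "(nat (x + 1), nat l) \<in> mu"
        proof -
          have "(fst p, snd p) \<in> mu" "nat (x + 1) \<le> fst p" "nat l \<le> snd p"
            using pm lj that by (auto simp: x_def dg_def jj_def)
          thus ?thesis using part unfolding is_partition_def by blast
        qed
        moreover have "h' (nat (x + 1), nat l) = 0"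
        proof (rule ccontr)
          assume "h' (nat (x + 1), nat l) \<noteq> 0"
          hence "n \<le> lv a h' (nat (x + 1), nat l)" using low[OF calculation] by auto
          thus False using \<open>h' (nat (x + 1), nat l) \<noteq> 0\<close> c0 that by (simp add: lv_def jj_def c_def)
        qed
        ultimately show ?thesis using that by (simp add: inn_def hh_def)
      qed
      have sub: "inn mu u w \<and> hh h' u w = 0" if "0 \<le> u" "0 \<le> w" "u = x \<or> u = x + 1" "w = l - 1 \<or> w = l" for u w
      proof -
        have d: "inn mu (x + 1) l" "hh h' (x + 1) l = 0" using D that by auto
        have 1: "inn mu x l \<and> hh h' x l = 0" if "x \<ge> 0"
          using inn_down(1)[OF part d(1) that] hh_mono(1)[OF v' d(1) that] d(2) by (auto simp: hh_def)
        have 2: "inn mu (x + 1) (l - 1) \<and> hh h' (x + 1) (l - 1) = 0" if "l - 1 \<ge> 0"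
          using inn_down(2)[OF part, of "x+1" "l-1"] hh_mono(2)[OF v', of "x+1" "l-1"] d that by (auto simp: hh_def)
        have 3: "inn mu x (l - 1) \<and> hh h' x (l - 1) = 0" if "x \<ge> 0" "l - 1 \<ge> 0"
          using inn_down(2)[OF part, of "x" "l-1"] hh_mono(2)[OF v', of "x" "l-1"] 1[OF that(1)] that by (auto simp: hh_def)
        show ?thesis using d 1 2 3 that by auto
      qed
      have all: "(inn mu u w \<and> hh h' u w = 0) = (0 \<le> u \<and> 0 \<le> w)" if "u = x \<or> u = x + 1" "w = l - 1 \<or> w = l" for u w
        using sub[of u w] that by (auto simp: inn_def)
      have "corner mu a h' d (n - a - 1) (l - 1) = of_bool (0 \<le> x \<and> 0 \<le> l - 1) + of_bool (0 \<le> x + 1 \<and> 0 \<le> l)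
         - of_bool (0 \<le> x + 1 \<and> 0 \<le> l - 1) - of_bool (0 \<le> x \<and> 0 \<le> l) - of_bool (x = - 1 \<and> l = 0)"
        unfolding cxy c0 by (simp add: all)
      also have "\<dots> = 0" by (cases "0 \<le> x"; cases "0 \<le> l - 1"; cases "x = -1"; cases "l = 0") auto
      finally show ?thesis using c0 by simp
    next
      case ne: False
      hence "hh h' u w \<noteq> c" for u w using False by (auto simp: hh_def)
      thus ?thesis unfolding cxy using False ne by simp
    qed
  qed
  thus "corner mu a h' d (n - a - 1) (l - 1) \<ge> 0" by simp
  assume l: "l = jj p"
  have "nat (x + 1) = fst p" "nat l = snd p" using l pm by (auto simp: x_def dg_def jj_def)
  hence "hh h' (x + 1) l = int (h p - 1)" by (simp add: hh_def h'_def)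
  moreover have "c = int (h p)" using l pm by (simp add: c_def lv_def)
  ultimately show "corner mu a h' d (n - a - 1) (l - 1) = 0" using main pm by simp
qed

text \<open>Without poles the product is a polynomial with symmetric coefficients, of a degree fixed
  by the class. The factor that \<open>res_at\<close> leaves out has exponent 0.\<close>

lemma down_polynomial:
  "\<exists>g\<in>poly_sym. \<forall>h i. sig h = X \<longrightarrow> (\<forall>l. corner mu a h d n (l - 1) \<ge> 0) \<longrightarrow> corner mu a h d n (i - 1) = 0
     \<longrightarrow> res_at pos (\<lambda>l. corner mu a h d n (l - 1)) i = g h (pos i)"
proof -
  define g where "g = (\<lambda>h x. \<Sum>r\<le>nat (tot X d n). newton (moment pos (\<lambda>l. corner mu a h d n (l - 1))) r * x ^ (nat (tot X d n) - r))"
  have "g \<in> poly_sym" unfolding g_def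
    by (intro poly_sym_sum poly_sym.monom sym_newton moment_corner_sym)
  moreover have "res_at pos (\<lambda>l. corner mu a h d n (l - 1)) i = g h (pos i)"
    if "sig h = X" "\<And>l. corner mu a h d n (l - 1) \<ge> 0" "corner mu a h d n (i - 1) = 0" for h i
  proof -
    have "res_at pos (\<lambda>l. corner mu a h d n (l - 1)) i = zprod (\<lambda>l. pos i - pos l) (\<lambda>l. corner mu a h d n (l - 1))"
      unfolding res_at_def using that(3) by (intro zprod_cong) auto
    also have "\<dots> = g h (pos i)"
    proof -
      have "{l. corner mu a h d n (l - 1) \<noteq> 0} = (\<lambda>l. l + 1) ` {l. corner mu a h d n l \<noteq> 0}"
        by (auto simp: image_iff intro!: exI[of _ "_ - 1"])
      hence "finite {l. corner mu a h d n (l - 1) \<noteq> 0}" using finite_supp_corner[OF fin_mu] by simp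
      from zprod_polynomial[OF this that(2), where e = pos and x = "pos i"] show ?thesis
        unfolding g_def total_corner that(1) by blast
    qed
    finally show ?thesis .
  qed
  ultimately show ?thesis by blast
qed

text \<open>All members of the class have the same bottom and equally many bottom boxes, all of them
  removable. Averaging over the box to be removed therefore costs only the inverse of a positive
  integer.\<close>

lemma class_sum_step:
  assumes h0: "h0 \<in> configs X" and b: "bottom h0 d n" and \<phi>: "\<phi> \<in> symf"
  shows "(d, n) \<in># X" "\<exists>g\<in>poly_sym. class_sum X \<phi> = addable_sum (move X d n) d n g"
proof -
  let ?P = "card (deep h0 d n)"
  have bX: "bottom h d n" "card (removable mu a h d n) = ?P" if "h \<in> configs X" for h
  proof -
    have s: "sig h = sig h0" using that h0 by (simp add: configs_def)
    show "bottom h d n" using bottom_sig[OF s] b by simp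
    thus "card (removable mu a h d n) = ?P" using removable_bottom that card_deep_sig[OF s] by (simp add: configs_def)
  qed
  have "?P > 0" using b fin_mu by (auto simp: bottom_deep card_gt_0_iff deep_def)
  then obtain p where "p \<in> removable mu a h0 d n" using bX(2)[OF h0] by (metis card.empty ex_in_conv less_numeral_extra(3))
  thus m: "(d, n) \<in># X" using removable_in_sig[of p h0 d n] h0 by (simp add: configs_def)
  let ?X' = "move X d n"
  obtain f where f: "f \<in> poly_sym" "\<And>h p. p \<in> mu \<Longrightarrow> dg p = d \<Longrightarrow> lv a h p = n + 1 \<Longrightarrow> \<phi> (h(p := Suc (h p))) = f h (pos (jj p))"
    using sym_add_box[OF \<phi>, of d n] by blast
  obtain g where g: "g \<in> poly_sym" "\<And>h i. sig h = ?X' \<Longrightarrow> (\<And>l. corner mu a h d (n - a - 1) (l - 1) \<ge> 0) \<Longrightarrow> corner mu a h d (n - a - 1) (i - 1) = 0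
     \<Longrightarrow> res_at pos (\<lambda>l. corner mu a h d (n - a - 1) (l - 1)) i = g h (pos i)"
    using down_polynomial[of ?X' d "n - a - 1"] by blast
  define k :: 'k where "k = inverse (of_int (int ?P)) * (-1) powi (1 - tot ?X' d n)"
  have kR: "k \<in> R" unfolding k_def using \<open>?P > 0\<close> by (intro mult_R inverse_int_R sign_R) simp
  have "of_nat ?P * class_sum X \<phi> = (\<Sum>h\<in>configs X. \<Sum>p\<in>removable mu a h d n. wt h * \<phi> h)"
    unfolding class_sum_def sum_distrib_left using bX by (intro sum.cong) auto
  also have "\<dots> = addable_sum ?X' d n (\<lambda>h x. ((-1) powi (1 - tot ?X' d n)) * (f h x * g h x))"
    unfolding sum_removable_addable[OF m] addable_sum_def
  proof (intro sum.cong refl)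
    fix h p assume h: "h \<in> configs ?X'" and p: "p \<in> addable mu a h d n"
    have v: "valid mu h" "sig h = ?X'" using h by (auto simp: configs_def)
    have pm: "p \<in> mu" "dg p = d" "lv a h p = n + 1" using p by (auto simp: addable_def)
    note A = removable_of_addable[OF p v(1)]
    have "sig (h(p := Suc (h p))) = X" using sig_raise(2)[OF pm] m unfolding v(2) by simp
    hence hX: "h(p := Suc (h p)) \<in> configs X" using A(2) by (simp add: configs_def)
    note c = corner_under_bottom[OF A(2) bX(1)[OF hX] A(1), unfolded A(3)]
    have "down h d n (jj p) = g h (pos (jj p))"
      unfolding down_def by (rule g(2)[OF v(2)]) (use c in auto)
    thus "wt (h(p := Suc (h p))) * \<phi> (h(p := Suc (h p)))
        = wt h * up h d n (jj p) * ((-1) powi (1 - tot ?X' d n) * (f h (pos (jj p)) * g h (pos (jj p))))"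
      unfolding wt_add_box[OF pm(1,3,2) corner_addable[OF part v(1) p]] f(2)[OF pm] total_corner0 v(2)
      by (simp only: ac_simps)
  qed
  finally have "class_sum X \<phi> = addable_sum ?X' d n (\<lambda>h x. k * (f h x * g h x))"
    using \<open>?P > 0\<close> unfolding addable_sum_scale k_def by (simp add: field_simps)
  moreover have "(\<lambda>h x. k * (f h x * g h x)) \<in> poly_sym"
    by (intro poly_sym_mult poly_sym_scalar kR f g)
  ultimately show "\<exists>g\<in>poly_sym. class_sum X \<phi> = addable_sum (move X d n) d n g" by blast
qed

lemma vcoef_empty: "vcoef mu a (\<lambda>_. 0) D B y = 0"
proof -
  have z: "of_bool (P \<and> z = y) * step_ind a B y (a * z) = 0" for P z
    by (cases "z = y") (auto simp: step_ind_def)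
  have e: "a * \<eta> - a = a * (\<eta> - 1)" "- (a * \<eta>) - a = a * (- \<eta> - 1)" for \<eta> by (simp_all add: algebra_simps)
  have "pair_coef a D B y \<delta> \<eta> (a * \<eta>) = 0" for \<delta> \<eta>
    unfolding pair_coef_def e z by simp
  moreover have "frame_coef a D B y \<delta> \<eta> (a * \<eta>) = 0" for \<delta> \<eta>
    unfolding frame_coef_def e z by simp
  ultimately show ?thesis unfolding vcoef_def lv_def by (simp flip: right_diff_distrib)
qed

lemma wt_empty: "wt (\<lambda>_. 0) = 1"
  unfolding wt_def vcoef_empty by (simp add: zprod_def)

text \<open>Induction on the number of boxes: removing a bottom box leads to classes with strictly
  fewer boxes, along the whole chain. The class of the empty height function has the single weight
  1.\<close>

lemma sums_in_regular: "sums_in R X"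
proof (induction "nat (hgt X)" arbitrary: X rule: less_induct)
  case less
  show ?case
  proof (cases "configs X = {}")
    case True thus ?thesis by (simp add: sums_in_def class_sum_def zero_R)
  next
    case False
    then obtain h0 where h0: "h0 \<in> configs X" by blast
    show ?thesis
    proof (cases "\<exists>p\<in>mu. h0 p > 0")
      case True
      then obtain d n where b: "bottom h0 d n" using bottom_exists by blast
      show ?thesis unfolding sums_in_def
      proof
        fix \<phi> assume \<phi>: "\<phi> \<in> symf"
        note m = class_sum_step(1)[OF h0 b \<phi>]
        obtain g where g: "g \<in> poly_sym" "class_sum X \<phi> = addable_sum (move X d n) d n g" using class_sum_step(2)[OF h0 b \<phi>] by blast
        have "addable_sum (move X d n) d n g \<in> R"
        proof (cases "configs (move X d n) = {}")
          case True thus ?thesis by (simp add: addable_sum_def zero_R)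
        next
          case F: False
          show ?thesis
          proof (rule addable_sum_mem[OF zero_R add_R diff_R _ g(1)])
            fix Y assume "chain d n (move X d n) Y"
            from hgt_chain[OF this] have "nat (hgt Y) < nat (hgt X)"
              using hgt_move[OF m] hgt_nonneg[OF F] by simp
            thus "sums_in R Y" by (rule less)
          qed
        qed
        thus "class_sum X \<phi> \<in> R" using g by simp
      qed
    next
      case F: False
      have z: "h = (\<lambda>_. 0)" if "h \<in> configs X" for h
      proof -
        have "int (\<Sum>p\<in>mu. h p) = int (\<Sum>p\<in>mu. h0 p)" using that h0 unfolding hgt_sig[symmetric] by (simp add: configs_def)
        hence "(\<Sum>p\<in>mu. h p) = (\<Sum>p\<in>mu. h0 p)" by linarith
        also have "\<dots> = 0" using F by simp
        finally have "(\<Sum>p\<in>mu. h p) = 0" .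
        hence "\<forall>p\<in>mu. h p = 0" using fin_mu by simp
        moreover have "p \<notin> mu \<Longrightarrow> h p = 0" for p using that unfolding configs_def valid_def by blast
        ultimately show ?thesis by blast
      qed
      hence "configs X = {\<lambda>_. 0}" using h0 by blast
      thus ?thesis by (simp add: sums_in_def class_sum_def wt_empty sym_R)
    qed
  qed
qed

end

section \<open>The order of a weight along the hyperplane\<close>

lemma sum_pick:
  fixes z :: int
  assumes "finite S" "z \<in> S"
  shows "(\<Sum>y\<in>S. of_bool (P \<and> z = y) * step_ind a 0 y v) = of_bool P * step_ind a 0 z (v::int)"
proof -
  have "(\<Sum>y\<in>S. of_bool (P \<and> z = y) * step_ind a 0 y v) = (\<Sum>y\<in>S. if y = z then of_bool P * step_ind a 0 z v else 0)"
    by (intro sum.cong) auto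
  thus ?thesis using assms by (simp add: sum.delta)
qed

text \<open>The level differences for which a pair affects the order along \<open>eps\<close> = 0.
  It consists of a + 1 integers, so between levels congruent modulo a + 1 only equality
  remains.\<close>

definition band :: "int \<Rightarrow> int \<Rightarrow> int" where "band a v = of_bool (- a \<le> v \<and> v \<le> 0)"

text \<open>The kernel of the quadratic form sum_d w_d^2 - w_d w_(d+1) in the numbers w_d of boxes
  per diagonal.\<close>

definition near :: "(nat \<times> nat) \<Rightarrow> (nat \<times> nat) \<Rightarrow> int" where
  "near p q = of_bool (dg p = dg q) - of_bool (dg p = dg q + 1)"

lemma double_sum_swap: "(\<Sum>p\<in>A. \<Sum>q\<in>A. F p q) = (\<Sum>p\<in>A. \<Sum>q\<in>A. F q p)"
  by (rule sum.swap)

text \<open>Exchanging p and q in the terms with the shift a turns them into the condition v < -a on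
  the same difference v. Together with v > 0 this is the complement of the band.\<close>

lemma sum_indicators_band:
  assumes "a > 0"
  shows "(\<Sum>p\<in>mu. \<Sum>q\<in>mu. of_bool (dg p = dg q) * (of_bool (0 < b p - b q) + of_bool (0 < b p - b q - a))
       - of_bool (dg p = dg q + 1) * of_bool (0 < b p - b q) - of_bool (dg q = dg p + 1) * of_bool (0 < b p - b q - a))
     = (\<Sum>p\<in>mu. \<Sum>q\<in>mu. near p q) - (\<Sum>p\<in>mu. \<Sum>q\<in>mu. near p q * band a (b p - b q))"
proof -
  let ?A = "\<lambda>p q. near p q * of_bool (0 < b p - b q)"
  let ?B = "\<lambda>p q. near q p * of_bool (0 < b p - b q - a)"
  have "(\<Sum>p\<in>mu. \<Sum>q\<in>mu. of_bool (dg p = dg q) * (of_bool (0 < b p - b q) + of_bool (0 < b p - b q - a))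
       - of_bool (dg p = dg q + 1) * of_bool (0 < b p - b q) - of_bool (dg q = dg p + 1) * of_bool (0 < b p - b q - a))
     = (\<Sum>p\<in>mu. \<Sum>q\<in>mu. ?A p q) + (\<Sum>p\<in>mu. \<Sum>q\<in>mu. ?B p q)"
    unfolding sum.distrib[symmetric] by (intro sum.cong refl) (simp add: near_def algebra_simps eq_commute)
  also have "(\<Sum>p\<in>mu. \<Sum>q\<in>mu. ?B p q) = (\<Sum>p\<in>mu. \<Sum>q\<in>mu. ?B q p)" by (rule double_sum_swap)
  also have "(\<Sum>p\<in>mu. \<Sum>q\<in>mu. ?A p q) + \<dots> = (\<Sum>p\<in>mu. \<Sum>q\<in>mu. near p q - near p q * band a (b p - b q))"
    unfolding sum.distrib[symmetric]
    by (intro sum.cong refl) (use assms in \<open>auto simp: band_def\<close>)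
  finally show ?thesis by (simp add: sum_subtractf)
qed

lemma sum_pred:
  assumes "is_partition mu" "q \<in> mu"
  shows "(\<Sum>p\<in>mu. of_bool (fst p + u = fst q \<and> snd p + v = snd q)) = (of_bool (u \<le> fst q \<and> v \<le> snd q) :: int)"
proof -
  let ?p = "(fst q - u, snd q - v)"
  have m: "?p \<in> mu" using assms unfolding is_partition_def by (metis diff_le_self prod.collapse)
  have "(\<Sum>p\<in>mu. of_bool (fst p + u = fst q \<and> snd p + v = snd q)) = (\<Sum>p\<in>mu. if p = ?p then of_bool (u \<le> fst q \<and> v \<le> snd q) else (0::int))"
    by (intro sum.cong) auto
  thus ?thesis using assms m by (simp add: sum.delta is_partition_def)
qed

text \<open>For the empty height function the band admits only position differences 0 and -1. For
  fixed q the four kinds of neighbours give (1 - [i > 0])(1 - [j > 0]), so the left side counts the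
  origin, and so does the right side.\<close>

lemma near_flat:
  assumes "is_partition mu" "a > 0"
  shows "(\<Sum>p\<in>mu. \<Sum>q\<in>mu. near p q * band a (a * jj p - a * jj q)) = (\<Sum>p\<in>mu. of_bool (dg p = 0) * band a (a * jj p))"
proof -
  have b: "band a (a * z) = of_bool (z = 0) + of_bool (z = -1)" for z
  proof -
    have "(- a \<le> a * z) = (-1 \<le> z)" using mult_le_cancel_left_pos[OF assms(2), of "-1" z] by simp
    moreover have "(a * z \<le> 0) = (z \<le> 0)" using mult_le_cancel_left_pos[OF assms(2), of z 0] by simp
    ultimately show ?thesis by (auto simp: band_def)
  qed
  let ?S = "\<lambda>p q u v. of_bool (fst p + u = fst q \<and> snd p + v = snd q) :: int"
  have "(\<Sum>p\<in>mu. \<Sum>q\<in>mu. near p q * band a (a * jj p - a * jj q))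
     = (\<Sum>p\<in>mu. \<Sum>q\<in>mu. ?S p q 0 0 + ?S p q 1 1 - ?S p q 0 1) - (\<Sum>p\<in>mu. \<Sum>q\<in>mu. ?S q p 1 0)"
  proof -
    have "near p q * band a (a * jj p - a * jj q) = ?S p q 0 0 + ?S p q 1 1 - ?S p q 0 1 - ?S q p 1 0" for p q
    proof -
      obtain i j k l where pq: "p = (i, j)" "q = (k, l)" by (cases p, cases q)
      have "(int i - int j = int k - int l \<and> int j - int l = 0) = (i = k \<and> j = l)"
        "(int i - int j = int k - int l \<and> int j - int l = -1) = (i + 1 = k \<and> j + 1 = l)"
        "(int i - int j = int k - int l + 1 \<and> int j - int l = 0) = (k + 1 = i \<and> l = j)"
        "(int i - int j = int k - int l + 1 \<and> int j - int l = -1) = (i = k \<and> j + 1 = l)" by auto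
      note e = this
      have "near p q * (of_bool (jj p - jj q = 0) + of_bool (jj p - jj q = -1))
         = of_bool (int i - int j = int k - int l \<and> int j - int l = 0) + of_bool (int i - int j = int k - int l \<and> int j - int l = -1)
         - of_bool (int i - int j = int k - int l + 1 \<and> int j - int l = 0) - of_bool (int i - int j = int k - int l + 1 \<and> int j - int l = -1)"
        unfolding near_def dg_def jj_def pq by (simp add: of_bool_conj algebra_simps)
      thus ?thesis unfolding right_diff_distrib[symmetric] b e by (simp add: pq)
    qed
    thus ?thesis by (simp only: sum_subtractf)
  qed
  also have "(\<Sum>p\<in>mu. \<Sum>q\<in>mu. ?S p q 0 0 + ?S p q 1 1 - ?S p q 0 1) = (\<Sum>q\<in>mu. \<Sum>p\<in>mu. ?S p q 0 0 + ?S p q 1 1 - ?S p q 0 1)"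
    by (rule sum.swap)
  also have "\<dots> - (\<Sum>p\<in>mu. \<Sum>q\<in>mu. ?S q p 1 0) = (\<Sum>p\<in>mu. of_bool (dg p = 0) * band a (a * jj p))"
    unfolding sum_subtractf[of "\<lambda>q. \<Sum>p\<in>mu. ?S p q 0 0 + ?S p q 1 1 - ?S p q 0 1" "\<lambda>q. \<Sum>p\<in>mu. ?S p q 1 0" mu, symmetric]
  proof (rule sum.cong[OF refl])
    fix q assume q: "q \<in> mu"
    show "(\<Sum>p\<in>mu. ?S p q 0 0 + ?S p q 1 1 - ?S p q 0 1) - (\<Sum>p\<in>mu. ?S p q 1 0) = of_bool (dg q = 0) * band a (a * jj q)"
      unfolding sum_subtractf sum.distrib sum_pred[OF assms(1) q] b
      by (cases q) (auto simp: dg_def jj_def)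
  qed
  finally show ?thesis .
qed

text \<open>Every factor of \<open>wt\<close> is an integer multiple of \<open>eps\<close>, so minus
  this total is the order of \<open>wt\<close>. Summing over y removes the positions, and the terms
  of the empty height function cancel by \<open>near_flat\<close>.\<close>

theorem vcoef_total:
  assumes "is_partition mu" "a > 0"
  shows "- total (vcoef mu a h 0 0) = (\<Sum>p\<in>mu. \<Sum>q\<in>mu. near p q * band a (lv a h p - lv a h q))
     - (\<Sum>p\<in>mu. of_bool (dg p = 0) * band a (lv a h p))"
proof -
  have fin: "finite mu" using assms by (simp add: is_partition_def)
  let ?S = "window mu"
  let ?F = "\<lambda>b p q. of_bool (dg p = dg q) * (of_bool (0 < b p - b q) + of_bool (0 < b p - b q - a))
       - of_bool (dg p = dg q + 1) * of_bool (0 < b p - b q) - of_bool (dg q = dg p + 1) * of_bool (0 < b p - b q - a) :: int"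
  have P: "(\<Sum>y\<in>?S. pair_coef a 0 0 y (dg p - dg q) (jj p - jj q) (lv a h p - lv a h q))
      = ?F (lv a h) p q - ?F (\<lambda>p. a * jj p) p q" if "p \<in> mu" "q \<in> mu" for p q
  proof -
    have "(\<Sum>y\<in>?S. pair_coef a 0 0 y (dg p - dg q) (jj p - jj q) (lv a h p - lv a h q))
      = of_bool (dg p - dg q = 0) * step_ind a 0 (jj p - jj q) (lv a h p - lv a h q)
      + of_bool (dg p - dg q = 0) * step_ind a 0 (jj p - jj q - 1) (lv a h p - lv a h q - a)
      - of_bool (dg p - dg q - 1 = 0) * step_ind a 0 (jj p - jj q) (lv a h p - lv a h q)
      - of_bool (dg p - dg q + 1 = 0) * step_ind a 0 (jj p - jj q - 1) (lv a h p - lv a h q - a)"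
      unfolding pair_coef_def sum.distrib sum_subtractf
        sum_pick[OF window(1)[OF fin] window(2)[OF that]] sum_pick[OF window(1)[OF fin] window(3)[OF that]] ..
    also have "a * (jj p - jj q - 1) = a * jj p - a * jj q - a" by (simp add: algebra_simps)
    hence "step_ind a 0 (jj p - jj q - 1) (lv a h p - lv a h q - a) = of_bool (0 < lv a h p - lv a h q - a) - of_bool (0 < a * jj p - a * jj q - a)"
      by (simp only: step_ind_def)
    also have "step_ind a 0 (jj p - jj q) (lv a h p - lv a h q) = of_bool (0 < lv a h p - lv a h q) - of_bool (0 < a * jj p - a * jj q)"
      by (simp only: step_ind_def right_diff_distrib)
    finally have main: "(\<Sum>y\<in>?S. pair_coef a 0 0 y (dg p - dg q) (jj p - jj q) (lv a h p - lv a h q))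
      = of_bool (dg p - dg q = 0) * (of_bool (0 < lv a h p - lv a h q) - of_bool (0 < a * jj p - a * jj q))
      + of_bool (dg p - dg q = 0) * (of_bool (0 < lv a h p - lv a h q - a) - of_bool (0 < a * jj p - a * jj q - a))
      - of_bool (dg p - dg q - 1 = 0) * (of_bool (0 < lv a h p - lv a h q) - of_bool (0 < a * jj p - a * jj q))
      - of_bool (dg p - dg q + 1 = 0) * (of_bool (0 < lv a h p - lv a h q - a) - of_bool (0 < a * jj p - a * jj q - a))" .
    have "(dg p - dg q = 0) = (dg p = dg q)" "(dg p - dg q - 1 = 0) = (dg p = dg q + 1)" "(dg p - dg q + 1 = 0) = (dg q = dg p + 1)" by auto
    note e = this
    show ?thesis unfolding main e by (simp only: algebra_simps)
  qed
  have G: "(\<Sum>y\<in>?S. frame_coef a 0 0 y (dg p) (jj p) (lv a h p)) = of_bool (dg p = 0) * (band a (a * jj p) - band a (lv a h p))" if "p \<in> mu" for p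
  proof -
    have "(\<Sum>y\<in>?S. frame_coef a 0 0 y (dg p) (jj p) (lv a h p))
      = of_bool (dg p = 0) * step_ind a 0 (jj p) (lv a h p) + of_bool (- dg p = 0) * step_ind a 0 (- jj p - 1) (- lv a h p - a)"
      unfolding frame_coef_def sum.distrib
        sum_pick[OF window(1)[OF fin] window(4)[OF that]] sum_pick[OF window(1)[OF fin] window(5)[OF that]] ..
    also have "a * (- jj p - 1) = - (a * jj p) - a" by (simp add: algebra_simps)
    hence "step_ind a 0 (- jj p - 1) (- lv a h p - a) = of_bool (0 < - lv a h p - a) - of_bool (0 < - (a * jj p) - a)"
      by (simp only: step_ind_def)
    also have "of_bool (dg p = 0) * step_ind a 0 (jj p) (lv a h p) + of_bool (- dg p = 0) * (of_bool (0 < - lv a h p - a) - of_bool (0 < - (a * jj p) - a))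
      = of_bool (dg p = 0) * (band a (a * jj p) - band a (lv a h p))"
    proof -
      have "of_bool (0 < v) + of_bool (0 < - v - a) = 1 - band a v" for v using assms(2) by (auto simp: band_def)
      from this[of "lv a h p"] this[of "a * jj p"] show ?thesis
        by (cases "dg p = 0") (simp_all add: step_ind_def)
    qed
    finally show ?thesis .
  qed
  have "total (vcoef mu a h 0 0) = (\<Sum>y\<in>?S. vcoef mu a h 0 0 y)"
    by (rule total_window[OF window(1)[OF fin] vcoef_window])
  also have "\<dots> = (\<Sum>p\<in>mu. \<Sum>q\<in>mu. \<Sum>y\<in>?S. pair_coef a 0 0 y (dg p - dg q) (jj p - jj q) (lv a h p - lv a h q))
      - (\<Sum>p\<in>mu. \<Sum>y\<in>?S. frame_coef a 0 0 y (dg p) (jj p) (lv a h p))"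
    unfolding vcoef_def sum_subtractf sum.swap[of _ _ ?S] ..
  also have "\<dots> = (\<Sum>p\<in>mu. \<Sum>q\<in>mu. ?F (lv a h) p q) - (\<Sum>p\<in>mu. \<Sum>q\<in>mu. ?F (\<lambda>p. a * jj p) p q)
      - (\<Sum>p\<in>mu. of_bool (dg p = 0) * band a (a * jj p)) + (\<Sum>p\<in>mu. of_bool (dg p = 0) * band a (lv a h p))"
    by (simp add: P G sum_subtractf right_diff_distrib)
  finally show ?thesis
    unfolding sum_indicators_band[OF assms(2)] near_flat[OF assms] by linarith
qed

lemma near_count:
  "(\<Sum>p\<in>S. \<Sum>q\<in>S. near p q) = (\<Sum>d\<in>T. int (card {p\<in>S. dg p = d}) ^ 2 - int (card {p\<in>S. dg p = d}) * int (card {p\<in>S. dg p = d + 1}))"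
  if "finite S" "finite T" "dg ` S \<subseteq> T"
proof -
  have c: "int (card {p\<in>S. dg p = d}) = (\<Sum>p\<in>S. of_bool (dg p = d))" for d
    using that by (simp add: of_bool_def sum.If_cases Int_def)
  have "(\<Sum>d\<in>T. int (card {p\<in>S. dg p = d}) ^ 2 - int (card {p\<in>S. dg p = d}) * int (card {p\<in>S. dg p = d + 1}))
     = (\<Sum>d\<in>T. \<Sum>q\<in>S. \<Sum>p\<in>S. of_bool (dg q = d) * (of_bool (dg p = d) - of_bool (dg p = d + 1)))"
    unfolding c power2_eq_square right_diff_distrib[symmetric] sum_subtractf[symmetric] by (simp only: sum_product)
  also have "\<dots> = (\<Sum>q\<in>S. \<Sum>p\<in>S. \<Sum>d\<in>T. of_bool (dg q = d) * (of_bool (dg p = d) - of_bool (dg p = d + 1)))"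
    unfolding sum.swap[of _ _ T] ..
  also have "\<dots> = (\<Sum>q\<in>S. \<Sum>p\<in>S. near p q)"
  proof (intro sum.cong refl)
    fix p q assume "q \<in> S"
    have "(\<Sum>d\<in>T. of_bool (dg q = d) * (of_bool (dg p = d) - of_bool (dg p = d + 1))) = (\<Sum>d\<in>T. if d = dg q then near p q else 0)"
      by (intro sum.cong) (auto simp: near_def)
    thus "(\<Sum>d\<in>T. of_bool (dg q = d) * (of_bool (dg p = d) - of_bool (dg p = d + 1))) = near p q"
      using that \<open>q \<in> S\<close> by (auto simp: sum.delta)
  qed
  also have "\<dots> = (\<Sum>p\<in>S. \<Sum>q\<in>S. near p q)" by (rule sum.swap)
  finally show ?thesis by (rule sym)
qed

text \<open>Twice the form is the sum of the squares of the differences of neighbouring w_d; the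
  range starts one diagonal early so that a shift of the index does not change the sum of squares.
  The square at the last occupied diagonal is positive, since w drops to 0 there.\<close>

lemma near_positive:
  assumes "finite S" "S \<noteq> {}"
  shows "(\<Sum>p\<in>S. \<Sum>q\<in>S. near p q) \<ge> 1"
proof -
  define w where "w d = int (card {p\<in>S. dg p = d})" for d
  define A B where "A = Min (dg ` S)" and "B = Max (dg ` S)"
  have AB: "A \<le> dg p" "dg p \<le> B" if "p \<in> S" for p unfolding A_def B_def using assms that by auto
  have B: "B \<in> dg ` S" unfolding B_def using assms by simp
  have z: "w d = 0" if "d < A \<or> d > B" for d
  proof -
    have e: "{p\<in>S. dg p = d} = {}" using AB that by fastforce
    show ?thesis unfolding w_def e by simp
  qed
  have wB: "w B > 0" unfolding w_def using B assms by (auto simp: card_gt_0_iff)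
  have AB': "A \<le> B" using AB assms by fastforce
  have "dg ` S \<subseteq> {A-1..B}" using AB by fastforce
  from near_count[OF assms(1) _ this]
  have q: "(\<Sum>p\<in>S. \<Sum>q\<in>S. near p q) = (\<Sum>d\<in>{A-1..B}. w d ^ 2 - w d * w (d + 1))"
    unfolding w_def by simp
  have "(\<Sum>d\<in>{A-1..B}. w (d + 1) ^ 2) = (\<Sum>d\<in>{A..B+1}. w d ^ 2)"
    by (rule sum.reindex_bij_witness[of _ "\<lambda>d. d - 1" "\<lambda>d. d + 1"]) auto
  also have "\<dots> = (\<Sum>d\<in>{A..B}. w d ^ 2)"
    using z AB' by (intro sum.mono_neutral_right) (auto simp: not_le)
  also have "\<dots> = (\<Sum>d\<in>{A-1..B}. w d ^ 2)"
    using z by (intro sum.mono_neutral_left) (auto simp: not_le)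
  finally have sh: "(\<Sum>d\<in>{A-1..B}. w (d + 1) ^ 2) = (\<Sum>d\<in>{A-1..B}. w d ^ 2)" .
  have "2 * (\<Sum>d\<in>{A-1..B}. w d ^ 2 - w d * w (d + 1)) = (\<Sum>d\<in>{A-1..B}. w d ^ 2) + (\<Sum>d\<in>{A-1..B}. w (d+1) ^ 2) - (\<Sum>d\<in>{A-1..B}. 2 * w d * w (d + 1))"
    unfolding sh by (simp add: sum_subtractf sum_distrib_left algebra_simps)
  also have "\<dots> = (\<Sum>d\<in>{A-1..B}. (w d - w (d + 1)) ^ 2)"
    by (simp add: power2_diff sum.distrib sum_subtractf)
  also have "\<dots> \<ge> (w B - w (B + 1)) ^ 2"
    by (rule member_le_sum) (use AB' in auto)
  moreover have "(w B - w (B + 1)) ^ 2 > 0" using wB z by simp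
  ultimately show ?thesis unfolding q by linarith
qed

lemma near_groups_positive:
  assumes "finite S" "S \<noteq> {}"
  shows "(\<Sum>p\<in>S. \<Sum>q\<in>S. near p q * of_bool (b p = b q)) \<ge> 1"
proof -
  let ?f = "\<lambda>t. \<Sum>p\<in>{p\<in>S. b p = t}. \<Sum>q\<in>{p\<in>S. b p = t}. near p q"
  have "(\<Sum>p\<in>S. \<Sum>q\<in>S. near p q * of_bool (b p = b q)) = (\<Sum>t\<in>b ` S. \<Sum>p\<in>{p\<in>S. b p = t}. \<Sum>q\<in>S. near p q * of_bool (b p = b q))"
    by (rule sum.image_gen[OF assms(1)])
  also have "\<dots> = (\<Sum>t\<in>b ` S. ?f t)"
  proof (rule sum.cong[OF refl], rule sum.cong[OF refl])
    fix t p assume "p \<in> {p\<in>S. b p = t}"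
    thus "(\<Sum>q\<in>S. near p q * of_bool (b p = b q)) = (\<Sum>q\<in>{p\<in>S. b p = t}. near p q)"
      using assms by (simp add: sum.inter_filter[symmetric] of_bool_def if_distrib eq_commute cong: if_cong)
  qed
  finally have e: "(\<Sum>p\<in>S. \<Sum>q\<in>S. near p q * of_bool (b p = b q)) = (\<Sum>t\<in>b ` S. ?f t)" .
  have "?f t \<ge> 1" if "t \<in> b ` S" for t
    by (rule near_positive) (use assms that in auto)
  hence "(\<Sum>t\<in>b ` S. 1) \<le> (\<Sum>t\<in>b ` S. ?f t)" by (intro sum_mono)
  moreover have "int (card (b ` S)) \<ge> 1" using assms by (simp add: Suc_le_eq card_gt_0_iff)
  ultimately show ?thesis unfolding e by simp
qed

context boxes
begin

text \<open>Removing a bottom box does not change this coefficient: the corner value at the box is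
  1, the one below it is 0, and 1 is subtracted at y = 0.\<close>

lemma vcoef_zero_weight:
  assumes "valid mu h"
  shows "vcoef mu a h 0 0 0 = 0"
  using assms
proof (induction "\<Sum>p\<in>mu. h p" arbitrary: h rule: less_induct)
  case (less h)
  show ?case
  proof (cases "\<exists>p\<in>mu. h p > 0")
    case False
    have "h p = 0" for p
    proof (cases "p \<in> mu")
      case True thus ?thesis using False by auto
    next
      case F: False thus ?thesis using less.prems unfolding valid_def by blast
    qed
    hence "h = (\<lambda>_. 0)" by auto
    thus ?thesis by (simp add: vcoef_empty)
  next
    case True
    then obtain d n where b: "bottom h d n" using bottom_exists by blast
    then obtain p where p: "p \<in> removable mu a h d n" unfolding removable_bottom[OF less.prems b] bottom_deep by blast
    let ?h = "h(p := h p - 1)"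
    note A = addable_of_removable[OF p less.prems]
    have pm: "p \<in> mu" "lv a ?h p = n + 1" "dg p = d" "h p > 0" using A(1) p by (auto simp: addable_def removable_def)
    have "(\<Sum>q\<in>mu. ?h q) < (\<Sum>q\<in>mu. h q)"
      using fin_mu pm by (intro sum_strict_mono_ex1) (auto intro!: bexI[of _ p])
    from less.hyps[OF this A(2)] have "vcoef mu a ?h 0 0 0 = 0" .
    moreover have "corner mu a ?h d (n - a - 1) (jj p - 1) = 0"
      by (rule corner_under_bottom(2)[OF less.prems b p refl])
    moreover have "corner mu a ?h d n (jj p) = 1" by (rule corner_addable[OF part A(2,1)])
    ultimately show ?thesis
      using vcoef_add_box[OF fin_mu pm(1,2,3) refl a_pos, of 0] unfolding A(3) by simp
  qed
qed

end

lemma is_partition_steps: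
  assumes fin: "finite S" and s1: "\<And>i j. (Suc i, j) \<in> S \<Longrightarrow> (i, j) \<in> S" and s2: "\<And>i j. (i, Suc j) \<in> S \<Longrightarrow> (i, j) \<in> S"
  shows "is_partition S"
proof -
  have 1: "(i + k, j) \<in> S \<Longrightarrow> (i, j) \<in> S" for i j k by (induction k) (auto dest: s1)
  have 2: "(i, j + k) \<in> S \<Longrightarrow> (i, j) \<in> S" for i j k by (induction k) (auto dest: s2)
  show ?thesis unfolding is_partition_def
  proof (intro conjI fin allI impI)
    fix k1 k2 j1 j2 assume "(k1, k2) \<in> S \<and> j1 \<le> k1 \<and> j2 \<le> k2"
    thus "(j1, j2) \<in> S" using 1[of j1 "k1 - j1" k2] 2[of j1 j2 "k2 - j2"] by auto
  qed
qed

lemma valid_outside: "valid mu h \<Longrightarrow> p \<notin> mu \<Longrightarrow> h p = 0"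
  unfolding valid_def by blast

section \<open>Classes whose low columns are rigid\<close>

context boxes
begin

definition epsR :: "'k set" where "epsR = (\<lambda>x. eps * x) ` R"

lemma epsR_mult: "x \<in> epsR \<Longrightarrow> y \<in> R \<Longrightarrow> x * y \<in> epsR"
  unfolding epsR_def by (auto simp: ac_simps intro: mult_R)

lemma epsR_closed:
  "0 \<in> epsR" "x \<in> epsR \<Longrightarrow> y \<in> epsR \<Longrightarrow> x + y \<in> epsR" "x \<in> epsR \<Longrightarrow> y \<in> epsR \<Longrightarrow> x - y \<in> epsR"
proof -
  show "0 \<in> epsR" unfolding epsR_def using zero_R by force
  assume "x \<in> epsR" "y \<in> epsR"
  then obtain u v where "x = eps * u" "y = eps * v" "u \<in> R" "v \<in> R" unfolding epsR_def by auto
  hence "x + y = eps * (u + v)" "x - y = eps * (u - v)" "u + v \<in> R" "u - v \<in> R"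
    by (auto intro: add_R diff_R simp: algebra_simps)
  thus "x + y \<in> epsR" "x - y \<in> epsR" unfolding epsR_def by blast+
qed

lemma zprod_pos: "finite {l. s l \<noteq> 0} \<Longrightarrow> zprod pos s = zprod of_int s * eps powi total s"
proof -
  assume fin: "finite {l. s l \<noteq> 0}"
  have "(\<Prod>l\<in>A. eps powi s l) = eps powi (\<Sum>l\<in>A. s l)" if "finite A" for A
    using that eps_nz by (induction A) (auto simp: power_int_add)
  from this[OF fin] show ?thesis
    unfolding zprod_def total_def pos_def by (simp add: power_int_mult_distrib prod.distrib)
qed

lemma zprod_int_R: "s 0 = 0 \<Longrightarrow> zprod of_int s \<in> R"
  unfolding zprod_def
proof (intro prod_R)
  fix l assume "s 0 = 0" "l \<in> {l. s l \<noteq> 0}"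
  hence "l \<noteq> 0" by auto
  thus "of_int l powi s l \<in> R"
    using inverse_int_R by (auto simp: power_int_def intro!: power_R of_int_R)
qed

lemma sum_over_subset_restrict:
  assumes "lam \<subseteq> mu"
  shows "(\<Sum>p\<in>mu. \<Sum>q\<in>mu. (F p q :: int)) - (\<Sum>p\<in>lam. \<Sum>q\<in>lam. F p q) = (\<Sum>p\<in>mu. \<Sum>q\<in>mu. if p \<in> lam \<and> q \<in> lam then 0 else F p q)"
proof -
  have r: "sum f lam = (\<Sum>p\<in>mu. if p \<in> lam then f p else 0)" for f :: "nat \<times> nat \<Rightarrow> int"
    using sum.inter_restrict[OF fin_mu, of f lam] assms by (simp add: Int_absorb1)
  have "(\<Sum>p\<in>lam. \<Sum>q\<in>lam. F p q) = (\<Sum>p\<in>mu. if p \<in> lam then \<Sum>q\<in>mu. (if q \<in> lam then F p q else 0) else 0)"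
    unfolding r ..
  also have "\<dots> = (\<Sum>p\<in>mu. \<Sum>q\<in>mu. if p \<in> lam \<and> q \<in> lam then F p q else 0)"
    by (intro sum.cong) auto
  finally show ?thesis by (auto simp: sum_subtractf[symmetric] intro!: sum.cong)
qed

text \<open>A class in which the low columns (those below level \<open>n\<^sub>0\<close>) are separated from the other ones
  by more than \<open>a\<close> and pairwise congruent modulo \<open>a + 1\<close>: its low columns are rigid, so its sums
  are those of the partition of high columns up to a positive power of \<open>eps\<close>.\<close>

context
  fixes X :: "(int \<times> int) multiset" and n0 :: int and h0 :: cfg
  assumes n0: "n0 \<le> 0" and low_ne: "\<exists>v\<in>#X. snd v < n0"
    and sep: "\<And>v. v \<in># X \<Longrightarrow> snd v < n0 \<Longrightarrow> snd v \<le> n0 - a - 2"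
    and congruent: "\<And>v w. v \<in># X \<Longrightarrow> snd v < n0 \<Longrightarrow> w \<in># X \<Longrightarrow> snd w < n0 \<Longrightarrow> (a + 1) dvd (snd v - snd w)"
    and h0: "h0 \<in> configs X"
begin

text \<open>The high columns are read off from the one member \<open>h0\<close>; by
  \<open>low_iff\<close> every member of the class has the same ones.\<close>

definition lam :: "(nat \<times> nat) set" where "lam = {p\<in>mu. n0 \<le> lv a h0 p}"

definition high_part :: "cfg \<Rightarrow> cfg" where "high_part h = (\<lambda>p. if p \<in> lam then h p else 0)"

definition glue :: "cfg \<Rightarrow> cfg" where "glue h' = (\<lambda>p. if p \<in> lam then h' p else h0 p)"

lemma lv_in: "h \<in> configs X \<Longrightarrow> p \<in> mu \<Longrightarrow> (dg p, lv a h p) \<in># X"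
  using fin_mu by (auto simp: configs_def sig_def)

lemma low_sep: "h \<in> configs X \<Longrightarrow> p \<in> mu \<Longrightarrow> lv a h p < n0 \<Longrightarrow> lv a h p \<le> n0 - a - 2"
  using sep[OF lv_in] by simp

lemma low_cong: "h \<in> configs X \<Longrightarrow> p \<in> mu \<Longrightarrow> q \<in> mu \<Longrightarrow> lv a h p < n0 \<Longrightarrow> lv a h q < n0 \<Longrightarrow> (a + 1) dvd (lv a h p - lv a h q)"
  using congruent[OF lv_in _ lv_in] by simp

lemma valid_step:
  assumes "valid mu h"
  shows "(Suc i, j) \<in> mu \<Longrightarrow> lv a h (Suc i, j) \<le> lv a h (i, j)" "(i, Suc j) \<in> mu \<Longrightarrow> lv a h (i, Suc j) \<le> lv a h (i, j) + a"
  using assms unfolding valid_def lv_def jj_def by (auto simp: algebra_simps)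

text \<open>One diagonal step raises the level by at most a, so the separation keeps the successor
  low. Then the difference is a multiple of a + 1, and a positive multiple would be too
  large.\<close>

lemma low_diag_step:
  assumes "h \<in> configs X" "(Suc i, Suc j) \<in> mu" "lv a h (i, j) < n0"
  shows "lv a h (Suc i, Suc j) \<le> lv a h (i, j)"
proof -
  have m: "(Suc i, j) \<in> mu" "(i, j) \<in> mu" using assms(2) part unfolding is_partition_def by (meson le_SucI le_refl)+
  have v: "valid mu h" using assms(1) by (simp add: configs_def)
  have le: "lv a h (Suc i, Suc j) \<le> lv a h (i, j) + a"
    using valid_step(1)[OF v m(1)] valid_step(2)[OF v assms(2)] by linarith
  hence "lv a h (Suc i, Suc j) < n0" using low_sep[OF assms(1) m(2) assms(3)] by linarith
  hence "(a + 1) dvd (lv a h (Suc i, Suc j) - lv a h (i, j))" using low_cong assms m by blast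
  thus ?thesis using le zdvd_imp_le[of "a + 1" "lv a h (Suc i, Suc j) - lv a h (i, j)"] by fastforce
qed

lemma low_diag:
  assumes "h \<in> configs X"
  shows "(i + k, j + k) \<in> mu \<Longrightarrow> lv a h (i, j) < n0 \<Longrightarrow> lv a h (i + k, j + k) \<le> lv a h (i, j)"
proof (induction k)
  case (Suc k)
  have "(i + k, j + k) \<in> mu" using Suc.prems(1) part unfolding is_partition_def by (metis add_Suc_right le_SucI le_refl)
  thus ?case using Suc low_diag_step[OF assms, of "i + k" "j + k"] by force
qed simp

lemma clip_mono:
  assumes "h \<in> configs X" "p \<in> mu" "q \<in> mu" "dg p = dg q" "jj p \<le> jj q"
  shows "min (lv a h q) n0 \<le> min (lv a h p) n0"
proof -
  obtain i j where p: "p = (i, j)" by (cases p)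
  define k where "k = snd q - snd p"
  have "q = (i + k, j + k)" using assms(4,5) unfolding k_def p by (cases q) (auto simp: dg_def jj_def)
  thus ?thesis using low_diag[OF assms(1), of i k j] assms(3) p by (cases "lv a h p < n0") auto
qed

text \<open>Levels cut off at \<open>n0\<close> decrease along each diagonal, so the columns below a
  given level form a final segment of the diagonal. Its size is prescribed by the class, which
  forbids a proper inclusion of two such segments.\<close>

lemma clip_le:
  assumes h: "h \<in> configs X" "h' \<in> configs X" and p: "p \<in> mu"
  shows "min (lv a h p) n0 \<le> min (lv a h' p) n0"
proof (rule ccontr)
  define b where "b = min (lv a h p) n0"
  assume "\<not> ?thesis"
  hence lt: "min (lv a h' p) n0 < b" unfolding b_def by linarith
  have cnt: "card {q\<in>mu. dg q = dg p \<and> lv a h q < b} = card {q\<in>mu. dg q = dg p \<and> lv a h' q < b}"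
    using card_sig[of "\<lambda>d n. d = dg p \<and> n < b" h] card_sig[of "\<lambda>d n. d = dg p \<and> n < b" h'] h
    by (simp add: configs_def)
  have b0: "b \<le> n0" by (simp add: b_def)
  have "{q\<in>mu. dg q = dg p \<and> lv a h q < b} \<subset> {q\<in>mu. dg q = dg p \<and> lv a h' q < b}"
  proof
    show "{q\<in>mu. dg q = dg p \<and> lv a h q < b} \<subseteq> {q\<in>mu. dg q = dg p \<and> lv a h' q < b}"
    proof
      fix q assume "q \<in> {q\<in>mu. dg q = dg p \<and> lv a h q < b}"
      hence q: "q \<in> mu" "dg q = dg p" "lv a h q < b" by auto
      have "jj p \<le> jj q"
      proof (rule ccontr)
        assume "\<not> jj p \<le> jj q"
        hence "b \<le> min (lv a h q) n0" using clip_mono[OF h(1) q(1) p q(2)] by (simp add: b_def)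
        thus False using q by linarith
      qed
      hence "min (lv a h' q) n0 < b" using clip_mono[OF h(2) p q(1)] q(2) lt by linarith
      thus "q \<in> {q\<in>mu. dg q = dg p \<and> lv a h' q < b}" using q b0 by auto
    qed
    have "lv a h' p < b" using lt b0 by linarith
    thus "{q\<in>mu. dg q = dg p \<and> lv a h q < b} \<noteq> {q\<in>mu. dg q = dg p \<and> lv a h' q < b}"
      using p unfolding b_def by force
  qed
  from psubset_card_mono[OF _ this] cnt fin_mu show False by simp
qed

lemma clip_eq: "h \<in> configs X \<Longrightarrow> p \<in> mu \<Longrightarrow> min (lv a h p) n0 = min (lv a h0 p) n0"
  using clip_le h0 by (metis order_antisym)

lemma low_iff: "h \<in> configs X \<Longrightarrow> p \<in> mu \<Longrightarrow> p \<in> lam \<longleftrightarrow> n0 \<le> lv a h p"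
  using clip_eq[of h p] unfolding lam_def by auto

lemma low_rigid:
  assumes "h \<in> configs X" "p \<notin> lam"
  shows "h p = h0 p"
proof (cases "p \<in> mu")
  case True
  have "lv a h p = lv a h0 p" using clip_eq[OF assms(1) True] assms low_iff[OF assms(1) True] low_iff[OF h0 True] by auto
  thus ?thesis by (simp add: lv_def)
next
  case False
  thus ?thesis using valid_outside[of mu h p] valid_outside[of mu h0 p] assms(1) h0 by (simp add: configs_def)
qed

lemma lam_sub: "lam \<subseteq> mu" by (auto simp: lam_def)

lemma lam_partition: "is_partition lam"
proof (rule is_partition_steps)
  show "finite lam" using fin_mu lam_sub finite_subset by blast
  have v: "valid mu h0" using h0 by (simp add: configs_def)
  show "(i, j) \<in> lam" if m: "(Suc i, j) \<in> lam" for i j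
  proof -
    have "(Suc i, j) \<in> mu" "n0 \<le> lv a h0 (Suc i, j)" using m by (auto simp: lam_def)
    moreover have "(i, j) \<in> mu" using calculation part unfolding is_partition_def by (meson le_SucI le_refl)
    ultimately show ?thesis using valid_step(1)[OF v, of i j] by (auto simp: lam_def)
  qed
  show "(i, j) \<in> lam" if m: "(i, Suc j) \<in> lam" for i j
  proof -
    have "(i, Suc j) \<in> mu" "n0 \<le> lv a h0 (i, Suc j)" using m by (auto simp: lam_def)
    moreover have "(i, j) \<in> mu" using calculation part unfolding is_partition_def by (meson le_SucI le_refl)
    ultimately show ?thesis using valid_step(2)[OF v, of i j] low_sep[OF h0, of "(i, j)"] by (fastforce simp: lam_def)
  qed
qed

lemma lam_step:
  "(i, j) \<in> mu \<Longrightarrow> (i, j) \<notin> lam \<Longrightarrow> (Suc i, j) \<notin> lam" "(i, j) \<in> mu \<Longrightarrow> (i, j) \<notin> lam \<Longrightarrow> (i, Suc j) \<notin> lam"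
  using lam_partition unfolding is_partition_def by (meson le_SucI le_refl)+

interpretation L: boxes R eps lam a
  by unfold_locales (use lam_partition a_pos in auto)

definition XH :: "(int \<times> int) multiset" where "XH = filter_mset (\<lambda>v. n0 \<le> snd v) X"

lemma sig_split:
  assumes "\<And>p. p \<in> mu \<Longrightarrow> p \<in> lam \<longleftrightarrow> n0 \<le> lv a h p"
  shows "filter_mset (\<lambda>v. n0 \<le> snd v) (sig h) = image_mset (\<lambda>p. (dg p, lv a h p)) (mset_set lam)"
    "filter_mset (\<lambda>v. \<not> n0 \<le> snd v) (sig h) = image_mset (\<lambda>p. (dg p, lv a h p)) (mset_set (mu - lam))"
proof -
  have "{p\<in>mu. n0 \<le> lv a h p} = lam" "{p\<in>mu. \<not> n0 \<le> lv a h p} = mu - lam" using assms lam_sub by auto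
  thus "filter_mset (\<lambda>v. n0 \<le> snd v) (sig h) = image_mset (\<lambda>p. (dg p, lv a h p)) (mset_set lam)"
    "filter_mset (\<lambda>v. \<not> n0 \<le> snd v) (sig h) = image_mset (\<lambda>p. (dg p, lv a h p)) (mset_set (mu - lam))"
    unfolding sig_def filter_mset_image_mset by (simp_all add: filter_mset_mset_set fin_mu)
qed

lemma image_mset_lv_cong:
  "(\<And>p. p \<in> S \<Longrightarrow> h p = h' p) \<Longrightarrow> image_mset (\<lambda>p. (dg p, lv a h p)) (mset_set S) = image_mset (\<lambda>p. (dg p, lv a h' p)) (mset_set S)"
  by (cases "finite S") (auto simp: lv_def intro!: image_mset_cong)

lemma high_part_configs:
  assumes "h \<in> configs X"
  shows "high_part h \<in> L.configs XH"
proof -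
  have v: "valid mu h" "sig h = X" using assms by (auto simp: configs_def)
  have "valid lam (high_part h)"
    unfolding valid_def
  proof (intro conjI allI impI)
    fix i j
    show "p \<notin> lam \<Longrightarrow> high_part h p = 0" for p by (simp add: high_part_def)
    assume m: "(Suc i, j) \<in> lam"
    hence "(i, j) \<in> lam" "(Suc i, j) \<in> mu" using lam_partition lam_sub unfolding is_partition_def by (meson le_SucI le_refl, blast)
    thus "high_part h (i, j) \<le> high_part h (Suc i, j)" using m v(1) by (simp add: high_part_def valid_def)
  next
    fix i j
    assume m: "(i, Suc j) \<in> lam"
    hence "(i, j) \<in> lam" "(i, Suc j) \<in> mu" using lam_partition lam_sub unfolding is_partition_def by (meson le_SucI le_refl, blast)
    thus "high_part h (i, j) \<le> high_part h (i, Suc j)" using m v(1) by (simp add: high_part_def valid_def)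
  qed
  moreover have "L.sig (high_part h) = XH"
  proof -
    have "XH = image_mset (\<lambda>p. (dg p, lv a h p)) (mset_set lam)"
      using sig_split(1)[OF low_iff[OF assms]] v(2) by (simp add: XH_def)
    also have "\<dots> = L.sig (high_part h)"
      unfolding L.sig_def by (rule image_mset_lv_cong) (simp add: high_part_def)
    finally show ?thesis ..
  qed
  ultimately show ?thesis by (simp add: L.configs_def)
qed

lemma glue_configs:
  assumes "h' \<in> L.configs XH"
  shows "glue h' \<in> configs X"
proof -
  have v: "valid lam h'" "L.sig h' = XH" using assms by (auto simp: L.configs_def)
  have v0: "valid mu h0" "sig h0 = X" using h0 by (auto simp: configs_def)
  have hi: "n0 \<le> lv a h' p" if "p \<in> lam" for p
  proof -
    have "(dg p, lv a h' p) \<in># XH" unfolding v(2)[symmetric] L.sig_def using that L.fin_mu by auto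
    thus ?thesis by (simp add: XH_def)
  qed
  have lo: "lv a h0 p \<le> n0 - a - 2" if "p \<in> mu" "p \<notin> lam" for p
    using low_sep[OF h0 that(1)] that by (auto simp: lam_def)
  have "valid mu (glue h')"
    unfolding valid_def
  proof (intro conjI allI impI)
    fix i j
    show "p \<notin> mu \<Longrightarrow> glue h' p = 0" for p
      using valid_outside[OF v0(1)] lam_sub unfolding glue_def by auto
    assume m: "(Suc i, j) \<in> mu"
    have ij: "(i, j) \<in> mu" using m part unfolding is_partition_def by (meson le_SucI le_refl)
    consider "(Suc i, j) \<in> lam" "(i, j) \<in> lam" | "(Suc i, j) \<notin> lam" "(i, j) \<in> lam" | "(Suc i, j) \<notin> lam" "(i, j) \<notin> lam"
      using lam_step(1)[OF ij] by blast
    thus "glue h' (i, j) \<le> glue h' (Suc i, j)"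
    proof cases
      case 1 thus ?thesis using v(1) by (simp add: glue_def valid_def)
    next
      case 2 thus ?thesis using hi[of "(i, j)"] lo[of "(Suc i, j)"] m a_pos by (simp add: glue_def lv_def jj_def)
    next
      case 3 thus ?thesis using v0(1) m by (simp add: glue_def valid_def)
    qed
  next
    fix i j
    assume m: "(i, Suc j) \<in> mu"
    have ij: "(i, j) \<in> mu" using m part unfolding is_partition_def by (meson le_SucI le_refl)
    consider "(i, Suc j) \<in> lam" "(i, j) \<in> lam" | "(i, Suc j) \<notin> lam" "(i, j) \<in> lam" | "(i, Suc j) \<notin> lam" "(i, j) \<notin> lam"
      using lam_step(2)[OF ij] by blast
    thus "glue h' (i, j) \<le> glue h' (i, Suc j)"
    proof cases
      case 1 thus ?thesis using v(1) by (simp add: glue_def valid_def)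
    next
      case 2 thus ?thesis using hi[of "(i, j)"] lo[of "(i, Suc j)"] m a_pos by (simp add: glue_def lv_def jj_def algebra_simps)
    next
      case 3 thus ?thesis using v0(1) m by (simp add: glue_def valid_def)
    qed
  qed
  moreover have "sig (glue h') = X"
  proof -
    have split: "p \<in> lam \<longleftrightarrow> n0 \<le> lv a (glue h') p" if "p \<in> mu" for p
      using hi[of p] lo[OF that] a_pos by (cases "p \<in> lam") (auto simp: glue_def lv_def)
    have "filter_mset (\<lambda>v. n0 \<le> snd v) (sig (glue h')) = L.sig h'"
    proof -
      have "filter_mset (\<lambda>v. n0 \<le> snd v) (sig (glue h')) = image_mset (\<lambda>p. (dg p, lv a (glue h') p)) (mset_set lam)"
        using sig_split(1) split by blast
      also have "\<dots> = L.sig h'" unfolding L.sig_def by (rule image_mset_lv_cong) (simp add: glue_def)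
      finally show ?thesis .
    qed
    moreover have "filter_mset (\<lambda>v. \<not> n0 \<le> snd v) (sig (glue h')) = filter_mset (\<lambda>v. \<not> n0 \<le> snd v) (sig h0)"
    proof -
      have "filter_mset (\<lambda>v. \<not> n0 \<le> snd v) (sig (glue h')) = image_mset (\<lambda>p. (dg p, lv a (glue h') p)) (mset_set (mu - lam))"
        using sig_split(2) split by blast
      also have "\<dots> = image_mset (\<lambda>p. (dg p, lv a h0 p)) (mset_set (mu - lam))"
        by (rule image_mset_lv_cong) (simp add: glue_def)
      also have "\<dots> = filter_mset (\<lambda>v. \<not> n0 \<le> snd v) (sig h0)"
        using sig_split(2) low_iff[OF h0] by metis
      finally show ?thesis .
    qed
    ultimately show ?thesis using v(2) v0(2) unfolding XH_def by (metis multiset_partition)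
  qed
  ultimately show ?thesis by (simp add: configs_def)
qed

lemma bij_high_part: "bij_betw high_part (configs X) (L.configs XH)"
proof (rule bij_betw_byWitness[of _ glue])
  show "\<forall>h\<in>configs X. glue (high_part h) = h"
    using low_rigid by (auto simp: glue_def high_part_def)
  show "\<forall>h\<in>L.configs XH. high_part (glue h) = h"
  proof
    fix h assume "h \<in> L.configs XH"
    hence "p \<notin> lam \<Longrightarrow> h p = 0" for p unfolding L.configs_def valid_def by blast
    thus "high_part (glue h) = h" by (auto simp: glue_def high_part_def)
  qed
qed (use high_part_configs glue_configs in auto)

text \<open>For a high and a low column the two comparisons, with 0 and with a, are decided by the
  separation alone. Pairs of low columns are fixed by rigidity, so what the low columns contribute
  is the same for the whole class.\<close>

lemma rest_coef:
  assumes "h \<in> configs X"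
  shows "vcoef mu a h 0 0 y - vcoef lam a (high_part h) 0 0 y = vcoef mu a h0 0 0 y - vcoef lam a (high_part h0) 0 0 y"
proof -
  let ?P = "\<lambda>h p q. pair_coef a 0 0 y (dg p - dg q) (jj p - jj q) (lv a h p - lv a h q)"
  let ?F = "\<lambda>h p. frame_coef a 0 0 y (dg p) (jj p) (lv a h p)"
  have e: "vcoef mu a h 0 0 y - vcoef lam a (high_part h) 0 0 y
      = (\<Sum>p\<in>mu. \<Sum>q\<in>mu. if p \<in> lam \<and> q \<in> lam then 0 else ?P h p q) - (\<Sum>p\<in>mu - lam. ?F h p)" for h
  proof -
    have l: "lv a (high_part h) p = lv a h p" if "p \<in> lam" for p using that by (simp add: lv_def high_part_def)
    have "vcoef lam a (high_part h) 0 0 y = (\<Sum>p\<in>lam. \<Sum>q\<in>lam. ?P h p q) - (\<Sum>p\<in>lam. ?F h p)"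
      unfolding vcoef_def by (intro arg_cong2[of _ _ _ _ "(-)"] sum.cong refl) (simp_all add: l)
    thus ?thesis
      unfolding vcoef_def sum_over_subset_restrict[OF lam_sub, symmetric] sum_diff[OF fin_mu lam_sub] by simp
  qed
  have "?P h p q = ?P h0 p q" if "p \<in> mu" "q \<in> mu" "\<not> (p \<in> lam \<and> q \<in> lam)" for p q
  proof -
    have lo: "lv a h p = lv a h0 p \<and> lv a h0 p \<le> n0 - a - 2" if "p \<in> mu" "p \<notin> lam" for p
      using low_rigid[OF assms that(2)] low_sep[OF h0 that(1)] low_iff[OF h0 that(1)] that by (auto simp: lv_def)
    have hi: "n0 \<le> lv a h p" "n0 \<le> lv a h0 p" if "p \<in> lam" for p
      using low_iff[OF assms, of p] low_iff[OF h0, of p] lam_sub that by blast+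
    have "(0 < lv a h p - lv a h q) = (0 < lv a h0 p - lv a h0 q) \<and> (0 < lv a h p - lv a h q - a) = (0 < lv a h0 p - lv a h0 q - a)"
    proof (cases "p \<in> lam")
      case True
      hence "q \<notin> lam" using that by blast
      thus ?thesis using lo[OF \<open>q \<in> mu\<close>] hi[OF True] a_pos by auto
    next
      case False
      show ?thesis
      proof (cases "q \<in> lam")
        case True thus ?thesis using lo[OF \<open>p \<in> mu\<close> False] hi[OF True] a_pos by auto
      next
        case F: False thus ?thesis using lo[OF \<open>p \<in> mu\<close> False] lo[OF \<open>q \<in> mu\<close> F] by auto
      qed
    qed
    thus ?thesis unfolding pair_coef_def step_ind_def by simp
  qed
  moreover have "?F h p = ?F h0 p" if "p \<in> mu - lam" for p
    using low_rigid[OF assms] that by (simp add: lv_def)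
  ultimately show ?thesis unfolding e
    by (intro arg_cong2[of _ _ _ _ "(-)"] sum.cong refl) auto
qed

definition rest :: "int \<Rightarrow> int" where "rest y = vcoef mu a h0 0 0 y - vcoef lam a (high_part h0) 0 0 y"

lemma rest_window: "{y. rest y \<noteq> 0} \<subseteq> window mu \<union> window lam"
proof
  fix y assume "y \<in> {y. rest y \<noteq> 0}"
  hence "vcoef mu a h0 0 0 y \<noteq> 0 \<or> vcoef lam a (high_part h0) 0 0 y \<noteq> 0" by (auto simp: rest_def)
  thus "y \<in> window mu \<union> window lam" using vcoef_window by blast
qed

lemma finite_rest: "finite {y. rest y \<noteq> 0}"
  by (rule finite_subset[OF rest_window]) (simp add: window(1) fin_mu L.fin_mu)

lemma rest_zero: "rest 0 = 0"
  using vcoef_zero_weight[of h0] L.vcoef_zero_weight[of "high_part h0"] h0 high_part_configs[OF h0]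
  by (simp add: rest_def configs_def L.configs_def)

text \<open>Mixed pairs are more than a apart and miss the band in both orders. Between low columns
  the congruence turns the band into equality of levels, which leaves a positive form for each
  level. Low levels are below -a, so the frame term does not contribute.\<close>

lemma rest_order: "total rest \<le> -1"
proof -
  let ?b = "lv a h0"
  have l: "lv a (high_part h0) p = ?b p" if "p \<in> lam" for p using that by (simp add: lv_def high_part_def)
  let ?S = "window mu \<union> window lam"
  have fin: "finite ?S" using window(1) fin_mu L.fin_mu by auto
  have "total rest = (\<Sum>y\<in>?S. rest y)"
    by (rule total_window[OF fin rest_window])
  also have "\<dots> = (\<Sum>y\<in>?S. vcoef mu a h0 0 0 y) - (\<Sum>y\<in>?S. vcoef lam a (high_part h0) 0 0 y)"
    unfolding rest_def by (rule sum_subtractf)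
  also have "(\<Sum>y\<in>?S. vcoef mu a h0 0 0 y) = total (vcoef mu a h0 0 0)"
    by (rule total_window[OF fin le_supI1[OF vcoef_window], symmetric])
  also have "(\<Sum>y\<in>?S. vcoef lam a (high_part h0) 0 0 y) = total (vcoef lam a (high_part h0) 0 0)"
    by (rule total_window[OF fin le_supI2[OF vcoef_window], symmetric])
  finally have "- total rest = - total (vcoef mu a h0 0 0) - - total (vcoef lam a (high_part h0) 0 0)" by simp
  also have "\<dots> = ((\<Sum>p\<in>mu. \<Sum>q\<in>mu. near p q * band a (?b p - ?b q)) - (\<Sum>p\<in>lam. \<Sum>q\<in>lam. near p q * band a (?b p - ?b q)))
     - ((\<Sum>p\<in>mu. of_bool (dg p = 0) * band a (?b p)) - (\<Sum>p\<in>lam. of_bool (dg p = 0) * band a (?b p)))"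
    unfolding vcoef_total[OF part a_pos] vcoef_total[OF lam_partition a_pos] by (simp add: l)
  also have "(\<Sum>p\<in>mu. of_bool (dg p = 0) * band a (?b p)) - (\<Sum>p\<in>lam. of_bool (dg p = 0) * band a (?b p))
      = (\<Sum>p\<in>mu - lam. of_bool (dg p = 0) * band a (?b p))"
    by (rule sum_diff[OF fin_mu lam_sub, symmetric])
  also have "\<dots> = 0"
  proof (rule sum.neutral, rule ballI)
    fix p assume "p \<in> mu - lam"
    hence "?b p < - a" using low_sep[OF h0, of p] n0 by (auto simp: lam_def)
    thus "of_bool (dg p = 0) * band a (?b p) = 0" by (simp add: band_def)
  qed
  also have "(\<Sum>p\<in>mu. \<Sum>q\<in>mu. near p q * band a (?b p - ?b q)) - (\<Sum>p\<in>lam. \<Sum>q\<in>lam. near p q * band a (?b p - ?b q))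
      = (\<Sum>p\<in>mu. \<Sum>q\<in>mu. if p \<in> lam \<and> q \<in> lam then 0 else near p q * band a (?b p - ?b q))"
    by (rule sum_over_subset_restrict[OF lam_sub])
  also have "\<dots> = (\<Sum>p\<in>mu. \<Sum>q\<in>mu. if p \<in> mu - lam \<and> q \<in> mu - lam then near p q * of_bool (?b p = ?b q) else 0)"
  proof (intro sum.cong refl)
    fix p q assume pq: "p \<in> mu" "q \<in> mu"
    have lo: "?b p \<le> n0 - a - 2" if "p \<in> mu" "p \<notin> lam" for p using low_sep[OF h0 that(1)] that by (auto simp: lam_def)
    have hi: "n0 \<le> ?b p" if "p \<in> lam" for p using that by (simp add: lam_def)
    consider "p \<in> lam" "q \<in> lam" | "p \<in> lam" "q \<notin> lam" | "p \<notin> lam" "q \<in> lam" | "p \<notin> lam" "q \<notin> lam" by blast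
    thus "(if p \<in> lam \<and> q \<in> lam then 0 else near p q * band a (?b p - ?b q))
        = (if p \<in> mu - lam \<and> q \<in> mu - lam then near p q * of_bool (?b p = ?b q) else 0)"
    proof cases
      case 1 thus ?thesis by simp
    next
      case 2 thus ?thesis using hi[of p] lo[OF pq(2)] a_pos by (auto simp: band_def)
    next
      case 3 thus ?thesis using hi[of q] lo[OF pq(1)] a_pos by (auto simp: band_def)
    next
      case 4
      have "(a + 1) dvd (?b q - ?b p)" using low_cong[OF h0 pq(2,1)] 4 pq by (auto simp: lam_def)
      hence "?b q - ?b p > 0 \<Longrightarrow> a + 1 \<le> ?b q - ?b p" by (rule zdvd_imp_le)
      hence "band a (?b p - ?b q) = of_bool (?b p = ?b q)" using a_pos by (auto simp: band_def)
      thus ?thesis using 4 pq by simp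
    qed
  qed
  also have "\<dots> = (\<Sum>p\<in>mu - lam. \<Sum>q\<in>mu - lam. near p q * of_bool (?b p = ?b q))"
  proof -
    have "(\<Sum>p\<in>mu - lam. \<Sum>q\<in>mu - lam. near p q * of_bool (?b p = ?b q)) = (\<Sum>p\<in>mu - lam. \<Sum>q\<in>mu. if q \<in> mu - lam then near p q * of_bool (?b p = ?b q) else 0)"
      using fin_mu by (intro sum.cong sum.mono_neutral_cong_left) auto
    also have "\<dots> = (\<Sum>p\<in>mu. \<Sum>q\<in>mu. if p \<in> mu - lam \<and> q \<in> mu - lam then near p q * of_bool (?b p = ?b q) else 0)"
      using fin_mu by (intro sum.mono_neutral_cong_left) auto
    finally show ?thesis ..
  qed
  finally have eq: "- total rest = (\<Sum>p\<in>mu - lam. \<Sum>q\<in>mu - lam. near p q * of_bool (?b p = ?b q)) - 0" .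
  have "(\<Sum>p\<in>mu - lam. \<Sum>q\<in>mu - lam. near p q * of_bool (?b p = ?b q)) \<ge> 1"
  proof (rule near_groups_positive)
    show "finite (mu - lam)" using fin_mu by simp
    obtain v where "v \<in># X" "snd v < n0" using low_ne by blast
    then obtain p where "p \<in> mu" "?b p < n0" using h0 fin_mu by (auto simp: configs_def sig_def)
    thus "mu - lam \<noteq> {}" by (auto simp: lam_def)
  qed
  thus ?thesis using eq by linarith
qed

lemma wt_split:
  assumes "h \<in> configs X"
  shows "wt h = zprod pos (\<lambda>y. - rest y) * L.wt (high_part h)"
proof -
  let ?A = "\<lambda>y. if y = 0 then 0 else - vcoef lam a (high_part h) 0 0 y"
  have fA: "finite {y. ?A y \<noteq> 0}"
    by (rule finite_subset[OF vcoef_window[of lam a "high_part h" 0 0, THEN subset_trans[rotated]] window(1)[OF L.fin_mu]]) auto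
  have fr: "finite {y. - rest y \<noteq> 0}" using finite_rest by simp
  have nz: "pos l \<noteq> 0" if "- rest l \<noteq> 0" for l using that rest_zero by (intro pos_nz) auto
  have "wt h = zprod pos (\<lambda>y. - rest y + ?A y)"
    unfolding wt_def
  proof (intro zprod_cong refl)
    fix y
    have "vcoef mu a h 0 0 y = rest y + vcoef lam a (high_part h) 0 0 y"
      using rest_coef[OF assms, of y] by (simp add: rest_def)
    thus "(if y = 0 then 0 else - vcoef mu a h 0 0 y) = - rest y + ?A y" using rest_zero by auto
  qed
  also have "\<dots> = zprod pos (\<lambda>y. - rest y) * zprod pos ?A"
    by (rule zprod_add[OF fr fA nz])
  finally show ?thesis by (simp only: L.wt_def)
qed

lemma rest_factor: "zprod pos (\<lambda>y. - rest y) \<in> epsR"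
proof -
  have "total (\<lambda>y. - rest y) = - total rest" by (simp add: total_def sum_negf)
  hence "total (\<lambda>y. - rest y) = int (Suc (nat (- total rest - 1)))" using rest_order by simp
  hence "zprod pos (\<lambda>y. - rest y) = eps * (eps ^ nat (- total rest - 1) * zprod of_int (\<lambda>y. - rest y))"
    using zprod_pos[of "\<lambda>y. - rest y"] finite_rest by (simp del: of_nat_Suc add: power_int_of_nat)
  thus ?thesis unfolding epsR_def by (auto intro!: mult_R power_R eps_R zprod_int_R simp: rest_zero)
qed

lemma sym_high:
  assumes "\<phi> \<in> symf"
  shows "\<exists>\<psi>\<in>L.symf. \<forall>h\<in>configs X. \<phi> h = \<psi> (high_part h)"
  using assms
proof induction
  case (const c) thus ?case using L.symf.const[of c] by (intro bexI[of _ "\<lambda>_. c"]) auto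
next
  case (add \<phi> \<psi>)
  then obtain f g where "f \<in> L.symf" "g \<in> L.symf" "\<forall>h\<in>configs X. \<phi> h = f (high_part h)" "\<forall>h\<in>configs X. \<psi> h = g (high_part h)" by blast
  thus ?case by (intro bexI[OF _ L.symf.add[of f g]]) auto
next
  case (mult \<phi> \<psi>)
  then obtain f g where "f \<in> L.symf" "g \<in> L.symf" "\<forall>h\<in>configs X. \<phi> h = f (high_part h)" "\<forall>h\<in>configs X. \<psi> h = g (high_part h)" by blast
  thus ?case by (intro bexI[OF _ L.symf.mult[of f g]]) auto
next
  case (psum m d n)
  define c where "c = (\<Sum>p\<in>mu - lam. of_bool (dg p = d \<and> lv a h0 p = n) * pos (jj p) ^ m)"
  have "c \<in> R" unfolding c_def by (intro sum_R mult_R power_R pos_R) (auto simp: of_bool_def intro: one_R zero_R)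
  hence "(\<lambda>h. L.psum m d n h + c) \<in> L.symf" by (intro L.symf.add L.symf.const L.symf.psum)
  moreover have "psum m d n h = L.psum m d n (high_part h) + c" if "h \<in> configs X" for h
  proof -
    have "psum m d n h = (\<Sum>p\<in>mu - lam. of_bool (dg p = d \<and> lv a h p = n) * pos (jj p) ^ m) + (\<Sum>p\<in>lam. of_bool (dg p = d \<and> lv a h p = n) * pos (jj p) ^ m)"
      unfolding psum_def using sum.subset_diff[OF lam_sub fin_mu] by blast
    also have "(\<Sum>p\<in>mu - lam. of_bool (dg p = d \<and> lv a h p = n) * pos (jj p) ^ m) = c"
      unfolding c_def using low_rigid[OF that] by (intro sum.cong) (auto simp: lv_def)
    also have "(\<Sum>p\<in>lam. of_bool (dg p = d \<and> lv a h p = n) * pos (jj p) ^ m) = L.psum m d n (high_part h)"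
      unfolding L.psum_def by (intro sum.cong) (auto simp: lv_def high_part_def)
    finally show ?thesis by simp
  qed
  ultimately show ?case by (intro bexI[of _ "\<lambda>h. L.psum m d n h + c"]) auto
qed

lemma terminal_sums_in: "sums_in epsR X"
  unfolding sums_in_def
proof
  fix \<phi> assume "\<phi> \<in> symf"
  then obtain \<psi> where \<psi>: "\<psi> \<in> L.symf" "\<And>h. h \<in> configs X \<Longrightarrow> \<phi> h = \<psi> (high_part h)" using sym_high by blast
  have "class_sum X \<phi> = zprod pos (\<lambda>y. - rest y) * (\<Sum>h\<in>configs X. L.wt (high_part h) * \<psi> (high_part h))"
    unfolding class_sum_def sum_distrib_left by (intro sum.cong) (auto simp: wt_split \<psi>)
  also have "(\<Sum>h\<in>configs X. L.wt (high_part h) * \<psi> (high_part h)) = L.class_sum XH \<psi>"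
    unfolding L.class_sum_def by (rule sum.reindex_bij_betw[OF bij_high_part])
  finally show "class_sum X \<phi> \<in> epsR"
    using epsR_mult[OF rest_factor] L.sums_in_regular[of XH] \<psi>(1) by (simp add: L.sums_in_def)
qed

end

end

lemma filter_mset_empty_conv: "filter_mset P M = {#} \<longleftrightarrow> (\<forall>x\<in>#M. \<not> P x)"
  by (induction M) auto

context boxes
begin

section \<open>Separated classes\<close>

abbreviation low_cols :: "int \<Rightarrow> (int \<times> int) multiset \<Rightarrow> (int \<times> int) multiset" where
  "low_cols n0 X \<equiv> filter_mset (\<lambda>v. snd v < n0) X"

text \<open>If the lowest level is \<open>n\<close>, then raising a column at level \<open>n\<close>, and then the columns of a chain
  starting there, does not change the sum \<open>total_spread\<close> of the spreads. Once no column is left at level \<open>n\<close>,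
  passing to \<open>n + 1\<close> decreases \<open>total_spread\<close> unless all levels are congruent to \<open>n + 1\<close> modulo \<open>a + 1\<close>. As no
  low column exceeds \<open>n + 1 + total_spread\<close>, the low columns never reach level \<open>n\<^sub>0\<close>.\<close>

definition spread :: "int \<Rightarrow> int \<Rightarrow> nat" where
  "spread n b = nat (b - n - 1) + of_bool (b > n \<and> (a + 1) dvd (b - n))"

definition total_spread :: "int \<Rightarrow> (int \<times> int) multiset \<Rightarrow> nat" where
  "total_spread n L = (\<Sum>v\<in>#L. spread n (snd v))"

text \<open>By \<open>total_spread_bound\<close> low levels are at most \<open>n + 1\<close> plus
  the total spread. The constant a + 3 thus puts them at or below \<open>n0 - a - 2\<close>, the
  separation required of a rigid class.\<close>

definition gap :: "int \<Rightarrow> int \<Rightarrow> (int \<times> int) multiset \<Rightarrow> bool" where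
  "gap n0 n X \<longleftrightarrow> n0 \<le> 0 \<and> low_cols n0 X \<noteq> {#} \<and> (\<forall>v\<in>#low_cols n0 X. n \<le> snd v)
     \<and> n + int (total_spread n (low_cols n0 X)) + a + 3 \<le> n0"

lemma total_spread_bound: "v \<in># L \<Longrightarrow> snd v \<le> n + 1 + int (total_spread n L)"
proof -
  assume "v \<in># L"
  then obtain L' where "L = add_mset v L'" by (metis multi_member_split)
  hence "nat (snd v - n - 1) \<le> total_spread n L" by (simp add: total_spread_def spread_def)
  thus ?thesis by linarith
qed

lemma low_cols_move:
  assumes "(d, m) \<in># X" "m + 1 < n0"
  shows "(d, m) \<in># low_cols n0 X" "low_cols n0 (move X d m) = move (low_cols n0 X) d m"
proof -
  obtain X' where "X = add_mset (d, m) X'" using assms(1) by (metis multi_member_split)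
  thus "(d, m) \<in># low_cols n0 X" "low_cols n0 (move X d m) = move (low_cols n0 X) d m" using assms(2) by auto
qed

lemma total_spread_move:
  assumes "(d, m) \<in># L"
  shows "total_spread n (move L d m) + spread n m = total_spread n L + spread n (m + 1)"
proof -
  obtain L' where "L = add_mset (d, m) L'" using assms(1) by (metis multi_member_split)
  thus ?thesis by (simp add: total_spread_def)
qed

lemma spread_move:
  assumes "n \<le> m" "(a + 1) dvd (m - n)"
  shows "spread n (m + 1) = spread n m"
proof -
  have nd: "\<not> (a + 1) dvd (m + 1 - n)"
  proof
    assume "(a + 1) dvd (m + 1 - n)"
    hence "(a + 1) dvd (m + 1 - n - (m - n))" using assms(2) by (rule dvd_diff)
    thus False using a_pos by (simp add: zdvd_not_zless)
  qed
  show ?thesis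
  proof (cases "m = n")
    case True thus ?thesis using nd by (simp add: spread_def)
  next
    case False thus ?thesis using assms nd by (simp add: spread_def)
  qed
qed

lemma gap_move:
  assumes "gap n0 n X" "(d, m) \<in># X" "n \<le> m" "(a + 1) dvd (m - n)" "m + 1 < n0"
  shows "gap n0 n (move X d m)" "total_spread n (low_cols n0 (move X d m)) = total_spread n (low_cols n0 X)"
proof -
  note l = low_cols_move[OF assms(2,5)]
  show g: "total_spread n (low_cols n0 (move X d m)) = total_spread n (low_cols n0 X)"
    using total_spread_move[OF l(1), of n] spread_move[OF assms(3,4)] unfolding l(2) by simp
  have "n \<le> snd v" if "v \<in># low_cols n0 (move X d m)" for v
  proof -
    have "v = (d, m + 1) \<or> v \<in># low_cols n0 X" using that unfolding l(2) by (auto dest: in_diffD)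
    thus ?thesis using assms(1,3) unfolding gap_def by fastforce
  qed
  thus "gap n0 n (move X d m)" using assms(1) g unfolding gap_def l(2) by auto
qed

definition at_level :: "int \<Rightarrow> int \<Rightarrow> (int \<times> int) multiset \<Rightarrow> nat" where
  "at_level n0 n X = size (filter_mset (\<lambda>v. snd v = n) (low_cols n0 X))"

text \<open>The columns raised along a chain sit at n plus positive multiples of a + 1. Raising them
  keeps the total spread, and none of them enters or leaves level n.\<close>

lemma gap_chain:
  assumes "chain d m X Y" "gap n0 n X" "n \<le> m" "(a + 1) dvd (m - n)" "m \<le> n + 1 + int (total_spread n (low_cols n0 X))"
  shows "gap n0 n Y \<and> total_spread n (low_cols n0 Y) = total_spread n (low_cols n0 X) \<and> at_level n0 n Y = at_level n0 n X"
  using assms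
proof (induction rule: chain.induct)
  case (chain_step d m X Y)
  let ?m = "m + a + 1" and ?X = "move X d (m + a + 1)"
  have "?m < n0" using chain_step.prems unfolding gap_def by linarith
  hence "(d, ?m) \<in># low_cols n0 X" using chain_step.hyps(1) by auto
  from total_spread_bound[OF this, of n] have b: "?m \<le> n + 1 + int (total_spread n (low_cols n0 X))" by simp
  hence lt: "?m + 1 < n0" using chain_step.prems(1) a_pos unfolding gap_def by linarith
  have d: "(a + 1) dvd (?m - n)" using dvd_add[OF chain_step.prems(3) dvd_refl] by (simp add: algebra_simps)
  have le: "n \<le> ?m" using chain_step.prems a_pos by linarith
  note g = gap_move[OF chain_step.prems(1) chain_step.hyps(1) le d lt]
  have "at_level n0 n ?X = at_level n0 n X"
  proof -
    have "?m \<noteq> n" "?m + 1 \<noteq> n" using chain_step.prems(2) a_pos by auto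
    moreover obtain L where "low_cols n0 X = add_mset (d, ?m) L"
      using low_cols_move(1)[OF chain_step.hyps(1) lt] by (metis multi_member_split)
    ultimately show ?thesis unfolding at_level_def low_cols_move(2)[OF chain_step.hyps(1) lt] by simp
  qed
  thus ?case using chain_step.IH[OF g(1) le d] b unfolding g(2) by simp
qed simp

lemma at_level_zero:
  assumes "gap n0 n X" "at_level n0 n X = 0"
  shows "(\<forall>v\<in>#low_cols n0 X. (a + 1) dvd (snd v - (n + 1))) \<or> gap n0 (n + 1) X \<and> total_spread (n + 1) (low_cols n0 X) < total_spread n (low_cols n0 X)"
proof (cases "\<forall>v\<in>#low_cols n0 X. (a + 1) dvd (snd v - (n + 1))")
  case False
  then obtain v where v: "v \<in># low_cols n0 X" "\<not> (a + 1) dvd (snd v - (n + 1))" by blast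
  have ge: "n + 1 \<le> snd w" if "w \<in># low_cols n0 X" for w
  proof -
    have "snd w \<noteq> n" using assms(2) that unfolding at_level_def size_eq_0_iff_empty filter_mset_empty_conv by blast
    thus ?thesis using assms(1) that unfolding gap_def by fastforce
  qed
  have le: "spread (n + 1) b \<le> spread n b" if "n + 1 \<le> b" for b
    using that by (cases "b = n + 1") (auto simp: spread_def)
  have lt: "spread (n + 1) (snd v) < spread n (snd v)"
  proof -
    have "snd v \<noteq> n + 1" using v(2) by auto
    thus ?thesis using ge[OF v(1)] v(2) by (auto simp: spread_def)
  qed
  obtain L where L: "low_cols n0 X = add_mset v L" using v(1) by (metis multi_member_split)
  have "(\<Sum>w\<in>#L. spread (n + 1) (snd w)) \<le> (\<Sum>w\<in>#L. spread n (snd w))"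
    by (intro sum_mset_mono le ge) (simp add: L)
  hence "total_spread (n + 1) (low_cols n0 X) < total_spread n (low_cols n0 X)" using lt by (simp add: total_spread_def L)
  thus ?thesis using assms(1) ge unfolding gap_def by auto
qed blast

text \<open>A column at a negative level contains a box, and low levels are negative since
  \<open>n0\<close> is at most 0. Hence the lowest box is at level n exactly.\<close>

lemma gap_bottom:
  assumes "gap n0 n X" "at_level n0 n X \<noteq> 0" "h \<in> configs X"
  shows "\<exists>d. bottom h d n"
proof -
  have sig: "sig h = X" using assms(3) by (simp add: configs_def)
  have pos: "h p > 0" if "lv a h p < 0" for p
    using that a_pos by (cases "h p = 0") (auto simp: lv_def jj_def mult_less_0_iff)
  have n: "n < n0" "n0 \<le> 0" using assms(1) a_pos unfolding gap_def by auto
  obtain v where "v \<in># low_cols n0 X" "snd v = n" using assms(2) by (auto simp: at_level_def size_eq_0_iff_empty filter_mset_empty_conv)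
  then obtain p where p: "p \<in> mu" "lv a h p = n" unfolding sig[symmetric] sig_def using fin_mu by auto
  obtain d n' where b: "bottom h d n'" using bottom_exists[of p h] pos[of p] p n by auto
  have "n' \<le> n" using b pos[of p] p n unfolding bottom_def by auto
  moreover have "n \<le> n'"
  proof -
    obtain q where q: "q \<in> mu" "lv a h q = n'" using b unfolding bottom_def by blast
    hence "(dg q, n') \<in># low_cols n0 X" using calculation n unfolding sig[symmetric] sig_def using fin_mu by auto
    thus ?thesis using assms(1) unfolding gap_def by fastforce
  qed
  ultimately show ?thesis using b by (intro exI[of _ d]) simp
qed

text \<open>Lexicographic induction. While a column is at level n, removing a bottom box keeps the
  total spread and lowers \<open>at_level\<close>. Afterwards the class is either rigid or has a
  smaller total spread with respect to n + 1.\<close>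

lemma gap_sums_in: "gap n0 n X \<Longrightarrow> sums_in epsR X"
proof (induction "(total_spread n (low_cols n0 X), at_level n0 n X)" arbitrary: X n
    rule: wf_induct_rule[OF wf_lex_prod[OF wf_less_than wf_less_than]])
  case (1 X n)
  show ?case
  proof (cases "configs X = {}")
    case True thus ?thesis by (simp add: sums_in_def class_sum_def epsR_closed)
  next
    case False
    then obtain h0 where h0: "h0 \<in> configs X" by blast
    show ?thesis
    proof (cases "at_level n0 n X = 0")
      case True
      show ?thesis
      proof (cases "\<forall>v\<in>#low_cols n0 X. (a + 1) dvd (snd v - (n + 1))")
        case dv: True
        show ?thesis
        proof (rule terminal_sums_in[OF _ _ _ _ h0])
          show "n0 \<le> 0" "\<exists>v\<in>#X. snd v < n0" using 1(2) unfolding gap_def filter_mset_empty_conv by blast+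
          show "snd v \<le> n0 - a - 2" if "v \<in># X" "snd v < n0" for v
            using total_spread_bound[of v "low_cols n0 X" n] that 1(2) unfolding gap_def by auto
          show "(a + 1) dvd (snd v - snd w)" if "v \<in># X" "snd v < n0" "w \<in># X" "snd w < n0" for v w
          proof -
            have "(a + 1) dvd ((snd v - (n + 1)) - (snd w - (n + 1)))" by (rule dvd_diff) (use dv that in fastforce)+
            thus ?thesis by simp
          qed
        qed
      next
        case F: False
        hence g: "gap n0 (n + 1) X" "total_spread (n + 1) (low_cols n0 X) < total_spread n (low_cols n0 X)"
          using at_level_zero[OF 1(2) True] by blast+
        thus ?thesis by (intro 1(1)[OF _ g(1)]) simp
      qed
    next
      case F: False
      then obtain d where b: "bottom h0 d n" using gap_bottom[OF 1(2) _ h0] by blast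
      show ?thesis unfolding sums_in_def
      proof
        fix \<phi> assume \<phi>: "\<phi> \<in> symf"
        note m = class_sum_step(1)[OF h0 b \<phi>]
        obtain g where g: "g \<in> poly_sym" "class_sum X \<phi> = addable_sum (move X d n) d n g" using class_sum_step(2)[OF h0 b \<phi>] by blast
        have lt: "n + 1 < n0" using 1(2) a_pos unfolding gap_def by linarith
        note G = gap_move[OF 1(2) m order_refl _ lt]
        have al: "at_level n0 n (move X d n) < at_level n0 n X"
        proof -
          obtain L where "low_cols n0 X = add_mset (d, n) L" using low_cols_move(1)[OF m lt] by (metis multi_member_split)
          thus ?thesis unfolding at_level_def low_cols_move(2)[OF m lt] by simp
        qed
        have "addable_sum (move X d n) d n g \<in> epsR"
        proof (rule addable_sum_mem[OF epsR_closed _ g(1)])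
          fix Y assume "chain d n (move X d n) Y"
          from gap_chain[OF this G(1) order_refl]
          have Y: "gap n0 n Y" "total_spread n (low_cols n0 Y) = total_spread n (low_cols n0 X)" "at_level n0 n Y = at_level n0 n (move X d n)"
            using G(2) by simp_all
          thus "sums_in epsR Y" using al by (intro 1(1)[OF _ Y(1)]) (simp add: Y(2,3))
        qed
        thus "class_sum X \<phi> \<in> epsR" using g by simp
      qed
    qed
  qed
qed

text \<open>If the columns within distance \<open>scale k\<close> of the lowest level do not form a gap, then there is a
  further column within distance \<open>scale (k + 1)\<close>; this happens at most \<open>card mu\<close> times.\<close>

fun scale :: "nat \<Rightarrow> int" where
  "scale 0 = 0"
| "scale (Suc k) = int (card mu) * (scale k + 1) + a + 3"

lemma scale_step: "scale k < scale (Suc k) \<or> mu = {}"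
proof (cases "mu = {}")
  case False
  have nonneg: "scale k \<ge> 0" using a_pos by (induction k) auto
  have "card mu \<ge> 1" using False fin_mu by (simp add: Suc_le_eq card_gt_0_iff)
  hence "1 * (scale k + 1) \<le> int (card mu) * (scale k + 1)" using nonneg by (intro mult_right_mono) auto
  thus ?thesis using a_pos by simp
qed blast

lemma scale_nonneg: "scale k \<ge> 0" using a_pos by (induction k) auto

text \<open>If each of the \<open>card mu + 1\<close> disjoint open windows between consecutive
  scales above the lowest level contained a column, there would be more columns than
  \<open>card mu\<close>. The upper end of an empty window serves as \<open>n0\<close>; the bound on
  the level of \<open>p0\<close> makes it at most 0.\<close>

lemma gap_exists:
  assumes p0: "p0 \<in> mu" "lv a h p0 \<le> - scale (Suc (card mu))"
  shows "\<exists>n0 n. gap n0 n (sig h)"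
proof -
  have mono: "k \<le> l \<Longrightarrow> scale k \<le> scale l" for k l
  proof (rule lift_Suc_mono_le)
    show "scale k \<le> scale (Suc k)" for k using scale_step[of k] p0(1) by (auto simp del: scale.simps)
  qed
  define n where "n = Min (lv a h ` mu)"
  have n: "n \<in> lv a h ` mu" unfolding n_def using fin_mu p0(1) by (intro Min_in) auto
  moreover have "\<And>p. p \<in> mu \<Longrightarrow> n \<le> lv a h p" unfolding n_def using fin_mu by simp
  ultimately have n: "n \<in> lv a h ` mu" "\<And>p. p \<in> mu \<Longrightarrow> n \<le> lv a h p" by blast+
  have "\<exists>k\<le>card mu. \<forall>p\<in>mu. \<not> (n + scale k < lv a h p \<and> lv a h p < n + scale (Suc k))"
  proof (rule ccontr)
    assume "\<not> ?thesis"
    hence "\<forall>k\<in>{..card mu}. \<exists>p\<in>mu. n + scale k < lv a h p \<and> lv a h p < n + scale (Suc k)" by auto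
    then obtain f where f: "\<And>k. k \<le> card mu \<Longrightarrow> f k \<in> mu \<and> n + scale k < lv a h (f k) \<and> lv a h (f k) < n + scale (Suc k)"
      by (metis atMost_iff)
    have ne: "f k \<noteq> f l" if "k < l" "l \<le> card mu" for k l
      using f[of k] f[of l] mono[of "Suc k" l] that by (auto simp del: scale.simps)
    have "inj_on f {..card mu}"
      by (rule inj_onI) (metis ne atMost_iff linorder_neqE_nat)
    hence "card {..card mu} \<le> card mu" using f by (intro card_inj_on_le[OF _ _ fin_mu]) auto
    thus False by simp
  qed
  then obtain k where k: "k \<le> card mu" "\<And>p. p \<in> mu \<Longrightarrow> \<not> (n + scale k < lv a h p \<and> lv a h p < n + scale (Suc k))" by blast
  let ?n0 = "n + scale (Suc k)" and ?L = "low_cols (n + scale (Suc k)) (sig h)"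
  have mem: "v \<in># sig h \<longleftrightarrow> (\<exists>p\<in>mu. v = (dg p, lv a h p))" for v unfolding sig_def using fin_mu by auto
  have "n \<le> - scale (Suc k)" using n(2)[OF p0(1)] p0(2) mono[of "Suc k" "Suc (card mu)"] k(1) by linarith
  moreover have "?L \<noteq> {#}"
  proof -
    obtain p where "p \<in> mu" "lv a h p = n" using n(1) by auto
    hence "(dg p, n) \<in># ?L" using mem scale_step[of k] scale_nonneg[of k] p0 by (auto simp del: scale.simps)
    thus ?thesis by (metis empty_iff set_mset_empty)
  qed
  moreover have "\<forall>v\<in>#?L. n \<le> snd v" using mem n(2) by (auto simp del: scale.simps)
  moreover have "n + int (total_spread n ?L) + a + 3 \<le> ?n0"
  proof -
    have "int (spread n (snd v)) \<le> scale k + 1" if "v \<in># ?L" for v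
    proof -
      have "snd v \<le> n + scale k" using that mem k(2) by (fastforce simp del: scale.simps)
      thus ?thesis using scale_nonneg[of k] by (simp add: spread_def)
    qed
    hence "(\<Sum>v\<in>#?L. int (spread n (snd v))) \<le> (\<Sum>v\<in>#?L. scale k + 1)" by (intro sum_mset_mono)
    also have "\<dots> = int (size ?L) * (scale k + 1)" by simp
    also have "\<dots> \<le> int (card mu) * (scale k + 1)"
    proof (rule mult_right_mono)
      have "size ?L \<le> size (sig h)" by (rule size_filter_mset_lesseq)
      thus "int (size ?L) \<le> int (card mu)" by (simp add: sig_def del: scale.simps)
    qed (use scale_nonneg[of k] in simp)
    also have "(\<Sum>v\<in>#?L. int (spread n (snd v))) = int (total_spread n ?L)"
    proof -
      have "int (\<Sum>v\<in>#M. spread n (snd v)) = (\<Sum>v\<in>#M. int (spread n (snd v)))" for M :: "(int \<times> int) multiset"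
        by (induction M) auto
      thus ?thesis by (simp add: total_spread_def del: scale.simps)
    qed
    finally show ?thesis by simp
  qed
  ultimately show ?thesis unfolding gap_def by (intro exI[of _ ?n0] exI[of _ n]) (simp del: scale.simps)
qed

theorem sums_in_tail: "\<exists>B. \<forall>X. hgt X > B \<longrightarrow> sums_in epsR X"
proof (intro exI allI impI)
  fix X assume big: "hgt X > (\<Sum>p\<in>mu. a * jj p + scale (Suc (card mu)))"
  show "sums_in epsR X"
  proof (cases "configs X = {}")
    case True thus ?thesis by (simp add: sums_in_def class_sum_def epsR_closed)
  next
    case False
    then obtain h where h: "sig h = X" by (auto simp: configs_def)
    have "\<exists>p\<in>mu. lv a h p \<le> - scale (Suc (card mu))"
    proof (rule ccontr)
      assume "\<not> ?thesis"
      hence "\<And>p. p \<in> mu \<Longrightarrow> int (h p) \<le> a * jj p + scale (Suc (card mu))" by (fastforce simp: lv_def simp del: scale.simps)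
      hence "(\<Sum>p\<in>mu. int (h p)) \<le> (\<Sum>p\<in>mu. a * jj p + scale (Suc (card mu)))" by (rule sum_mono)
      thus False using big hgt_sig[of h] unfolding h by (simp del: scale.simps)
    qed
    thus ?thesis using gap_exists[of _ h] gap_sums_in unfolding h by blast
  qed
qed

end

section \<open>Expansion of the unit factors\<close>

context eps_ring
begin

text \<open>Homogeneity: positions are integer multiples of \<open>eps\<close>, so the k-th moment
  is divisible by the k-th power of \<open>eps\<close>, and Newton's recursion preserves the
  grading.\<close>

lemma newton_pos_eps: "\<exists>c\<in>R. newton (moment pos s) r = eps ^ r * c"
proof (induction r rule: less_induct)
  case (less r)
  show ?case
  proof (cases r)
    case 0 thus ?thesis using one_R by auto
  next
    case (Suc m)
    have "\<exists>c\<in>R. moment pos s k = eps ^ k * c" for k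
    proof (rule bexI)
      show "moment pos s k = eps ^ k * (\<Sum>l\<in>{l. s l \<noteq> 0}. of_int (s l) * of_int l ^ k)"
        by (simp add: moment_def pos_def power_mult_distrib sum_distrib_left ac_simps)
    qed (intro sum_R mult_R power_R of_int_R)
    then obtain f where f: "\<And>k. f k \<in> R" "\<And>k. moment pos s k = eps ^ k * f k" by metis
    from less Suc have "\<forall>k\<in>{..m}. \<exists>c\<in>R. newton (moment pos s) k = eps ^ k * c" by auto
    then obtain g where g: "\<And>k. k \<le> m \<Longrightarrow> g k \<in> R" "\<And>k. k \<le> m \<Longrightarrow> newton (moment pos s) k = eps ^ k * g k"
      by (metis atMost_iff)
    have "(\<Sum>k\<le>m. moment pos s (Suc k) * newton (moment pos s) (m - k)) = (\<Sum>k\<le>m. eps ^ Suc m * (f (Suc k) * g (m - k)))"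
    proof (rule sum.cong[OF refl])
      fix k assume "k \<in> {..m}"
      hence "eps ^ Suc m = eps ^ Suc k * eps ^ (m - k)" unfolding power_add[symmetric] by simp
      thus "moment pos s (Suc k) * newton (moment pos s) (m - k) = eps ^ Suc m * (f (Suc k) * g (m - k))"
        unfolding f(2)[of "Suc k"] g(2)[of "m - k", OF diff_le_self] by (simp only: ac_simps)
    qed
    hence "(\<Sum>k\<le>m. moment pos s (Suc k) * newton (moment pos s) (m - k)) = eps ^ Suc m * (\<Sum>k\<le>m. f (Suc k) * g (m - k))"
      by (simp only: sum_distrib_left)
    hence "newton (moment pos s) r = eps ^ r * (inverse (of_int (- int (Suc m))) * (\<Sum>k\<le>m. f (Suc k) * g (m - k)))"
      unfolding Suc by (simp add: newton.simps(2) field_simps del: of_nat_Suc power_Suc)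
    moreover have "inverse (of_int (- int (Suc m))) * (\<Sum>k\<le>m. f (Suc k) * g (m - k)) \<in> R"
      using f g by (intro mult_R inverse_int_R sum_R) auto
    ultimately show ?thesis by blast
  qed
qed

text \<open>The product of the (1 - pos l x)^(s l), cut off after degree m in x. By homogeneity the
  omitted terms carry higher powers of \<open>eps\<close>.\<close>

definition trunc :: "nat \<Rightarrow> (int \<Rightarrow> int) \<Rightarrow> 'k \<Rightarrow> 'k" where
  "trunc m s x = (\<Sum>r\<le>m. newton (moment pos s) r * x ^ r)"

lemma trunc_upd:
  assumes "finite {l. s l \<noteq> 0}" "x \<in> R"
  shows "\<exists>c\<in>R. trunc m (s(t := s t + 1)) x = (1 - pos t * x) * trunc m s x + eps ^ Suc m * c"
proof -
  have n: "newton (moment pos (s(t := s t + 1))) r = newton (moment pos s) r - (if r = 0 then 0 else pos t * newton (moment pos s) (r - 1))" for r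
  proof -
    have "moment pos (s(t := s t + 1)) = (\<lambda>k. moment pos s k + pos t ^ k)" using moment_upd[OF assms(1)] by blast
    moreover have "newton (\<lambda>k. M k + e ^ k) r = newton M r - (if r = 0 then 0 else e * newton M (r - 1))" for M and e :: 'k
    proof (cases r)
      case (Suc k)
      have n: "newton_int M' (int k) = newton M' k" for M' :: "nat \<Rightarrow> 'k" and k by (simp add: newton_int_def)
      have e: "int (Suc k) - 1 = int k" by simp
      show ?thesis using newton_int_add_root[of M e "int (Suc k)"] unfolding e n Suc by simp
    qed simp
    ultimately show ?thesis by simp
  qed
  define s' where "s' = s(t := s t + 1)"
  note n' = n[folded s'_def]
  have "trunc m s' x = (1 - pos t * x) * trunc m s x + pos t * newton (moment pos s) m * x ^ Suc m"
  proof (induction m)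
    case 0 thus ?case by (simp add: trunc_def)
  next
    case (Suc m)
    have "trunc (Suc m) s' x = trunc m s' x + newton (moment pos s') (Suc m) * x ^ Suc m"
      by (simp add: trunc_def)
    thus ?case unfolding Suc.IH n' by (simp add: trunc_def algebra_simps)
  qed
  moreover obtain c where c: "c \<in> R" "newton (moment pos s) m = eps ^ m * c" using newton_pos_eps by blast
  ultimately have "trunc m (s(t := s t + 1)) x = (1 - pos t * x) * trunc m s x + eps ^ Suc m * (of_int t * c * x ^ Suc m)"
    unfolding s'_def by (simp add: pos_def algebra_simps del: fun_upd_apply)
  moreover have "of_int t * c * x ^ Suc m \<in> R" by (intro mult_R of_int_R c power_R assms)
  ultimately show ?thesis by blast
qed

lemma zprod_upd:
  assumes "finite {l. s l \<noteq> 0}" "\<And>l. f l \<noteq> 0"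
  shows "zprod f (s(t := s t + 1)) = f t * zprod f s"
proof -
  have "zprod f (\<lambda>l. s l + (if l = t then 1 else 0)) = zprod f s * zprod f (\<lambda>l. if l = t then 1 else 0)"
    using assms by (intro zprod_add) auto
  moreover have "(\<lambda>l. s l + (if l = t then 1 else 0)) = s(t := s t + 1)" by auto
  moreover have "zprod f (\<lambda>l. if l = t then 1 else 0) = f t" by (simp add: zprod_def if_distrib cong: if_cong)
  ultimately show ?thesis by simp
qed

text \<open>Induction on the sum of the absolute exponents, moving one exponent towards 0. A
  negative exponent means dividing the error by a linear factor, which is why the inverses must lie
  in \<open>R\<close>.\<close>

lemma zprod_trunc:
  assumes x: "x \<in> R" and u: "\<And>l. 1 - pos l * x \<noteq> 0" "\<And>l. inverse (1 - pos l * x) \<in> R"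
  shows "finite {l. s l \<noteq> 0} \<Longrightarrow> \<exists>c\<in>R. zprod (\<lambda>l. 1 - pos l * x) s = trunc m s x + eps ^ Suc m * c"
proof (induction "nat (\<Sum>l\<in>{l. s l \<noteq> 0}. \<bar>s l\<bar>)" arbitrary: s rule: less_induct)
  case (less s)
  let ?z = "zprod (\<lambda>l. 1 - pos l * x)"
  have smaller: "nat (\<Sum>l\<in>{l. (s(t := b)) l \<noteq> 0}. \<bar>(s(t := b)) l\<bar>) < nat (\<Sum>l\<in>{l. s l \<noteq> 0}. \<bar>s l\<bar>)"
    "finite {l. (s(t := b)) l \<noteq> 0}" if "\<bar>b\<bar> < \<bar>s t\<bar>" for t b
  proof -
    have sub: "{l. (s(t := b)) l \<noteq> 0} \<subseteq> {l. s l \<noteq> 0}" using that by auto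
    show "finite {l. (s(t := b)) l \<noteq> 0}" by (rule finite_subset[OF sub less.prems])
    have "(\<Sum>l\<in>{l. (s(t := b)) l \<noteq> 0}. \<bar>(s(t := b)) l\<bar>) = (\<Sum>l\<in>{l. s l \<noteq> 0}. \<bar>(s(t := b)) l\<bar>)"
      using sub by (intro sum.mono_neutral_left less.prems) auto
    also have "\<dots> < (\<Sum>l\<in>{l. s l \<noteq> 0}. \<bar>s l\<bar>)"
      using that by (intro sum_strict_mono_ex1 less.prems) (auto intro!: bexI[of _ t])
    finally have "(\<Sum>l\<in>{l. (s(t := b)) l \<noteq> 0}. \<bar>(s(t := b)) l\<bar>) < (\<Sum>l\<in>{l. s l \<noteq> 0}. \<bar>s l\<bar>)" .
    thus "nat (\<Sum>l\<in>{l. (s(t := b)) l \<noteq> 0}. \<bar>(s(t := b)) l\<bar>) < nat (\<Sum>l\<in>{l. s l \<noteq> 0}. \<bar>s l\<bar>)"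
      by (subst nat_less_eq_zless) (auto intro: sum_nonneg simp del: fun_upd_apply)
  qed
  show ?case
  proof (cases "\<exists>t. s t \<noteq> 0")
    case False
    hence s: "s = (\<lambda>_. 0)" by auto
    have n: "newton (moment pos s) r = of_bool (r = 0)" for r
      unfolding s moment_def by (simp add: newton_zero_moments)
    have "trunc m s x = (\<Sum>r\<le>m. if r = 0 then 1 else 0)" unfolding trunc_def by (intro sum.cong) (auto simp: n)
    hence "trunc m s x = 1" by simp
    thus ?thesis using zero_R by (auto simp: s zprod_def)
  next
    case True
    then obtain t where t: "s t \<noteq> 0" by blast
    let ?u = "1 - pos t * x"
    show ?thesis
    proof (cases "s t > 0")
      case pos: True
      let ?s = "s(t := s t - 1)"
      have up: "?s(t := ?s t + 1) = s" by simp
      have lt: "\<bar>s t - 1\<bar> < \<bar>s t\<bar>" using pos by simp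
      obtain c where c: "c \<in> R" "?z ?s = trunc m ?s x + eps ^ Suc m * c"
        using less.hyps[OF smaller[OF lt]] by blast
      obtain c' where c': "c' \<in> R" "trunc m s x = ?u * trunc m ?s x + eps ^ Suc m * c'"
        using trunc_upd[OF smaller(2)[OF lt] x, of m t] unfolding up by blast
      have "?z s = ?u * ?z ?s" using zprod_upd[OF smaller(2)[OF lt], of "\<lambda>l. 1 - pos l * x" t] u(1) unfolding up by blast
      hence "?z s = trunc m s x + eps ^ Suc m * (?u * c - c')" unfolding c c' by (simp add: algebra_simps)
      moreover have "?u * c - c' \<in> R" by (intro diff_R mult_R one_R pos_R x c c')
      ultimately show ?thesis by blast
    next
      case neg: False
      let ?s = "s(t := s t + 1)"
      have lt: "\<bar>s t + 1\<bar> < \<bar>s t\<bar>" using neg t by simp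
      obtain c where c: "c \<in> R" "?z ?s = trunc m ?s x + eps ^ Suc m * c"
        using less.hyps[OF smaller[OF lt]] by blast
      obtain c' where c': "c' \<in> R" "trunc m ?s x = ?u * trunc m s x + eps ^ Suc m * c'"
        using trunc_upd[OF less.prems x, of m t] by blast
      have "?z ?s = ?u * ?z s" using zprod_upd[OF less.prems, of "\<lambda>l. 1 - pos l * x" t] u(1) by blast
      hence z: "?u * ?z s = ?u * trunc m s x + eps ^ Suc m * c' + eps ^ Suc m * c" unfolding c(2) c'(2) by simp
      have ui: "?u * inverse ?u = 1" using u(1)[of t] by simp
      have "?u * (trunc m s x + eps ^ Suc m * (inverse ?u * (c + c'))) = ?u * trunc m s x + (?u * inverse ?u) * (eps ^ Suc m * (c + c'))"
        by (simp only: distrib_left ac_simps)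
      hence "?u * ?z s = ?u * (trunc m s x + eps ^ Suc m * (inverse ?u * (c + c')))"
        unfolding z ui by (simp only: mult_1_left distrib_left distrib_right ac_simps)
      hence "?z s = trunc m s x + eps ^ Suc m * (inverse ?u * (c + c'))"
        using u(1)[of t] by (metis mult_left_cancel)
      moreover have "inverse ?u * (c + c') \<in> R" by (intro mult_R add_R u c c')
      ultimately show ?thesis by blast
    qed
  qed
qed

end

section \<open>Factors that are units on the hyperplane, as functions on a class\<close>

locale unit_boxes = boxes R eps mu a for R :: "'k::field_char_0 set" and eps mu a +
  fixes v1 v3 :: 'k
  assumes v1_R: "v1 \<in> R" and v3_R: "v3 \<in> R"
    and unit: "D \<noteq> 0 \<or> B \<noteq> 0 \<Longrightarrow> of_int D * v1 + of_int B * v3 + of_int y * eps \<noteq> 0"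
      "D \<noteq> 0 \<or> B \<noteq> 0 \<Longrightarrow> inverse (of_int D * v1 + of_int B * v3 + of_int y * eps) \<in> R"
begin

definition chern :: "int \<Rightarrow> int \<Rightarrow> int \<Rightarrow> 'k" where
  "chern D B y = of_int D * v1 + of_int B * v3 + pos y"

text \<open>Symmetry is asked on one class only: a sum over columns with coefficients depending on
  diagonal and level is a polynomial in power sums once the finitely many groups are known.\<close>

definition class_sym :: "(int \<times> int) multiset \<Rightarrow> (cfg \<Rightarrow> 'k) set" where
  "class_sym X = {u. \<exists>\<phi>\<in>symf. \<forall>h\<in>configs X. u h = \<phi> h}"

lemma class_symI: "\<phi> \<in> symf \<Longrightarrow> (\<And>h. h \<in> configs X \<Longrightarrow> u h = \<phi> h) \<Longrightarrow> u \<in> class_sym X"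
  unfolding class_sym_def by blast

lemma class_sym_const: "c \<in> R \<Longrightarrow> (\<lambda>_. c) \<in> class_sym X"
  by (rule class_symI[OF symf.const]) auto

lemma class_sym_add: "f \<in> class_sym X \<Longrightarrow> g \<in> class_sym X \<Longrightarrow> (\<lambda>h. f h + g h) \<in> class_sym X"
proof -
  assume "f \<in> class_sym X" "g \<in> class_sym X"
  then obtain \<phi> \<psi> where "\<phi> \<in> symf" "\<psi> \<in> symf" "\<forall>h\<in>configs X. f h = \<phi> h" "\<forall>h\<in>configs X. g h = \<psi> h" unfolding class_sym_def by blast
  thus ?thesis by (intro class_symI[OF symf.add[of \<phi> \<psi>]]) auto
qed

lemma class_sym_mult: "f \<in> class_sym X \<Longrightarrow> g \<in> class_sym X \<Longrightarrow> (\<lambda>h. f h * g h) \<in> class_sym X"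
proof -
  assume "f \<in> class_sym X" "g \<in> class_sym X"
  then obtain \<phi> \<psi> where "\<phi> \<in> symf" "\<psi> \<in> symf" "\<forall>h\<in>configs X. f h = \<phi> h" "\<forall>h\<in>configs X. g h = \<psi> h" unfolding class_sym_def by blast
  thus ?thesis by (intro class_symI[OF symf.mult[of \<phi> \<psi>]]) auto
qed

lemma class_sym_diff: "f \<in> class_sym X \<Longrightarrow> g \<in> class_sym X \<Longrightarrow> (\<lambda>h. f h - g h) \<in> class_sym X"
  using class_sym_add[OF _ class_sym_mult[OF class_sym_const[OF uminus_R[OF one_R]]], of f X g] by simp

lemma class_sym_sum: "(\<And>i. i \<in> A \<Longrightarrow> f i \<in> class_sym X) \<Longrightarrow> (\<lambda>h. \<Sum>i\<in>A. f i h) \<in> class_sym X"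
  by (induction A rule: infinite_finite_induct) (auto intro: class_sym_add class_sym_const zero_R)

lemma psum_affine_sym:
  assumes "c1 \<in> R" "c0 \<in> R"
  shows "(\<lambda>h. \<Sum>p\<in>mu. of_bool (dg p = d \<and> lv a h p = n) * (c1 * pos (jj p) + c0) ^ m) \<in> symf"
proof -
  have "(\<lambda>h. \<Sum>p\<in>mu. of_bool (dg p = d \<and> lv a h p = n) * (c1 * pos (jj p) + c0) ^ m)
       = (\<lambda>h. \<Sum>r\<le>m. (of_nat (m choose r) * c1 ^ r * c0 ^ (m - r)) * psum r d n h)"
    unfolding binomial_ring psum_def sum_distrib_left sum.swap[of _ _ mu]
    by (simp add: power_mult_distrib ac_simps)
  thus ?thesis by (auto intro!: sym_sum sym_scale symf.psum mult_R of_nat_R power_R assms)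
qed

lemma sum_by_level:
  assumes "h \<in> configs X"
  shows "(\<Sum>p\<in>mu. F (dg p) (lv a h p) p) = (\<Sum>v\<in>set_mset X. \<Sum>p\<in>mu. of_bool (dg p = fst v \<and> lv a h p = snd v) * (F (fst v) (snd v) p :: 'k))"
proof -
  have "(\<Sum>v\<in>set_mset X. \<Sum>p\<in>mu. of_bool (dg p = fst v \<and> lv a h p = snd v) * F (fst v) (snd v) p)
      = (\<Sum>p\<in>mu. \<Sum>v\<in>set_mset X. if v = (dg p, lv a h p) then F (dg p) (lv a h p) p else 0)"
    by (subst sum.swap) (auto intro!: sum.cong)
  also have "\<dots> = (\<Sum>p\<in>mu. F (dg p) (lv a h p) p)"
    using assms fin_mu by (intro sum.cong refl) (auto simp: sum.delta configs_def sig_def)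
  finally show ?thesis ..
qed

lemma one_point_sym:
  assumes "\<And>d n. G d n \<in> R" "\<And>d n. c0 d n \<in> R" "c1 \<in> R"
  shows "(\<lambda>h. \<Sum>p\<in>mu. G (dg p) (lv a h p) * (c1 * pos (jj p) + c0 (dg p) (lv a h p)) ^ m) \<in> class_sym X"
proof (rule class_symI)
  show "(\<lambda>h. \<Sum>v\<in>set_mset X. G (fst v) (snd v) * (\<Sum>p\<in>mu. of_bool (dg p = fst v \<and> lv a h p = snd v) * (c1 * pos (jj p) + c0 (fst v) (snd v)) ^ m)) \<in> symf"
    by (intro sym_sum sym_scale psum_affine_sym assms)
  fix h assume "h \<in> configs X"
  from sum_by_level[OF this, of "\<lambda>d n p. G d n * (c1 * pos (jj p) + c0 d n) ^ m"]
  show "(\<Sum>p\<in>mu. G (dg p) (lv a h p) * (c1 * pos (jj p) + c0 (dg p) (lv a h p)) ^ m)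
    = (\<Sum>v\<in>set_mset X. G (fst v) (snd v) * (\<Sum>p\<in>mu. of_bool (dg p = fst v \<and> lv a h p = snd v) * (c1 * pos (jj p) + c0 (fst v) (snd v)) ^ m))"
    by (simp add: sum_distrib_left ac_simps)
qed

text \<open>The binomial theorem separates the two positions, so the double sum becomes a
  combination of products of two power sums.\<close>

lemma two_point_sym:
  assumes G: "\<And>d n d' n'. G d n d' n' \<in> R" and c: "c \<in> R"
  shows "(\<lambda>h. \<Sum>p\<in>mu. \<Sum>q\<in>mu. G (dg p) (lv a h p) (dg q) (lv a h q) * (pos (jj p) - pos (jj q) + c) ^ m) \<in> class_sym X"
proof -
  have e: "(pos (jj p) - pos (jj q) + c) ^ m = (\<Sum>r\<le>m. of_nat (m choose r) * (1 * pos (jj p) + 0) ^ r * ((-1) * pos (jj q) + c) ^ (m - r))" for p q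
    using binomial_ring[of "pos (jj p)" "c - pos (jj q)" m] by (simp add: algebra_simps)
  let ?P = "\<lambda>r v h. \<Sum>p\<in>mu. of_bool (dg p = fst v \<and> lv a h p = snd v) * (1 * pos (jj p) + 0) ^ r"
  let ?Q = "\<lambda>r v h. \<Sum>p\<in>mu. of_bool (dg p = fst v \<and> lv a h p = snd v) * ((-1) * pos (jj p) + c) ^ r"
  show ?thesis
  proof (rule class_symI)
    show "(\<lambda>h. \<Sum>r\<le>m. of_nat (m choose r) * (\<Sum>v\<in>set_mset X. \<Sum>w\<in>set_mset X. G (fst v) (snd v) (fst w) (snd w) * (?P r v h * ?Q (m - r) w h))) \<in> symf"
      by (intro sym_sum sym_scale symf.mult psum_affine_sym G c of_nat_R one_R zero_R uminus_R)
    fix h assume h: "h \<in> configs X"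
    have A: "(\<Sum>p\<in>mu. \<Sum>q\<in>mu. G (dg p) (lv a h p) (dg q) (lv a h q) * ((1 * pos (jj p) + 0) ^ r * ((-1) * pos (jj q) + c) ^ (m - r)))
      = (\<Sum>v\<in>set_mset X. \<Sum>w\<in>set_mset X. G (fst v) (snd v) (fst w) (snd w) * (?P r v h * ?Q (m - r) w h))" for r
    proof -
      have "(\<Sum>q\<in>mu. G d n (dg q) (lv a h q) * (x * ((-1) * pos (jj q) + c) ^ (m - r)))
        = (\<Sum>w\<in>set_mset X. G d n (fst w) (snd w) * (x * ?Q (m - r) w h))" for d n x
        using sum_by_level[OF h, of "\<lambda>d' n' q. G d n d' n' * (x * ((-1) * pos (jj q) + c) ^ (m - r))"]
        by (simp add: sum_distrib_left ac_simps)
      moreover have "(\<Sum>p\<in>mu. \<Sum>w\<in>set_mset X. G (dg p) (lv a h p) (fst w) (snd w) * ((1 * pos (jj p) + 0) ^ r * y w))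
        = (\<Sum>v\<in>set_mset X. \<Sum>w\<in>set_mset X. G (fst v) (snd v) (fst w) (snd w) * (?P r v h * y w))" for y
        using sum_by_level[OF h, of "\<lambda>d n p. \<Sum>w\<in>set_mset X. G d n (fst w) (snd w) * ((1 * pos (jj p) + 0) ^ r * y w)"]
        by (simp add: sum_distrib_left sum_distrib_right sum.swap[of _ _ mu] ac_simps)
      ultimately show ?thesis by simp
    qed
    have "(\<Sum>p\<in>mu. \<Sum>q\<in>mu. G (dg p) (lv a h p) (dg q) (lv a h q) * (pos (jj p) - pos (jj q) + c) ^ m)
      = (\<Sum>r\<le>m. of_nat (m choose r) * (\<Sum>p\<in>mu. \<Sum>q\<in>mu. G (dg p) (lv a h p) (dg q) (lv a h q) * ((1 * pos (jj p) + 0) ^ r * ((-1) * pos (jj q) + c) ^ (m - r))))"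
      unfolding e sum_distrib_left sum.swap[of _ _ "{..m}"] by (simp only: ac_simps)
    also have "\<dots> = (\<Sum>r\<le>m. of_nat (m choose r) * (\<Sum>v\<in>set_mset X. \<Sum>w\<in>set_mset X. G (fst v) (snd v) (fst w) (snd w) * (?P r v h * ?Q (m - r) w h)))"
      by (simp only: A)
    finally show "(\<Sum>p\<in>mu. \<Sum>q\<in>mu. G (dg p) (lv a h p) (dg q) (lv a h q) * (pos (jj p) - pos (jj q) + c) ^ m)
      = (\<Sum>r\<le>m. of_nat (m choose r) * (\<Sum>v\<in>set_mset X. \<Sum>w\<in>set_mset X. G (fst v) (snd v) (fst w) (snd w) * (?P r v h * ?Q (m - r) w h)))" .
  qed
qed

end

lemma sum_pick_power:
  fixes g :: "int \<Rightarrow> 'k::field_char_0"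
  assumes "finite S" "z \<in> S"
  shows "(\<Sum>y\<in>S. of_int (of_bool (P \<and> z = y) * step_ind a B y v) * g y)
    = of_bool P * of_bool (B < v) * g z - of_bool (P \<and> B < a * z) * g z"
proof -
  have "(\<Sum>y\<in>S. of_int (of_bool (P \<and> z = y) * step_ind a B y v) * g y)
    = (\<Sum>y\<in>S. if y = z then of_bool P * of_bool (B < v) * g z - of_bool (P \<and> B < a * z) * g z else 0)"
    by (intro sum.cong) (auto simp: step_ind_def)
  thus ?thesis using assms by (simp add: sum.delta)
qed

lemma abs_step_ind: "step_ind a B y v \<noteq> 0 \<Longrightarrow> \<bar>B\<bar> \<le> \<bar>v\<bar> + \<bar>a * y\<bar>"
  by (auto simp: step_ind_def of_bool_def split: if_splits)

context boxes
begin

lemma finite_weights: "finite {(D, B). \<exists>y. vcoef mu a h D B y \<noteq> 0}"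
proof -
  define M where "M = (\<Sum>p\<in>mu. \<bar>dg p\<bar> + \<bar>jj p\<bar> + \<bar>lv a h p\<bar>)"
  have M: "\<bar>dg p\<bar> \<le> M" "\<bar>jj p\<bar> \<le> M" "\<bar>lv a h p\<bar> \<le> M" "0 \<le> M" if "p \<in> mu" for p
  proof -
    have "\<bar>dg p\<bar> + \<bar>jj p\<bar> + \<bar>lv a h p\<bar> \<le> M" unfolding M_def
      by (rule member_le_sum[OF that _ fin_mu]) simp
    thus "\<bar>dg p\<bar> \<le> M" "\<bar>jj p\<bar> \<le> M" "\<bar>lv a h p\<bar> \<le> M" "0 \<le> M" by linarith+
  qed
  define K where "K = 2 * M + 1"
  define N where "N = K + a + a * K"
  have K0: "K \<ge> 0" unfolding K_def M_def by (simp add: sum_nonneg)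
  have N: "\<bar>B\<bar> \<le> N" if "step_ind a B y v \<noteq> 0" "\<bar>y\<bar> \<le> K" "\<bar>v\<bar> \<le> K + a" for B y v
  proof -
    have "\<bar>a * y\<bar> \<le> a * K" using that(2) a_pos by (simp add: abs_mult)
    thus ?thesis using abs_step_ind[OF that(1)] that(3) unfolding N_def by linarith
  qed
  have "\<bar>D\<bar> \<le> K \<and> \<bar>B\<bar> \<le> N" if ne: "vcoef mu a h D B y \<noteq> 0" for D B y
  proof -
    have "(\<exists>p\<in>mu. \<exists>q\<in>mu. pair_coef a D B y (dg p - dg q) (jj p - jj q) (lv a h p - lv a h q) \<noteq> 0)
       \<or> (\<exists>p\<in>mu. frame_coef a D B y (dg p) (jj p) (lv a h p) \<noteq> 0)"
    proof (rule ccontr)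
      assume "\<not> ?thesis" hence "vcoef mu a h D B y = 0" unfolding vcoef_def by (simp add: sum.neutral)
      thus False using ne by simp
    qed
    thus ?thesis
    proof (elim disjE bexE)
      fix p q assume pq: "p \<in> mu" "q \<in> mu" and nz: "pair_coef a D B y (dg p - dg q) (jj p - jj q) (lv a h p - lv a h q) \<noteq> 0"
      have b: "\<bar>dg p - dg q\<bar> \<le> 2 * M" "\<bar>jj p - jj q\<bar> \<le> 2 * M" "\<bar>lv a h p - lv a h q\<bar> \<le> 2 * M"
        using M[OF pq(1)] M[OF pq(2)] by linarith+
      consider "dg p - dg q = D" "jj p - jj q = y" "step_ind a B y (lv a h p - lv a h q) \<noteq> 0"
        | "dg p - dg q = D" "jj p - jj q - 1 = y" "step_ind a B y (lv a h p - lv a h q - a) \<noteq> 0"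
        | "dg p - dg q - 1 = D" "jj p - jj q = y" "step_ind a B y (lv a h p - lv a h q) \<noteq> 0"
        | "dg p - dg q + 1 = D" "jj p - jj q - 1 = y" "step_ind a B y (lv a h p - lv a h q - a) \<noteq> 0"
        using nz unfolding pair_coef_def by fastforce
      thus ?thesis
      proof cases
        case 1 show ?thesis using N[OF 1(3)] 1(1,2) b a_pos unfolding K_def by linarith
      next
        case 2 show ?thesis using N[OF 2(3)] 2(1,2) b a_pos unfolding K_def by linarith
      next
        case 3 show ?thesis using N[OF 3(3)] 3(1,2) b a_pos unfolding K_def by linarith
      next
        case 4 show ?thesis using N[OF 4(3)] 4(1,2) b a_pos unfolding K_def by linarith
      qed
    next
      fix p assume p: "p \<in> mu" and nz: "frame_coef a D B y (dg p) (jj p) (lv a h p) \<noteq> 0"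
      consider "dg p = D" "jj p = y" "step_ind a B y (lv a h p) \<noteq> 0"
        | "- dg p = D" "- jj p - 1 = y" "step_ind a B y (- lv a h p - a) \<noteq> 0"
        using nz unfolding frame_coef_def by fastforce
      thus ?thesis
      proof cases
        case 1 show ?thesis using N[OF 1(3)] 1(1,2) M[OF p] a_pos unfolding K_def by linarith
      next
        case 2 show ?thesis using N[OF 2(3)] 2(1,2) M[OF p] a_pos unfolding K_def by linarith
      qed
    qed
  qed
  hence "{(D, B). \<exists>y. vcoef mu a h D B y \<noteq> 0} \<subseteq> {-K..K} \<times> {-N..N}" by fastforce
  thus ?thesis by (rule finite_subset) simp
qed

text \<open>\<open>near_gen\<close> gathers the terms 1 and -1/t1 of the pair factor,
  \<open>far_gen\<close> the terms 1/(t1 t2) and -1/t2. Dividing by t2 shifts the level by -a and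
  the position by -eps.\<close>

definition near_gen :: "int \<Rightarrow> int \<Rightarrow> int \<Rightarrow> int \<Rightarrow> int \<Rightarrow> int \<Rightarrow> 'k" where
  "near_gen D B d n d' n' = (of_bool (d - d' = D) - of_bool (d - d' - 1 = D)) * of_bool (B < n - n')"

definition far_gen :: "int \<Rightarrow> int \<Rightarrow> int \<Rightarrow> int \<Rightarrow> int \<Rightarrow> int \<Rightarrow> 'k" where
  "far_gen D B d n d' n' = (of_bool (d - d' = D) - of_bool (d - d' + 1 = D)) * of_bool (B < n - n' - a)"

text \<open>The half of \<open>step_ind\<close> that compares with \<open>a * y\<close> does not
  involve h and is collected in the constant C; the rest are one-point and two-point sums over the
  columns.\<close>

lemma moment_vcoef:
  "\<exists>C\<in>R. \<forall>h. moment pos (vcoef mu a h D B) k =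
      (\<Sum>p\<in>mu. \<Sum>q\<in>mu. near_gen D B (dg p) (lv a h p) (dg q) (lv a h q) * (pos (jj p) - pos (jj q) + 0) ^ k)
    + (\<Sum>p\<in>mu. \<Sum>q\<in>mu. far_gen D B (dg p) (lv a h p) (dg q) (lv a h q) * (pos (jj p) - pos (jj q) + (- eps)) ^ k)
    - (\<Sum>p\<in>mu. (of_bool (dg p = D) * of_bool (B < lv a h p)) * (1 * pos (jj p) + 0) ^ k)
    - (\<Sum>p\<in>mu. (of_bool (- dg p = D) * of_bool (B < - lv a h p - a)) * ((-1) * pos (jj p) + (- eps)) ^ k) + C"
proof (rule bexI, rule allI)
  fix h
  let ?S = "window mu" and ?g = "\<lambda>y. pos y ^ k"
  let ?c = "\<lambda>P z. of_bool (P \<and> B < a * z) * ?g z"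
  let ?C1 = "\<lambda>p q. ?c (dg p - dg q = D) (jj p - jj q) + ?c (dg p - dg q = D) (jj p - jj q - 1)
     - ?c (dg p - dg q - 1 = D) (jj p - jj q) - ?c (dg p - dg q + 1 = D) (jj p - jj q - 1)"
  let ?C2 = "\<lambda>p. ?c (dg p = D) (jj p) + ?c (- dg p = D) (- jj p - 1)"
  let ?n = "\<lambda>p q. near_gen D B (dg p) (lv a h p) (dg q) (lv a h q) * (pos (jj p) - pos (jj q) + 0) ^ k"
  let ?f = "\<lambda>p q. far_gen D B (dg p) (lv a h p) (dg q) (lv a h q) * (pos (jj p) - pos (jj q) + (- eps)) ^ k"
  let ?u = "\<lambda>p. (of_bool (dg p = D) * of_bool (B < lv a h p)) * (1 * pos (jj p) + 0) ^ k"
  let ?w = "\<lambda>p. (of_bool (- dg p = D) * of_bool (B < - lv a h p - a)) * ((-1) * pos (jj p) + (- eps)) ^ k"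
  have P: "(\<Sum>y\<in>?S. of_int (pair_coef a D B y (dg p - dg q) (jj p - jj q) (lv a h p - lv a h q)) * ?g y)
      = ?n p q + ?f p q - ?C1 p q" if "p \<in> mu" "q \<in> mu" for p q
  proof -
    have e: "pos (jj p - jj q) = pos (jj p) - pos (jj q) + 0" "pos (jj p - jj q - 1) = pos (jj p) - pos (jj q) + (- eps)"
      by (simp_all add: pos_def algebra_simps)
    show ?thesis
      unfolding pair_coef_def of_int_add of_int_diff distrib_right left_diff_distrib sum.distrib sum_subtractf
        sum_pick_power[OF window(1)[OF fin_mu] window(2)[OF that]] sum_pick_power[OF window(1)[OF fin_mu] window(3)[OF that]]
        near_gen_def far_gen_def e[symmetric] by simp
  qed
  have F: "(\<Sum>y\<in>?S. of_int (frame_coef a D B y (dg p) (jj p) (lv a h p)) * ?g y) = ?u p + ?w p - ?C2 p" if "p \<in> mu" for p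
  proof -
    have e: "pos (jj p) = 1 * pos (jj p) + 0" "pos (- jj p - 1) = (-1) * pos (jj p) + (- eps)"
      by (simp_all add: pos_def algebra_simps)
    show ?thesis
      unfolding frame_coef_def of_int_add distrib_right left_diff_distrib sum.distrib sum_subtractf
        sum_pick_power[OF window(1)[OF fin_mu] window(4)[OF that]] sum_pick_power[OF window(1)[OF fin_mu] window(5)[OF that]]
        e(2)[symmetric] by simp
  qed
  have "moment pos (vcoef mu a h D B) k = (\<Sum>y\<in>?S. of_int (vcoef mu a h D B y) * ?g y)"
    by (rule moment_window[OF window(1)[OF fin_mu] vcoef_window])
  also have "\<dots> = (\<Sum>p\<in>mu. \<Sum>q\<in>mu. \<Sum>y\<in>?S. of_int (pair_coef a D B y (dg p - dg q) (jj p - jj q) (lv a h p - lv a h q)) * ?g y)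
     - (\<Sum>p\<in>mu. \<Sum>y\<in>?S. of_int (frame_coef a D B y (dg p) (jj p) (lv a h p)) * ?g y)"
    unfolding vcoef_def of_int_diff of_int_sum left_diff_distrib sum_subtractf sum_distrib_right sum.swap[of _ _ ?S] ..
  also have "\<dots> = (\<Sum>p\<in>mu. \<Sum>q\<in>mu. ?n p q + ?f p q - ?C1 p q) - (\<Sum>p\<in>mu. ?u p + ?w p - ?C2 p)"
    by (intro arg_cong2[of _ _ _ _ "(-)"] sum.cong refl P F)
  also have "\<dots> = (\<Sum>p\<in>mu. \<Sum>q\<in>mu. ?n p q) + (\<Sum>p\<in>mu. \<Sum>q\<in>mu. ?f p q) - (\<Sum>p\<in>mu. ?u p) - (\<Sum>p\<in>mu. ?w p)
     + ((\<Sum>p\<in>mu. ?C2 p) - (\<Sum>p\<in>mu. \<Sum>q\<in>mu. ?C1 p q))"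
    by (simp only: sum.distrib sum_subtractf) (simp only: algebra_simps)
  finally show "moment pos (vcoef mu a h D B) k = (\<Sum>p\<in>mu. \<Sum>q\<in>mu. ?n p q) + (\<Sum>p\<in>mu. \<Sum>q\<in>mu. ?f p q) - (\<Sum>p\<in>mu. ?u p) - (\<Sum>p\<in>mu. ?w p)
     + ((\<Sum>p\<in>mu. ?C2 p) - (\<Sum>p\<in>mu. \<Sum>q\<in>mu. ?C1 p q))" .
next
  show "(\<Sum>p\<in>mu. of_bool (dg p = D \<and> B < a * jj p) * pos (jj p) ^ k + of_bool (- dg p = D \<and> B < a * (- jj p - 1)) * pos (- jj p - 1) ^ k) -
    (\<Sum>p\<in>mu. \<Sum>q\<in>mu.
       of_bool (dg p - dg q = D \<and> B < a * (jj p - jj q)) * pos (jj p - jj q) ^ k +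
       of_bool (dg p - dg q = D \<and> B < a * (jj p - jj q - 1)) * pos (jj p - jj q - 1) ^ k -
       of_bool (dg p - dg q - 1 = D \<and> B < a * (jj p - jj q)) * pos (jj p - jj q) ^ k -
       of_bool (dg p - dg q + 1 = D \<and> B < a * (jj p - jj q - 1)) * pos (jj p - jj q - 1) ^ k) \<in> R"
    by (intro diff_R sum_R add_R mult_R power_R pos_R) (auto simp: of_bool_def intro: one_R zero_R)
qed

lemma of_bool_R: "of_bool P \<in> R" by (auto simp: of_bool_def intro: one_R zero_R)

lemma double_sum_sig: "(\<Sum>p\<in>mu. \<Sum>q\<in>mu. F (dg p, lv a h p) (dg q, lv a h q)) = (\<Sum>v\<in>#sig h. \<Sum>w\<in>#sig h. F v w)"
  by (simp only: sum_sig)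

lemma total_vcoef_sig:
  assumes "sig h = sig h'"
  shows "total (vcoef mu a h D B) = total (vcoef mu a h' D B)"
proof -
  have t: "(of_int (total (vcoef mu a h D B)) :: 'k) = moment pos (vcoef mu a h D B) 0" for h
    by (simp add: total_def moment_def)
  obtain C where C: "\<And>h. moment pos (vcoef mu a h D B) 0 =
      (\<Sum>p\<in>mu. \<Sum>q\<in>mu. near_gen D B (dg p) (lv a h p) (dg q) (lv a h q)) + (\<Sum>p\<in>mu. \<Sum>q\<in>mu. far_gen D B (dg p) (lv a h p) (dg q) (lv a h q))
    - (\<Sum>p\<in>mu. of_bool (dg p = D) * of_bool (B < lv a h p)) - (\<Sum>p\<in>mu. of_bool (- dg p = D) * of_bool (B < - lv a h p - a)) + C"
    using moment_vcoef[of D B 0] by (auto simp only: power_0 mult_1_right)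
  have "moment pos (vcoef mu a h D B) 0 = moment pos (vcoef mu a h' D B) 0"
    unfolding C
    using double_sum_sig[of "\<lambda>v w. near_gen D B (fst v) (snd v) (fst w) (snd w)" h] double_sum_sig[of "\<lambda>v w. near_gen D B (fst v) (snd v) (fst w) (snd w)" h']
      double_sum_sig[of "\<lambda>v w. far_gen D B (fst v) (snd v) (fst w) (snd w)" h] double_sum_sig[of "\<lambda>v w. far_gen D B (fst v) (snd v) (fst w) (snd w)" h']
      sum_sig[of "\<lambda>v. of_bool (fst v = D) * of_bool (B < snd v) :: 'k" h] sum_sig[of "\<lambda>v. of_bool (fst v = D) * of_bool (B < snd v) :: 'k" h']
      sum_sig[of "\<lambda>v. of_bool (- fst v = D) * of_bool (B < - snd v - a) :: 'k" h] sum_sig[of "\<lambda>v. of_bool (- fst v = D) * of_bool (B < - snd v - a) :: 'k" h']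
    unfolding assms fst_conv snd_conv by simp
  hence "(of_int (total (vcoef mu a h D B)) :: 'k) = of_int (total (vcoef mu a h' D B))" unfolding t .
  thus ?thesis by simp
qed

end

context unit_boxes
begin

lemma moment_vcoef_sym: "(\<lambda>h. moment pos (vcoef mu a h D B) k) \<in> class_sym X"
proof -
  obtain C where C: "C \<in> R" "\<And>h. moment pos (vcoef mu a h D B) k =
      (\<Sum>p\<in>mu. \<Sum>q\<in>mu. near_gen D B (dg p) (lv a h p) (dg q) (lv a h q) * (pos (jj p) - pos (jj q) + 0) ^ k)
    + (\<Sum>p\<in>mu. \<Sum>q\<in>mu. far_gen D B (dg p) (lv a h p) (dg q) (lv a h q) * (pos (jj p) - pos (jj q) + (- eps)) ^ k)
    - (\<Sum>p\<in>mu. (of_bool (dg p = D) * of_bool (B < lv a h p)) * (1 * pos (jj p) + 0) ^ k)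
    - (\<Sum>p\<in>mu. (of_bool (- dg p = D) * of_bool (B < - lv a h p - a)) * ((-1) * pos (jj p) + (- eps)) ^ k) + C"
    using moment_vcoef[of D B k] by blast
  show ?thesis unfolding C(2)
    by (intro class_sym_add class_sym_diff class_sym_const C(1) two_point_sym zero_R uminus_R eps_R
        one_point_sym[where G = "\<lambda>d n. of_bool (d = D) * of_bool (B < n)" and ?c0.0 = "\<lambda>_ _. 0" and ?c1.0 = 1]
        one_point_sym[where G = "\<lambda>d n. of_bool (- d = D) * of_bool (B < - n - a)" and ?c0.0 = "\<lambda>_ _. - eps" and ?c1.0 = "-1"])
       (auto simp: near_gen_def far_gen_def intro!: mult_R diff_R of_bool_R one_R uminus_R zero_R)
qed

text \<open>A unit factor is symmetric only up to powers of \<open>eps\<close>. The precision m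
  stays free because the error must still beat the poles of the individual weights.\<close>

definition approx :: "nat \<Rightarrow> (int \<times> int) multiset \<Rightarrow> (cfg \<Rightarrow> 'k) set" where
  "approx m X = {u. \<exists>\<phi>\<in>symf. \<forall>h\<in>configs X. \<exists>r\<in>R. u h = \<phi> h + eps ^ Suc m * r}"

lemma approx_class: "u \<in> class_sym X \<Longrightarrow> u \<in> approx m X"
  unfolding class_sym_def approx_def using zero_R by force

lemma approx_mult:
  assumes "u \<in> approx m X" "w \<in> approx m X"
  shows "(\<lambda>h. u h * w h) \<in> approx m X"
proof -
  obtain \<phi> \<psi> where s: "\<phi> \<in> symf" "\<psi> \<in> symf" and "\<forall>h\<in>configs X. \<exists>r\<in>R. u h = \<phi> h + eps ^ Suc m * r" "\<forall>h\<in>configs X. \<exists>r\<in>R. w h = \<psi> h + eps ^ Suc m * r"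
    using assms unfolding approx_def by blast
  have "\<exists>r\<in>R. u h * w h = \<phi> h * \<psi> h + eps ^ Suc m * r" if "h \<in> configs X" for h
  proof -
    obtain r r' where "r \<in> R" "r' \<in> R" "u h = \<phi> h + eps ^ Suc m * r" "w h = \<psi> h + eps ^ Suc m * r'"
      using \<open>\<forall>h\<in>configs X. \<exists>r\<in>R. u h = \<phi> h + eps ^ Suc m * r\<close> \<open>\<forall>h\<in>configs X. \<exists>r\<in>R. w h = \<psi> h + eps ^ Suc m * r\<close> \<open>h \<in> configs X\<close> by blast
    thus ?thesis
      by (intro bexI[of _ "r * \<psi> h + \<phi> h * r' + eps ^ Suc m * r * r'"])
         (use sym_R[OF s(1), of h] sym_R[OF s(2), of h] in \<open>auto simp: algebra_simps simp del: power_Suc intro!: add_R mult_R power_R eps_R\<close>)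
  qed
  thus ?thesis unfolding approx_def mem_Collect_eq by (intro bexI[OF _ symf.mult[OF s]] ballI)
qed

lemma approx_const: "c \<in> R \<Longrightarrow> (\<lambda>_. c) \<in> approx m X"
  by (rule approx_class[OF class_sym_const])

lemma approx_prod: "(\<And>i. i \<in> A \<Longrightarrow> f i \<in> approx m X) \<Longrightarrow> (\<lambda>h. \<Prod>i\<in>A. f i h) \<in> approx m X"
  by (induction A rule: infinite_finite_induct) (auto intro: approx_mult approx_const one_R)

lemma newton_class_sym:
  "(\<And>k. (\<lambda>h. M h k) \<in> class_sym X) \<Longrightarrow> (\<lambda>h. newton (M h) n) \<in> class_sym X"
  by (rule newton_closed[OF class_sym_const class_sym_add class_sym_mult])

text \<open>Each factor is the unit D v1 + B v3 times 1 - pos y x, with x minus the inverse of this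
  unit. The power of the unit is constant on the class, and the remaining product is expanded by
  \<open>zprod_trunc\<close>.\<close>

lemma zprod_approx:
  assumes DB: "D \<noteq> 0 \<or> B \<noteq> 0"
  shows "(\<lambda>h. zprod (chern D B) (\<lambda>y. - vcoef mu a h D B y)) \<in> approx m X"
proof (cases "configs X = {}")
  case True thus ?thesis unfolding approx_def using symf.const[OF one_R] by auto
next
  case False
  then obtain h0 where h0: "h0 \<in> configs X" by blast
  let ?al = "of_int D * v1 + of_int B * v3"
  have al: "?al \<noteq> 0" "inverse ?al \<in> R" using unit[OF DB, of 0] by auto
  define x where "x = - inverse ?al"
  have x: "x \<in> R" using al uminus_R by (simp add: x_def)
  have f: "chern D B y = ?al * (1 - pos y * x)" for y
    using al(1) by (simp add: chern_def x_def field_simps)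
  have c: "chern D B y \<noteq> 0" "inverse (chern D B y) \<in> R" for y using unit[OF DB, of y] by (simp_all add: chern_def pos_def)
  have u: "1 - pos y * x \<noteq> 0" for y using c(1)[of y] unfolding f by simp
  have ui: "inverse (1 - pos y * x) \<in> R" for y
  proof -
    have "inverse (1 - pos y * x) = ?al * inverse (chern D B y)" unfolding f inverse_mult_distrib using al(1) by (simp add: mult.assoc[symmetric])
    thus ?thesis using c(2)[of y] by (auto intro!: mult_R add_R of_int_R v1_R v3_R)
  qed
  have alp: "?al powi t \<in> R" for t
    using al(2) by (auto simp: power_int_def intro!: power_R mult_R add_R of_int_R v1_R v3_R)
  define T where "T = ?al powi (- total (vcoef mu a h0 D B))"
  define \<phi> where "\<phi> = (\<lambda>h. T * trunc m (\<lambda>y. - vcoef mu a h D B y) x)"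
  have "\<phi> \<in> class_sym X" unfolding \<phi>_def trunc_def moment_uminus
    by (intro class_sym_mult class_sym_const class_sym_sum newton_class_sym power_R x)
       (use alp class_sym_diff[OF class_sym_const[OF zero_R] moment_vcoef_sym] in \<open>auto simp: T_def moment_uminus\<close>)
  then obtain \<psi> where \<psi>: "\<psi> \<in> symf" "\<forall>h\<in>configs X. \<phi> h = \<psi> h" unfolding class_sym_def by blast
  have "\<exists>r\<in>R. zprod (chern D B) (\<lambda>y. - vcoef mu a h D B y) = \<psi> h + eps ^ Suc m * r" if h: "h \<in> configs X" for h
  proof -
    let ?s = "\<lambda>y. - vcoef mu a h D B y"
    have fin: "finite {y. ?s y \<noteq> 0}" using finite_supp_vcoef[OF fin_mu] by simp
    have "zprod (chern D B) ?s = ?al powi (\<Sum>y\<in>{y. ?s y \<noteq> 0}. ?s y) * zprod (\<lambda>y. 1 - pos y * x) ?s"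
    proof -
      have "(\<Prod>l\<in>A. ?al powi t l) = ?al powi (\<Sum>l\<in>A. t l)" if "finite A" for A and t :: "int \<Rightarrow> int"
        using that al(1) by (induction A) (auto simp: power_int_add)
      from this[OF fin] show ?thesis unfolding zprod_def f power_int_mult_distrib prod.distrib by simp
    qed
    also have "(\<Sum>y\<in>{y. ?s y \<noteq> 0}. ?s y) = - total (vcoef mu a h0 D B)"
      using total_vcoef_sig[of h h0 D B] h h0 by (simp add: total_def sum_negf configs_def)
    finally have e: "zprod (chern D B) ?s = T * zprod (\<lambda>y. 1 - pos y * x) ?s" by (simp add: T_def)
    obtain r where r: "r \<in> R" "zprod (\<lambda>y. 1 - pos y * x) ?s = trunc m ?s x + eps ^ Suc m * r"
      using zprod_trunc[OF x u ui fin] by blast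
    have "zprod (chern D B) ?s = \<psi> h + eps ^ Suc m * (T * r)"
      using \<psi>(2) h unfolding e r(2) \<phi>_def by (simp add: algebra_simps)
    moreover have "T * r \<in> R" using alp r(1) by (auto simp: T_def intro: mult_R)
    ultimately show ?thesis by blast
  qed
  thus ?thesis unfolding approx_def using \<psi>(1) by blast
qed

lemma wt_order: "\<exists>m. eps ^ m * wt h \<in> R"
proof -
  let ?s = "\<lambda>y. if y = 0 then 0 else - vcoef mu a h 0 0 y"
  have fin: "finite {y. ?s y \<noteq> 0}" by (rule finite_subset[OF _ finite_supp_vcoef[OF fin_mu, of a h 0 0]]) auto
  have w: "wt h = zprod of_int ?s * eps powi total ?s" unfolding wt_def by (rule zprod_pos[OF fin])
  let ?m = "nat (- total ?s)"
  have "eps ^ ?m * eps powi total ?s \<in> R"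
  proof (cases "total ?s \<ge> 0")
    case True thus ?thesis by (simp add: power_int_def power_R eps_R mult_R)
  next
    case False
    hence "eps ^ ?m * eps powi total ?s = 1" using eps_nz by (simp add: power_int_def power_mult_distrib[symmetric])
    thus ?thesis using one_R by simp
  qed
  hence "zprod of_int ?s * (eps ^ ?m * eps powi total ?s) \<in> R"
    by (rule mult_R[OF zprod_int_R, rotated]) simp
  moreover have "eps ^ ?m * wt h = zprod of_int ?s * (eps ^ ?m * eps powi total ?s)" unfolding w by (rule mult.left_commute)
  ultimately show ?thesis by (intro exI[of _ ?m]) (simp only:)
qed

text \<open>The class is finite, so one power \<open>eps ^ m\<close> clears the poles of all its
  weights. With precision m the error is then \<open>eps\<close> times an element of
  \<open>R\<close>.\<close>

theorem class_sum_mem: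
  assumes u: "\<And>m. u \<in> approx m X" and G: "sums_in I X"
    and I: "epsR \<subseteq> I" "\<And>x y. x \<in> I \<Longrightarrow> y \<in> I \<Longrightarrow> x + y \<in> I"
  shows "(\<Sum>h\<in>configs X. wt h * u h) \<in> I"
proof -
  obtain f where f: "\<And>h. eps ^ f h * wt h \<in> R" using wt_order by metis
  define m where "m = (\<Sum>h\<in>configs X. f h)"
  have m: "eps ^ m * wt h \<in> R" if "h \<in> configs X" for h
  proof -
    have "f h \<le> m" unfolding m_def using finite_configs that by (intro member_le_sum) auto
    hence "eps ^ m = eps ^ (m - f h) * eps ^ f h" unfolding power_add[symmetric] by simp
    thus ?thesis using mult_R[OF power_R[OF eps_R] f[of h], of "m - f h"] by (simp add: ac_simps)
  qed
  obtain \<phi> where \<phi>: "\<phi> \<in> symf" "\<forall>h\<in>configs X. \<exists>r\<in>R. u h = \<phi> h + eps ^ Suc m * r" using u[of m] unfolding approx_def by blast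
  then obtain r where r: "\<And>h. h \<in> configs X \<Longrightarrow> r h \<in> R" "\<And>h. h \<in> configs X \<Longrightarrow> u h = \<phi> h + eps ^ Suc m * r h" by metis
  have "(\<Sum>h\<in>configs X. wt h * u h) = class_sum X \<phi> + eps * (\<Sum>h\<in>configs X. (eps ^ m * wt h) * r h)"
    unfolding class_sum_def sum_distrib_left sum.distrib[symmetric] by (intro sum.cong) (auto simp: r(2) algebra_simps)
  moreover have "class_sum X \<phi> \<in> I" using G \<phi>(1) by (auto simp: sums_in_def)
  moreover have "eps * (\<Sum>h\<in>configs X. (eps ^ m * wt h) * r h) \<in> I"
    using I(1) by (auto simp: epsR_def intro!: sum_R mult_R[OF m r(1)])
  ultimately show ?thesis using I(2) by simp
qed

end

section \<open>The ring of functions regular on the hyperplane\<close>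

definition tf :: "rat poly poly poly \<Rightarrow> rf3" where "tf p = Fract p 1"

lemma tf_hom:
  "tf (p + q) = tf p + tf q" "tf (p * q) = tf p * tf q" "tf (- p) = - tf p" "tf (p - q) = tf p - tf q"
  "tf 0 = 0" "tf 1 = 1"
  by (simp_all add: tf_def Zero_fract_def One_fract_def)

lemma tf_of_nat: "tf (of_nat n) = of_nat n" by (induction n) (simp_all add: tf_hom)

lemma tf_of_int: "tf (of_int n) = of_int n"
  by (cases n rule: int_cases2) (simp_all add: tf_hom tf_of_nat)

lemma tf_power: "tf (p ^ n) = tf p ^ n" by (induction n) (simp_all add: tf_hom)

lemma tf_sum: "tf (sum f A) = (\<Sum>x\<in>A. tf (f x))"
  by (induction A rule: infinite_finite_induct) (simp_all add: tf_hom)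

lemma tf_zero_iff: "tf p = 0 \<longleftrightarrow> p = 0"
  by (simp add: tf_def Zero_fract_def eq_fract)

lemma sub_hom:
  "sub_s3 a (p + q) = sub_s3 a p + sub_s3 a q" "sub_s3 a (p * q) = sub_s3 a p * sub_s3 a q"
  "sub_s3 a (- p) = - sub_s3 a p" "sub_s3 a (p - q) = sub_s3 a p - sub_s3 a q"
  "sub_s3 a 0 = 0" "sub_s3 a 1 = 1"
  by (simp_all add: sub_s3_def)

lemma sub_of_int: "sub_s3 a (of_int n) = of_int n"
proof -
  have "sub_s3 a (of_nat m) = of_nat m" for m by (induction m) (simp_all add: sub_hom)
  thus ?thesis by (cases n rule: int_cases2) (simp_all add: sub_hom)
qed

abbreviation x1 :: "rat poly poly poly" where "x1 \<equiv> [:[:[:0, 1:]:]:]"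
abbreviation x2 :: "rat poly poly poly" where "x2 \<equiv> [:[:0, 1:]:]"
abbreviation x3 :: "rat poly poly poly" where "x3 \<equiv> [:0, 1:]"

lemma V_tf: "V1 = tf x1" "V2 = tf x2" "V3 = tf x3"
  by (simp_all add: V1_def V2_def V3_def tf_def)

lemma V_nz: "V1 \<noteq> 0" "V2 \<noteq> 0" "V3 \<noteq> 0" unfolding V_tf tf_zero_iff by simp_all

definition eps3 :: "int \<Rightarrow> rf3" where "eps3 a = V1 + V2 - of_int a * V3"

definition epsP :: "int \<Rightarrow> rat poly poly poly" where "epsP a = x1 + x2 - of_int a * x3"

lemma eps3_tf: "eps3 a = tf (epsP a)"
  unfolding eps3_def epsP_def V_tf by (simp only: tf_hom tf_of_int)

lemma sub_x: "sub_s3 a x1 = [:[:0, 1:]:]" "sub_s3 a x2 = [:0, 1:]"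
  "sub_s3 a x3 = smult [:1 / of_int a:] ([:[:0, 1:]:] + [:0, 1:])"
  by (simp_all add: sub_s3_def)

lemma of_int_poly_const: "(of_int n :: 'a::comm_ring_1 poly) = [:of_int n:]"
  by (rule of_int_poly)

lemma sub_epsP:
  assumes "a \<noteq> 0"
  shows "sub_s3 a (epsP a) = 0"
proof -
  have "sub_s3 a (epsP a) = [:[:0, 1:]:] + [:0, 1:] - of_int a * smult [:1 / of_int a:] ([:[:0, 1:]:] + [:0, 1:])"
    by (simp only: epsP_def sub_hom sub_of_int sub_x)
  also have "\<dots> = 0" unfolding of_int_poly_const using assms by simp
  finally show ?thesis .
qed

text \<open>On the hyperplane the form becomes (D + B/a) s1 + (B/a) s2, and both coefficients vanish
  only for D = B = 0.\<close>

lemma sub_linear: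
  assumes "a > 0" "D \<noteq> 0 \<or> B \<noteq> 0"
  shows "sub_s3 a (of_int D * x1 + of_int B * x3 + of_int y * epsP a) \<noteq> 0"
proof
  assume z: "sub_s3 a (of_int D * x1 + of_int B * x3 + of_int y * epsP a) = 0"
  have "sub_s3 a (of_int D * x1 + of_int B * x3 + of_int y * epsP a)
      = of_int D * [:[:0, 1:]:] + of_int B * smult [:1 / of_int a:] ([:[:0, 1:]:] + [:0, 1:]) + of_int y * sub_s3 a (epsP a)"
    by (simp only: sub_hom sub_of_int sub_x)
  hence e: "of_int D * [:[:0, 1:]:] + of_int B * smult [:1 / of_int a:] ([:[:0, 1:]:] + [:0, 1:]) = (0 :: rat poly poly)"
    using sub_epsP[of a] assms(1) z by simp
  have "coeff (coeff (of_int D * [:[:0, 1:]:] + of_int B * smult [:1 / of_int a:] ([:[:0, 1:]:] + [:0, 1:]) :: rat poly poly) 1) 0 = of_int B / of_int a"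
    unfolding of_int_poly_const by simp
  hence "B = 0" unfolding e using assms(1) by simp
  moreover have "coeff (coeff (of_int D * [:[:0, 1:]:] + of_int B * smult [:1 / of_int a:] ([:[:0, 1:]:] + [:0, 1:]) :: rat poly poly) 0) 1 = of_int D + of_int B / of_int a"
    unfolding of_int_poly_const by simp
  hence "of_int D + of_int B / (of_int a :: rat) = 0" unfolding e by simp
  ultimately show False using assms(2) by simp
qed

lemma regular_tf: "regular_sub a (tf p)"
  unfolding regular_sub_def tf_def by (rule exI[of _ p], rule exI[of _ 1]) (simp add: sub_hom)

lemma regular_inverse_tf: "sub_s3 a p \<noteq> 0 \<Longrightarrow> regular_sub a (inverse (tf p))"
  unfolding regular_sub_def tf_def by (rule exI[of _ 1], rule exI[of _ p]) auto

lemma sub_nz: "sub_s3 a D \<noteq> 0 \<Longrightarrow> D \<noteq> 0" by (auto simp: sub_hom)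

lemma regular_add: "regular_sub a F \<Longrightarrow> regular_sub a G \<Longrightarrow> regular_sub a (F + G)"
  unfolding regular_sub_def
proof (elim exE conjE)
  fix N D N' D' assume "F = Fract N D" "sub_s3 a D \<noteq> 0" "G = Fract N' D'" "sub_s3 a D' \<noteq> 0"
  thus "\<exists>N D. F + G = Fract N D \<and> sub_s3 a D \<noteq> 0"
    by - (rule exI[of _ "N * D' + N' * D"], rule exI[of _ "D * D'"], auto simp: sub_hom sub_nz)
qed

lemma regular_mult: "regular_sub a F \<Longrightarrow> regular_sub a G \<Longrightarrow> regular_sub a (F * G)"
  unfolding regular_sub_def
proof (elim exE conjE)
  fix N D N' D' assume "F = Fract N D" "sub_s3 a D \<noteq> 0" "G = Fract N' D'" "sub_s3 a D' \<noteq> 0"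
  thus "\<exists>N D. F * G = Fract N D \<and> sub_s3 a D \<noteq> 0"
    by - (rule exI[of _ "N * N'"], rule exI[of _ "D * D'"], auto simp: sub_hom)
qed

text \<open>\<open>eval_sub\<close> selects some fraction. Cross-multiplying it with one whose
  numerator is divisible by \<open>epsP a\<close> shows that the numerator of every admissible
  fraction vanishes under the substitution.\<close>

lemma eval_sub_eps:
  assumes a: "a \<noteq> 0" and F: "F = eps3 a * G" "regular_sub a G"
  shows "eval_sub a F = 0"
proof -
  obtain N' D' where G: "G = Fract N' D'" "sub_s3 a D' \<noteq> 0" using F(2) unfolding regular_sub_def by blast
  have F': "F = Fract (epsP a * N') D'" unfolding F(1) G(1) eps3_tf tf_def by simp
  have z: "r = 0" if r: "F = Fract N D" "sub_s3 a D \<noteq> 0" "r = Fract (sub_s3 a N) (sub_s3 a D)" for r N D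
  proof -
    have "N * D' = epsP a * N' * D" using r(1) sub_nz[OF r(2)] sub_nz[OF G(2)] unfolding F' by (simp add: eq_fract)
    hence "sub_s3 a N * sub_s3 a D' = 0" unfolding sub_hom(2)[symmetric] using a by (simp add: sub_hom sub_epsP)
    hence "sub_s3 a N = 0" using G(2) by simp
    thus ?thesis using r by (simp add: Zero_fract_def eq_fract)
  qed
  have "\<exists>r N D. F = Fract N D \<and> sub_s3 a D \<noteq> 0 \<and> r = Fract (sub_s3 a N) (sub_s3 a D)" using F' G(2) by blast
  hence "\<exists>N D. F = Fract N D \<and> sub_s3 a D \<noteq> 0 \<and> eval_sub a F = Fract (sub_s3 a N) (sub_s3 a D)"
    unfolding eval_sub_def by (rule someI_ex)
  thus ?thesis using z by blast
qed

lemma unit_boxes_regular: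
  assumes "is_partition mu" "a > 0"
  shows "unit_boxes {F. regular_sub a F} (eps3 a) mu a V1 V3"
proof
  show "1 \<in> {F. regular_sub a F}" using regular_tf[of a 1] by (simp add: tf_hom)
  show "x \<in> {F. regular_sub a F} \<Longrightarrow> y \<in> {F. regular_sub a F} \<Longrightarrow> x + y \<in> {F. regular_sub a F}"
    "x \<in> {F. regular_sub a F} \<Longrightarrow> y \<in> {F. regular_sub a F} \<Longrightarrow> x * y \<in> {F. regular_sub a F}" for x y
    by (auto intro: regular_add regular_mult)
  show "x \<in> {F. regular_sub a F} \<Longrightarrow> - x \<in> {F. regular_sub a F}" for x
    using regular_mult[OF regular_tf[of a "-1"], of x] by (simp add: tf_hom)
  show "inverse (of_int m) \<in> {F. regular_sub a F}" if "m \<noteq> 0" for m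
    using regular_inverse_tf[of a "of_int m"] that by (simp add: tf_of_int sub_of_int)
  show "eps3 a \<in> {F. regular_sub a F}" unfolding eps3_tf using regular_tf by simp
  show "eps3 a \<noteq> 0"
  proof -
    have "coeff (coeff (coeff (epsP a) 0) 0) 1 = 1" unfolding epsP_def of_int_poly_const by simp
    hence "epsP a \<noteq> 0" by auto
    thus ?thesis unfolding eps3_tf tf_zero_iff .
  qed
  show "V1 \<in> {F. regular_sub a F}" "V3 \<in> {F. regular_sub a F}" unfolding V_tf using regular_tf by auto
  fix D B y :: int assume DB: "D \<noteq> 0 \<or> B \<noteq> 0"
  have e: "of_int D * V1 + of_int B * V3 + of_int y * eps3 a = tf (of_int D * x1 + of_int B * x3 + of_int y * epsP a)"
    unfolding eps3_tf V_tf by (simp only: tf_hom tf_of_int)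
  note s = sub_linear[OF assms(2) DB, of y]
  show "of_int D * V1 + of_int B * V3 + of_int y * eps3 a \<noteq> 0"
    unfolding e tf_zero_iff using sub_nz[OF s] .
  show "inverse (of_int D * V1 + of_int B * V3 + of_int y * eps3 a) \<in> {F. regular_sub a F}"
    unfolding e using regular_inverse_tf[OF s] by simp
qed (use assms in auto)

section \<open>Laurent polynomials\<close>

text \<open>The value g of a weight is left open: monomials give the Laurent polynomial as a
  rational function, powers of Chern classes give \<open>ch\<close>. The same closure rules then
  serve both.\<close>

definition rep :: "(int \<times> int \<times> int \<Rightarrow> rf3) \<Rightarrow> lpoly \<Rightarrow> rf3 \<Rightarrow> bool" where
  "rep g L F \<longleftrightarrow> finite (lsupp L) \<and> (\<Sum>w\<in>lsupp L. of_int (L w) * g w) = F"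

lemma sum_lsupp:
  "finite S \<Longrightarrow> lsupp L \<subseteq> S \<Longrightarrow> (\<Sum>w\<in>lsupp L. of_int (L w) * g w) = (\<Sum>w\<in>S. of_int (L w) * (g w :: rf3))"
  by (rule sum.mono_neutral_left) (auto simp: lsupp_def)

lemma rep_zero: "rep g (\<lambda>_. 0) 0" by (simp add: rep_def lsupp_def)

lemma rep_add:
  assumes "rep g L F" "rep g M G"
  shows "rep g (\<lambda>w. L w + M w) (F + G)"
proof -
  let ?S = "lsupp L \<union> lsupp M"
  have fin: "finite ?S" "lsupp (\<lambda>w. L w + M w) \<subseteq> ?S" using assms by (auto simp: rep_def lsupp_def)
  have "(\<Sum>w\<in>lsupp (\<lambda>w. L w + M w). of_int (L w + M w) * g w) = (\<Sum>w\<in>?S. of_int (L w) * g w) + (\<Sum>w\<in>?S. of_int (M w) * g w)"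
    unfolding sum_lsupp[OF fin, of g] by (simp add: distrib_right sum.distrib)
  also have "\<dots> = F + G" using assms fin(1) by (auto simp: rep_def sum_lsupp[OF fin(1), symmetric])
  finally show ?thesis using fin by (auto simp: rep_def intro: finite_subset)
qed

lemma rep_uminus: "rep g L F \<Longrightarrow> rep g (\<lambda>w. - L w) (- F)"
  by (auto simp: rep_def lsupp_def sum_negf)

lemma rep_diff: "rep g L F \<Longrightarrow> rep g M G \<Longrightarrow> rep g (\<lambda>w. L w - M w) (F - G)"
  using rep_add[OF _ rep_uminus] by force

lemma rep_sum: "(\<And>i. i \<in> A \<Longrightarrow> rep g (L i) (F i)) \<Longrightarrow> rep g (\<lambda>w. \<Sum>i\<in>A. L i w) (\<Sum>i\<in>A. F i)"
  by (induction A rule: infinite_finite_induct) (auto intro: rep_add rep_zero)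

lemma rep_on: "finite S \<Longrightarrow> rep g (\<lambda>w. of_bool (w \<in> S)) (\<Sum>w\<in>S. g w)"
  by (simp add: rep_def lsupp_def)

lemma rep_single: "rep g (\<lambda>w. of_bool (w = u)) (g u)"
  using rep_on[of "{u}" g] by simp

lemma rep_lp: "rep mono3 L F \<longleftrightarrow> finite (lsupp L) \<and> lp_to_rf L = F"
  by (simp add: rep_def lp_to_rf_def)

lemma rep_ch: "rep (\<lambda>w. c1w w ^ m / of_nat (fact m)) L F \<longleftrightarrow> finite (lsupp L) \<and> ch m L = F"
  by (simp add: rep_def ch_def)

lemma mono3_tf:
  assumes "0 \<le> w1" "0 \<le> w2" "0 \<le> w3"
  shows "mono3 (w1, w2, w3) = tf (monom (monom (monom 1 (nat w1)) (nat w2)) (nat w3))"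
proof -
  have "x1 ^ i = monom (monom (monom 1 i) 0) 0" for i
    by (induction i) (simp add: monom_0 one_pCons, simp add: monom_0 monom_Suc mult.commute)
  moreover have "x2 ^ i = monom (monom 1 i) 0" for i
    by (induction i) (simp add: monom_0 one_pCons, simp add: monom_0 monom_Suc mult.commute)
  moreover have "x3 ^ i = monom 1 i" for i
    by (induction i) (simp_all add: monom_Suc mult.commute)
  ultimately have "x1 ^ i * x2 ^ j * x3 ^ k = monom (monom (monom 1 i) j) k" for i j k
    by (simp add: mult_monom)
  thus ?thesis using assms by (simp add: mono3_def power_int_def V_tf tf_power[symmetric] tf_hom(2)[symmetric])
qed

lemma mono3_mult: "mono3 (u1, u2, u3) * mono3 (w1, w2, w3) = mono3 (u1 + w1, u2 + w2, u3 + w3)"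
  using V_nz by (simp add: mono3_def power_int_add ac_simps)

text \<open>A monomial with large exponents clears all negative powers, and polynomial coefficients
  can be compared. This uniqueness is what gives \<open>laurent_coeffs\<close> its meaning.\<close>

lemma lp_zero:
  assumes "rep mono3 L 0"
  shows "L = (\<lambda>_. 0)"
proof (rule ccontr)
  assume "L \<noteq> (\<lambda>_. 0)"
  then obtain w where w: "L w \<noteq> 0" by (metis ext)
  have fin: "finite (lsupp L)" and z: "(\<Sum>w\<in>lsupp L. of_int (L w) * mono3 w) = 0" using assms by (auto simp: rep_def)
  define N where "N = (\<Sum>(w1, w2, w3)\<in>lsupp L. \<bar>w1\<bar> + \<bar>w2\<bar> + \<bar>w3\<bar>)"
  have N: "0 \<le> N + w1" "0 \<le> N + w2" "0 \<le> N + w3" if "(w1, w2, w3) \<in> lsupp L" for w1 w2 w3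
  proof -
    have "\<bar>w1\<bar> + \<bar>w2\<bar> + \<bar>w3\<bar> \<le> N" unfolding N_def
      using member_le_sum[of "(w1, w2, w3)" "lsupp L" "\<lambda>(w1, w2, w3). \<bar>w1\<bar> + \<bar>w2\<bar> + \<bar>w3\<bar>"] fin that by auto
    thus "0 \<le> N + w1" "0 \<le> N + w2" "0 \<le> N + w3" by linarith+
  qed
  let ?m = "\<lambda>(w1, w2, w3). monom (monom (monom (1::rat) (nat (N + w1))) (nat (N + w2))) (nat (N + w3))"
  have "0 = mono3 (N, N, N) * (\<Sum>w\<in>lsupp L. of_int (L w) * mono3 w)" unfolding z by simp
  also have "\<dots> = (\<Sum>w\<in>lsupp L. tf (of_int (L w) * ?m w))"
    unfolding sum_distrib_left
  proof (intro sum.cong refl)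
    fix w assume "w \<in> lsupp L"
    then obtain w1 w2 w3 where w: "w = (w1, w2, w3)" "(w1, w2, w3) \<in> lsupp L" by (cases w) auto
    show "mono3 (N, N, N) * (of_int (L w) * mono3 w) = tf (of_int (L w) * ?m w)"
      unfolding tf_hom tf_of_int w(1) prod.case mono3_tf[OF N[OF w(2)], symmetric] mono3_mult[symmetric] by (simp only: ac_simps)
  qed
  finally have "tf (\<Sum>w\<in>lsupp L. of_int (L w) * ?m w) = 0" by (simp only: tf_sum)
  hence P: "(\<Sum>w\<in>lsupp L. of_int (L w) * ?m w) = 0" by (simp only: tf_zero_iff)
  obtain w1 w2 w3 where w123: "w = (w1, w2, w3)" by (cases w)
  let ?c = "\<lambda>p. coeff (coeff (coeff p (nat (N + w3))) (nat (N + w2))) (nat (N + w1))"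
  have "0 = ?c (\<Sum>w\<in>lsupp L. of_int (L w) * ?m w)" unfolding P by simp
  also have "\<dots> = (\<Sum>u\<in>lsupp L. if u = w then of_int (L w) else 0)"
    unfolding coeff_sum
  proof (intro sum.cong refl)
    fix u assume "u \<in> lsupp L"
    then obtain u1 u2 u3 where u: "u = (u1, u2, u3)" "(u1, u2, u3) \<in> lsupp L" by (cases u) auto
    have wl: "(w1, w2, w3) \<in> lsupp L" using w w123 by (simp add: lsupp_def)
    show "?c (of_int (L u) * ?m u) = (if u = w then of_int (L w) else 0)"
      using N[OF u(2)] N[OF wl] unfolding of_int_poly_const u(1) w123 by (auto simp: nat_eq_iff)
  qed
  also have "\<dots> = of_int (L w)" using fin w by (simp add: sum.delta lsupp_def)
  finally show False using w by simp
qed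

lemma laurent_coeffs_rep:
  assumes "rep mono3 L F"
  shows "laurent_coeffs F = L"
  unfolding laurent_coeffs_def
proof (rule the_equality)
  show "finite (lsupp L) \<and> lp_to_rf L = F" using assms by (simp add: rep_lp)
  fix M assume "finite (lsupp M) \<and> lp_to_rf M = F"
  hence "rep mono3 M F" by (simp add: rep_lp)
  have "rep mono3 (\<lambda>w. M w - L w) 0" using rep_diff[OF \<open>rep mono3 M F\<close> assms] by simp
  from lp_zero[OF this] show "M = L" by (metis eq_iff_diff_eq_0 ext)
qed

lemma geometric_window:
  fixes x :: rf3
  assumes "x \<noteq> 0" "m \<le> n"
  shows "(1 - x) * (\<Sum>k\<in>{m..<n}. x powi k) = x powi m - x powi n"
  using assms(2)
proof (induction n rule: int_ge_induct)
  case (step i)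
  have "{m..<i + 1} = insert i {m..<i}" using step.hyps by auto
  moreover have "x powi (i + 1) = x powi i * x" using assms(1) by (simp add: power_int_add_1)
  ultimately have "(1 - x) * (\<Sum>k\<in>{m..<i + 1}. x powi k) = x powi i - x powi (i + 1) + (1 - x) * (\<Sum>k\<in>{m..<i}. x powi k)"
    by (simp add: algebra_simps)
  thus ?case unfolding step.IH by simp
qed simp

lemma V3_ne_1: "1 - V3 \<noteq> 0"
proof -
  have "1 - V3 = tf (1 - x3)" by (simp add: V_tf tf_hom)
  moreover have "coeff (1 - x3) 1 = -1" by simp
  hence "1 - x3 \<noteq> 0" by (metis coeff_0 neg_equal_0_iff_equal zero_neq_one)
  ultimately show ?thesis using tf_zero_iff by metis
qed

lemma rep_range:
  assumes "m \<le> n"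
  shows "rep mono3 (\<lambda>(w1, w2, w3). of_bool (w1 = u1 \<and> w2 = u2 \<and> m \<le> w3 \<and> w3 < n))
    (V1 powi u1 * V2 powi u2 * (V3 powi m - V3 powi n) / (1 - V3))"
proof -
  let ?S = "(\<lambda>k. (u1, u2, k)) ` {m..<n}"
  have "(\<Sum>w\<in>?S. mono3 w) = V1 powi u1 * V2 powi u2 * (\<Sum>k\<in>{m..<n}. V3 powi k)"
    by (subst sum.reindex) (auto simp: inj_on_def mono3_def sum_distrib_left)
  also have "\<dots> = V1 powi u1 * V2 powi u2 * (V3 powi m - V3 powi n) / (1 - V3)"
    unfolding geometric_window[OF V_nz(3) assms, symmetric] using V3_ne_1 by simp
  finally have "rep mono3 (\<lambda>w. of_bool (w \<in> ?S)) (V1 powi u1 * V2 powi u2 * (V3 powi m - V3 powi n) / (1 - V3))"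
    using rep_on[of ?S mono3] by simp
  moreover have "(\<lambda>w. of_bool (w \<in> ?S)) = (\<lambda>(w1, w2, w3). of_bool (w1 = u1 \<and> w2 = u2 \<and> m \<le> w3 \<and> w3 < n) :: int)"
    by (auto simp: fun_eq_iff)
  ultimately show ?thesis by simp
qed

text \<open>The expansion of a monomial times (1 - t3^c)/(1 - t3); the difference of indicators
  covers both signs of c.\<close>

definition blk :: "int \<Rightarrow> int \<Rightarrow> int \<Rightarrow> lpoly" where
  "blk u1 u2 c = (\<lambda>(w1, w2, w3). of_bool (u1 = w1 \<and> u2 = w2) * (of_bool (w3 < c) - of_bool (w3 < 0)))"

lemma rep_blk: "rep mono3 (blk u1 u2 c) (V1 powi u1 * V2 powi u2 * (1 - V3 powi c) / (1 - V3))"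
proof (cases "0 \<le> c")
  case True
  have "blk u1 u2 c = (\<lambda>(w1, w2, w3). of_bool (w1 = u1 \<and> w2 = u2 \<and> 0 \<le> w3 \<and> w3 < c))"
    using True by (auto simp: blk_def fun_eq_iff)
  thus ?thesis using rep_range[OF True, of u1 u2] by simp
next
  case False
  have "blk u1 u2 c = (\<lambda>w. - (case w of (w1, w2, w3) \<Rightarrow> of_bool (w1 = u1 \<and> w2 = u2 \<and> c \<le> w3 \<and> w3 < 0)))"
    using False by (auto simp: blk_def fun_eq_iff)
  moreover have "- (V1 powi u1 * V2 powi u2 * (V3 powi c - V3 powi 0) / (1 - V3)) = V1 powi u1 * V2 powi u2 * (1 - V3 powi c) / (1 - V3)"
    by (simp add: algebra_simps diff_divide_distrib)
  ultimately show ?thesis using rep_uminus[OF rep_range[of c 0 u1 u2]] False by simp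
qed

lemma step_ind_blk:
  assumes "v = c + a * u2"
  shows "of_bool (u1 - u2 = w1 - w2 \<and> u2 = w2) * step_ind a (w3 + a * w2) w2 v = blk u1 u2 c (w1, w2, w3)"
  using assms by (auto simp: step_ind_def blk_def)

section \<open>Weights of a fixed submodule\<close>

definition chi :: "(nat \<times> nat) set \<Rightarrow> cfg \<Rightarrow> lpoly" where
  "chi mu h = (\<lambda>(w1, w2, w3). of_bool (0 \<le> w1 \<and> 0 \<le> w2 \<and> (nat w1, nat w2) \<in> mu \<and> - int (h (nat w1, nat w2)) \<le> w3 \<and> w3 < 0))"

lemma sum_of_bool_single:
  assumes "finite A" "\<And>p. p \<in> A \<Longrightarrow> Q p \<Longrightarrow> p = q"
  shows "(\<Sum>p\<in>A. of_bool (Q p)) = (of_bool (q \<in> A \<and> Q q) :: int)"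
proof -
  have "(\<Sum>p\<in>A. of_bool (Q p)) = (\<Sum>p\<in>A. if p = q then of_bool (Q q) else (0::int))"
    using assms(2) by (intro sum.cong) auto
  thus ?thesis using assms(1) by (simp add: sum.delta)
qed

lemma chi_sum:
  assumes "finite mu"
  shows "chi mu h = (\<lambda>w. \<Sum>p\<in>mu. (\<lambda>(w1, w2, w3). of_bool (w1 = int (fst p) \<and> w2 = int (snd p) \<and> - int (h p) \<le> w3 \<and> w3 < 0)) w)"
proof
  fix w :: "int \<times> int \<times> int" obtain w1 w2 w3 where w: "w = (w1, w2, w3)" by (cases w)
  show "chi mu h w = (\<Sum>p\<in>mu. (\<lambda>(w1, w2, w3). of_bool (w1 = int (fst p) \<and> w2 = int (snd p) \<and> - int (h p) \<le> w3 \<and> w3 < 0)) w)"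
    unfolding w prod.case chi_def by (subst sum_of_bool_single[OF assms, of _ "(nat w1, nat w2)"]) auto
qed

lemma chi_bar_sum:
  assumes "finite mu"
  shows "(\<lambda>w. chi mu h (case w of (w1, w2, w3) \<Rightarrow> (- w1, - w2, - w3)))
    = (\<lambda>w. \<Sum>p\<in>mu. (\<lambda>(w1, w2, w3). of_bool (w1 = - int (fst p) \<and> w2 = - int (snd p) \<and> 1 \<le> w3 \<and> w3 < int (h p) + 1)) w)"
proof
  fix w :: "int \<times> int \<times> int" obtain w1 w2 w3 where w: "w = (w1, w2, w3)" by (cases w)
  show "chi mu h (case w of (w1, w2, w3) \<Rightarrow> (- w1, - w2, - w3))
    = (\<Sum>p\<in>mu. (\<lambda>(w1, w2, w3). of_bool (w1 = - int (fst p) \<and> w2 = - int (snd p) \<and> 1 \<le> w3 \<and> w3 < int (h p) + 1)) w)"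
    unfolding w prod.case chi_def by (subst sum_of_bool_single[OF assms, of _ "(nat (- w1), nat (- w2))"]) auto
qed

definition tp :: "nat \<times> nat \<Rightarrow> rf3" where "tp p = V1 powi int (fst p) * V2 powi int (snd p)"
definition tb :: "nat \<times> nat \<Rightarrow> rf3" where "tb p = V1 powi (- int (fst p)) * V2 powi (- int (snd p))"
definition xp :: "cfg \<Rightarrow> nat \<times> nat \<Rightarrow> rf3" where "xp h p = V3 powi (- int (h p))"
definition xb :: "cfg \<Rightarrow> nat \<times> nat \<Rightarrow> rf3" where "xb h p = V3 powi int (h p)"

lemma Fmu_sum: "Fmu mu = (\<Sum>p\<in>mu. tp p)"
  by (simp add: Fmu_def tp_def case_prod_unfold)

lemma Fmu_bar_sum: "Fmu_bar mu = (\<Sum>p\<in>mu. tb p)"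
  by (simp add: Fmu_bar_def tb_def case_prod_unfold power_int_minus inverse_eq_divide power_one_over)

lemma FQ_closed:
  assumes "finite mu" "charQ Q = chi mu h"
  shows "FQ mu Q = (\<Sum>p\<in>mu. tp p * xp h p) / (1 - V3)"
proof -
  have "rep mono3 (chi mu h) (\<Sum>p\<in>mu. V1 powi int (fst p) * V2 powi int (snd p) * (V3 powi (- int (h p)) - V3 powi 0) / (1 - V3))"
    unfolding chi_sum[OF assms(1)] by (intro rep_sum rep_range) simp
  hence "lp_to_rf (charQ Q) = (\<Sum>p\<in>mu. tp p * xp h p - tp p) / (1 - V3)"
    unfolding assms(2) rep_lp by (simp add: tp_def xp_def right_diff_distrib sum_divide_distrib)
  thus ?thesis unfolding FQ_def Fmu_sum by (simp add: sum_subtractf add_divide_distrib[symmetric])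
qed

lemma FQ_bar_closed:
  assumes "finite mu" "charQ Q = chi mu h"
  shows "FQ_bar mu Q = - V3 * (\<Sum>p\<in>mu. tb p * xb h p) / (1 - V3)"
proof -
  have "rep mono3 (\<lambda>w. chi mu h (case w of (w1, w2, w3) \<Rightarrow> (- w1, - w2, - w3)))
     (\<Sum>p\<in>mu. V1 powi (- int (fst p)) * V2 powi (- int (snd p)) * (V3 powi 1 - V3 powi (int (h p) + 1)) / (1 - V3))"
    unfolding chi_bar_sum[OF assms(1)] by (intro rep_sum rep_range) simp
  hence "lp_to_rf (\<lambda>w. charQ Q (case w of (w1, w2, w3) \<Rightarrow> (- w1, - w2, - w3)))
      = (\<Sum>p\<in>mu. V3 * (tb p - tb p * xb h p)) / (1 - V3)"
    unfolding assms(2) rep_lp using V_nz by (simp add: tb_def xb_def power_int_add right_diff_distrib sum_divide_distrib ac_simps)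
  hence e: "lp_to_rf (\<lambda>w. charQ Q (case w of (w1, w2, w3) \<Rightarrow> (- w1, - w2, - w3)))
      = V3 * ((\<Sum>p\<in>mu. tb p) - (\<Sum>p\<in>mu. tb p * xb h p)) / (1 - V3)"
    by (simp add: sum_distrib_left[symmetric] sum_subtractf)
  have "A / (1 - 1 / V3) = - V3 * A / (1 - V3)" for A
    using V_nz V3_ne_1 by (simp add: field_simps)
  thus ?thesis unfolding FQ_bar_def Fmu_bar_sum e by (simp add: add_divide_distrib[symmetric] algebra_simps)
qed

text \<open>In the new form each of the three numerators F Fb - f fb, F - f, Fb - fb becomes 0 at t3
  = 1. Division by 1 - t3 then yields blocks, and V is visibly a Laurent polynomial.\<close>

lemma vertex_algebra:
  fixes F Fb f fb u v x :: "'a::field"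
  assumes "u \<noteq> 0" "v \<noteq> 0" "x \<noteq> 0" "1 - x \<noteq> 0"
  shows "f / (1 - x) - (- x * fb / (1 - x)) / (u * v * x)
     + f / (1 - x) * (- x * fb / (1 - x)) * (1 - u) * (1 - v) * (1 - x) / (u * v * x)
     + (- F - Fb / (u * v) + F * Fb * (1 - u) * (1 - v) / (u * v)) / (1 - x)
   = (F * Fb - f * fb) / (1 - x) * (1 + inverse u * inverse v - inverse u - inverse v)
     - (F - f) / (1 - x) - (Fb - fb) * (inverse u * inverse v) / (1 - x)"
proof -
  define z where "z = 1 - x"
  have z: "z \<noteq> 0" using assms by (simp add: z_def)
  have "f / z - (- x * fb / z) / (u * v * x) + f / z * (- x * fb / z) * (1 - u) * (1 - v) * z / (u * v * x)
     + (- F - Fb / (u * v) + F * Fb * (1 - u) * (1 - v) / (u * v)) / z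
   = (F * Fb - f * fb) / z * (1 + inverse u * inverse v - inverse u - inverse v)
     - (F - f) / z - (Fb - fb) * (inverse u * inverse v) / z"
    using assms(1-3) z by (simp add: field_simps)
  thus ?thesis by (simp add: z_def)
qed

definition VL :: "(nat \<times> nat) set \<Rightarrow> int \<Rightarrow> cfg \<Rightarrow> lpoly" where
  "VL mu a h = (\<lambda>(w1, w2, w3). vcoef mu a h (w1 - w2) (w3 + a * w2) w2)"

lemma pair_blk:
  fixes p q :: "nat \<times> nat" and h :: cfg
  defines "P1 \<equiv> int (fst p)" and "P2 \<equiv> int (snd p)" and "Q1 \<equiv> int (fst q)" and "Q2 \<equiv> int (snd q)" and "c \<equiv> int (h q) - int (h p)"
  shows "pair_coef a (w1 - w2) (w3 + a * w2) w2 (dg p - dg q) (jj p - jj q) (lv a h p - lv a h q)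
    = blk (P1 - Q1) (P2 - Q2) c (w1, w2, w3) + blk (P1 - Q1 - 1) (P2 - Q2 - 1) c (w1, w2, w3)
      - blk (P1 - Q1 - 1) (P2 - Q2) c (w1, w2, w3) - blk (P1 - Q1) (P2 - Q2 - 1) c (w1, w2, w3)"
proof -
  have e: "dg p - dg q = (P1 - Q1) - (P2 - Q2)" "dg p - dg q = (P1 - Q1 - 1) - (P2 - Q2 - 1)"
    "dg p - dg q - 1 = (P1 - Q1 - 1) - (P2 - Q2)" "dg p - dg q + 1 = (P1 - Q1) - (P2 - Q2 - 1)"
    "jj p - jj q = P2 - Q2" by (simp_all add: dg_def jj_def P1_def P2_def Q1_def Q2_def)
  have b: "lv a h p - lv a h q = c + a * (P2 - Q2)" "lv a h p - lv a h q - a = c + a * (P2 - Q2 - 1)"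
    by (simp_all add: lv_def jj_def P2_def Q2_def c_def algebra_simps)
  show ?thesis
    unfolding pair_coef_def e(5) using step_ind_blk[OF b(1), of "P1 - Q1" w1 w2 w3] step_ind_blk[OF b(2), of "P1 - Q1 - 1" w1 w2 w3]
      step_ind_blk[OF b(1), of "P1 - Q1 - 1" w1 w2 w3] step_ind_blk[OF b(2), of "P1 - Q1" w1 w2 w3]
    unfolding e(1,2)[symmetric] e(3,4)[symmetric] by simp
qed

lemma frame_blk:
  fixes p :: "nat \<times> nat" and h :: cfg
  defines "P1 \<equiv> int (fst p)" and "P2 \<equiv> int (snd p)"
  shows "frame_coef a (w1 - w2) (w3 + a * w2) w2 (dg p) (jj p) (lv a h p)
    = blk P1 P2 (- int (h p)) (w1, w2, w3) + blk (- P1 - 1) (- P2 - 1) (int (h p)) (w1, w2, w3)"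
proof -
  have e: "dg p = P1 - P2" "- dg p = (- P1 - 1) - (- P2 - 1)" "jj p = P2"
    by (simp_all add: dg_def jj_def P1_def P2_def)
  have b: "lv a h p = - int (h p) + a * P2" "- lv a h p - a = int (h p) + a * (- P2 - 1)"
    by (simp_all add: lv_def jj_def P2_def algebra_simps)
  show ?thesis
    unfolding frame_coef_def e(3) using step_ind_blk[OF b(1), of P1 w1 w2 w3] step_ind_blk[OF b(2), of "- P1 - 1" w1 w2 w3]
    unfolding e(1,2)[symmetric] by simp
qed

lemma rep_VL:
  assumes "finite mu" "charQ Q = chi mu h"
  shows "rep mono3 (VL mu a h) (VQ mu Q)"
proof -
  let ?g = "\<lambda>u1 u2 c. V1 powi u1 * V2 powi u2 * (1 - V3 powi c) / (1 - V3)"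
  let ?i = "\<lambda>p. int (fst p)" and ?j = "\<lambda>p. int (snd p)"
  let ?c = "\<lambda>p q. int (h q) - int (h p)"
  have VL: "VL mu a h = (\<lambda>w. (\<Sum>p\<in>mu. \<Sum>q\<in>mu. blk (?i p - ?i q) (?j p - ?j q) (?c p q) w + blk (?i p - ?i q - 1) (?j p - ?j q - 1) (?c p q) w
      - blk (?i p - ?i q - 1) (?j p - ?j q) (?c p q) w - blk (?i p - ?i q) (?j p - ?j q - 1) (?c p q) w)
      - (\<Sum>p\<in>mu. blk (?i p) (?j p) (- int (h p)) w + blk (- ?i p - 1) (- ?j p - 1) (int (h p)) w))"
    unfolding VL_def vcoef_def pair_blk frame_blk by (simp only: split_def prod.collapse)
  have main: "rep mono3 (VL mu a h) ((\<Sum>p\<in>mu. \<Sum>q\<in>mu. ?g (?i p - ?i q) (?j p - ?j q) (?c p q) + ?g (?i p - ?i q - 1) (?j p - ?j q - 1) (?c p q)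
      - ?g (?i p - ?i q - 1) (?j p - ?j q) (?c p q) - ?g (?i p - ?i q) (?j p - ?j q - 1) (?c p q))
      - (\<Sum>p\<in>mu. ?g (?i p) (?j p) (- int (h p)) + ?g (- ?i p - 1) (- ?j p - 1) (int (h p))))"
    unfolding VL by (intro rep_diff rep_add rep_sum rep_blk)
  let ?F = "\<Sum>p\<in>mu. tp p" and ?Fb = "\<Sum>p\<in>mu. tb p" and ?f = "\<Sum>p\<in>mu. tp p * xp h p" and ?fb = "\<Sum>p\<in>mu. tb p * xb h p"
  let ?u = "inverse V1" and ?v = "inverse V2"
  have pm: "V1 powi (m - 1) = V1 powi m * ?u" "V2 powi (m - 1) = V2 powi m * ?v" for m
    using V_nz by (simp_all add: power_int_diff divide_inverse)
  have A: "?g (?i p - ?i q) (?j p - ?j q) (?c p q) + ?g (?i p - ?i q - 1) (?j p - ?j q - 1) (?c p q)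
      - ?g (?i p - ?i q - 1) (?j p - ?j q) (?c p q) - ?g (?i p - ?i q) (?j p - ?j q - 1) (?c p q)
      = (tp p * tb q - tp p * xp h p * (tb q * xb h q)) / (1 - V3) * (1 + ?u * ?v - ?u - ?v)" for p q
  proof -
    have s: "V1 powi (?i p - ?i q) * V2 powi (?j p - ?j q) = tp p * tb q" "V3 powi (?c p q) = xp h p * xb h q"
      using V_nz by (simp_all add: tp_def tb_def xp_def xb_def power_int_diff power_int_minus divide_inverse ac_simps)
    have "?g (?i p - ?i q) (?j p - ?j q) (?c p q) + ?g (?i p - ?i q - 1) (?j p - ?j q - 1) (?c p q)
      - ?g (?i p - ?i q - 1) (?j p - ?j q) (?c p q) - ?g (?i p - ?i q) (?j p - ?j q - 1) (?c p q)
      = (V1 powi (?i p - ?i q) * V2 powi (?j p - ?j q)) * (1 - V3 powi (?c p q)) / (1 - V3) * (1 + ?u * ?v - ?u - ?v)"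
      unfolding pm by (simp add: divide_inverse algebra_simps)
    thus ?thesis unfolding s by (simp add: algebra_simps)
  qed
  have "(\<Sum>p\<in>mu. \<Sum>q\<in>mu. ?g (?i p - ?i q) (?j p - ?j q) (?c p q) + ?g (?i p - ?i q - 1) (?j p - ?j q - 1) (?c p q)
      - ?g (?i p - ?i q - 1) (?j p - ?j q) (?c p q) - ?g (?i p - ?i q) (?j p - ?j q - 1) (?c p q))
      = (?F * ?Fb - ?f * ?fb) / (1 - V3) * (1 + ?u * ?v - ?u - ?v)"
    unfolding A sum_distrib_right[symmetric] sum_divide_distrib[symmetric] sum_subtractf sum_product ..
  moreover have "(\<Sum>p\<in>mu. ?g (?i p) (?j p) (- int (h p)) + ?g (- ?i p - 1) (- ?j p - 1) (int (h p)))
      = (?F - ?f) / (1 - V3) + (?Fb - ?fb) * (?u * ?v) / (1 - V3)"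
  proof -
    have "?g (?i p) (?j p) (- int (h p)) + ?g (- ?i p - 1) (- ?j p - 1) (int (h p))
      = (tp p - tp p * xp h p) / (1 - V3) + (tb p - tb p * xb h p) * (?u * ?v) / (1 - V3)" for p
      unfolding pm by (simp add: tp_def tb_def xp_def xb_def algebra_simps)
    thus ?thesis by (simp add: sum.distrib sum_divide_distrib[symmetric] sum_distrib_right[symmetric] sum_subtractf)
  qed
  moreover have "VQ mu Q = (?F * ?Fb - ?f * ?fb) / (1 - V3) * (1 + ?u * ?v - ?u - ?v)
      - (?F - ?f) / (1 - V3) - (?Fb - ?fb) * (?u * ?v) / (1 - V3)"
    unfolding VQ_def FQ_closed[OF assms] FQ_bar_closed[OF assms] Gmu_def Fmu_sum Fmu_bar_sum
    by (rule vertex_algebra[OF V_nz V3_ne_1])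
  ultimately show ?thesis using main by (simp only: diff_diff_add)
qed

text \<open>The factor 1 - t3 cancels the denominator of F_Q, and every column leaves (1 - t1)(1 -
  t2) times its lowest monomial.\<close>

definition FL :: "(nat \<times> nat) set \<Rightarrow> cfg \<Rightarrow> lpoly" where
  "FL mu h = (\<lambda>w. \<Sum>p\<in>mu. of_bool (w = (int (fst p), int (snd p), - int (h p))) - of_bool (w = (int (fst p) + 1, int (snd p), - int (h p)))
     - of_bool (w = (int (fst p), int (snd p) + 1, - int (h p))) + of_bool (w = (int (fst p) + 1, int (snd p) + 1, - int (h p))))"

lemma rep_FL:
  "rep g (FL mu h) (\<Sum>p\<in>mu. g (int (fst p), int (snd p), - int (h p)) - g (int (fst p) + 1, int (snd p), - int (h p))
     - g (int (fst p), int (snd p) + 1, - int (h p)) + g (int (fst p) + 1, int (snd p) + 1, - int (h p)))"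
  unfolding FL_def by (intro rep_sum rep_add rep_diff rep_single)

lemma laurent_F:
  assumes "finite mu" "charQ Q = chi mu h"
  shows "laurent_coeffs (FQ mu Q * (1 - V1) * (1 - V2) * (1 - V3)) = FL mu h"
proof (rule laurent_coeffs_rep)
  have "FQ mu Q * (1 - V1) * (1 - V2) * (1 - V3) = (\<Sum>p\<in>mu. tp p * xp h p) * ((1 - V1) * (1 - V2))"
    unfolding FQ_closed[OF assms] using V3_ne_1 by (simp add: field_simps)
  also have "\<dots> = (\<Sum>p\<in>mu. mono3 (int (fst p), int (snd p), - int (h p)) - mono3 (int (fst p) + 1, int (snd p), - int (h p))
     - mono3 (int (fst p), int (snd p) + 1, - int (h p)) + mono3 (int (fst p) + 1, int (snd p) + 1, - int (h p)))"
    unfolding sum_distrib_right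
  proof (rule sum.cong[OF refl])
    fix p
    have "V1 powi (int i + 1) = V1 powi int i * V1" "V2 powi (int i + 1) = V2 powi int i * V2" for i
      using V_nz by (simp_all add: power_int_add)
    note pa = this
    show "tp p * xp h p * ((1 - V1) * (1 - V2)) = mono3 (int (fst p), int (snd p), - int (h p)) - mono3 (int (fst p) + 1, int (snd p), - int (h p))
     - mono3 (int (fst p), int (snd p) + 1, - int (h p)) + mono3 (int (fst p) + 1, int (snd p) + 1, - int (h p))"
      unfolding mono3_def prod.case pa tp_def xp_def by (simp only: algebra_simps)
  qed
  finally show "rep mono3 (FL mu h) (FQ mu Q * (1 - V1) * (1 - V2) * (1 - V3))" using rep_FL[of mono3 mu h] by simp
qed

lemma laurent_V:
  "finite mu \<Longrightarrow> charQ Q = chi mu h \<Longrightarrow> laurent_coeffs (VQ mu Q) = VL mu a h"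
  by (rule laurent_coeffs_rep[OF rep_VL])

section \<open>Vertex weights in terms of diagonals, levels and positions\<close>

locale vertex =
  fixes mu :: "(nat \<times> nat) set" and a :: int
  assumes partition: "is_partition mu" and a_positive: "a > 0"

sublocale vertex \<subseteq> U: unit_boxes "{F. regular_sub a F}" "eps3 a" mu a V1 V3
  by (rule unit_boxes_regular[OF partition a_positive])

context vertex
begin

lemma c1w_chern: "c1w (D + y, y, B - a * y) = U.chern D B y"
proof -
  have "U.chern D B y = of_int D * V1 + of_int B * V3 + of_int y * eps3 a"
    by (simp add: U.chern_def U.pos_def)
  also have "\<dots> = c1w (D + y, y, B - a * y)"
    unfolding eps3_def c1w_def by (simp add: algebra_simps)
  finally show ?thesis ..
qed

lemma c1w_chern': "c1w (w1, w2, w3) = U.chern (w1 - w2) (w3 + a * w2) w2"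
  using c1w_chern[of "w1 - w2" w2 "w3 + a * w2"] by simp

text \<open>The weights are grouped by (D, B). The group (0, 0) is \<open>wt\<close>, its zero
  weight having exponent 0 by \<open>vcoef_zero_weight\<close>. P may exceed the actual support, so
  that one P can serve a whole class.\<close>

lemma euler_VL:
  assumes v: "valid mu h" and P: "finite P" "(0, 0) \<notin> P" "{(D, B). \<exists>y. vcoef mu a h D B y \<noteq> 0} \<subseteq> insert (0, 0) P"
  shows "euler_neg (VL mu a h) = U.wt h * (\<Prod>(D, B)\<in>P. zprod (U.chern D B) (\<lambda>y. - vcoef mu a h D B y))"
proof -
  let ?t = "\<lambda>((D, B), y). (D + y, y, B - a * y)"
  let ?T = "insert (0, 0) P \<times> window mu"
  let ?z = "\<lambda>(D, B). zprod (U.chern D B) (\<lambda>y. - vcoef mu a h D B y)"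
  have fin: "finite ?T" using P window(1)[OF U.fin_mu] by simp
  have inj: "inj_on ?t ?T" by (auto simp: inj_on_def)
  have sub: "lsupp (VL mu a h) \<subseteq> ?t ` ?T"
  proof
    fix w assume w: "w \<in> lsupp (VL mu a h)"
    obtain w1 w2 w3 where e: "w = (w1, w2, w3)" by (cases w)
    have nz: "vcoef mu a h (w1 - w2) (w3 + a * w2) w2 \<noteq> 0" using w by (simp add: lsupp_def VL_def e)
    hence "((w1 - w2, w3 + a * w2), w2) \<in> ?T" using P(3) vcoef_window[of mu a h "w1 - w2" "w3 + a * w2"] by blast
    moreover have "w = ?t ((w1 - w2, w3 + a * w2), w2)" by (simp add: e)
    ultimately show "w \<in> ?t ` ?T" by (rule rev_image_eqI)
  qed
  have "euler_neg (VL mu a h) = (\<Prod>w\<in>?t ` ?T. c1w w powi (- VL mu a h w))"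
    unfolding euler_neg_def using fin sub by (intro prod.mono_neutral_left) (auto simp: lsupp_def)
  also have "\<dots> = (\<Prod>x\<in>?T. (\<lambda>((D, B), y). U.chern D B y powi (- vcoef mu a h D B y)) x)"
    unfolding prod.reindex[OF inj] comp_def
  proof (rule prod.cong[OF refl])
    fix x :: "(int \<times> int) \<times> int" obtain D B y where x: "x = ((D, B), y)" by (metis prod.exhaust)
    have "VL mu a h (D + y, y, B - a * y) = vcoef mu a h D B y" by (simp add: VL_def)
    thus "c1w (?t x) powi (- VL mu a h (?t x)) = (\<lambda>((D, B), y). U.chern D B y powi (- vcoef mu a h D B y)) x"
      unfolding x prod.case c1w_chern by simp
  qed
  also have "\<dots> = (\<Prod>DB\<in>insert (0, 0) P. \<Prod>y\<in>window mu. (\<lambda>((D, B), y). U.chern D B y powi (- vcoef mu a h D B y)) (DB, y))"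
    by (simp only: prod.cartesian_product split_def prod.collapse)
  also have "\<dots> = (\<Prod>DB\<in>insert (0, 0) P. ?z DB)"
  proof (rule prod.cong[OF refl])
    fix DB show "(\<Prod>y\<in>window mu. (\<lambda>((D, B), y). U.chern D B y powi (- vcoef mu a h D B y)) (DB, y)) = ?z DB"
      using vcoef_window[of mu a h "fst DB" "snd DB"]
      by (cases DB) (auto simp: zprod_window[OF window(1)[OF U.fin_mu]])
  qed
  also have "\<dots> = ?z (0, 0) * (\<Prod>DB\<in>P. ?z DB)" using P by simp
  also have "?z (0, 0) = U.wt h"
    unfolding U.wt_def prod.case using U.vcoef_zero_weight[OF v]
    by (intro zprod_cong) (auto simp: U.chern_def)
  finally show ?thesis .
qed

lemma ch_FL_sym: "(\<lambda>h. ch m (FL mu h)) \<in> U.class_sym X"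
proof -
  let ?g = "\<lambda>w. c1w w ^ m / of_nat (fact m)"
  define k where "k = inverse (of_int (int (fact m)) :: rf3)"
  have kR: "k \<in> {F. regular_sub a F}" unfolding k_def by (rule U.inverse_int_R) simp
  define T where "T e1 e2 h = (\<Sum>p\<in>mu. k * (1 * U.pos (jj p) + (of_int (dg p + e1 - e2) * V1 + of_int (lv a h p + a * e2) * V3 + U.pos e2)) ^ m)" for e1 e2 h
  have T: "T e1 e2 \<in> U.class_sym X" for e1 e2
    unfolding T_def
    by (rule U.one_point_sym[where G = "\<lambda>_ _. k" and ?c0.0 = "\<lambda>d n. of_int (d + e1 - e2) * V1 + of_int (n + a * e2) * V3 + U.pos e2"])
       (intro kR U.add_R U.mult_R U.of_int_R U.v1_R U.v3_R U.pos_R U.one_R)+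
  have g: "?g (int (fst p) + e1, int (snd p) + e2, - int (h p))
      = k * (1 * U.pos (jj p) + (of_int (dg p + e1 - e2) * V1 + of_int (lv a h p + a * e2) * V3 + U.pos e2)) ^ m" for p e1 e2 h
  proof -
    have e: "c1w (int (fst p) + e1, int (snd p) + e2, - int (h p))
      = 1 * U.pos (jj p) + (of_int (dg p + e1 - e2) * V1 + of_int (lv a h p + a * e2) * V3 + U.pos e2)"
      unfolding c1w_chern' U.chern_def by (simp add: dg_def jj_def lv_def U.pos_def algebra_simps)
    show ?thesis unfolding e k_def by (simp only: divide_inverse of_int_of_nat_eq mult.commute)
  qed
  have "ch m (FL mu h) = T 0 0 h - T 1 0 h - T 0 1 h + T 1 1 h" for h
  proof -
    have "ch m (FL mu h) = (\<Sum>p\<in>mu. ?g (int (fst p), int (snd p), - int (h p)) - ?g (int (fst p) + 1, int (snd p), - int (h p))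
     - ?g (int (fst p), int (snd p) + 1, - int (h p)) + ?g (int (fst p) + 1, int (snd p) + 1, - int (h p)))"
      using rep_FL[of ?g mu h] unfolding rep_ch by simp
    also have "\<dots> = T 0 0 h - T 1 0 h - T 0 1 h + T 1 1 h"
      unfolding T_def sum_subtractf[symmetric] sum.distrib[symmetric] g[symmetric] by simp
    finally show ?thesis .
  qed
  moreover have "(\<lambda>h. T 0 0 h - T 1 0 h - T 0 1 h + T 1 1 h) \<in> U.class_sym X"
    by (intro U.class_sym_add U.class_sym_diff T)
  ultimately show ?thesis by simp
qed

definition weight :: "nat list \<Rightarrow> cfg \<Rightarrow> rf3" where
  "weight is h = euler_neg (VL mu a h) * (\<Prod>j<length is. ch (2 + is ! j) (FL mu h))"

lemma wQ_weight: "charQ Q = chi mu h \<Longrightarrow> wQ mu is Q = weight is h"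
  unfolding wQ_def weight_def laurent_F[OF U.fin_mu] laurent_V[OF U.fin_mu, where a = a] ..

lemma class_weight_sum:
  assumes G: "U.sums_in I X" and I: "U.epsR \<subseteq> I" "\<And>x y. x \<in> I \<Longrightarrow> y \<in> I \<Longrightarrow> x + y \<in> I"
  shows "(\<Sum>h\<in>U.configs X. weight is h) \<in> I"
proof -
  define P where "P = (\<Union>h\<in>U.configs X. {(D, B). \<exists>y. vcoef mu a h D B y \<noteq> 0}) - {(0, 0)}"
  define u where "u h = (\<Prod>DB\<in>P. zprod (U.chern (fst DB) (snd DB)) (\<lambda>y. - vcoef mu a h (fst DB) (snd DB) y)) * (\<Prod>j<length is. ch (2 + is ! j) (FL mu h))" for h
  have "finite P" unfolding P_def by (intro finite_Diff finite_UN_I U.finite_configs U.finite_weights)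
  have "weight is h = U.wt h * u h" if "h \<in> U.configs X" for h
  proof -
    have "valid mu h" using that by (simp add: U.configs_def)
    from euler_VL[OF this \<open>finite P\<close>] have "euler_neg (VL mu a h) = U.wt h * (\<Prod>(D, B)\<in>P. zprod (U.chern D B) (\<lambda>y. - vcoef mu a h D B y))"
      using that unfolding P_def by blast
    thus ?thesis by (simp add: weight_def u_def case_prod_unfold)
  qed
  hence "(\<Sum>h\<in>U.configs X. weight is h) = (\<Sum>h\<in>U.configs X. U.wt h * u h)" by simp
  moreover have "u \<in> U.approx m X" for m
  proof -
    have "(\<lambda>h. zprod (U.chern (fst DB) (snd DB)) (\<lambda>y. - vcoef mu a h (fst DB) (snd DB) y)) \<in> U.approx m X" if "DB \<in> P" for DB
      using that by (intro U.zprod_approx) (auto simp: P_def prod_eq_iff)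
    thus ?thesis unfolding u_def by (intro U.approx_mult U.approx_prod U.approx_class[OF ch_FL_sym])
  qed
  ultimately show ?thesis using U.class_sum_mem[OF _ G I] by simp
qed

end

section \<open>Invariant submodules are spanned by monomials\<close>

text \<open>Elimination: some t with nonzero value at the new point w0 is used to clear that
  coordinate in the others, and the combination is applied to functions vanishing at w0. This bounds
  \<open>cdim\<close> from below.\<close>

lemma spanning_card:
  fixes t :: "'i \<Rightarrow> 'w \<Rightarrow> complex"
  assumes "finite S" "finite A" "\<And>f. \<exists>c. \<forall>w\<in>S. f w = (\<Sum>i\<in>A. c i * t i w)"
  shows "card S \<le> card A"
  using assms
proof (induction S arbitrary: A t rule: finite_induct)
  case (insert w0 S)
  obtain c1 where "(1::complex) = (\<Sum>i\<in>A. c1 i * t i w0)" using insert.prems(2)[of "\<lambda>_. 1"] by auto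
  then obtain i0 where i0: "i0 \<in> A" "t i0 w0 \<noteq> 0" by (metis (no_types, lifting) mult_zero_right sum.neutral zero_neq_one)
  let ?t = "\<lambda>i w. t i w - t i w0 / t i0 w0 * t i0 w"
  have "\<exists>c. \<forall>w\<in>S. f w = (\<Sum>i\<in>A - {i0}. c i * ?t i w)" for f
  proof -
    obtain c where c: "\<forall>w\<in>insert w0 S. (f(w0 := 0)) w = (\<Sum>i\<in>A. c i * t i w)" using insert.prems(2)[of "f(w0 := 0)"] by blast
    have split: "(\<Sum>i\<in>A. c i * t i w) = c i0 * t i0 w + (\<Sum>i\<in>A - {i0}. c i * t i w)" for w
      by (rule sum.remove[OF insert.prems(1) i0(1)])
    have "(\<Sum>i\<in>A. c i * t i w0) = 0" using c by simp
    hence z: "(\<Sum>i\<in>A - {i0}. c i * t i w0) = - (c i0 * t i0 w0)" unfolding split by (simp add: eq_neg_iff_add_eq_0 add.commute)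
    have "f w = (\<Sum>i\<in>A - {i0}. c i * ?t i w)" if "w \<in> S" for w
    proof -
      have "(\<Sum>i\<in>A - {i0}. c i * ?t i w) = (\<Sum>i\<in>A - {i0}. c i * t i w) - (\<Sum>i\<in>A - {i0}. c i * t i w0) * (t i0 w / t i0 w0)"
        unfolding sum_distrib_right sum_subtractf[symmetric]
        by (intro sum.cong refl) (simp add: right_diff_distrib divide_inverse ac_simps)
      also have "\<dots> = (\<Sum>i\<in>A. c i * t i w)" unfolding z split using i0(2) by simp
      also have "\<dots> = f w"
      proof -
        have "w \<noteq> w0" using that insert.hyps(2) by blast
        thus ?thesis using bspec[OF c, of w] that by simp
      qed
      finally show ?thesis ..
    qed
    thus ?thesis by blast
  qed
  hence "card S \<le> card (A - {i0})" using insert.prems(1) by (intro insert.IH) auto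
  moreover have "Suc (card (A - {i0})) = card A" using insert.prems(1) i0(1) by (rule card_Suc_Diff1)
  ultimately show ?case using insert.hyps by simp
qed simp

definition delta :: "int \<times> int \<times> int \<Rightarrow> vec" where "delta w = (\<lambda>u. if u = w then 1 else 0)"

definition on_set :: "(int \<times> int \<times> int) set \<Rightarrow> vec set" where
  "on_set S = {v. \<forall>w. w \<notin> S \<longrightarrow> v w = 0}"

lemma on_setD: "v \<in> on_set S \<Longrightarrow> w \<notin> S \<Longrightarrow> v w = 0"
  unfolding on_set_def by blast

lemma delta_on_set: "delta w \<in> on_set S \<longleftrightarrow> w \<in> S"
proof
  assume "delta w \<in> on_set S"
  from on_setD[OF this, of w] show "w \<in> S" by (auto simp: delta_def)
qed (auto simp: on_set_def delta_def)

lemma inj_delta: "inj delta"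
  by (rule injI) (metis delta_def zero_neq_one)

lemma delta_span:
  assumes "finite S"
  shows "on_set S \<subseteq> cspan (delta ` S)"
proof
  fix v assume v: "v \<in> on_set S"
  have "v = lincomb (delta ` S) (\<lambda>s. v (inv delta s))"
  proof
    fix w
    have "lincomb (delta ` S) (\<lambda>s. v (inv delta s)) w = (\<Sum>u\<in>S. v u * delta u w)"
      unfolding lincomb_def by (subst sum.reindex) (auto simp: inj_on_subset[OF inj_delta] inv_f_f[OF inj_delta])
    also have "\<dots> = (\<Sum>u\<in>S. if u = w then v w else 0)" by (intro sum.cong) (auto simp: delta_def)
    also have "\<dots> = v w" using assms on_setD[OF v, of w] by (simp add: sum.delta)
    finally show "v w = lincomb (delta ` S) (\<lambda>s. v (inv delta s)) w" ..
  qed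
  thus "v \<in> cspan (delta ` S)" unfolding cspan_def by blast
qed

lemma cdim_on_set:
  assumes "finite S"
  shows "cdim (on_set S) = card S"
  unfolding cdim_def
proof (rule Least_equality)
  show "\<exists>T. finite T \<and> card T = card S \<and> T \<subseteq> on_set S \<and> on_set S \<subseteq> cspan T"
    using assms delta_span[OF assms] by (intro exI[of _ "delta ` S"]) (auto simp: card_image inj_on_subset[OF inj_delta] delta_on_set)
  fix n assume "\<exists>T. finite T \<and> card T = n \<and> T \<subseteq> on_set S \<and> on_set S \<subseteq> cspan T"
  then obtain T where T: "finite T" "card T = n" "on_set S \<subseteq> cspan T" by blast
  have "\<exists>c. \<forall>w\<in>S. f w = (\<Sum>s\<in>T. c s * s w)" for f
  proof -
    have "(\<lambda>w. if w \<in> S then f w else 0) \<in> cspan T" using T(3) by (auto simp: on_set_def)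
    then obtain c where "(\<lambda>w. if w \<in> S then f w else 0) = lincomb T c" unfolding cspan_def by blast
    hence "\<forall>w\<in>S. f w = (\<Sum>s\<in>T. c s * s w)" unfolding lincomb_def by (metis (mono_tags, lifting))
    thus ?thesis by blast
  qed
  from spanning_card[OF assms T(1), of "\<lambda>s. s", OF this] show "card S \<le> n" using T(2) by simp
qed

lemma wspace_on_set: "wspace (on_set S) w = on_set (S \<inter> {w})"
  by (auto simp: wspace_def on_set_def)

lemma charQ_on_set: "charQ (on_set S) = (\<lambda>w. of_bool (w \<in> S))"
proof
  fix w show "charQ (on_set S) w = of_bool (w \<in> S)"
    unfolding charQ_def wspace_on_set by (subst cdim_on_set) auto
qed

lemma tact_apply: "tact (t1, t2, t3) v (w1, w2, w3) = t1 powi w1 * t2 powi w2 * t3 powi w3 * v (w1, w2, w3)"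
  by (simp add: tact_def)

lemma separate_weights:
  assumes "w \<noteq> u"
  shows "\<exists>t1 t2 t3 :: complex. t1 \<noteq> 0 \<and> t2 \<noteq> 0 \<and> t3 \<noteq> 0 \<and>
    (case w of (w1, w2, w3) \<Rightarrow> t1 powi w1 * t2 powi w2 * t3 powi w3) \<noteq> (case u of (w1, w2, w3) \<Rightarrow> t1 powi w1 * t2 powi w2 * t3 powi w3)"
proof -
  have inj: "(2::complex) powi m \<noteq> 2 powi n" if "m \<noteq> n" for m n
  proof
    assume "(2::complex) powi m = 2 powi n"
    hence "norm ((2::complex) powi m) = norm ((2::complex) powi n)" by simp
    hence "(2::real) powi m = 2 powi n" by (simp add: norm_power_int)
    thus False using that by (metis linorder_neqE power_int_strict_increasing one_less_numeral_iff semiring_norm(76) less_irrefl)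
  qed
  obtain w1 w2 w3 u1 u2 u3 where e: "w = (w1, w2, w3)" "u = (u1, u2, u3)" by (cases w, cases u)
  consider "w1 \<noteq> u1" | "w2 \<noteq> u2" | "w3 \<noteq> u3" using assms e by auto
  thus ?thesis
  proof cases
    case 1 thus ?thesis using inj[OF 1] unfolding e by (intro exI[of _ 2] exI[of _ 1]) simp
  next
    case 2 show ?thesis using inj[OF 2] unfolding e by (rule_tac exI[of _ 1], rule_tac exI[of _ 2], rule_tac exI[of _ 1]) simp
  next
    case 3 show ?thesis using inj[OF 3] unfolding e by (rule_tac exI[of _ 1], rule_tac exI[of _ 1], rule_tac exI[of _ 2]) simp
  qed
qed

text \<open>If v has a second weight u, a torus element separating w from u, minus its scalar at u,
  kills the coordinate u, keeps that of w and creates no new one. Induction on the support isolates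
  w.\<close>

lemma delta_mem:
  assumes Q: "admissible mu Q" and v: "v \<in> Q" and w: "v w \<noteq> 0"
  shows "delta w \<in> Q"
proof -
  have add: "(\<lambda>w. u w + v w) \<in> Q" if "u \<in> Q" "v \<in> Q" for u v using Q that unfolding admissible_def by blast
  have scale: "(\<lambda>w. c * v w) \<in> Q" if "v \<in> Q" for c v using Q that unfolding admissible_def by blast
  have act: "tact (t1, t2, t3) v \<in> Q" if "v \<in> Q" "t1 \<noteq> 0" "t2 \<noteq> 0" "t3 \<noteq> 0" for t1 t2 t3 v using Q that unfolding admissible_def by blast
  have fin: "finite {w. v w \<noteq> 0}" if "v \<in> Q" for v using Q that unfolding admissible_def is_vec_def by blast
  show ?thesis using v w
  proof (induction "card {w. v w \<noteq> 0}" arbitrary: v rule: less_induct)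
    case (less v)
    show ?case
    proof (cases "\<exists>u. u \<noteq> w \<and> v u \<noteq> 0")
      case False
      hence "delta w = (\<lambda>u. inverse (v w) * v u)" using less.prems(2) by (auto simp: delta_def fun_eq_iff)
      thus ?thesis using scale[OF less.prems(1)] by simp
    next
      case True
      then obtain u where u: "u \<noteq> w" "v u \<noteq> 0" by blast
      define ct :: "complex \<Rightarrow> complex \<Rightarrow> complex \<Rightarrow> int \<times> int \<times> int \<Rightarrow> complex"
        where "ct t1 t2 t3 w = (case w of (w1, w2, w3) \<Rightarrow> t1 powi w1 * t2 powi w2 * t3 powi w3)" for t1 t2 t3 w
      obtain t1 t2 t3 where t: "t1 \<noteq> 0" "t2 \<noteq> 0" "t3 \<noteq> 0" "ct t1 t2 t3 w \<noteq> ct t1 t2 t3 u"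
        using separate_weights[of w u] u(1) unfolding ct_def by blast
      let ?v = "\<lambda>x. tact (t1, t2, t3) v x + (- ct t1 t2 t3 u) * v x"
      have e: "?v x = (ct t1 t2 t3 x - ct t1 t2 t3 u) * v x" for x
        by (cases x) (simp add: tact_apply ct_def algebra_simps)
      have v: "?v \<in> Q" by (intro add act[OF less.prems(1) t(1-3)] scale less.prems(1))
      have w: "?v w \<noteq> 0" unfolding e using t(4) less.prems(2) by simp
      have "card {x. ?v x \<noteq> 0} < card {x. v x \<noteq> 0}"
      proof (rule psubset_card_mono[OF fin[OF less.prems(1)]])
        have "{x. ?v x \<noteq> 0} \<subseteq> {x. v x \<noteq> 0} - {u}" unfolding e by auto
        thus "{x. ?v x \<noteq> 0} \<subset> {x. v x \<noteq> 0}" using u(2) by blast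
      qed
      from less.hyps[OF this v w] show ?thesis .
    qed
  qed
qed

definition upward :: "(nat \<times> nat) set \<Rightarrow> (int \<times> int \<times> int) set \<Rightarrow> bool" where
  "upward mu S \<longleftrightarrow> finite S \<and> S \<subseteq> Bw mu \<and> (\<forall>i\<in>{1,2,3}. \<forall>u\<in>Bw mu. sub_ei i u \<in> S \<longrightarrow> u \<in> S)"

lemma admissible_upward:
  assumes Q: "admissible mu Q"
  shows "\<exists>S. upward mu S \<and> Q = on_set S"
proof -
  define S where "S = {w. delta w \<in> Q}"
  have add: "(\<lambda>w. u w + v w) \<in> Q" if "u \<in> Q" "v \<in> Q" for u v using Q that unfolding admissible_def by blast
  have scale: "(\<lambda>w. c * v w) \<in> Q" if "v \<in> Q" for c v using Q that unfolding admissible_def by blast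
  have zero: "(\<lambda>_. 0) \<in> Q" using Q unfolding admissible_def by blast
  have "fin_dim Q" using Q by (simp add: admissible_def)
  then obtain T where T: "finite T" "T \<subseteq> Q" "Q \<subseteq> cspan T" unfolding fin_dim_def by blast
  have vec: "is_vec mu v" if "v \<in> Q" for v using Q that unfolding admissible_def by blast
  have finS: "finite S"
  proof (rule finite_subset)
    show "S \<subseteq> (\<Union>s\<in>T. {w. s w \<noteq> 0})"
    proof
      fix w assume "w \<in> S"
      hence "delta w \<in> cspan T" using T(3) by (auto simp: S_def)
      then obtain c where "delta w = lincomb T c" unfolding cspan_def by blast
      hence "(\<Sum>s\<in>T. c s * s w) = 1" unfolding lincomb_def by (metis delta_def)
      hence "\<exists>s\<in>T. s w \<noteq> 0" by (metis (no_types, lifting) mult_zero_right sum.neutral zero_neq_one)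
      thus "w \<in> (\<Union>s\<in>T. {w. s w \<noteq> 0})" by blast
    qed
    show "finite (\<Union>s\<in>T. {w. s w \<noteq> 0})" using T(1,2) vec by (auto simp: is_vec_def)
  qed
  have SB: "S \<subseteq> Bw mu"
  proof
    fix w assume "w \<in> S"
    hence "is_vec mu (delta w)" using vec by (simp add: S_def)
    thus "w \<in> Bw mu" by (auto simp: is_vec_def delta_def)
  qed
  have QS: "Q = on_set S"
  proof
    show "Q \<subseteq> on_set S" using delta_mem[OF Q] by (auto simp: on_set_def S_def)
    show "on_set S \<subseteq> Q"
    proof
      fix v assume v: "v \<in> on_set S"
      have "(\<lambda>u. \<Sum>w\<in>A. v w * delta w u) \<in> Q" if "A \<subseteq> S" "finite A" for A
        using that(2,1) by (induction A rule: finite_induct) (auto intro: zero add scale simp: S_def)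
      from this[OF order_refl finS] have "(\<lambda>u. \<Sum>w\<in>S. v w * delta w u) \<in> Q" .
      moreover have "(\<lambda>u. \<Sum>w\<in>S. v w * delta w u) = v"
      proof
        fix u
        have "(\<Sum>w\<in>S. v w * delta w u) = (\<Sum>w\<in>S. if w = u then v u else 0)" by (intro sum.cong) (auto simp: delta_def)
        thus "(\<Sum>w\<in>S. v w * delta w u) = v u" using finS on_setD[OF v, of u] by (simp add: sum.delta)
      qed
      ultimately show "v \<in> Q" by simp
    qed
  qed
  have "u \<in> S" if "i \<in> {1,2,3}" "u \<in> Bw mu" "sub_ei i u \<in> S" for i u
  proof -
    have "xmul mu i (delta (sub_ei i u)) \<in> Q" using Q that unfolding admissible_def S_def by blast
    moreover have "xmul mu i (delta (sub_ei i u)) u \<noteq> 0" using that(2) by (simp add: xmul_def delta_def)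
    ultimately show ?thesis using delta_mem[OF Q] by (simp add: S_def)
  qed
  thus ?thesis using finS SB QS unfolding upward_def by blast
qed

lemma upward_admissible:
  assumes S: "upward mu S"
  shows "admissible mu (on_set S)"
proof -
  have fin: "finite S" and SB: "S \<subseteq> Bw mu" and up: "\<And>i u. i \<in> {1,2,3} \<Longrightarrow> u \<in> Bw mu \<Longrightarrow> sub_ei i u \<in> S \<Longrightarrow> u \<in> S"
    using S unfolding upward_def by blast+
  have supp: "{w. v w \<noteq> 0} \<subseteq> S" if "v \<in> on_set S" for v using that by (auto simp: on_set_def)
  have "is_vec mu v" if "v \<in> on_set S" for v
    using supp[OF that] SB finite_subset[OF _ fin] by (auto simp: is_vec_def)
  moreover have "xmul mu i v \<in> on_set S" if "i \<in> {1,2,3}" "v \<in> on_set S" for i v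
    unfolding on_set_def mem_Collect_eq
  proof (intro allI impI)
    fix u assume "u \<notin> S"
    thus "xmul mu i v u = 0" using up[OF that(1), of u] on_setD[OF that(2), of "sub_ei i u"] by (auto simp: xmul_def)
  qed
  moreover have "tact (t1, t2, t3) v \<in> on_set S" if "v \<in> on_set S" for t1 t2 t3 v
    using that by (auto simp: on_set_def tact_def)
  moreover have "fin_dim (on_set S)"
    unfolding fin_dim_def using delta_span[OF fin] fin by (intro exI[of _ "delta ` S"]) (auto simp: delta_on_set)
  ultimately show ?thesis unfolding admissible_def by (auto simp: on_set_def)
qed

section \<open>Invariant submodules as height functions\<close>

definition under :: "(nat \<times> nat) set \<Rightarrow> cfg \<Rightarrow> (int \<times> int \<times> int) set" where
  "under mu h = {(k1, k2, k3). 0 \<le> k1 \<and> 0 \<le> k2 \<and> (nat k1, nat k2) \<in> mu \<and> - int (h (nat k1, nat k2)) \<le> k3 \<and> k3 < 0}"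

lemma under_mem: "(int i, int j, k) \<in> under mu h \<longleftrightarrow> (i, j) \<in> mu \<and> - int (h (i, j)) \<le> k \<and> k < 0"
  by (simp add: under_def)

lemma under_cases:
  assumes "w \<in> Bw mu"
  obtains i j k where "w = (int i, int j, k)" "(i, j) \<in> mu" "k < 0"
proof -
  obtain k1 k2 k3 where w: "w = (k1, k2, k3)" by (cases w)
  thus ?thesis using assms that[of "nat k1" "nat k2" k3] by (auto simp: Bw_def)
qed

lemma under_image: "under mu h = (\<lambda>(p, k). (int (fst p), int (snd p), k)) ` (SIGMA p:mu. {- int (h p)..<0})"
proof
  show "under mu h \<subseteq> (\<lambda>(p, k). (int (fst p), int (snd p), k)) ` (SIGMA p:mu. {- int (h p)..<0})"
  proof
    fix w assume "w \<in> under mu h"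
    then obtain k1 k2 k3 where "w = (k1, k2, k3)" "0 \<le> k1" "0 \<le> k2" "(nat k1, nat k2) \<in> mu" "- int (h (nat k1, nat k2)) \<le> k3" "k3 < 0"
      by (auto simp: under_def)
    thus "w \<in> (\<lambda>(p, k). (int (fst p), int (snd p), k)) ` (SIGMA p:mu. {- int (h p)..<0})"
      by (intro image_eqI[of _ _ "((nat k1, nat k2), k3)"]) auto
  qed
qed (auto simp: under_def)

lemma card_under:
  assumes "finite mu"
  shows "finite (under mu h)" "card (under mu h) = (\<Sum>p\<in>mu. h p)"
proof -
  show "finite (under mu h)" unfolding under_image using assms by auto
  have "inj_on (\<lambda>(p, k). (int (fst p), int (snd p), k)) (SIGMA p:mu. {- int (h p)..<0})"
    by (auto simp: inj_on_def prod_eq_iff)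
  thus "card (under mu h) = (\<Sum>p\<in>mu. h p)" unfolding under_image using assms by (simp add: card_image)
qed

lemma upward_under:
  assumes "finite mu" "valid mu h"
  shows "upward mu (under mu h)"
proof -
  have sub: "under mu h \<subseteq> Bw mu" by (auto simp: under_def Bw_def)
  have "u \<in> under mu h" if "i \<in> {1,2,3}" "u \<in> Bw mu" "sub_ei i u \<in> under mu h" for i u
  proof -
    note iu = that
    have "sub_ei i u \<in> Bw mu" using that(3) sub by blast
    then obtain k1 k2 k3 where s: "sub_ei i u = (int k1, int k2, k3)" by (rule under_cases)
    obtain m1 m2 m3 where u: "u = (int m1, int m2, m3)" "(m1, m2) \<in> mu" "m3 < 0" using iu(2) by (rule under_cases)
    have m: "(k1, k2) \<in> mu" "- int (h (k1, k2)) \<le> k3" using that(3) unfolding s under_mem by auto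
    consider "m1 = Suc k1" "m2 = k2" "m3 = k3" | "m1 = k1" "m2 = Suc k2" "m3 = k3" | "m1 = k1" "m2 = k2" "m3 = k3 + 1"
      using iu(1) s u(1) by (auto simp: sub_ei_def)
    hence "- int (h (m1, m2)) \<le> m3"
    proof cases
      case 1
      hence "h (k1, k2) \<le> h (m1, m2)" using assms(2) u(2) unfolding valid_def by blast
      thus ?thesis using 1 m by simp
    next
      case 2
      hence "h (k1, k2) \<le> h (m1, m2)" using assms(2) u(2) unfolding valid_def by blast
      thus ?thesis using 2 m by simp
    next
      case 3 thus ?thesis using m by simp
    qed
    thus ?thesis unfolding u(1) under_mem using u by simp
  qed
  thus ?thesis unfolding upward_def using sub card_under[OF assms(1)] by blast
qed

lemma up_closed_negatives:
  fixes K :: "int set"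
  assumes "finite K" "\<And>k. k \<in> K \<Longrightarrow> k < 0" "\<And>k. k \<in> K \<Longrightarrow> k + 1 < 0 \<Longrightarrow> k + 1 \<in> K"
  shows "\<exists>n::nat. K = {k. - int n \<le> k \<and> k < 0}"
proof (cases "K = {}")
  case True thus ?thesis by (intro exI[of _ 0]) auto
next
  case False
  define m where "m = Min K"
  have m: "m \<in> K" "\<And>k. k \<in> K \<Longrightarrow> m \<le> k" unfolding m_def using assms(1) False by auto
  have c: "k < 0 \<longrightarrow> k \<in> K" if "m \<le> k" for k
    using that by (induction k rule: int_ge_induct) (use m(1) assms(3) in auto)
  have e: "- int (nat (- m)) = m" using assms(2)[OF m(1)] by simp
  show ?thesis by (rule exI[of _ "nat (- m)"], unfold e) (use m(2) assms(2) c in blast)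
qed

lemma upward_is_under:
  assumes part: "is_partition mu" and S: "upward mu S"
  shows "\<exists>h. valid mu h \<and> S = under mu h"
proof -
  have fin: "finite S" and SB: "S \<subseteq> Bw mu" and up: "\<And>i u. i \<in> {1,2,3} \<Longrightarrow> u \<in> Bw mu \<Longrightarrow> sub_ei i u \<in> S \<Longrightarrow> u \<in> S"
    using S unfolding upward_def by blast+
  have B: "(int i, int j, k) \<in> Bw mu \<longleftrightarrow> (i, j) \<in> mu \<and> k < 0" for i j k by (simp add: Bw_def)
  have ex: "\<exists>n::nat. {k. (int i, int j, k) \<in> S} = {k. - int n \<le> k \<and> k < 0}" for i j
  proof (rule up_closed_negatives)
    show "finite {k. (int i, int j, k) \<in> S}"
      by (rule finite_subset[of _ "(\<lambda>(_, _, k). k) ` S"]) (use fin in \<open>force+\<close>)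
    show "k < 0" if "k \<in> {k. (int i, int j, k) \<in> S}" for k using that SB B by auto
    show "k + 1 \<in> {k. (int i, int j, k) \<in> S}" if "k \<in> {k. (int i, int j, k) \<in> S}" "k + 1 < 0" for k
      using up[of 3 "(int i, int j, k + 1)"] that SB B by (auto simp: sub_ei_def)
  qed
  obtain g where g: "\<And>i j. {k. (int i, int j, k) \<in> S} = {k. - int (g i j) \<le> k \<and> k < 0}"
    using ex by metis
  define f where "f p = g (fst p) (snd p)" for p
  have f: "{k. (int i, int j, k) \<in> S} = {k. - int (f (i, j)) \<le> k \<and> k < 0}" for i j
    using g by (simp add: f_def)
  define h where "h p = (if p \<in> mu then f p else 0)" for p
  have mem: "(int i, int j, k) \<in> S \<longleftrightarrow> (i, j) \<in> mu \<and> - int (h (i, j)) \<le> k \<and> k < 0" for i j k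
  proof (cases "(i, j) \<in> mu")
    case True thus ?thesis using f[of i j] by (auto simp: h_def)
  next
    case False thus ?thesis using SB B by auto
  qed
  have "S = under mu h"
  proof (rule set_eqI)
    fix w
    show "w \<in> S \<longleftrightarrow> w \<in> under mu h"
    proof (cases "w \<in> Bw mu")
      case True
      then obtain i j k where "w = (int i, int j, k)" by (rule under_cases)
      thus ?thesis by (simp add: mem under_mem)
    next
      case False thus ?thesis using SB by (auto simp: under_def Bw_def)
    qed
  qed
  moreover have "valid mu h"
    unfolding valid_def
  proof (intro conjI allI impI)
    show "h p = 0" if "p \<notin> mu" for p using that by (simp add: h_def)
    show "h (i, j) \<le> h (Suc i, j)" if m: "(Suc i, j) \<in> mu" for i j
    proof (cases "h (i, j) = 0")
      case False
      have "(i, j) \<in> mu" using False by (auto simp: h_def split: if_splits)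
      hence "(int i, int j, - int (h (i, j))) \<in> S" using False by (simp add: mem)
      hence "(int (Suc i), int j, - int (h (i, j))) \<in> S"
        using up[of 1 "(int (Suc i), int j, - int (h (i, j)))"] False m B[of "Suc i" j] by (simp add: sub_ei_def)
      thus ?thesis unfolding mem by simp
    qed simp
    show "h (i, j) \<le> h (i, Suc j)" if m: "(i, Suc j) \<in> mu" for i j
    proof (cases "h (i, j) = 0")
      case False
      have "(i, j) \<in> mu" using False by (auto simp: h_def split: if_splits)
      hence "(int i, int j, - int (h (i, j))) \<in> S" using False by (simp add: mem)
      hence "(int i, int (Suc j), - int (h (i, j))) \<in> S"
        using up[of 2 "(int i, int (Suc j), - int (h (i, j)))"] False m B[of i "Suc j"] by (simp add: sub_ei_def)
      thus ?thesis unfolding mem by simp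
    qed simp
  qed
  ultimately show ?thesis by blast
qed

lemma under_inj:
  assumes "valid mu h" "valid mu h'" "under mu h = under mu h'"
  shows "h = h'"
proof -
  have le: "h p \<le> h' p" if "valid mu h" "under mu h = under mu h'" for h h' :: cfg and p
  proof (cases "h p = 0")
    case False
    have "p \<in> mu" using False valid_outside[OF that(1), of p] by argo
    hence "(int (fst p), int (snd p), - int (h p)) \<in> under mu h" using False under_mem[of "fst p" "snd p" _ mu h] by simp
    thus ?thesis unfolding that(2) using under_mem[of "fst p" "snd p" _ mu h'] by simp
  qed simp
  show ?thesis using le[of h h'] le[of h' h] assms by (auto simp: fun_eq_iff intro: antisym)
qed

lemma charQ_under: "charQ (on_set (under mu h)) = chi mu h"
  unfolding charQ_on_set chi_def under_def by auto

lemma admissible_bij: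
  assumes "is_partition mu"
  shows "bij_betw (\<lambda>h. on_set (under mu h)) {h. valid mu h \<and> (\<Sum>p\<in>mu. h p) + card mu = n}
    {Q. admissible mu Q \<and> cdim Q + card mu = n}"
proof -
  have fin: "finite mu" using assms by (simp add: is_partition_def)
  have cd: "cdim (on_set (under mu h)) = (\<Sum>p\<in>mu. h p)" for h
    using cdim_on_set card_under[OF fin] by metis
  have "inj_on (\<lambda>h. on_set (under mu h)) {h. valid mu h \<and> (\<Sum>p\<in>mu. h p) + card mu = n}"
  proof (rule inj_onI)
    fix h h' assume h: "h \<in> {h. valid mu h \<and> (\<Sum>p\<in>mu. h p) + card mu = n}" "h' \<in> {h. valid mu h \<and> (\<Sum>p\<in>mu. h p) + card mu = n}"
      and e: "on_set (under mu h) = on_set (under mu h')"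
    have "under mu h = under mu h'" using e delta_on_set by blast
    thus "h = h'" using h under_inj by blast
  qed
  moreover have "(\<lambda>h. on_set (under mu h)) ` {h. valid mu h \<and> (\<Sum>p\<in>mu. h p) + card mu = n} = {Q. admissible mu Q \<and> cdim Q + card mu = n}"
  proof
    show "(\<lambda>h. on_set (under mu h)) ` {h. valid mu h \<and> (\<Sum>p\<in>mu. h p) + card mu = n} \<subseteq> {Q. admissible mu Q \<and> cdim Q + card mu = n}"
      using upward_admissible[OF upward_under[OF fin]] cd by auto
    show "{Q. admissible mu Q \<and> cdim Q + card mu = n} \<subseteq> (\<lambda>h. on_set (under mu h)) ` {h. valid mu h \<and> (\<Sum>p\<in>mu. h p) + card mu = n}"
    proof
      fix Q assume Q: "Q \<in> {Q. admissible mu Q \<and> cdim Q + card mu = n}"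
      then obtain S where S: "upward mu S" "Q = on_set S" using admissible_upward by blast
      then obtain h where "valid mu h" "S = under mu h" using upward_is_under[OF assms] by blast
      thus "Q \<in> (\<lambda>h. on_set (under mu h)) ` {h. valid mu h \<and> (\<Sum>p\<in>mu. h p) + card mu = n}" using Q S(2) cd by auto
    qed
  qed
  ultimately show ?thesis by (simp add: bij_betw_def)
qed

section \<open>The vertex\<close>

lemma sum_mem:
  assumes "0 \<in> I" "\<And>x y. x \<in> I \<Longrightarrow> y \<in> I \<Longrightarrow> x + y \<in> I" "\<And>i. i \<in> A \<Longrightarrow> f i \<in> I"
  shows "sum f A \<in> I"
  using assms(3) by (induction A rule: infinite_finite_induct) (simp_all add: assms(1,2))

context vertex
begin

lemma finite_heights: "finite {h. valid mu h \<and> (\<Sum>p\<in>mu. h p) + card mu = n}"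
proof (rule finite_subset[OF _ finite_set_of_finite_funs[OF U.fin_mu, of "{..n}" 0]])
  show "{h. valid mu h \<and> (\<Sum>p\<in>mu. h p) + card mu = n} \<subseteq> {f. \<forall>x. (x \<in> mu \<longrightarrow> f x \<in> {..n}) \<and> (x \<notin> mu \<longrightarrow> f x = 0)}"
  proof
    fix h assume h: "h \<in> {h. valid mu h \<and> (\<Sum>p\<in>mu. h p) + card mu = n}"
    have le: "h p \<le> n" if "p \<in> mu" for p using member_le_sum[OF that _ U.fin_mu, of h] h by simp
    have z: "h p = 0" if "p \<notin> mu" for p using valid_outside[of mu h p] that h by simp
    show "h \<in> {f. \<forall>x. (x \<in> mu \<longrightarrow> f x \<in> {..n}) \<and> (x \<notin> mu \<longrightarrow> f x = 0)}" 
      using le z by simp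
  qed
qed simp

lemma coeff_heights:
  "Wvert_coeff mu is n = (1 / (V1 * V2)) ^ length is * (\<Sum>h\<in>{h. valid mu h \<and> (\<Sum>p\<in>mu. h p) + card mu = n}. weight is h)"
  unfolding Wvert_coeff_def sum.reindex_bij_betw[OF admissible_bij[OF partition, of n], symmetric]
  by (simp add: wQ_weight[OF charQ_under])

text \<open>The number of boxes is determined by the class, so the height functions of one
  coefficient of the vertex form a union of full classes. It is applied with the regular functions
  and with \<open>epsR\<close>.\<close>

lemma heights_mem:
  assumes I: "0 \<in> I" "U.epsR \<subseteq> I" "\<And>x y. x \<in> I \<Longrightarrow> y \<in> I \<Longrightarrow> x + y \<in> I"
    and G: "\<And>X. U.hgt X = int n - int (card mu) \<Longrightarrow> U.sums_in I X"
  shows "(\<Sum>h\<in>{h. valid mu h \<and> (\<Sum>p\<in>mu. h p) + card mu = n}. weight is h) \<in> I"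
proof -
  let ?N = "{h. valid mu h \<and> (\<Sum>p\<in>mu. h p) + card mu = n}"
  have hg: "U.hgt (U.sig h) = int n - int (card mu) \<longleftrightarrow> (\<Sum>p\<in>mu. h p) + card mu = n" for h
    unfolding U.hgt_sig by linarith
  have "(\<Sum>h\<in>?N. weight is h) = (\<Sum>X\<in>U.sig ` ?N. \<Sum>h\<in>{h\<in>?N. U.sig h = X}. weight is h)"
    by (rule sum.image_gen[OF finite_heights])
  also have "\<dots> = (\<Sum>X\<in>U.sig ` ?N. \<Sum>h\<in>U.configs X. weight is h)"
  proof (rule sum.cong[OF refl])
    fix X assume "X \<in> U.sig ` ?N"
    then obtain h0 where h0: "(\<Sum>p\<in>mu. h0 p) + card mu = n" "X = U.sig h0" by blast
    have "h \<in> {h\<in>?N. U.sig h = X} \<longleftrightarrow> h \<in> U.configs X" for h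
    proof -
      have "U.sig h = X \<Longrightarrow> (\<Sum>p\<in>mu. h p) + card mu = n" using hg[of h] hg[of h0] h0 by simp
      thus ?thesis unfolding U.configs_def by blast
    qed
    hence "{h\<in>?N. U.sig h = X} = U.configs X" by blast
    thus "(\<Sum>h\<in>{h\<in>?N. U.sig h = X}. weight is h) = (\<Sum>h\<in>U.configs X. weight is h)" by simp
  qed
  also have "\<dots> \<in> I"
  proof (rule sum_mem[OF I(1,3)])
    fix X assume "X \<in> U.sig ` ?N"
    then obtain h0 where h0: "(\<Sum>p\<in>mu. h0 p) + card mu = n" "X = U.sig h0" by blast
    have "U.hgt X = int n - int (card mu)" using hg[of h0] h0 by simp
    from class_weight_sum[OF G[OF this] I(2,3)] show "(\<Sum>h\<in>U.configs X. weight is h) \<in> I" .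
  qed
  finally show ?thesis .
qed

lemma prefactor_regular: "(1 / (V1 * V2)) ^ k \<in> {F. regular_sub a F}"
proof (rule U.power_R)
  have "sub_s3 a (x1 * x2) = [:[:0, 1:]:] * [:0, 1:]" by (simp only: sub_hom sub_x)
  hence "sub_s3 a (x1 * x2) \<noteq> 0" by simp
  from regular_inverse_tf[OF this] show "1 / (V1 * V2) \<in> {F. regular_sub a F}"
    unfolding tf_hom(2) V_tf[symmetric] inverse_eq_divide by blast
qed

lemma coeff_regular: "regular_sub a (Wvert_coeff mu is n)"
proof -
  have "(\<Sum>h\<in>{h. valid mu h \<and> (\<Sum>p\<in>mu. h p) + card mu = n}. weight is h) \<in> {F. regular_sub a F}"
  proof (rule heights_mem[OF U.zero_R _ U.add_R U.sums_in_regular])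
    show "U.epsR \<subseteq> {F. regular_sub a F}" using U.mult_R[OF U.eps_R] by (auto simp: U.epsR_def)
  qed
  thus ?thesis unfolding coeff_heights using U.mult_R[OF prefactor_regular] by blast
qed

lemma coeff_tail: "finite {n. eval_sub a (Wvert_coeff mu is n) \<noteq> 0}"
proof -
  obtain B where B: "\<And>X. U.hgt X > B \<Longrightarrow> U.sums_in U.epsR X" using U.sums_in_tail by blast
  have "eval_sub a (Wvert_coeff mu is n) = 0" if "int n > B + int (card mu)" for n
  proof -
    have "(\<Sum>h\<in>{h. valid mu h \<and> (\<Sum>p\<in>mu. h p) + card mu = n}. weight is h) \<in> U.epsR"
      by (rule heights_mem[OF U.epsR_closed(1) order_refl U.epsR_closed(2) B]) (use that in auto)
    from U.epsR_mult[OF this prefactor_regular] have "Wvert_coeff mu is n \<in> U.epsR"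
      unfolding coeff_heights by (simp only: mult.commute)
    thus ?thesis using eval_sub_eps[of a] a_positive by (auto simp: U.epsR_def)
  qed
  note zero = this
  have "{n. eval_sub a (Wvert_coeff mu is n) \<noteq> 0} \<subseteq> {..nat (B + int (card mu))}"
  proof (intro subsetI)
    fix n assume "n \<in> {n. eval_sub a (Wvert_coeff mu is n) \<noteq> 0}"
    hence "int n \<le> B + int (card mu)" using zero[of n] by force
    from nat_mono[OF this] show "n \<in> {..nat (B + int (card mu))}" by simp
  qed
  thus ?thesis by (rule finite_subset) simp
qed

end

theorem theorem4:
  fixes mu :: "(nat \<times> nat) set" and "is" :: "nat list" and a :: int
  assumes "is_partition mu" and "mu \<noteq> {}" and "a > 0"
  shows "(\<forall>n. finite {Q. admissible mu Q \<and> cdim Q + card mu = n})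
       \<and> (\<forall>n. regular_sub a (Wvert_coeff mu is n))
       \<and> finite {n. eval_sub a (Wvert_coeff mu is n) \<noteq> 0}"
proof -
  interpret vertex mu a by unfold_locales (use assms in auto)
  have "finite {Q. admissible mu Q \<and> cdim Q + card mu = n}" for n
    using bij_betw_finite[OF admissible_bij[OF assms(1)]] finite_heights by blast
  thus ?thesis using coeff_regular coeff_tail by blast
qed

end
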